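(* Let $x\in|\mathbb{P}^1|$ be a closed point of degree one and let $K'=K_x'\times\prod_{z\neq x}K_z$ with $K_x'=\{k\in K_x\mid k\equiv \mathrm{id} \bmod (\pi_x)\}$. Let $y\in|\mathbb{P}^1|$ be a closed point of degree $d$ with $y\neq x$, and let $\Phi_y'$ be the Hecke operator given by the characteristic function of $K'\begin{pmatrix}\pi_y&0\\0&1\end{pmatrix}K'$. If $\lambda\in\mathbb{C}^{\times}$, then $\dim_{\mathbb{C}}\mathcal{A}^{K'}(\Phi_y',\lambda)=d(q+1)$.
   Context: Let $q$ be a prime power and $F=\mathbb{F}_q(t)$ the function field of $\mathbb{P}^1$ over $\mathbb{F}_q$; $|\mathbb{P}^1|$ is the set of closed points (equivalently, places of $F$). For $y\in|\mathbb{P}^1|$: $F_y$ is the completion of $F$ at $y$, $\mathcal{O}_y$ its ring of integers, $\pi_y\in F$ a uniformizer, $\kappa(y)=\mathcal{O}_y/(\pi_y)$, the degree of $y$ is $|y|=[\kappa(y):\mathbb{F}_q]$, and $|\cdot|_y$ is the absolute value with $|\pi_y|_y=q^{-|y|}$. $\mathbb{A}$ is the adele ring of $F$, $\mathcal{O}_{\mathbb{A}}=\prod_y\mathcal{O}_y$, $G=\mathrm{GL}_2$, $Z$ is the center of $G(\mathbb{A})$, $K=\mathrm{GL}_2(\mathcal{O}_{\mathbb{A}})$, $K_y=\mathrm{GL}_2(\mathcal{O}_y)$. A matrix in $\mathrm{GL}_2(F_y)$ is viewed in $G(\mathbb{A})$ by putting the identity at all other places. $G(\mathbb{A})$ carries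 the Haar measure with $\mathrm{vol}(K)=1$. A locally constant, compactly supported, bi-$K'$-invariant function $\Phi:G(\mathbb{A})\to\mathbb{C}$ (Hecke operator) acts on functions by $\Phi(f)(g)=\int_{G(\mathbb{A})}\Phi(h)f(gh)\,dh$. $\mathcal{A}^{K'}$ is the complex vector space of functions $f:G(\mathbb{A})\to\mathbb{C}$ that are left $G(F)$-invariant, $Z$-invariant, right $K'$-invariant, and of moderate growth, i.e. there are constants $C,N$ with $|f(g)|\le C|g|^N$ for all $g\in G(\mathbb{A})$. Here $|g|=\prod_y |g_y|_y$, with $|g_y|_y$ the maximum of the $y$-adic absolute values of the entries of $g_y$ and of $\det(g_y)^{-1}$. For $\lambda\in\mathbb{C}$, $\mathcal{A}^{K'}(\Phi,\lambda)=\{f\in\mathcal{A}^{K'}\mid\Phi(f)=\lambda f\}$. *)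

theory Defs
  imports
    "HOL-Analysis.Analysis"
    "HOL-Algebra.Embedded_Algebras"
    "HOL-Algebra.QuotRing"
    "HOL-Computational_Algebra.Fraction_Field"
    "HOL-Computational_Algebra.Polynomial"
    "HOL-Library.Function_Algebras"
begin

text \<open>
  The finite field is a type \<open>'k :: {field, finite}\<close>, so \<open>q = CARD('k)\<close>, and \<open>F = 'k poly fract\<close>.
  The closed points of the projective line are identified with the places of \<open>F\<close>, a place being
  represented by its normalised discrete valuation. The value at \<open>0\<close> is meaningless and fixed to
  \<open>0\<close>. Triviality on constants needs no mention: nonzero constants are roots of unity.
\<close>

definition is_place_val :: "('k::{field,finite} poly fract \<Rightarrow> int) \<Rightarrow> bool" where
  "is_place_val v \<longleftrightarrow>
     v 0 = 0 \<and>
     (\<forall>a b. a \<noteq> 0 \<longrightarrow> b \<noteq> 0 \<longrightarrow> v (a * b) = v a + v b) \<and>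
     (\<forall>a b. a \<noteq> 0 \<longrightarrow> b \<noteq> 0 \<longrightarrow> a + b \<noteq> 0 \<longrightarrow> min (v a) (v b) \<le> v (a + b)) \<and>
     (\<exists>a. a \<noteq> 0 \<and> v a = 1)"

text \<open>The valuation at infinity; it only serves to show that the type of places is inhabited.\<close>

definition degree_val :: "'k::{field,finite} poly fract \<Rightarrow> int" where
  "degree_val x = (if x = 0 then 0 else
     (let (a, b) = (SOME (a, b). b \<noteq> 0 \<and> x = Fract a b) in int (degree b) - int (degree a)))"

lemma degree_val_Fract:
  assumes "a \<noteq> 0" "b \<noteq> 0"
  shows "degree_val (Fract a b) = int (degree b) - int (degree a)"
proof -
  define p where "p = (SOME (c, d). d \<noteq> 0 \<and> Fract a b = Fract c d)"
  have nz: "Fract a b \<noteq> 0"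
    using assms by (simp add: Zero_fract_def eq_fract)
  have "case p of (c, d) \<Rightarrow> d \<noteq> 0 \<and> Fract a b = Fract c d"
    unfolding p_def by (rule someI[of _ "(a, b)"]) (use assms in auto)
  then obtain c d where p: "p = (c, d)" "d \<noteq> 0" "Fract a b = Fract c d"
    by (cases p) auto
  have "c \<noteq> 0"
    using nz p by (auto simp: Zero_fract_def eq_fract)
  moreover have "a * d = c * b"
    using p assms by (simp add: eq_fract)
  ultimately have "degree a + degree d = degree c + degree b"
    using p assms by (metis degree_mult_eq)
  moreover have "degree_val (Fract a b) = (case p of (c, d) \<Rightarrow> int (degree d) - int (degree c))"
    using nz by (simp only: degree_val_def p_def Let_def if_False)
  ultimately show ?thesis
    using p by simp
qed

lemma is_place_val_degree_val: "is_place_val (degree_val :: 'k::{field,finite} poly fract \<Rightarrow> int)"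
  unfolding is_place_val_def
proof (intro conjI allI impI)
  show "degree_val 0 = 0"
    by (simp add: degree_val_def)
next
  fix x y :: "'k poly fract"
  assume "x \<noteq> 0" "y \<noteq> 0"
  then obtain a b c d where *: "x = Fract a b" "y = Fract c d" "a \<noteq> 0" "b \<noteq> 0" "c \<noteq> 0" "d \<noteq> 0"
    by (metis Fract_cases_nonzero)
  then show "degree_val (x * y) = degree_val x + degree_val y"
    by (simp add: degree_val_Fract degree_mult_eq)
next
  fix x y :: "'k poly fract"
  assume "x \<noteq> 0" "y \<noteq> 0" and nz: "x + y \<noteq> 0"
  then obtain a b c d where *: "x = Fract a b" "y = Fract c d" "a \<noteq> 0" "b \<noteq> 0" "c \<noteq> 0" "d \<noteq> 0"
    by (metis Fract_cases_nonzero)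
  have sum: "x + y = Fract (a * d + c * b) (b * d)"
    using * by simp
  have "a * d + c * b \<noteq> 0"
    using nz unfolding sum by (auto simp: Zero_fract_def eq_fract)
  moreover have "degree (a * d + c * b) \<le> max (degree a + degree d) (degree c + degree b)"
    using degree_add_le_max[of "a * d" "c * b"] * by (simp add: degree_mult_eq)
  ultimately show "min (degree_val x) (degree_val y) \<le> degree_val (x + y)"
    unfolding sum using * by (simp add: degree_val_Fract degree_mult_eq)
next
  have "degree_val (Fract (1 :: 'k poly) [:0, 1:]) = 1"
    by (simp add: degree_val_Fract)
  moreover have "Fract (1 :: 'k poly) [:0, 1:] \<noteq> 0"
    by (simp add: Zero_fract_def eq_fract)
  ultimately show "\<exists>a :: 'k poly fract. a \<noteq> 0 \<and> degree_val a = 1"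
    by blast
qed

typedef (overloaded) ('k :: "{field,finite}") place =
  "{v :: 'k poly fract \<Rightarrow> int. is_place_val v}"
  morphisms place_val Abs_place
  using is_place_val_degree_val by blast

definition uniformizer :: "'k::{field,finite} place \<Rightarrow> 'k poly fract \<Rightarrow> bool" where
  "uniformizer y \<pi> \<longleftrightarrow> \<pi> \<noteq> 0 \<and> place_val y \<pi> = 1"

text \<open>
  \<open>F_y\<close> is the ring of Cauchy sequences modulo null sequences. The Cauchy condition is phrased with
  the valuation rather than the absolute value, whose normalisation depends on the degree
  of \<open>y\<close>, which in turn is read off from the completion.
\<close>

type_synonym 'k completed = "(nat \<Rightarrow> 'k poly fract) set"

definition cauchy_seqs :: "'k::{field,finite} place \<Rightarrow> (nat \<Rightarrow> 'k poly fract) set" where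
  "cauchy_seqs y =
     {s. \<forall>n. \<exists>M. \<forall>i\<ge>M. \<forall>j\<ge>M. s i = s j \<or> n \<le> place_val y (s i - s j)}"

definition null_seqs :: "'k::{field,finite} place \<Rightarrow> (nat \<Rightarrow> 'k poly fract) set" where
  "null_seqs y = {s. \<forall>n. \<exists>M. \<forall>i\<ge>M. s i = 0 \<or> n \<le> place_val y (s i)}"

definition cauchy_ring :: "'k::{field,finite} place \<Rightarrow> (nat \<Rightarrow> 'k poly fract) ring" where
  "cauchy_ring y =
     \<lparr>carrier = cauchy_seqs y, mult = (\<lambda>s t i. s i * t i), one = (\<lambda>_. 1),
      zero = (\<lambda>_. 0), add = (\<lambda>s t i. s i + t i)\<rparr>"

definition completion :: "'k::{field,finite} place \<Rightarrow> 'k completed ring" where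
  "completion y = cauchy_ring y Quot null_seqs y"

definition to_completion :: "'k::{field,finite} place \<Rightarrow> 'k poly fract \<Rightarrow> 'k completed" where
  "to_completion y a = null_seqs y +>\<^bsub>cauchy_ring y\<^esub> (\<lambda>_. a)"

text \<open>
  On a Cauchy sequence that is not a null sequence the valuation is eventually constant; this
  gives the extension to the nonzero elements of the completion.
\<close>

definition completion_val :: "'k::{field,finite} place \<Rightarrow> 'k completed \<Rightarrow> int" where
  "completion_val y A =
     (THE n. \<forall>s\<in>A. \<forall>\<^sub>F i in sequentially. s i \<noteq> 0 \<and> place_val y (s i) = n)"

definition integer_ring :: "'k::{field,finite} place \<Rightarrow> 'k completed ring" where
  "integer_ring y = (completion y)
     \<lparr>carrier := {A \<in> carrier (completion y). A = \<zero>\<^bsub>completion y\<^esub> \<or> 0 \<le> completion_val y A}\<rparr>"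

definition max_ideal :: "'k::{field,finite} place \<Rightarrow> 'k completed set" where
  "max_ideal y = PIdl\<^bsub>integer_ring y\<^esub> (to_completion y (SOME \<pi>. uniformizer y \<pi>))"

definition residue_field :: "'k::{field,finite} place \<Rightarrow> 'k completed set ring" where
  "residue_field y = integer_ring y Quot max_ideal y"

definition residue_constants :: "'k::{field,finite} place \<Rightarrow> 'k completed set set" where
  "residue_constants y =
     range (\<lambda>c. max_ideal y +>\<^bsub>integer_ring y\<^esub> to_completion y (Fract [:c:] 1))"

definition place_degree :: "'k::{field,finite} place \<Rightarrow> nat" where
  "place_degree y =
     ring.dim (residue_field y) (residue_constants y) (carrier (residue_field y))"

definition completion_abs :: "'k::{field,finite} place \<Rightarrow> 'k completed \<Rightarrow> real" where
  "completion_abs y A =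
     (if A = \<zero>\<^bsub>completion y\<^esub> then 0
      else real CARD('k) powi (- (int (place_degree y) * completion_val y A)))"

definition completion_topology :: "'k::{field,finite} place \<Rightarrow> 'k completed topology" where
  "completion_topology y =
     Metric_space.mtopology (carrier (completion y))
       (\<lambda>A B. completion_abs y (A \<ominus>\<^bsub>completion y\<^esub> B))"

type_synonym 'k adele = "'k place \<Rightarrow> 'k completed"

definition adeles :: "'k::{field,finite} adele ring" where
  "adeles =
     \<lparr>carrier = {a. (\<forall>z. a z \<in> carrier (completion z)) \<and>
                    finite {z. a z \<notin> carrier (integer_ring z)}},
      mult = (\<lambda>a b z. a z \<otimes>\<^bsub>completion z\<^esub> b z), one = (\<lambda>z. \<one>\<^bsub>completion z\<^esub>),
      zero = (\<lambda>z. \<zero>\<^bsub>completion z\<^esub>), add = (\<lambda>a b z. a z \<oplus>\<^bsub>completion z\<^esub> b z)\<rparr>"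

definition integral_adeles :: "'k::{field,finite} adele ring" where
  "integral_adeles = adeles\<lparr>carrier := {a. \<forall>z. a z \<in> carrier (integer_ring z)}\<rparr>"

definition adele_topology :: "'k::{field,finite} adele topology" where
  "adele_topology = topology_generated_by
     {{a. \<forall>z. a z \<in> U z} | U.
        (\<forall>z. openin (completion_topology z) (U z)) \<and>
        finite {z. U z \<noteq> carrier (integer_ring z)}}"

definition det2 :: "('a, 'b) ring_scheme \<Rightarrow> 'a^2^2 \<Rightarrow> 'a" where
  "det2 R M = (M$1$1 \<otimes>\<^bsub>R\<^esub> M$2$2) \<ominus>\<^bsub>R\<^esub> (M$1$2 \<otimes>\<^bsub>R\<^esub> M$2$1)"

definition GL2 :: "('a, 'b) ring_scheme \<Rightarrow> ('a^2^2) monoid" where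
  "GL2 R =
     \<lparr>carrier = {M. (\<forall>i j. M$i$j \<in> carrier R) \<and> det2 R M \<in> Units R},
      mult = (\<lambda>M N. \<chi> i j. (M$i$1 \<otimes>\<^bsub>R\<^esub> N$1$j) \<oplus>\<^bsub>R\<^esub> (M$i$2 \<otimes>\<^bsub>R\<^esub> N$2$j)),
      one = (\<chi> i j. if i = j then \<one>\<^bsub>R\<^esub> else \<zero>\<^bsub>R\<^esub>)\<rparr>"

abbreviation GA :: "('k::{field,finite} adele^2^2) monoid" where
  "GA \<equiv> GL2 adeles"

definition component :: "'k::{field,finite} adele^2^2 \<Rightarrow> 'k place \<Rightarrow> 'k completed^2^2" where
  "component g z = (\<chi> i j. (g$i$j) z)"

text \<open>The image of \<open>GL\<^sub>2(F)\<close> in \<open>GL\<^sub>2(\<A>)\<close> under the diagonal embedding.\<close>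

definition GF :: "('k::{field,finite} adele^2^2) set" where
  "GF = {\<chi> i j. (\<lambda>z. to_completion z (\<gamma>$i$j)) | \<gamma> :: 'k poly fract^2^2. invertible \<gamma>}"

definition monoid_center :: "('a, 'b) monoid_scheme \<Rightarrow> 'a set" where
  "monoid_center H = {z \<in> carrier H. \<forall>g\<in>carrier H. z \<otimes>\<^bsub>H\<^esub> g = g \<otimes>\<^bsub>H\<^esub> z}"

definition max_compact :: "('k::{field,finite} adele^2^2) set" where
  "max_compact = carrier (GL2 integral_adeles)"

definition local_congruence :: "'k::{field,finite} place \<Rightarrow> ('k completed^2^2) set" where
  "local_congruence x =
     {k \<in> carrier (GL2 (integer_ring x)).
        \<forall>i j. k$i$j \<ominus>\<^bsub>completion x\<^esub> \<one>\<^bsub>GL2 (completion x)\<^esub>$i$j \<in> max_ideal x}"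

definition congruence_subgroup :: "'k::{field,finite} place \<Rightarrow> ('k adele^2^2) set" where
  "congruence_subgroup x =
     {g \<in> carrier GA. component g x \<in> local_congruence x \<and>
        (\<forall>z. z \<noteq> x \<longrightarrow> component g z \<in> carrier (GL2 (integer_ring z)))}"

definition at_place ::
  "'k::{field,finite} place \<Rightarrow> 'k completed^2^2 \<Rightarrow> 'k adele^2^2" where
  "at_place y M = (\<chi> i j. (\<lambda>z. if z = y then M$i$j else \<one>\<^bsub>GL2 (completion z)\<^esub>$i$j))"

definition unif_matrix ::
  "'k::{field,finite} place \<Rightarrow> 'k poly fract \<Rightarrow> 'k completed^2^2" where
  "unif_matrix y \<pi> =
     (\<chi> i j. to_completion y (if i = j then if i = 1 then \<pi> else 1 else 0))"

text \<open>
  The coarsest topology for which the entries and the inverse of the determinant are continuous,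
  i.e. the subspace topology for \<open>g \<mapsto> (g, 1 / det g)\<close>.
\<close>

definition GA_topology :: "('k::{field,finite} adele^2^2) topology" where
  "GA_topology = topology_generated_by
     ({{g \<in> carrier GA. g$i$j \<in> U} | i j U. openin adele_topology U} \<union>
      {{g \<in> carrier GA. inv\<^bsub>adeles\<^esub> (det2 adeles g) \<in> U} | U. openin adele_topology U})"

text \<open>
  Regularity is not demanded: the topology is second countable and locally compact Hausdorff, so
  Borel measures that are finite on compact sets are regular.
\<close>

definition normalized_haar :: "('k::{field,finite} adele^2^2) measure \<Rightarrow> bool" where
  "normalized_haar \<mu> \<longleftrightarrow>
     space \<mu> = carrier GA \<and>
     sets \<mu> = sigma_sets (carrier GA) {U. openin GA_topology U} \<and>
     (\<forall>g\<in>carrier GA. \<forall>A\<in>sets \<mu>. emeasure \<mu> (g <#\<^bsub>GA\<^esub> A) = emeasure \<mu> A) \<and>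
     (\<forall>C. compactin GA_topology C \<longrightarrow> C \<in> sets \<mu> \<longrightarrow> emeasure \<mu> C < \<infinity>) \<and>
     emeasure \<mu> max_compact = 1"

definition local_height :: "'k::{field,finite} place \<Rightarrow> 'k completed^2^2 \<Rightarrow> real" where
  "local_height z M =
     Max (insert (completion_abs z (inv\<^bsub>completion z\<^esub> (det2 (completion z) M)))
            (range (\<lambda>(i, j). completion_abs z (M$i$j))))"

text \<open>All but finitely many local factors are \<open>1\<close>; the product runs over the others.\<close>

definition height :: "'k::{field,finite} adele^2^2 \<Rightarrow> real" where
  "height g = (\<Prod>z | local_height z (component g z) \<noteq> 1. local_height z (component g z))"

text \<open>
  A function on \<open>GL\<^sub>2(\<A>)\<close> is a function on the type of all matrices that vanishes outside the
  carrier of \<^const>\<open>GA\<close>.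
\<close>

definition automorphic ::
  "('k::{field,finite} adele^2^2) set \<Rightarrow> ('k adele^2^2 \<Rightarrow> complex) set" where
  "automorphic K' =
     {f. (\<forall>g. g \<notin> carrier GA \<longrightarrow> f g = 0) \<and>
         (\<forall>\<gamma>\<in>GF. \<forall>g\<in>carrier GA. f (\<gamma> \<otimes>\<^bsub>GA\<^esub> g) = f g) \<and>
         (\<forall>z\<in>monoid_center GA. \<forall>g\<in>carrier GA. f (z \<otimes>\<^bsub>GA\<^esub> g) = f g) \<and>
         (\<forall>k\<in>K'. \<forall>g\<in>carrier GA. f (g \<otimes>\<^bsub>GA\<^esub> k) = f g) \<and>
         (\<exists>C N :: real. \<forall>g\<in>carrier GA. cmod (f g) \<le> C * height g powr N)}"

definition hecke ::
  "('k::{field,finite} adele^2^2) measure \<Rightarrow> ('k adele^2^2 \<Rightarrow> complex) \<Rightarrow>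
   ('k adele^2^2 \<Rightarrow> complex) \<Rightarrow> 'k adele^2^2 \<Rightarrow> complex" where
  "hecke \<mu> \<Phi> f g =
     (if g \<in> carrier GA then LINT h|\<mu>. \<Phi> h * f (g \<otimes>\<^bsub>GA\<^esub> h) else 0)"

definition hecke_fun ::
  "('k::{field,finite} adele^2^2) set \<Rightarrow> 'k place \<Rightarrow> 'k poly fract \<Rightarrow> 'k adele^2^2 \<Rightarrow> complex" where
  "hecke_fun K' y \<pi> =
     indicator ((K' #>\<^bsub>GA\<^esub> at_place y (unif_matrix y \<pi>)) <#>\<^bsub>GA\<^esub> K')"

definition fun_scale :: "complex \<Rightarrow> ('a \<Rightarrow> complex) \<Rightarrow> 'a \<Rightarrow> complex" where
  "fun_scale c f = (\<lambda>g. c * f g)"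

lemma vector_space_fun_scale: "vector_space fun_scale"
  by unfold_locales (auto simp: fun_scale_def fun_eq_iff algebra_simps)

definition automorphic_eigenspace ::
  "('k::{field,finite} adele^2^2) measure \<Rightarrow> ('k adele^2^2) set \<Rightarrow>
   ('k adele^2^2 \<Rightarrow> complex) \<Rightarrow> complex \<Rightarrow> ('k adele^2^2 \<Rightarrow> complex) set" where
  "automorphic_eigenspace \<mu> K' \<Phi> l = {f \<in> automorphic K'. hecke \<mu> \<Phi> f = fun_scale l f}"

end

theory Submission
  imports Defs "HOL-Computational_Algebra.Polynomial_Factorial"
begin

text \<open>
  The proof turns automorphic functions into functions on an explicit graph and the Hecke operator
  into a recursion on that graph which can be solved freely from finitely many initial values.

  Put \<open>x\<close> at infinity: a place of degree one has a coordinate \<open>s\<close>, a function with a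
  simple pole at \<open>x\<close> such that \<open>F\<close> is the field of rational functions in \<open>s\<close>, and
  the functions regular outside \<open>x\<close> are the polynomials in \<open>s\<close> (\<open>coord_exists\<close>,
  \<open>integral_imp_poly\<close>). Since polynomials have unique factorisation, every adelic matrix can be
  made integral outside \<open>x\<close> by a rational one (\<open>clear_places\<close>), so a double coset of
  \<open>GL\<^sub>2(F)\<close>, \<open>Z\<close> and \<open>K'\<close> is a class of rational matrices at \<open>x\<close>.
  Reduction theory for \<open>GL\<^sub>2(\<FF>\<^sub>q[s])\<close> gives these classes the representatives
  \<open>diag(s\<^sup>n, 1)\<close> times a representative of a line \<open>w\<close> in \<open>\<FF>\<^sub>q\<^sup>2\<close>, where
  the line is determined for \<open>n > 0\<close> and irrelevant for \<open>n = 0\<close>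
  (\<open>normal_form\<close>, \<open>normal_form_unique\<close>). In terms of vector bundles, \<open>n\<close> is the
  difference of the degrees of the two summands and \<open>w\<close> comes from the trivialisation of the
  fibre at \<open>x\<close>. Thus automorphic functions are functions on the vertices \<open>(n, w)\<close>
  subject to the growth condition (\<open>automorphic_iff\<close>).

  The double coset of the Hecke operator is the disjoint union of the left cosets of \<open>K'\<close>
  indexed by the projective line over the residue field of \<open>y\<close>, so up to the nonzero factor
  \<open>vol(K')\<close> the operator sums a function over the neighbours of a vertex
  (\<open>hecke_eq_sum\<close>). One neighbour of \<open>(n, w)\<close> is \<open>(n + d, w)\<close>, all the others
  have first component at most \<open>\<bar>n - d\<bar>\<close> (\<open>neighbour_None\<close>, \<open>neighbour_Some\<close>).
  Ordering the vertices suitably, the eigenvalue equation at \<open>(n, w)\<close> therefore determines the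
  value at \<open>(n + d, w)\<close> from the values at smaller vertices, and the values at the vertices not
  of the form \<open>(n + d, w)\<close> are free. These are \<open>(0, None)\<close>, the \<open>(n, w)\<close>
  with \<open>0 < n < d\<close>, and the \<open>(d, w)\<close> with \<open>w \<noteq> None\<close>, which makes
  \<open>1 + (d - 1)(q + 1) + q = d(q + 1)\<close> of them (\<open>free_vertices\<close>).

  The growth condition imposes nothing further: a solution of the recursion grows at most
  exponentially in \<open>n\<close> (\<open>solution_growth\<close>), while \<open>q\<^sup>n\<close> is at most the third power
  of the height, by the product formula (\<open>height_bound\<close>).
\<close>

section \<open>Places of the rational function field\<close>

text \<open>The valuation of \<open>0\<close> is a default value. Here \<open>0\<close> counts as having
  infinite valuation, which makes the predicate stable under the ring operations.\<close>

definition vge :: "'k::{field,finite} place \<Rightarrow> int \<Rightarrow> 'k poly fract \<Rightarrow> bool" where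
  "vge z n a \<longleftrightarrow> a = 0 \<or> n \<le> place_val z a"

lemma is_place_val_place_val: "is_place_val (place_val z)"
  using place_val[of z] by simp

lemma place_val_0 [simp]: "place_val z 0 = 0"
  using is_place_val_place_val[of z] by (simp add: is_place_val_def)

lemma place_val_mult: "a \<noteq> 0 \<Longrightarrow> b \<noteq> 0 \<Longrightarrow> place_val z (a * b) = place_val z a + place_val z b"
  using is_place_val_place_val[of z] by (simp add: is_place_val_def)

lemma place_val_add_ge:
  "a \<noteq> 0 \<Longrightarrow> b \<noteq> 0 \<Longrightarrow> a + b \<noteq> 0 \<Longrightarrow> min (place_val z a) (place_val z b) \<le> place_val z (a + b)"
  using is_place_val_place_val[of z] by (simp add: is_place_val_def)

lemma uniformizer_exists: "\<exists>\<pi>. uniformizer z \<pi>"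
  using is_place_val_place_val[of z] by (simp add: is_place_val_def uniformizer_def)

lemma place_val_1 [simp]: "place_val z 1 = 0"
  using place_val_mult[of 1 1 z] by simp

lemma place_val_power: "a \<noteq> 0 \<Longrightarrow> place_val z (a ^ n) = int n * place_val z a"
  by (induction n) (simp_all add: place_val_mult algebra_simps)

lemma place_val_root_of_unity:
  assumes "a ^ n = 1" "n > 0" shows "place_val z a = 0"
proof -
  have "a \<noteq> 0" using assms by (metis power_0_left zero_neq_one less_irrefl)
  with place_val_power[of a z n] assms show ?thesis by simp
qed

lemma place_val_minus [simp]: "place_val z (- a) = place_val z a"
proof (cases "a = 0")
  case False
  have "place_val z (- 1) = 0" by (rule place_val_root_of_unity[of _ 2]) auto
  with place_val_mult[of "- 1" a z] False show ?thesis by simp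
qed simp

lemma place_val_inverse [simp]: "place_val z (inverse a) = - place_val z a"
  using place_val_mult[of a "inverse a" z] by (cases "a = 0") auto

lemma place_val_divide: "a \<noteq> 0 \<Longrightarrow> b \<noteq> 0 \<Longrightarrow> place_val z (a / b) = place_val z a - place_val z b"
  by (simp add: divide_inverse place_val_mult)

lemma place_val_prod:
  "finite A \<Longrightarrow> (\<And>i. i \<in> A \<Longrightarrow> f i \<noteq> 0) \<Longrightarrow> place_val z (\<Prod>i\<in>A. f i) = (\<Sum>i\<in>A. place_val z (f i))"
  by (induction A rule: finite_induct) (simp_all add: place_val_mult)

lemma place_val_powi: "a \<noteq> 0 \<Longrightarrow> place_val z (a powi n) = n * place_val z a"
  by (cases n rule: int_cases2) (simp_all add: place_val_power power_int_minus)

text \<open>Different valuations do not interfere: the smaller one wins.\<close>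

lemma place_val_add_eq:
  assumes "a \<noteq> 0" "b = 0 \<or> place_val z a < place_val z b"
  shows "a + b \<noteq> 0" "place_val z (a + b) = place_val z a"
proof -
  show nz: "a + b \<noteq> 0"
    using assms by (metis add_eq_0_iff less_irrefl place_val_minus add.right_neutral)
  show "place_val z (a + b) = place_val z a"
  proof (cases "b = 0")
    case False
    have "place_val z (a + b) \<ge> place_val z a"
      using place_val_add_ge[of a b z] assms nz False by auto
    moreover have "place_val z a \<ge> min (place_val z (a + b)) (place_val z b)"
      using place_val_add_ge[of "a + b" "- b" z] assms nz False by auto
    ultimately show ?thesis using assms False by auto
  qed simp
qed

lemma vge_0 [simp, intro]: "vge z n 0" by (simp add: vge_def)

lemma vge_1 [simp]: "vge z n 1 \<longleftrightarrow> n \<le> 0" by (simp add: vge_def)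

lemma vge_minus [simp]: "vge z n (- a) = vge z n a" by (simp add: vge_def)

lemma vge_add [intro]: "vge z n a \<Longrightarrow> vge z n b \<Longrightarrow> vge z n (a + b)"
  using place_val_add_ge[of a b z] unfolding vge_def
  by (metis add.left_neutral add.right_neutral min.bounded_iff order_trans)

lemma vge_diff [intro]: "vge z n a \<Longrightarrow> vge z n b \<Longrightarrow> vge z n (a - b)"
  using vge_add[of z n a "- b"] by simp

lemma vge_mult: "vge z n a \<Longrightarrow> vge z m b \<Longrightarrow> vge z (n + m) (a * b)"
  by (cases "a = 0"; cases "b = 0") (simp_all add: vge_def place_val_mult)

lemma vge_mult_0 [intro]: "vge z 0 a \<Longrightarrow> vge z n b \<Longrightarrow> vge z n (a * b)"
  using vge_mult[of z 0 a n b] by simp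

lemma vge_mult_0' [intro]: "vge z n a \<Longrightarrow> vge z 0 b \<Longrightarrow> vge z n (a * b)"
  using vge_mult[of z n a 0 b] by simp

lemma vge_mono: "vge z n a \<Longrightarrow> m \<le> n \<Longrightarrow> vge z m a"
  by (auto simp: vge_def)

lemma vge_sum: "(\<And>i. i \<in> A \<Longrightarrow> vge z n (f i)) \<Longrightarrow> vge z n (\<Sum>i\<in>A. f i)"
  by (induction A rule: infinite_finite_induct) auto

lemma vge_mult_iff: "c \<noteq> 0 \<Longrightarrow> vge z n (c * a) \<longleftrightarrow> vge z (n - place_val z c) a"
  by (cases "a = 0") (auto simp: vge_def place_val_mult)

lemma vge_divide: "c \<noteq> 0 \<Longrightarrow> vge z n (a / c) \<longleftrightarrow> vge z (n + place_val z c) a"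
  by (cases "a = 0") (auto simp: vge_def place_val_divide)

lemma vge_val [simp]: "vge z (place_val z a) a" by (simp add: vge_def)

lemma vge_unit:
  assumes "vge z 1 (a - 1)" shows "a \<noteq> 0" "place_val z a = 0"
  using place_val_add_eq[of 1 "a - 1" z] assms by (auto simp: vge_def)

lemma place_eqI: "(\<And>a. a \<noteq> 0 \<Longrightarrow> place_val z a = place_val w a) \<Longrightarrow> z = w"
  by (metis place_val_0 place_val_inject ext)

subsection \<open>Constants and evaluation of polynomials\<close>

definition const_elt :: "'k::{field,finite} \<Rightarrow> 'k poly fract" where
  "const_elt c = Fract [:c:] 1"

lemma const_elt_0 [simp]: "const_elt 0 = 0" by (simp add: const_elt_def Zero_fract_def)
lemma const_elt_1 [simp]: "const_elt 1 = 1" by (simp add: const_elt_def One_fract_def pCons_one)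
lemma const_elt_add: "const_elt (a + b) = const_elt a + const_elt b" by (simp add: const_elt_def)
lemma const_elt_minus: "const_elt (- a) = - const_elt a" by (simp add: const_elt_def)
lemma const_elt_diff: "const_elt (a - b) = const_elt a - const_elt b" by (simp add: const_elt_def)
lemma const_elt_mult: "const_elt (a * b) = const_elt a * const_elt b" by (simp add: const_elt_def mult.commute)
lemma const_elt_eq_iff [simp]: "const_elt a = const_elt b \<longleftrightarrow> a = b" by (simp add: const_elt_def eq_fract)
lemma const_elt_eq_0_iff [simp]: "const_elt a = 0 \<longleftrightarrow> a = 0" using const_elt_eq_iff[of a 0] by (simp del: const_elt_eq_iff)
lemma const_elt_inverse: "const_elt (inverse a) = inverse (const_elt a)"
  by (cases "a = 0") (simp_all add: inverse_unique[symmetric] flip: const_elt_mult)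
lemma const_elt_power: "const_elt (a ^ n) = const_elt a ^ n"
  by (induction n) (simp_all add: const_elt_mult)

lemma finite_field_root_of_unity:
  fixes c :: "'k::{field,finite}"
  assumes "c \<noteq> 0" shows "\<exists>n>0. c ^ n = 1"
proof -
  have "\<not> inj (\<lambda>n::nat. c ^ n)"
    using finite_imageD[of "\<lambda>n::nat. c ^ n" UNIV] by (auto simp: finite_subset[OF subset_UNIV])
  then obtain i j where ij: "i < j" "c ^ i = c ^ j"
    unfolding inj_def by (metis linorder_neqE_nat)
  have "c ^ i * c ^ (j - i) = c ^ i * 1"
    using ij by (metis le_add_diff_inverse less_imp_le mult.right_neutral power_add)
  hence "c ^ (j - i) = 1" using assms by simp
  with ij show ?thesis by (intro exI[of _ "j - i"]) auto
qed

lemma place_val_const_elt [simp]: "place_val z (const_elt c) = 0"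
proof (cases "c = 0")
  case False
  then obtain n where "n > 0" "c ^ n = 1" using finite_field_root_of_unity by blast
  thus ?thesis by (intro place_val_root_of_unity[of _ n]) (simp_all flip: const_elt_power)
qed simp

lemma vge_const_elt [simp]: "vge z n (const_elt c) \<longleftrightarrow> c = 0 \<or> n \<le> 0"
  by (simp add: vge_def)

text \<open>For a coordinate \<open>s\<close> of the projective line this is the embedding of
  \<open>\<FF>\<^sub>q[s]\<close> into \<open>F\<close>.\<close>

definition ev :: "'k::{field,finite} poly fract \<Rightarrow> 'k poly \<Rightarrow> 'k poly fract" where
  "ev s a = poly (map_poly const_elt a) s"

lemma ev_0 [simp]: "ev s 0 = 0" by (simp add: ev_def)
lemma ev_pCons: "ev s (pCons c a) = const_elt c + s * ev s a"
  by (simp add: ev_def map_poly_pCons)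
lemma ev_1 [simp]: "ev s 1 = 1" by (simp add: one_pCons ev_pCons)
lemma ev_add: "ev s (a + b) = ev s a + ev s b"
  by (induction a b rule: poly_induct2) (simp_all add: ev_pCons const_elt_add algebra_simps)
lemma ev_minus: "ev s (- a) = - ev s a"
  by (induction a) (simp_all add: ev_pCons const_elt_minus algebra_simps)
lemma ev_diff: "ev s (a - b) = ev s a - ev s b"
  using ev_add[of s a "- b"] by (simp add: ev_minus)
lemma ev_smult: "ev s (Polynomial.smult c a) = const_elt c * ev s a"
  by (induction a) (simp_all add: ev_pCons const_elt_mult algebra_simps)
lemma ev_mult: "ev s (a * b) = ev s a * ev s b"
  by (induction a) (simp_all add: ev_pCons ev_add ev_smult algebra_simps)
lemma ev_power: "ev s (a ^ n) = ev s a ^ n"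
  by (induction n) (simp_all add: ev_mult)

lemma vge_ev: "vge z 0 s \<Longrightarrow> vge z 0 (ev s a)"
  by (induction a) (auto simp: ev_pCons intro!: vge_add vge_mult_0)

text \<open>At a pole of \<open>s\<close> the leading term has strictly the smallest valuation.\<close>

lemma place_val_ev_pole:
  assumes "place_val z s < 0" "a \<noteq> 0"
  shows "ev s a \<noteq> 0 \<and> place_val z (ev s a) = int (degree a) * place_val z s"
  using assms(2)
proof (induction a)
  case (pCons c a)
  have s: "s \<noteq> 0" using assms(1) by auto
  show ?case
  proof (cases "a = 0")
    case True
    with pCons show ?thesis by (simp add: ev_pCons)
  next
    case False
    with pCons have IH: "ev s a \<noteq> 0" "place_val z (ev s a) = int (degree a) * place_val z s"
      by auto
    have v: "place_val z (s * ev s a) = int (Suc (degree a)) * place_val z s"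
      using IH s by (simp add: place_val_mult algebra_simps)
    have "place_val z (s * ev s a) < 0"
      unfolding v using assms(1) by (simp add: mult_less_0_iff)
    hence "s * ev s a + const_elt c \<noteq> 0" "place_val z (s * ev s a + const_elt c) = place_val z (s * ev s a)"
      using place_val_add_eq[of "s * ev s a" "const_elt c" z] IH s by auto
    thus ?thesis using v False by (simp add: ev_pCons add.commute)
  qed
qed simp

lemma poly_prime_decompose:
  fixes p a :: "'k::field poly"
  assumes "prime_elem p" "a \<noteq> 0"
  shows "\<exists>m b. a = p ^ m * b \<and> \<not> p dvd b"
  using assms(2)
proof (induction "degree a" arbitrary: a rule: less_induct)
  case less
  show ?case
  proof (cases "p dvd a")
    case True
    then obtain b where b: "a = p * b" by auto
    have "p \<noteq> 0" "\<not> is_unit p" using assms(1) by (auto simp: prime_elem_def)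
    hence "degree p > 0" by (auto simp: is_unit_iff_degree)
    hence "degree b < degree a" "b \<noteq> 0" using b less.prems \<open>p \<noteq> 0\<close> by (auto simp: degree_mult_eq)
    from less.hyps[OF this] obtain m c where "b = p ^ m * c" "\<not> p dvd c" by auto
    thus ?thesis using b by (intro exI[of _ "Suc m"] exI[of _ c]) auto
  next
    case False
    thus ?thesis by (intro exI[of _ 0] exI[of _ a]) auto
  qed
qed

lemma poly_prime_decompose_unique:
  fixes p a b :: "'k::field poly"
  assumes "prime_elem p" "p ^ m * a = p ^ n * b" "\<not> p dvd a" "\<not> p dvd b"
  shows "m = n"
proof (rule ccontr)
  assume "m \<noteq> n"
  have p0: "p \<noteq> 0" using assms(1) by auto
  have *: False if "i < j" "p ^ i * c = p ^ j * d" "\<not> p dvd c" for i j c d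
  proof -
    have "p ^ i * c = p ^ i * (p * (p ^ (j - Suc i) * d))"
      using that by (simp flip: power_Suc power_add mult.assoc)
    hence "c = p * (p ^ (j - Suc i) * d)" using p0 by simp
    thus False using that(3) by (metis dvd_triv_left)
  qed
  show False using *[of m n a b] *[of n m b a] assms \<open>m \<noteq> n\<close> by (metis linorder_neqE_nat)
qed

text \<open>The multiplicity of a prime factor. It is applied to primes that come from places, over a
  coefficient type without a chosen normalisation of gcds.\<close>

definition ordp :: "'k::field poly \<Rightarrow> 'k poly \<Rightarrow> nat" where
  "ordp p a = (SOME m. \<exists>b. a = p ^ m * b \<and> \<not> p dvd b)"

lemma ordp_decompose:
  assumes "prime_elem p" "a \<noteq> 0"
  obtains b where "a = p ^ ordp p a * b" "\<not> p dvd b"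
proof -
  have "\<exists>b. a = p ^ ordp p a * b \<and> \<not> p dvd b"
    unfolding ordp_def using poly_prime_decompose[OF assms] by (rule someI_ex)
  thus ?thesis using that by auto
qed

lemma ordp_eqI:
  assumes "prime_elem p" "\<not> p dvd b" shows "ordp p (p ^ m * b) = m"
proof -
  have "p ^ m * b \<noteq> 0" using assms by (auto simp: prime_elem_def)
  then obtain c where "p ^ m * b = p ^ ordp p (p ^ m * b) * c" "\<not> p dvd c"
    using ordp_decompose[OF assms(1)] by blast
  thus ?thesis using poly_prime_decompose_unique[OF assms(1)] assms(2) by metis
qed

lemma ordp_mult:
  assumes "prime_elem p" "a \<noteq> 0" "b \<noteq> 0"
  shows "ordp p (a * b) = ordp p a + ordp p b"
proof -
  obtain c where c: "a = p ^ ordp p a * c" "\<not> p dvd c" using ordp_decompose assms by metis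
  obtain d where d: "b = p ^ ordp p b * d" "\<not> p dvd d" using ordp_decompose assms by metis
  have "a * b = p ^ (ordp p a + ordp p b) * (c * d)"
    by (subst c(1), subst d(1)) (simp add: power_add)
  moreover have "\<not> p dvd c * d" using c d assms(1) by (simp add: prime_elem_dvd_mult_iff)
  ultimately show ?thesis using ordp_eqI[OF assms(1)] by metis
qed

lemma ordp_ge_iff:
  assumes "prime_elem p" "a \<noteq> 0" shows "m \<le> ordp p a \<longleftrightarrow> p ^ m dvd a"
proof
  assume "m \<le> ordp p a"
  thus "p ^ m dvd a" using ordp_decompose[OF assms] by (metis dvd_trans dvd_triv_left le_imp_power_dvd)
next
  assume "p ^ m dvd a"
  then obtain b where b: "a = p ^ m * b" by auto
  have "b \<noteq> 0" using b assms by auto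
  then obtain c where c: "b = p ^ ordp p b * c" "\<not> p dvd c" using ordp_decompose assms by metis
  have "a = p ^ (m + ordp p b) * c" by (subst b, subst c(1)) (simp add: power_add)
  thus "m \<le> ordp p a" using ordp_eqI[OF assms(1) c(2)] by simp
qed

section \<open>The completions\<close>

lemma cauchy_seqs_iff:
  "s \<in> cauchy_seqs z \<longleftrightarrow> (\<forall>n. \<exists>M. \<forall>i\<ge>M. \<forall>j\<ge>M. vge z n (s i - s j))"
  by (simp add: cauchy_seqs_def vge_def)

lemma null_seqs_iff: "s \<in> null_seqs z \<longleftrightarrow> (\<forall>n. \<forall>\<^sub>F i in sequentially. vge z n (s i))"
  by (simp add: null_seqs_def vge_def eventually_sequentially)

lemma cauchy_seqs_const [simp, intro]: "(\<lambda>_. a) \<in> cauchy_seqs z"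
  by (simp add: cauchy_seqs_iff)

lemma cauchy_seqs_add [intro]:
  assumes "s \<in> cauchy_seqs z" "t \<in> cauchy_seqs z" shows "(\<lambda>i. s i + t i) \<in> cauchy_seqs z"
  unfolding cauchy_seqs_iff
proof
  fix n
  obtain M where M: "\<forall>i\<ge>M. \<forall>j\<ge>M. vge z n (s i - s j)"
    using assms(1) unfolding cauchy_seqs_iff by blast
  obtain N where N: "\<forall>i\<ge>N. \<forall>j\<ge>N. vge z n (t i - t j)"
    using assms(2) unfolding cauchy_seqs_iff by blast
  have "vge z n (s i + t i - (s j + t j))" if "i \<ge> max M N" "j \<ge> max M N" for i j
    using vge_add[of z n "s i - s j" "t i - t j"] M N that by (simp add: algebra_simps)
  thus "\<exists>M. \<forall>i\<ge>M. \<forall>j\<ge>M. vge z n (s i + t i - (s j + t j))" by blast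
qed

lemma cauchy_seqs_minus [intro]: "s \<in> cauchy_seqs z \<Longrightarrow> (\<lambda>i. - s i) \<in> cauchy_seqs z"
proof -
  have "vge z n (- s i - - s j) = vge z n (s i - s j)" for n i j
    using vge_minus[of z n "s i - s j"] by (simp add: algebra_simps)
  thus "s \<in> cauchy_seqs z \<Longrightarrow> (\<lambda>i. - s i) \<in> cauchy_seqs z"
    unfolding cauchy_seqs_iff by simp
qed

lemma cauchy_seqs_diff:
  "s \<in> cauchy_seqs z \<Longrightarrow> t \<in> cauchy_seqs z \<Longrightarrow> (\<lambda>i. s i - t i) \<in> cauchy_seqs z"
  using cauchy_seqs_add[OF _ cauchy_seqs_minus, of s z t] by simp

lemma cauchy_seqs_bounded:
  assumes "s \<in> cauchy_seqs z" shows "\<exists>n\<le>0. \<forall>\<^sub>F i in sequentially. vge z n (s i)"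
proof -
  obtain M where M: "\<forall>i\<ge>M. \<forall>j\<ge>M. vge z 0 (s i - s j)"
    using assms(1) unfolding cauchy_seqs_iff by blast
  define n where "n = min 0 (place_val z (s M))"
  have "vge z n (s i)" if "i \<ge> M" for i
  proof -
    have "vge z n (s i - s M)" using M that by (auto simp: n_def intro: vge_mono[of z 0])
    moreover have "vge z n (s M)" by (auto simp: n_def vge_def)
    ultimately have "vge z n (s i - s M + s M)" by (rule vge_add)
    thus ?thesis by simp
  qed
  moreover have "n \<le> 0" by (simp add: n_def)
  ultimately show ?thesis unfolding eventually_sequentially by blast
qed

lemma cauchy_seqs_mult [intro]:
  assumes "s \<in> cauchy_seqs z" "t \<in> cauchy_seqs z" shows "(\<lambda>i. s i * t i) \<in> cauchy_seqs z"
  unfolding cauchy_seqs_iff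
proof
  fix n
  obtain a A where a: "\<forall>i\<ge>A. vge z a (s i)"
    using cauchy_seqs_bounded[OF assms(1)] by (auto simp: eventually_sequentially)
  obtain b B where b: "\<forall>i\<ge>B. vge z b (t i)"
    using cauchy_seqs_bounded[OF assms(2)] by (auto simp: eventually_sequentially)
  obtain M where M: "\<forall>i\<ge>M. \<forall>j\<ge>M. vge z (n - b) (s i - s j)"
    using assms(1) unfolding cauchy_seqs_iff by blast
  obtain N where N: "\<forall>i\<ge>N. \<forall>j\<ge>N. vge z (n - a) (t i - t j)"
    using assms(2) unfolding cauchy_seqs_iff by blast
  have "vge z n (s i * t i - s j * t j)"
    if "i \<ge> max (max A B) (max M N)" "j \<ge> max (max A B) (max M N)" for i j
  proof -
    have "vge z n ((s i - s j) * t i)" "vge z n (s j * (t i - t j))"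
      using vge_mult[of z "n - b" "s i - s j" b "t i"] vge_mult[of z a "s j" "n - a" "t i - t j"]
        a b M N that by auto
    hence "vge z n ((s i - s j) * t i + s j * (t i - t j))" by (rule vge_add)
    thus ?thesis by (simp add: algebra_simps)
  qed
  thus "\<exists>M. \<forall>i\<ge>M. \<forall>j\<ge>M. vge z n (s i * t i - s j * t j)" by blast
qed

lemma null_imp_cauchy: "s \<in> null_seqs z \<Longrightarrow> s \<in> cauchy_seqs z"
  unfolding cauchy_seqs_iff null_seqs_iff eventually_sequentially by (meson vge_diff)

lemma null_seqs_add: "s \<in> null_seqs z \<Longrightarrow> t \<in> null_seqs z \<Longrightarrow> (\<lambda>i. s i + t i) \<in> null_seqs z"
  unfolding null_seqs_iff
proof
  fix n
  assume "\<forall>n. \<forall>\<^sub>F i in sequentially. vge z n (s i)" "\<forall>n. \<forall>\<^sub>F i in sequentially. vge z n (t i)"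
  hence "\<forall>\<^sub>F i in sequentially. vge z n (s i)" "\<forall>\<^sub>F i in sequentially. vge z n (t i)" by blast+
  thus "\<forall>\<^sub>F i in sequentially. vge z n (s i + t i)" by eventually_elim (rule vge_add)
qed

lemma null_seqs_mult:
  assumes "s \<in> cauchy_seqs z" "t \<in> null_seqs z" shows "(\<lambda>i. s i * t i) \<in> null_seqs z"
  unfolding null_seqs_iff
proof
  fix n
  obtain a where a: "\<forall>\<^sub>F i in sequentially. vge z a (s i)"
    using cauchy_seqs_bounded[OF assms(1)] by auto
  have "\<forall>\<^sub>F i in sequentially. vge z (n - a) (t i)"
    using assms(2) by (simp add: null_seqs_iff)
  with a show "\<forall>\<^sub>F i in sequentially. vge z n (s i * t i)"
    by eventually_elim (use vge_mult[of z a _ "n - a"] in force)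
qed

lemma null_seqs_0 [simp, intro]: "(\<lambda>_. 0) \<in> null_seqs z" by (simp add: null_seqs_iff)

lemma null_seqs_minus: "s \<in> null_seqs z \<Longrightarrow> (\<lambda>i. - s i) \<in> null_seqs z"
  by (simp add: null_seqs_iff)

lemma cauchy_ring_simps [simp]:
  "carrier (cauchy_ring z) = cauchy_seqs z" "\<one>\<^bsub>cauchy_ring z\<^esub> = (\<lambda>_. 1)"
  "\<zero>\<^bsub>cauchy_ring z\<^esub> = (\<lambda>_. 0)" "s \<otimes>\<^bsub>cauchy_ring z\<^esub> t = (\<lambda>i. s i * t i)"
  "s \<oplus>\<^bsub>cauchy_ring z\<^esub> t = (\<lambda>i. s i + t i)"
  by (simp_all add: cauchy_ring_def)

lemma cring_cauchy_ring: "cring (cauchy_ring z)"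
proof (rule cringI)
  show "abelian_group (cauchy_ring z)"
  proof (rule abelian_groupI)
    fix s assume "s \<in> carrier (cauchy_ring z)"
    hence "(\<lambda>i. - s i) \<in> carrier (cauchy_ring z)" "(\<lambda>i. - s i) \<oplus>\<^bsub>cauchy_ring z\<^esub> s = \<zero>\<^bsub>cauchy_ring z\<^esub>"
      by auto
    thus "\<exists>t\<in>carrier (cauchy_ring z). t \<oplus>\<^bsub>cauchy_ring z\<^esub> s = \<zero>\<^bsub>cauchy_ring z\<^esub>" by blast
  qed (auto simp: algebra_simps)
  show "Group.comm_monoid (cauchy_ring z)"
    by (rule comm_monoidI) (auto simp: algebra_simps)
qed (auto simp: algebra_simps)

lemma cauchy_ring_a_inv [simp]:
  assumes "s \<in> cauchy_seqs z" shows "\<ominus>\<^bsub>cauchy_ring z\<^esub> s = (\<lambda>i. - s i)"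
proof -
  interpret cring "cauchy_ring z" by (rule cring_cauchy_ring)
  show ?thesis using assms by (intro minus_equality) auto
qed

lemma ideal_null_seqs: "ideal (null_seqs z) (cauchy_ring z)"
proof -
  interpret cring "cauchy_ring z" by (rule cring_cauchy_ring)
  show ?thesis
  proof (rule idealI)
    show "ring (cauchy_ring z)" by (rule ring_axioms)
    show "subgroup (null_seqs z) (add_monoid (cauchy_ring z))"
    proof (rule subgroup.intro)
      fix s assume "s \<in> null_seqs z"
      thus "inv\<^bsub>add_monoid (cauchy_ring z)\<^esub> s \<in> null_seqs z"
        unfolding a_inv_def[symmetric] by (simp add: null_seqs_minus null_imp_cauchy)
    qed (auto simp: null_seqs_add null_imp_cauchy)
  next
    fix s t assume *: "s \<in> null_seqs z" "t \<in> carrier (cauchy_ring z)"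
    thus "t \<otimes>\<^bsub>cauchy_ring z\<^esub> s \<in> null_seqs z" using null_seqs_mult[of t z s] by simp
    with * show "s \<otimes>\<^bsub>cauchy_ring z\<^esub> t \<in> null_seqs z" by (simp add: mult.commute)
  qed
qed

definition cls :: "'k::{field,finite} place \<Rightarrow> (nat \<Rightarrow> 'k poly fract) \<Rightarrow> 'k completed" where
  "cls z s = null_seqs z +>\<^bsub>cauchy_ring z\<^esub> s"

lemma mem_cls_iff: "t \<in> cls z s \<longleftrightarrow> (\<lambda>i. t i - s i) \<in> null_seqs z"
proof -
  have "t \<in> cls z s \<longleftrightarrow> (\<exists>h\<in>null_seqs z. t = (\<lambda>i. h i + s i))"
    by (auto simp: cls_def a_r_coset_def')
  also have "\<dots> \<longleftrightarrow> (\<lambda>i. t i - s i) \<in> null_seqs z"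
    by (force intro: bexI[of _ "\<lambda>i. t i - s i"])
  finally show ?thesis .
qed

lemma cls_eq_iff: "cls z s = cls z t \<longleftrightarrow> (\<lambda>i. s i - t i) \<in> null_seqs z"
proof
  assume "cls z s = cls z t"
  moreover have "s \<in> cls z s" by (simp add: mem_cls_iff)
  ultimately show "(\<lambda>i. s i - t i) \<in> null_seqs z" by (simp add: mem_cls_iff)
next
  assume *: "(\<lambda>i. s i - t i) \<in> null_seqs z"
  show "cls z s = cls z t"
  proof (rule Set.set_eqI)
    fix r
    show "r \<in> cls z s \<longleftrightarrow> r \<in> cls z t"
      using null_seqs_add[OF _ *, of "\<lambda>i. r i - s i"]
        null_seqs_add[OF _ null_seqs_minus[OF *], of "\<lambda>i. r i - t i"]
      by (auto simp: mem_cls_iff)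
  qed
qed

lemma cring_completion: "cring (completion z)"
  unfolding completion_def by (rule ideal.quotient_is_cring[OF ideal_null_seqs cring_cauchy_ring])

lemma completion_cls:
  shows carrier_completion: "carrier (completion z) = cls z ` cauchy_seqs z"
    and completion_zero: "\<zero>\<^bsub>completion z\<^esub> = cls z (\<lambda>_. 0)"
    and completion_one: "\<one>\<^bsub>completion z\<^esub> = cls z (\<lambda>_. 1)"
    and completion_add: "\<lbrakk>s \<in> cauchy_seqs z; t \<in> cauchy_seqs z\<rbrakk> \<Longrightarrow>
          cls z s \<oplus>\<^bsub>completion z\<^esub> cls z t = cls z (\<lambda>i. s i + t i)"
    and completion_mult: "\<lbrakk>s \<in> cauchy_seqs z; t \<in> cauchy_seqs z\<rbrakk> \<Longrightarrow>
          cls z s \<otimes>\<^bsub>completion z\<^esub> cls z t = cls z (\<lambda>i. s i * t i)"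
proof -
  interpret ideal "null_seqs z" "cauchy_ring z" by (rule ideal_null_seqs)
  have hom: "cls z \<in> ring_hom (cauchy_ring z) (completion z)"
    using rcos_ring_hom unfolding completion_def cls_def[abs_def] .
  show "carrier (completion z) = cls z ` cauchy_seqs z"
    by (auto simp: completion_def FactRing_def A_RCOSETS_def' cls_def)
  show "\<zero>\<^bsub>completion z\<^esub> = cls z (\<lambda>_. 0)"
    using a_rcos_const[of "\<lambda>_. 0"] by (simp add: completion_def FactRing_def cls_def)
  show "\<one>\<^bsub>completion z\<^esub> = cls z (\<lambda>_. 1)"
    by (simp add: completion_def FactRing_def cls_def)
  show "cls z s \<oplus>\<^bsub>completion z\<^esub> cls z t = cls z (\<lambda>i. s i + t i)"
    if "s \<in> cauchy_seqs z" "t \<in> cauchy_seqs z"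
    using ring_hom_add[OF hom, of s t] that by simp
  show "cls z s \<otimes>\<^bsub>completion z\<^esub> cls z t = cls z (\<lambda>i. s i * t i)"
    if "s \<in> cauchy_seqs z" "t \<in> cauchy_seqs z"
    using ring_hom_mult[OF hom, of s t] that by simp
qed

lemma to_completion_cls: "to_completion z a = cls z (\<lambda>_. a)"
  by (simp add: to_completion_def cls_def)

lemma to_completion_closed [simp, intro]: "to_completion z a \<in> carrier (completion z)"
  by (auto simp: to_completion_cls carrier_completion)

lemma to_completion_0 [simp]: "to_completion z 0 = \<zero>\<^bsub>completion z\<^esub>"
  by (simp add: to_completion_cls completion_zero)

lemma to_completion_1 [simp]: "to_completion z 1 = \<one>\<^bsub>completion z\<^esub>"
  by (simp add: to_completion_cls completion_one)

lemma to_completion_add: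
  "to_completion z (a + b) = to_completion z a \<oplus>\<^bsub>completion z\<^esub> to_completion z b"
  by (simp add: to_completion_cls completion_add)

lemma to_completion_mult:
  "to_completion z (a * b) = to_completion z a \<otimes>\<^bsub>completion z\<^esub> to_completion z b"
  by (simp add: to_completion_cls completion_mult)

lemma completion_minus:
  assumes "s \<in> cauchy_seqs z" shows "\<ominus>\<^bsub>completion z\<^esub> cls z s = cls z (\<lambda>i. - s i)"
proof -
  interpret cring "completion z" by (rule cring_completion)
  show ?thesis
    using assms cauchy_seqs_minus[OF assms]
    by (intro minus_equality) (simp_all add: completion_add completion_zero carrier_completion)
qed

lemma completion_diff:
  "\<lbrakk>s \<in> cauchy_seqs z; t \<in> cauchy_seqs z\<rbrakk> \<Longrightarrow>
     cls z s \<ominus>\<^bsub>completion z\<^esub> cls z t = cls z (\<lambda>i. s i - t i)"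
  by (simp add: a_minus_def completion_minus completion_add cauchy_seqs_minus)

lemma to_completion_diff:
  "to_completion z (a - b) = to_completion z a \<ominus>\<^bsub>completion z\<^esub> to_completion z b"
  by (simp add: to_completion_cls completion_diff)

lemma to_completion_eq_iff [simp]: "to_completion z a = to_completion z b \<longleftrightarrow> a = b"
proof
  assume "to_completion z a = to_completion z b"
  hence "vge z (place_val z (a - b) + 1) (a - b)"
    by (simp add: to_completion_cls cls_eq_iff null_seqs_iff)
  thus "a = b" by (simp add: vge_def)
qed simp

lemma to_completion_eq_0_iff [simp]: "to_completion z a = \<zero>\<^bsub>completion z\<^esub> \<longleftrightarrow> a = 0"
  using to_completion_eq_iff[of z a 0] by (simp del: to_completion_eq_iff)

subsection \<open>The extended valuation\<close>

lemma completion_zero_iff: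
  "s \<in> cauchy_seqs z \<Longrightarrow> cls z s = \<zero>\<^bsub>completion z\<^esub> \<longleftrightarrow> s \<in> null_seqs z"
  by (simp add: completion_zero cls_eq_iff)

text \<open>Adding a null sequence does not change a valuation that is eventually constant, so one
  representative of the class suffices to compute the definite description.\<close>

lemma completion_val_eqI:
  assumes ev: "\<forall>\<^sub>F i in sequentially. s i \<noteq> 0 \<and> place_val z (s i) = n"
  shows "completion_val z (cls z s) = n" "s \<notin> null_seqs z"
proof -
  have *: "\<forall>\<^sub>F i in sequentially. t i \<noteq> 0 \<and> place_val z (t i) = n" if "t \<in> cls z s" for t
  proof -
    have "\<forall>\<^sub>F i in sequentially. vge z (n + 1) (t i - s i)"
      using that by (simp add: mem_cls_iff null_seqs_iff)
    with ev show ?thesis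
    proof eventually_elim
      case (elim i)
      thus ?case using place_val_add_eq[of "s i" "t i - s i" z] by (auto simp: vge_def)
    qed
  qed
  show "completion_val z (cls z s) = n"
    unfolding completion_val_def
  proof (rule the_equality)
    show "\<forall>t\<in>cls z s. \<forall>\<^sub>F i in sequentially. t i \<noteq> 0 \<and> place_val z (t i) = n"
      using * by blast
  next
    fix m assume "\<forall>t\<in>cls z s. \<forall>\<^sub>F i in sequentially. t i \<noteq> 0 \<and> place_val z (t i) = m"
    moreover have "s \<in> cls z s" by (simp add: mem_cls_iff)
    ultimately have "\<forall>\<^sub>F i in sequentially. s i \<noteq> 0 \<and> place_val z (s i) = m" by blast
    with ev have "\<forall>\<^sub>F i in sequentially. m = n" by eventually_elim auto
    thus "m = n" by simp
  qed
  show "s \<notin> null_seqs z"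
  proof
    assume "s \<in> null_seqs z"
    hence "\<forall>\<^sub>F i in sequentially. vge z (n + 1) (s i)" by (simp add: null_seqs_iff)
    with ev have "\<forall>\<^sub>F i in sequentially. False" by eventually_elim (auto simp: vge_def)
    thus False by simp
  qed
qed

text \<open>The terms stay away from \<open>0\<close> while their differences become small, so the
  ultrametric inequality freezes the valuation.\<close>

lemma cauchy_not_null:
  assumes "s \<in> cauchy_seqs z" "s \<notin> null_seqs z"
  shows "\<exists>n. \<forall>\<^sub>F i in sequentially. s i \<noteq> 0 \<and> place_val z (s i) = n"
proof -
  obtain n where n: "\<And>M. \<exists>i\<ge>M. \<not> vge z n (s i)"
    using assms(2) by (auto simp: null_seqs_iff eventually_sequentially)
  obtain M where M: "\<forall>i\<ge>M. \<forall>j\<ge>M. vge z n (s i - s j)"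
    using assms(1) unfolding cauchy_seqs_iff by blast
  obtain j where j: "j \<ge> M" "\<not> vge z n (s j)" using n by blast
  have "s i \<noteq> 0 \<and> place_val z (s i) = place_val z (s j)" if "i \<ge> M" for i
  proof -
    have "vge z n (s i - s j)" using M j that by blast
    with j show ?thesis using place_val_add_eq[of "s j" "s i - s j" z] by (auto simp: vge_def)
  qed
  thus ?thesis by (auto simp: eventually_sequentially)
qed

text \<open>The conditions \<open>cge z 0\<close> and \<open>cge z 1\<close> describe the ring of integers
  and its maximal ideal, and all estimates in the completion are phrased by this predicate.\<close>

definition cge :: "'k::{field,finite} place \<Rightarrow> int \<Rightarrow> 'k completed \<Rightarrow> bool" where
  "cge z n A \<longleftrightarrow> A \<in> carrier (completion z) \<and> (A = \<zero>\<^bsub>completion z\<^esub> \<or> n \<le> completion_val z A)"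

lemma cge_cls:
  assumes "s \<in> cauchy_seqs z"
  shows "cge z n (cls z s) \<longleftrightarrow> (\<forall>\<^sub>F i in sequentially. vge z n (s i))"
proof (cases "s \<in> null_seqs z")
  case True
  thus ?thesis using assms by (auto simp: cge_def completion_zero_iff null_seqs_iff carrier_completion)
next
  case False
  then obtain m where m: "\<forall>\<^sub>F i in sequentially. s i \<noteq> 0 \<and> place_val z (s i) = m"
    using cauchy_not_null assms by blast
  have "(\<forall>\<^sub>F i in sequentially. vge z n (s i)) \<longleftrightarrow> (\<forall>\<^sub>F i in sequentially. (n \<le> m))"
    by (rule eventually_cong[OF m]) (auto simp: vge_def)
  thus ?thesis
    using assms False completion_val_eqI[OF m]
    by (auto simp: cge_def completion_zero_iff carrier_completion)
qed

lemma cge_closed: "cge z n A \<Longrightarrow> A \<in> carrier (completion z)"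
  by (simp add: cge_def)

lemma cge_representative: "cge z n A \<Longrightarrow> \<exists>s\<in>cauchy_seqs z. A = cls z s"
  by (auto simp: cge_def carrier_completion)

lemma cge_mono: "cge z n A \<Longrightarrow> m \<le> n \<Longrightarrow> cge z m A"
  by (auto simp: cge_def)

lemma cge_zero [simp, intro]: "cge z n \<zero>\<^bsub>completion z\<^esub>"
  by (simp add: completion_zero cge_cls)

lemma cge_to_completion [simp]: "cge z n (to_completion z a) \<longleftrightarrow> vge z n a"
  by (simp add: to_completion_cls cge_cls)

lemma cge_one [simp]: "cge z n \<one>\<^bsub>completion z\<^esub> \<longleftrightarrow> n \<le> 0"
  using cge_to_completion[of z n 1] by (simp del: cge_to_completion)

lemma cge_add [intro]: "cge z n A \<Longrightarrow> cge z n B \<Longrightarrow> cge z n (A \<oplus>\<^bsub>completion z\<^esub> B)"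
proof -
  assume *: "cge z n A" "cge z n B"
  then obtain s t where st: "s \<in> cauchy_seqs z" "t \<in> cauchy_seqs z" "A = cls z s" "B = cls z t"
    by (meson cge_representative)
  have "\<forall>\<^sub>F i in sequentially. vge z n (s i)" "\<forall>\<^sub>F i in sequentially. vge z n (t i)"
    using * st by (simp_all add: cge_cls)
  hence "\<forall>\<^sub>F i in sequentially. vge z n (s i + t i)" by eventually_elim auto
  thus ?thesis using st by (simp add: completion_add cge_cls cauchy_seqs_add)
qed

lemma cge_mult: "cge z n A \<Longrightarrow> cge z m B \<Longrightarrow> cge z (n + m) (A \<otimes>\<^bsub>completion z\<^esub> B)"
proof -
  assume *: "cge z n A" "cge z m B"
  then obtain s t where st: "s \<in> cauchy_seqs z" "t \<in> cauchy_seqs z" "A = cls z s" "B = cls z t"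
    by (meson cge_representative)
  have "\<forall>\<^sub>F i in sequentially. vge z n (s i)" "\<forall>\<^sub>F i in sequentially. vge z m (t i)"
    using * st by (simp_all add: cge_cls)
  hence "\<forall>\<^sub>F i in sequentially. vge z (n + m) (s i * t i)" by eventually_elim (rule vge_mult)
  thus ?thesis using st by (simp add: completion_mult cge_cls cauchy_seqs_mult)
qed

lemma cge_mult_0 [intro]: "cge z 0 A \<Longrightarrow> cge z n B \<Longrightarrow> cge z n (A \<otimes>\<^bsub>completion z\<^esub> B)"
  using cge_mult[of z 0 A n B] by simp

lemma cge_mult_0' [intro]: "cge z n A \<Longrightarrow> cge z 0 B \<Longrightarrow> cge z n (A \<otimes>\<^bsub>completion z\<^esub> B)"
  using cge_mult[of z n A 0 B] by simp

lemma cge_minus [intro]: "cge z n A \<Longrightarrow> cge z n (\<ominus>\<^bsub>completion z\<^esub> A)"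
proof -
  assume *: "cge z n A"
  then obtain s where s: "s \<in> cauchy_seqs z" "A = cls z s"
    by (meson cge_representative)
  thus ?thesis using * by (simp add: completion_minus cge_cls cauchy_seqs_minus)
qed

lemma cge_diff [intro]: "cge z n A \<Longrightarrow> cge z n B \<Longrightarrow> cge z n (A \<ominus>\<^bsub>completion z\<^esub> B)"
  by (auto simp: a_minus_def)

lemma cge_val: "A \<in> carrier (completion z) \<Longrightarrow> cge z (completion_val z A) A"
  by (simp add: cge_def)

lemma completion_val_to_completion [simp]:
  "a \<noteq> 0 \<Longrightarrow> completion_val z (to_completion z a) = place_val z a"
  unfolding to_completion_cls by (rule completion_val_eqI) simp

text \<open>A late term of a representing Cauchy sequence is a good approximation.\<close>

lemma completion_dense:
  assumes "A \<in> carrier (completion z)"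
  shows "\<exists>a. cge z n (A \<ominus>\<^bsub>completion z\<^esub> to_completion z a)"
proof -
  obtain s where s: "s \<in> cauchy_seqs z" "A = cls z s"
    using assms by (auto simp: carrier_completion)
  obtain M where M: "\<forall>i\<ge>M. \<forall>j\<ge>M. vge z n (s i - s j)"
    using s unfolding cauchy_seqs_iff by blast
  have "(\<lambda>i. s i - s M) \<in> cauchy_seqs z" using s by (simp add: cauchy_seqs_diff)
  moreover have "\<forall>\<^sub>F i in sequentially. vge z n (s i - s M)"
    using M by (auto simp: eventually_sequentially)
  ultimately have "cge z n (A \<ominus>\<^bsub>completion z\<^esub> to_completion z (s M))"
    using s by (simp add: to_completion_cls completion_diff cge_cls)
  thus ?thesis by blast
qed

lemma completion_val_mult:
  assumes "A \<in> carrier (completion z)" "B \<in> carrier (completion z)"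
    "A \<noteq> \<zero>\<^bsub>completion z\<^esub>" "B \<noteq> \<zero>\<^bsub>completion z\<^esub>"
  shows "A \<otimes>\<^bsub>completion z\<^esub> B \<noteq> \<zero>\<^bsub>completion z\<^esub>"
    "completion_val z (A \<otimes>\<^bsub>completion z\<^esub> B) = completion_val z A + completion_val z B"
proof -
  obtain s t where st: "s \<in> cauchy_seqs z" "t \<in> cauchy_seqs z" "A = cls z s" "B = cls z t"
    using assms unfolding carrier_completion by blast
  obtain n where n: "\<forall>\<^sub>F i in sequentially. s i \<noteq> 0 \<and> place_val z (s i) = n"
    using cauchy_not_null[of s z] st assms by (auto simp: completion_zero_iff)
  obtain m where m: "\<forall>\<^sub>F i in sequentially. t i \<noteq> 0 \<and> place_val z (t i) = m"
    using cauchy_not_null[of t z] st assms by (auto simp: completion_zero_iff)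
  have nm: "\<forall>\<^sub>F i in sequentially. s i * t i \<noteq> 0 \<and> place_val z (s i * t i) = n + m"
    using n m by eventually_elim (simp add: place_val_mult)
  show "A \<otimes>\<^bsub>completion z\<^esub> B \<noteq> \<zero>\<^bsub>completion z\<^esub>"
    using completion_val_eqI(2)[OF nm] st
    by (simp add: completion_mult completion_zero_iff cauchy_seqs_mult)
  show "completion_val z (A \<otimes>\<^bsub>completion z\<^esub> B) = completion_val z A + completion_val z B"
    using completion_val_eqI(1)[OF nm] completion_val_eqI(1)[OF n] completion_val_eqI(1)[OF m] st
    by (simp add: completion_mult)
qed

text \<open>The termwise inverse of a representing sequence is again a Cauchy sequence because the valuation
  of the terms is eventually constant.\<close>

lemma completion_Units:
  assumes "A \<in> carrier (completion z)" "A \<noteq> \<zero>\<^bsub>completion z\<^esub>"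
  shows "A \<in> Units (completion z)"
proof -
  interpret cring "completion z" by (rule cring_completion)
  obtain s where s: "s \<in> cauchy_seqs z" "A = cls z s"
    using assms unfolding carrier_completion by blast
  obtain n where n: "\<forall>\<^sub>F i in sequentially. s i \<noteq> 0 \<and> place_val z (s i) = n"
    using cauchy_not_null[of s z] s assms by (auto simp: completion_zero_iff)
  define t where "t = (\<lambda>i. inverse (s i))"
  have t: "t \<in> cauchy_seqs z"
    unfolding cauchy_seqs_iff
  proof
    fix m
    obtain M where M: "\<forall>i\<ge>M. \<forall>j\<ge>M. vge z (m + 2 * n) (s i - s j)"
      using s unfolding cauchy_seqs_iff by blast
    obtain N where N: "\<forall>i\<ge>N. s i \<noteq> 0 \<and> place_val z (s i) = n"
      using n by (auto simp: eventually_sequentially)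
    have "vge z m (t i - t j)" if "i \<ge> max M N" "j \<ge> max M N" for i j
    proof -
      have nz: "s i \<noteq> 0" "s j \<noteq> 0" "s i * s j \<noteq> 0" "place_val z (s i * s j) = 2 * n"
        using N that by (auto simp: place_val_mult)
      have "t i - t j = (s j - s i) / (s i * s j)"
        using nz by (simp add: t_def field_simps)
      moreover have "vge z (m + 2 * n) (s j - s i)" using M that by auto
      ultimately show ?thesis using nz by (simp add: vge_divide)
    qed
    thus "\<exists>M. \<forall>i\<ge>M. \<forall>j\<ge>M. vge z m (t i - t j)" by blast
  qed
  have "(\<lambda>i. s i * t i - 1) \<in> null_seqs z"
    unfolding null_seqs_iff
  proof
    fix m show "\<forall>\<^sub>F i in sequentially. vge z m (s i * t i - 1)"
      using n by eventually_elim (simp add: t_def)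
  qed
  hence "A \<otimes>\<^bsub>completion z\<^esub> cls z t = \<one>\<^bsub>completion z\<^esub>"
    using s t by (simp add: completion_mult completion_one cls_eq_iff)
  moreover have "cls z t \<in> carrier (completion z)" using t by (simp add: carrier_completion)
  ultimately show ?thesis
    using assms m_comm by (auto simp: Units_def intro!: bexI[of _ "cls z t"])
qed

lemma completion_one_neq_zero: "\<one>\<^bsub>completion z\<^esub> \<noteq> \<zero>\<^bsub>completion z\<^esub>"
  using to_completion_eq_iff[of z 1 0] by (simp del: to_completion_eq_iff)

lemma completion_Units_iff:
  "A \<in> Units (completion z) \<longleftrightarrow> A \<in> carrier (completion z) \<and> A \<noteq> \<zero>\<^bsub>completion z\<^esub>"
proof -
  interpret cring "completion z" by (rule cring_completion)
  have "\<zero>\<^bsub>completion z\<^esub> \<notin> Units (completion z)"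
    using completion_one_neq_zero[of z] by (auto simp: Units_def)
  thus ?thesis using completion_Units by auto
qed

lemma completion_val_one [simp]: "completion_val z \<one>\<^bsub>completion z\<^esub> = 0"
  using completion_val_to_completion[of 1 z] by simp

lemma completion_inv:
  assumes "A \<in> carrier (completion z)" "A \<noteq> \<zero>\<^bsub>completion z\<^esub>"
  shows "inv\<^bsub>completion z\<^esub> A \<in> carrier (completion z)" "inv\<^bsub>completion z\<^esub> A \<noteq> \<zero>\<^bsub>completion z\<^esub>"
    "completion_val z (inv\<^bsub>completion z\<^esub> A) = - completion_val z A"
    "A \<otimes>\<^bsub>completion z\<^esub> inv\<^bsub>completion z\<^esub> A = \<one>\<^bsub>completion z\<^esub>"
proof -
  interpret cring "completion z" by (rule cring_completion)
  have u: "A \<in> Units (completion z)" using assms by (rule completion_Units)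
  show c: "inv\<^bsub>completion z\<^esub> A \<in> carrier (completion z)" using u by auto
  show e: "A \<otimes>\<^bsub>completion z\<^esub> inv\<^bsub>completion z\<^esub> A = \<one>\<^bsub>completion z\<^esub>" using u by auto
  show n: "inv\<^bsub>completion z\<^esub> A \<noteq> \<zero>\<^bsub>completion z\<^esub>"
    using e assms completion_one_neq_zero by (metis r_null)
  show "completion_val z (inv\<^bsub>completion z\<^esub> A) = - completion_val z A"
    using completion_val_mult(2)[OF assms(1) c assms(2) n] e by simp
qed

lemma cge_unit:
  assumes "cge z 1 (A \<ominus>\<^bsub>completion z\<^esub> \<one>\<^bsub>completion z\<^esub>)" "A \<in> carrier (completion z)"
  shows "A \<noteq> \<zero>\<^bsub>completion z\<^esub>" "completion_val z A = 0"
proof -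
  obtain s where s: "s \<in> cauchy_seqs z" "A = cls z s"
    using assms unfolding carrier_completion by blast
  have "(\<lambda>i. s i - 1) \<in> cauchy_seqs z" using s by (simp add: cauchy_seqs_diff)
  hence "\<forall>\<^sub>F i in sequentially. vge z 1 (s i - 1)"
    using assms(1) s by (simp add: completion_one completion_diff cge_cls)
  hence *: "\<forall>\<^sub>F i in sequentially. s i \<noteq> 0 \<and> place_val z (s i) = 0"
    by eventually_elim (use vge_unit in blast)
  show "A \<noteq> \<zero>\<^bsub>completion z\<^esub>" "completion_val z A = 0"
    using completion_val_eqI[OF *] s by (simp_all add: completion_zero_iff)
qed

subsection \<open>Integers and the maximal ideal\<close>

lemma integer_ring_carrier: "carrier (integer_ring z) = {A. cge z 0 A}"
  by (auto simp: integer_ring_def cge_def)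

lemma integer_ring_simps [simp]:
  "\<one>\<^bsub>integer_ring z\<^esub> = \<one>\<^bsub>completion z\<^esub>" "\<zero>\<^bsub>integer_ring z\<^esub> = \<zero>\<^bsub>completion z\<^esub>"
  "A \<otimes>\<^bsub>integer_ring z\<^esub> B = A \<otimes>\<^bsub>completion z\<^esub> B" "A \<oplus>\<^bsub>integer_ring z\<^esub> B = A \<oplus>\<^bsub>completion z\<^esub> B"
  by (simp_all add: integer_ring_def)

lemma cring_integer_ring: "cring (integer_ring z)"
proof -
  interpret cring "completion z" by (rule cring_completion)
  have "subring {A. cge z 0 A} (completion z)"
    by (rule subringI) (auto dest: cge_closed)
  hence "subcring {A. cge z 0 A} (completion z)"
    by (intro subcringI') 
  moreover have "integer_ring z = (completion z)\<lparr>carrier := {A. cge z 0 A}\<rparr>"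
    by (simp add: integer_ring_def cge_def)
  ultimately show ?thesis using subcring_iff[of "{A. cge z 0 A}"] by (auto dest: cge_closed)
qed

text \<open>Subtraction in a ring record is defined through the inverse in the carrier, so it has to be
  transported to subrings.\<close>

lemma cring_subring_diff:
  assumes "cring R" "cring (R\<lparr>carrier := H\<rparr>)" "H \<subseteq> carrier R" "a \<in> H" "b \<in> H"
  shows "a \<ominus>\<^bsub>R\<lparr>carrier := H\<rparr>\<^esub> b = a \<ominus>\<^bsub>R\<^esub> b"
proof -
  interpret R: cring R by fact
  interpret S: cring "R\<lparr>carrier := H\<rparr>" by fact
  have c: "\<ominus>\<^bsub>R\<lparr>carrier := H\<rparr>\<^esub> b \<in> H" "\<ominus>\<^bsub>R\<lparr>carrier := H\<rparr>\<^esub> b \<oplus>\<^bsub>R\<^esub> b = \<zero>\<^bsub>R\<^esub>"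
    using S.a_inv_closed[of b] S.l_neg[of b] assms by simp_all
  hence "\<ominus>\<^bsub>R\<^esub> b = \<ominus>\<^bsub>R\<lparr>carrier := H\<rparr>\<^esub> b"
    using assms by (intro R.minus_equality) auto
  thus ?thesis by (simp add: a_minus_def)
qed

lemma integer_ring_diff:
  assumes "cge z 0 A" "cge z 0 B"
  shows "A \<ominus>\<^bsub>integer_ring z\<^esub> B = A \<ominus>\<^bsub>completion z\<^esub> B"
  using cring_subring_diff[of "completion z" "carrier (integer_ring z)" A B] assms
    cring_completion[of z] cring_integer_ring[of z]
  by (simp add: integer_ring_def cge_def subset_iff)

lemma max_ideal_iff: "A \<in> max_ideal z \<longleftrightarrow> cge z 1 A"
proof -
  interpret cring "completion z" by (rule cring_completion)
  define \<pi> :: "'a poly fract" where "\<pi> = (SOME \<pi>. uniformizer z \<pi>)"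
  have "uniformizer z \<pi>" unfolding \<pi>_def using uniformizer_exists by (rule someI_ex)
  hence \<pi>: "\<pi> \<noteq> 0" "place_val z \<pi> = 1" by (auto simp: uniformizer_def)
  have "A \<in> max_ideal z \<longleftrightarrow> (\<exists>B. cge z 0 B \<and> A = B \<otimes>\<^bsub>completion z\<^esub> to_completion z \<pi>)"
    by (auto simp: max_ideal_def cgenideal_def integer_ring_carrier \<pi>_def)
  also have "\<dots> \<longleftrightarrow> cge z 1 A"
  proof
    assume "\<exists>B. cge z 0 B \<and> A = B \<otimes>\<^bsub>completion z\<^esub> to_completion z \<pi>"
    thus "cge z 1 A" using \<pi> by (auto simp: vge_def)
  next
    assume *: "cge z 1 A"
    have "cge z (- 1) (to_completion z (inverse \<pi>))" using \<pi> by (simp add: vge_def)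
    with * have "cge z 0 (A \<otimes>\<^bsub>completion z\<^esub> to_completion z (inverse \<pi>))"
      using cge_mult[of z 1 A "-1"] by simp
    moreover have "A = A \<otimes>\<^bsub>completion z\<^esub> to_completion z (inverse \<pi>) \<otimes>\<^bsub>completion z\<^esub> to_completion z \<pi>"
      using * \<pi> by (simp add: m_assoc cge_closed flip: to_completion_mult)
    ultimately show "\<exists>B. cge z 0 B \<and> A = B \<otimes>\<^bsub>completion z\<^esub> to_completion z \<pi>" by blast
  qed
  finally show ?thesis .
qed

section \<open>Coordinates on the projective line\<close>

subsection \<open>Polynomials of bounded degree\<close>

text \<open>Polynomials of degree less than \<open>n\<close>: the standard residues modulo a polynomial of
  degree \<open>n\<close>, with \<open>0\<close> included for \<open>n = 0\<close>.\<close>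

definition small_polys :: "nat \<Rightarrow> 'k::{field,finite} poly set" where
  "small_polys n = {a. \<forall>i\<ge>n. poly.coeff a i = 0}"

lemma small_polys_iff: "a \<in> small_polys n \<longleftrightarrow> a = 0 \<or> degree a < n"
proof
  assume "a \<in> small_polys n"
  hence "\<not> n \<le> degree a \<or> lead_coeff a = 0" by (auto simp: small_polys_def)
  thus "a = 0 \<or> degree a < n" by auto
qed (auto simp: small_polys_def coeff_eq_0)

lemma small_polys_Suc: "small_polys (Suc n) = (\<lambda>(c, a). pCons c a) ` (UNIV \<times> small_polys n)"
proof (intro equalityI subsetI)
  fix a :: "'a poly" assume a: "a \<in> small_polys (Suc n)"
  obtain c b where b: "a = pCons c b" by (cases a)
  have "b \<in> small_polys n"
    unfolding small_polys_def
  proof (intro CollectI allI impI)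
    fix i assume "i \<ge> n"
    hence "poly.coeff a (Suc i) = 0" using a by (auto simp: small_polys_def)
    thus "poly.coeff b i = 0" by (simp add: b)
  qed
  thus "a \<in> (\<lambda>(c, a). pCons c a) ` (UNIV \<times> small_polys n)" using b by auto
qed (auto simp: small_polys_def coeff_pCons split: nat.splits)

lemma card_small_polys:
  "finite (small_polys n :: 'k::{field,finite} poly set) \<and>
   card (small_polys n :: 'k poly set) = CARD('k) ^ n"
proof (induction n)
  case 0
  have "small_polys 0 = {0 :: 'k poly}" by (auto simp: small_polys_iff)
  thus ?case by simp
next
  case (Suc n)
  have "inj_on (\<lambda>(c, a). pCons c a) (UNIV \<times> (small_polys n :: 'k poly set))"
    by (auto simp: inj_on_def)
  thus ?case using Suc by (simp add: small_polys_Suc card_image card_cartesian_product)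
qed

lemma poly_prime_factor:
  fixes b :: "'k::field poly"
  assumes "b \<noteq> 0" "\<not> is_unit b" shows "\<exists>p. prime_elem p \<and> p dvd b"
  using assms
proof (induction "degree b" arbitrary: b rule: less_induct)
  case less
  show ?case
  proof (cases "irreducible b")
    case True
    hence "prime_elem b" by (rule field_poly_irreducible_imp_prime)
    thus ?thesis by (intro exI[of _ b]) simp
  next
    case False
    then obtain c d where cd: "b = c * d" "\<not> is_unit c" "\<not> is_unit d"
      using less.prems by (auto simp: irreducible_def)
    hence "c \<noteq> 0" "d \<noteq> 0" using less.prems by auto
    hence "degree c < degree b" using cd by (auto simp: degree_mult_eq is_unit_iff_degree)
    thus ?thesis using less.hyps[of c] cd \<open>c \<noteq> 0\<close> by (metis dvd_mult2)
  qed
qed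

subsection \<open>Primes and places\<close>

text \<open>The place \<open>x\<close> is put at infinity: \<open>s\<close> has a simple pole there and
  generates \<open>F\<close>. All other places then correspond to the monic primes of
  \<open>\<FF>\<^sub>q[s]\<close>.\<close>

locale coord =
  fixes x :: "'k::{field,finite} place" and s :: "'k poly fract"
  assumes val_s: "place_val x s = - 1"
    and quot: "\<exists>a b. b \<noteq> 0 \<and> f = ev s a / ev s b"
begin

lemma s_nz: "s \<noteq> 0" using val_s by auto

lemma ev_nz: "a \<noteq> 0 \<Longrightarrow> ev s a \<noteq> 0"
  using place_val_ev_pole[of x s a] val_s by simp

lemma val_ev: "place_val x (ev s a) = - int (degree a)"
  using place_val_ev_pole[of x s a] val_s by (cases "a = 0") simp_all

lemma ev_eq_0_iff [simp]: "ev s a = 0 \<longleftrightarrow> a = 0" using ev_nz by auto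

lemma ev_eq_iff [simp]: "ev s a = ev s b \<longleftrightarrow> a = b"
  using ev_eq_0_iff[of "a - b"] by (simp only: ev_diff) simp

lemma quot_nz:
  assumes "f \<noteq> 0" obtains a b where "a \<noteq> 0" "b \<noteq> 0" "f = ev s a / ev s b"
  using quot[of f] assms by fastforce

text \<open>If \<open>s\<close> had a pole at \<open>z\<close>, then leading terms would make the valuation
  at \<open>z\<close> a positive multiple of the one at \<open>x\<close>; both are normalised, so
  the places would agree.\<close>

lemma vge_s:
  assumes "z \<noteq> x" shows "vge z 0 s"
proof (rule ccontr)
  assume "\<not> vge z 0 s"
  hence neg: "place_val z s < 0" by (simp add: vge_def)
  have *: "place_val z f = - place_val z s * place_val x f" if f0: "f \<noteq> 0" for f
  proof -
    obtain a b where ab: "a \<noteq> 0" "b \<noteq> 0" "f = ev s a / ev s b" by (rule quot_nz[OF f0])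
    show ?thesis
      using ab place_val_ev_pole[OF neg ab(1)] place_val_ev_pole[OF neg ab(2)]
      by (simp add: place_val_divide val_ev algebra_simps)
  qed
  obtain \<pi> where "\<pi> \<noteq> 0" "place_val z \<pi> = 1" using uniformizer_exists by (auto simp: uniformizer_def)
  with *[of \<pi>] have "- place_val z s dvd 1" by (metis dvd_triv_left)
  hence "place_val z s = - 1" using neg by auto
  hence "z = x" using * by (intro place_eqI) auto
  thus False using assms by simp
qed

lemma vge_poly: "z \<noteq> x \<Longrightarrow> vge z 0 (ev s a)"
  by (simp add: vge_ev vge_s)

text \<open>The polynomials that vanish at \<open>z\<close> form a nonzero prime ideal, generated by an
  element of least degree.\<close>

lemma prime_exists:
  assumes "z \<noteq> x"
  shows "\<exists>p. prime_elem p \<and> lead_coeff p = 1 \<and> (\<forall>a. vge z 1 (ev s a) \<longleftrightarrow> p dvd a)"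
proof -
  define I where "I = {a. vge z 1 (ev s a)}"
  have I_mult: "b * a \<in> I" if "a \<in> I" for a b
    using that vge_poly[OF assms, of b] by (auto simp: I_def ev_mult)
  have I_diff: "a - b \<in> I" if "a \<in> I" "b \<in> I" for a b
    using that by (auto simp: I_def ev_diff)
  obtain \<pi> where \<pi>: "\<pi> \<noteq> 0" "place_val z \<pi> = 1"
    using uniformizer_exists by (auto simp: uniformizer_def)
  obtain a b where ab: "a \<noteq> 0" "b \<noteq> 0" "\<pi> = ev s a / ev s b" by (rule quot_nz[OF \<pi>(1)])
  have "place_val z (ev s a) = 1 + place_val z (ev s b)"
    using ab \<pi> by (simp add: place_val_divide)
  moreover have "0 \<le> place_val z (ev s b)" using vge_poly[OF assms, of b] ab by (simp add: vge_def)
  ultimately have "a \<in> I" by (simp add: I_def vge_def)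
  define n where "n = (LEAST n. \<exists>a\<in>I. a \<noteq> 0 \<and> degree a = n)"
  have "\<exists>a\<in>I. a \<noteq> 0 \<and> degree a = n"
    unfolding n_def by (rule LeastI_ex) (use \<open>a \<in> I\<close> ab in blast)
  then obtain c where c: "c \<in> I" "c \<noteq> 0" "degree c = n" by blast
  have n_le: "n \<le> degree a" if "a \<in> I" "a \<noteq> 0" for a
    unfolding n_def by (rule Least_le) (use that in blast)
  define p where "p = [:inverse (lead_coeff c):] * c"
  have p: "p \<in> I" "p \<noteq> 0" "degree p = n" "lead_coeff p = 1"
    using c leading_coeff_neq_0[OF c(2)] I_mult[OF c(1), of "[:inverse (lead_coeff c):]"] by (simp_all add: p_def)
  have I_iff: "a \<in> I \<longleftrightarrow> p dvd a" for a
  proof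
    assume "a \<in> I"
    have "a mod p = a - (a div p) * p" by (simp add: minus_div_mult_eq_mod)
    hence "a mod p \<in> I" using I_diff I_mult \<open>a \<in> I\<close> p(1) by simp
    hence "a mod p = 0"
      using n_le[of "a mod p"] degree_mod_less[of p a] p by (metis leD)
    thus "p dvd a" by auto
  next
    assume "p dvd a"
    thus "a \<in> I" using I_mult[OF p(1)] by (auto simp: mult.commute)
  qed
  have "prime_elem p"
  proof (rule prime_elemI)
    show "p \<noteq> 0" by fact
    have "(1 :: 'k poly) \<notin> I" by (simp add: I_def)
    thus "\<not> p dvd 1" using I_iff by blast
  next
    fix a b assume "p dvd a * b"
    hence "a * b \<in> I" using I_iff by blast
    thus "p dvd a \<or> p dvd b"
      unfolding I_iff[symmetric]
      using vge_poly[OF assms, of a] vge_poly[OF assms, of b]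
      by (cases "a = 0"; cases "b = 0") (auto simp: I_def vge_def ev_mult place_val_mult)
  qed
  with p(4) I_iff show ?thesis by (auto simp: I_def)
qed

definition prime_at :: "'k place \<Rightarrow> 'k poly" where
  "prime_at z = (SOME p. prime_elem p \<and> lead_coeff p = 1 \<and> (\<forall>a. vge z 1 (ev s a) \<longleftrightarrow> p dvd a))"

lemma prime_at:
  assumes "z \<noteq> x"
  shows "prime_elem (prime_at z)" "lead_coeff (prime_at z) = 1"
    "vge z 1 (ev s a) \<longleftrightarrow> prime_at z dvd a"
  using someI_ex[OF prime_exists[OF assms]] unfolding prime_at_def by blast+

lemma degree_prime_at:
  assumes "z \<noteq> x" shows "degree (prime_at z) > 0"
proof -
  have "prime_at z \<noteq> 0" "\<not> is_unit (prime_at z)" using prime_at(1)[OF assms] by (auto simp: prime_elem_def)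
  thus ?thesis by (auto simp: is_unit_iff_degree)
qed

lemma val_not_dvd:
  assumes "z \<noteq> x" "\<not> prime_at z dvd a" shows "place_val z (ev s a) = 0"
  using vge_poly[OF assms(1), of a] prime_at(3)[OF assms(1), of a] assms(2) by (auto simp: vge_def)

text \<open>Every value of the valuation at \<open>z\<close> is a multiple of its value at the prime, and
  the value \<open>1\<close> is attained.\<close>

lemma val_prime_at:
  assumes "z \<noteq> x" shows "place_val z (ev s (prime_at z)) = 1"
proof -
  let ?p = "prime_at z"
  have p: "prime_elem ?p" by (rule prime_at[OF assms])
  have v: "place_val z (ev s a) = int (ordp ?p a) * place_val z (ev s ?p)" if a0: "a \<noteq> 0" for a
  proof -
    obtain b where b: "a = ?p ^ ordp ?p a * b" "\<not> ?p dvd b" by (rule ordp_decompose[OF p a0])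
    have nz: "ev s (?p ^ ordp ?p a) \<noteq> 0" "ev s b \<noteq> 0" "ev s ?p \<noteq> 0" using b a0 p by auto
    show ?thesis
      by (subst b(1), subst ev_mult, subst place_val_mult[OF nz(1,2)])
         (use nz in \<open>simp add: val_not_dvd[OF assms b(2)] ev_power place_val_power\<close>)
  qed
  obtain \<pi> where \<pi>: "\<pi> \<noteq> 0" "place_val z \<pi> = 1"
    using uniformizer_exists by (auto simp: uniformizer_def)
  obtain a b where ab: "a \<noteq> 0" "b \<noteq> 0" "\<pi> = ev s a / ev s b" by (rule quot_nz[OF \<pi>(1)])
  have "place_val z (ev s a / ev s b) = place_val z (ev s a) - place_val z (ev s b)"
    using ab by (simp add: place_val_divide)
  hence "1 = (int (ordp ?p a) - int (ordp ?p b)) * place_val z (ev s ?p)"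
    using \<pi>(2) v[OF ab(1)] v[OF ab(2)] by (simp add: ab(3) left_diff_distrib)
  hence e: "is_unit (place_val z (ev s ?p))" by (metis dvdI mult.commute)
  have "vge z 1 (ev s ?p)" using prime_at(3)[OF assms, of ?p] by simp
  hence "1 \<le> place_val z (ev s ?p)" using p by (auto simp: vge_def)
  with e show ?thesis by (simp add: zdvd1_eq)
qed

lemma val_ordp:
  assumes "z \<noteq> x" "a \<noteq> 0" shows "place_val z (ev s a) = int (ordp (prime_at z) a)"
proof -
  let ?p = "prime_at z"
  have p: "prime_elem ?p" by (rule prime_at[OF assms(1)])
  obtain b where b: "a = ?p ^ ordp ?p a * b" "\<not> ?p dvd b" by (rule ordp_decompose[OF p assms(2)])
  have nz: "ev s (?p ^ ordp ?p a) \<noteq> 0" "ev s b \<noteq> 0" "ev s ?p \<noteq> 0" using b assms p by auto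
  show ?thesis
    by (subst b(1), subst ev_mult, subst place_val_mult[OF nz(1,2)])
       (use nz in \<open>simp add: val_not_dvd[OF assms(1) b(2)] ev_power place_val_power val_prime_at[OF assms(1)]\<close>)
qed

lemma prime_at_inj:
  assumes "z \<noteq> x" "w \<noteq> x" "prime_at z = prime_at w" shows "z = w"
proof (rule place_eqI)
  fix f :: "'k poly fract" assume "f \<noteq> 0"
  then obtain a b where ab: "a \<noteq> 0" "b \<noteq> 0" "f = ev s a / ev s b" by (rule quot_nz)
  thus "place_val z f = place_val w f"
    using assms by (simp add: place_val_divide val_ordp)
qed

lemma val_prime_at_other:
  assumes "z \<noteq> x" "w \<noteq> x" "w \<noteq> z" shows "place_val w (ev s (prime_at z)) = 0"
proof (rule val_not_dvd[OF assms(2)])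
  show "\<not> prime_at w dvd prime_at z"
  proof
    assume dvd: "prime_at w dvd prime_at z"
    have "irreducible (prime_at z)" using prime_at(1)[OF assms(1)] by (rule prime_elem_imp_irreducible)
    moreover have "\<not> is_unit (prime_at w)" using prime_at(1)[OF assms(2)] by (auto simp: prime_elem_def)
    ultimately have "prime_at z dvd prime_at w" using dvd by (metis irreducibleD')
    hence "prime_at z dvd a \<longleftrightarrow> prime_at w dvd a" for a using dvd dvd_trans by blast
    hence "vge z 1 (ev s a) \<longleftrightarrow> vge w 1 (ev s a)" for a
      using prime_at(3)[OF assms(1)] prime_at(3)[OF assms(2)] by blast
    hence "prime_at z = prime_at w" by (simp add: prime_at_def)
    thus False using prime_at_inj assms by blast
  qed
qed

text \<open>Conversely, the multiplicity of a prime polynomial in numerator and denominator is a valuation.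
  This provides the place that detects a given prime in a denominator.\<close>

lemma place_of_prime:
  assumes p: "prime_elem p" shows "\<exists>z. z \<noteq> x \<and> vge z 1 (ev s p)"
proof -
  define v :: "'k poly fract \<Rightarrow> int" where
    "v f = (if f = 0 then 0 else
      (SOME n. \<exists>a b. a \<noteq> 0 \<and> b \<noteq> 0 \<and> f = ev s a / ev s b \<and> n = int (ordp p a) - int (ordp p b)))" for f
  have v_eq: "v (ev s a / ev s b) = int (ordp p a) - int (ordp p b)" if ab: "a \<noteq> 0" "b \<noteq> 0" for a b
  proof -
    have "v (ev s a / ev s b) =
      (SOME n. \<exists>c d. c \<noteq> 0 \<and> d \<noteq> 0 \<and> ev s a / ev s b = ev s c / ev s d \<and> n = int (ordp p c) - int (ordp p d))"
      using ab by (simp add: v_def)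
    also have "\<dots> = int (ordp p a) - int (ordp p b)"
    proof (rule some_equality)
      fix n assume "\<exists>c d. c \<noteq> 0 \<and> d \<noteq> 0 \<and> ev s a / ev s b = ev s c / ev s d \<and> n = int (ordp p c) - int (ordp p d)"
      then obtain c d where cd: "c \<noteq> 0" "d \<noteq> 0" "ev s a / ev s b = ev s c / ev s d"
        "n = int (ordp p c) - int (ordp p d)" by blast
      have "ev s (a * d) = ev s (c * b)"
        using cd ab by (simp add: ev_mult frac_eq_eq)
      hence "a * d = c * b" by simp
      hence "ordp p a + ordp p d = ordp p c + ordp p b" using ordp_mult[OF p] ab cd by metis
      thus "n = int (ordp p a) - int (ordp p b)" using cd by simp
    qed (use ab in blast)
    finally show ?thesis .
  qed
  have v_ev: "v (ev s a) = int (ordp p a)" if "a \<noteq> 0" for a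
    using v_eq[OF that, of 1] ordp_eqI[OF p, of 1 0] p by (simp add: prime_elem_def)
  have ordp_p: "ordp p p = 1"
    using ordp_eqI[OF p, of 1 1] p by (simp add: prime_elem_def)
  have "is_place_val v"
    unfolding is_place_val_def
  proof (intro conjI allI impI)
    show "v 0 = 0" by (simp add: v_def)
    show "\<exists>a. a \<noteq> 0 \<and> v a = 1" using p v_ev[of p] ordp_p by (intro exI[of _ "ev s p"]) auto
  next
    fix f g :: "'k poly fract" assume "f \<noteq> 0" "g \<noteq> 0"
    then obtain a b c d where *: "a \<noteq> 0" "b \<noteq> 0" "f = ev s a / ev s b" "c \<noteq> 0" "d \<noteq> 0" "g = ev s c / ev s d"
      by (metis quot_nz)
    have "f * g = ev s (a * c) / ev s (b * d)" using * by (simp add: ev_mult)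
    thus "v (f * g) = v f + v g" using * by (simp add: v_eq ordp_mult[OF p])
  next
    fix f g :: "'k poly fract" assume "f \<noteq> 0" "g \<noteq> 0" and nz: "f + g \<noteq> 0"
    then obtain a b c d where *: "a \<noteq> 0" "b \<noteq> 0" "f = ev s a / ev s b" "c \<noteq> 0" "d \<noteq> 0" "g = ev s c / ev s d"
      by (metis quot_nz)
    have fg: "f + g = ev s (a * d + c * b) / ev s (b * d)"
      using * by (simp add: ev_mult ev_add add_frac_eq)
    hence nz': "a * d + c * b \<noteq> 0" using nz by auto
    define m where "m = min (ordp p (a * d)) (ordp p (c * b))"
    have "p ^ m dvd a * d" "p ^ m dvd c * b"
      using ordp_ge_iff[OF p, of "a * d" m] ordp_ge_iff[OF p, of "c * b" m] * by (simp_all add: m_def)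
    hence "m \<le> ordp p (a * d + c * b)" using nz' by (simp add: ordp_ge_iff[OF p])
    moreover have "v (f + g) = int (ordp p (a * d + c * b)) - int (ordp p (b * d))"
      unfolding fg using nz' * by (intro v_eq) auto
    moreover have "v f = int (ordp p a) - int (ordp p b)" "v g = int (ordp p c) - int (ordp p d)"
      using * by (simp_all add: v_eq)
    ultimately show "min (v f) (v g) \<le> v (f + g)"
      using * by (simp add: m_def ordp_mult[OF p] min_def split: if_splits)
  qed
  hence v: "place_val (Abs_place v) = v" by (simp add: Abs_place_inverse)
  have "place_val (Abs_place v) (ev s p) = 1" using v_ev[of p] p ordp_p by (auto simp: v)
  moreover have "Abs_place v \<noteq> x" using calculation val_ev[of p] by auto
  ultimately show ?thesis by (intro exI[of _ "Abs_place v"]) (simp add: vge_def)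
qed

subsection \<open>Residues, polynomial part and support\<close>

text \<open>Every residue class at \<open>z\<close> contains a polynomial: the denominator of
  \<open>f\<close> is a unit at \<open>z\<close> after cancellation, and units can be inverted
  modulo the prime.\<close>

lemma residue_exists:
  fixes f :: "'k poly fract"
  assumes "z \<noteq> x" "vge z 0 f"
  shows "\<exists>c\<in>small_polys (degree (prime_at z)). vge z 1 (f - ev s c)"
proof (cases "f = 0")
  case True thus ?thesis by (intro bexI[of _ 0]) (auto simp: small_polys_def)
next
  case False
  let ?p = "prime_at z" and ?R = "small_polys (degree (prime_at z))"
  have p: "prime_elem ?p" by (rule prime_at[OF assms(1)])
  obtain a b where ab: "a \<noteq> 0" "b \<noteq> 0" "f = ev s a / ev s b" by (rule quot_nz[OF False])
  obtain b' where b': "b = ?p ^ ordp ?p b * b'" "\<not> ?p dvd b'" by (rule ordp_decompose[OF p ab(2)])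
  have "ordp ?p b \<le> ordp ?p a"
    using assms ab by (simp add: vge_def place_val_divide val_ordp)
  then obtain a' where a': "a = ?p ^ ordp ?p b * a'"
    using ordp_ge_iff[OF p ab(1)] by blast
  have b'0: "b' \<noteq> 0" using b' by auto
  have f: "f = ev s a' / ev s b'"
    unfolding ab(3) by (subst a', subst b'(1)) (use p in \<open>simp add: ev_mult ev_power\<close>)
  \<comment> \<open>multiplication by the denominator permutes the finitely many residues, so it can be inverted\<close>
  have "inj_on (\<lambda>c. (b' * c) mod ?p) ?R"
  proof (rule inj_onI)
    fix c d assume cd: "c \<in> ?R" "d \<in> ?R" "(b' * c) mod ?p = (b' * d) mod ?p"
    hence "?p dvd b' * (c - d)" by (simp add: mod_eq_dvd_iff right_diff_distrib)
    hence "?p dvd c - d" using p b' by (simp add: prime_elem_dvd_mult_iff)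
    moreover have "c - d \<in> ?R" using cd by (simp add: small_polys_def)
    ultimately show "c = d" by (metis small_polys_iff dvd_imp_degree_le leD right_minus_eq)
  qed
  moreover have "(\<lambda>c. (b' * c) mod ?p) ` ?R \<subseteq> ?R"
    using degree_mod_less[of ?p] p by (fastforce simp: small_polys_iff)
  ultimately have "(\<lambda>c. (b' * c) mod ?p) ` ?R = ?R"
    using card_small_polys endo_inj_surj by blast
  moreover have "a' mod ?p \<in> ?R" using degree_mod_less[of ?p a'] p by (auto simp: small_polys_iff)
  ultimately obtain c where c: "c \<in> ?R" "a' mod ?p = (b' * c) mod ?p" by (metis (no_types, lifting) imageE)
  have "?p dvd a' - b' * c" using c(2) by (simp add: mod_eq_dvd_iff)
  hence "vge z 1 (ev s (a' - b' * c))" using prime_at(3)[OF assms(1)] by blast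
  moreover have "f - ev s c = ev s (a' - b' * c) / ev s b'"
    using b'0 by (simp add: f ev_diff ev_mult field_simps)
  ultimately have "vge z 1 (f - ev s c)"
    using b'0 val_not_dvd[OF assms(1) b'(2)] by (simp add: vge_divide)
  with c show ?thesis by blast
qed

lemma residue_unique:
  assumes "z \<noteq> x" "c \<in> small_polys (degree (prime_at z))" "d \<in> small_polys (degree (prime_at z))"
    "vge z 1 (ev s c - ev s d)"
  shows "c = d"
proof -
  have "prime_at z dvd c - d" using assms(1,4) by (simp add: prime_at(3)[symmetric] ev_diff)
  moreover have "c - d \<in> small_polys (degree (prime_at z))" using assms by (simp add: small_polys_def)
  ultimately show ?thesis by (metis small_polys_iff dvd_imp_degree_le leD right_minus_eq)
qed

text \<open>Division with remainder: the quotient is the polynomial part and the remaining proper fraction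
  vanishes at infinity.\<close>

lemma poly_part: "\<exists>a. vge x 1 ((f :: 'k poly fract) - ev s a)"
proof (cases "f = 0")
  case True thus ?thesis by (intro exI[of _ 0]) simp
next
  case False
  then obtain a b where ab: "a \<noteq> 0" "b \<noteq> 0" "f = ev s a / ev s b" by (rule quot_nz)
  have "a = (a div b) * b + a mod b" by simp
  hence "ev s a = ev s (a div b) * ev s b + ev s (a mod b)" by (metis ev_add ev_mult)
  hence "f - ev s (a div b) = ev s (a mod b) / ev s b"
    using ab by (simp add: field_simps)
  moreover have "vge x 1 (ev s (a mod b) / ev s b)"
    using degree_mod_less[of b a] ab by (cases "a mod b = 0") (auto simp: vge_def place_val_divide val_ev)
  ultimately show ?thesis by metis
qed

text \<open>A prime factor of the denominator that cannot be cancelled would give a pole outside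
  \<open>x\<close>; the induction is on the degree of the denominator.\<close>

lemma integral_imp_poly:
  fixes f :: "'k poly fract"
  assumes "\<And>z. z \<noteq> x \<Longrightarrow> vge z 0 f" shows "\<exists>a. f = ev s a"
proof (rule ccontr)
  assume no: "\<nexists>a. f = ev s a"
  hence "f \<noteq> 0" by (metis ev_0)
  have "False" if "b \<noteq> 0" "f = ev s a / ev s b" for a b
    using that
  proof (induction "degree b" arbitrary: a b rule: less_induct)
    case less
    have a0: "a \<noteq> 0" using less.prems \<open>f \<noteq> 0\<close> by auto
    show ?case
    proof (cases "degree b = 0")
      case True
      then obtain c where c: "b = [:c:]" using degree_eq_zeroE by blast
      hence "c \<noteq> 0" using less.prems by auto
      hence "f = ev s (Polynomial.smult (inverse c) a)"
        using less.prems c by (simp add: ev_smult ev_pCons const_elt_inverse divide_inverse mult.commute)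
      thus False using no by blast
    next
      case False
      hence "\<not> is_unit b" using less.prems by (simp add: is_unit_iff_degree)
      then obtain p where pr: "prime_elem p" "p dvd b"
        using less.prems(1) poly_prime_factor by metis
      hence p: "irreducible p" using prime_elem_imp_irreducible by blast
      obtain z where z: "z \<noteq> x" "vge z 1 (ev s p)" using place_of_prime[OF pr(1)] by blast
      obtain b' where b': "b = p * b'" using pr by blast
      hence nz: "b' \<noteq> 0" "p \<noteq> 0" using less.prems by auto
      have "ev s a = f * ev s b" using less.prems by simp
      moreover have "vge z 1 (ev s b)" using z vge_poly[OF z(1), of b'] by (auto simp: b' ev_mult)
      ultimately have "vge z 1 (ev s a)" using assms[OF z(1)] by auto
      hence "prime_at z dvd a" using prime_at(3)[OF z(1)] by blast
      moreover have "prime_at z dvd p" using prime_at(3)[OF z(1)] z by blast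
      hence "p dvd prime_at z"
        using p(1) prime_at(1)[OF z(1)] by (metis irreducibleD' prime_elem_def)
      ultimately have "p dvd a" by (rule dvd_trans[rotated])
      then obtain a' where a': "a = p * a'" by blast
      have "f = ev s a' / ev s b'" using less.prems nz by (simp add: a' b' ev_mult)
      moreover have "degree b' < degree b"
        using nz pr by (auto simp: b' degree_mult_eq prime_elem_def is_unit_iff_degree)
      ultimately show False using less.hyps nz by blast
    qed
  qed
  moreover obtain a b where "b \<noteq> 0" "f = ev s a / ev s b" using quot by blast
  ultimately show False by blast
qed

text \<open>A zero or pole outside \<open>x\<close> gives a prime factor of the numerator or denominator,
  and there are only finitely many polynomials of bounded degree.\<close>

lemma finite_support:
  fixes f :: "'k poly fract"
  assumes "f \<noteq> 0" shows "finite {z. place_val z f \<noteq> 0}"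
proof -
  have fin: "finite {z. z \<noteq> x \<and> place_val z (ev s a) \<noteq> 0}" if "a \<noteq> 0" for a
  proof (rule finite_imageD)
    show "inj_on prime_at {z. z \<noteq> x \<and> place_val z (ev s a) \<noteq> 0}"
      by (auto simp: inj_on_def intro: prime_at_inj)
    have "prime_at z \<in> small_polys (Suc (degree a))" if "z \<noteq> x" "place_val z (ev s a) \<noteq> 0" for z
      using val_not_dvd[OF that(1), of a] that(2) dvd_imp_degree_le[of "prime_at z" a] \<open>a \<noteq> 0\<close>
      by (force simp: small_polys_iff)
    hence "prime_at ` {z. z \<noteq> x \<and> place_val z (ev s a) \<noteq> 0} \<subseteq> small_polys (Suc (degree a))" by blast
    thus "finite (prime_at ` {z. z \<noteq> x \<and> place_val z (ev s a) \<noteq> 0})"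
      using card_small_polys finite_subset by blast
  qed
  obtain a b where ab: "a \<noteq> 0" "b \<noteq> 0" "f = ev s a / ev s b" by (rule quot_nz[OF assms])
  have "{z. place_val z f \<noteq> 0} \<subseteq> insert x ({z. z \<noteq> x \<and> place_val z (ev s a) \<noteq> 0} \<union>
      {z. z \<noteq> x \<and> place_val z (ev s b) \<noteq> 0})"
    using ab by (auto simp: place_val_divide)
  thus ?thesis using fin[OF ab(1)] fin[OF ab(2)] finite_subset by blast
qed

end

section \<open>Residue fields and degrees\<close>

text \<open>Counting coordinate vectors turns the dimension that defines the degree of a place into a
  cardinality.\<close>

lemma (in ring) card_carrier_eq_card_power_dim:
  assumes K: "subfield K R" and fin: "finite (carrier R)"
  shows "card (carrier R) = card K ^ dim K (carrier R)"
proof -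
  have KR: "K \<subseteq> carrier R" using subfieldE(3)[OF K] .
  obtain Us where Us: "set Us = carrier R" using fin finite_list by blast
  have "Span K Us = carrier R"
    using Span_base_incl[OF K, of Us] Span_in_carrier[OF KR, of Us] Us by auto
  then obtain Vs where Vs: "set Vs \<subseteq> carrier R" "independent K Vs" "Span K Vs = carrier R"
    using filter_base[OF K, of Us] Us by auto
  have "dimension (length Vs) K (carrier R)"
    using dimension_independent[OF Vs(2)] Vs(3) by simp
  hence dim: "dim K (carrier R) = length Vs" using dimI[OF K] by (simp add: over_def)
  let ?L = "{Ks. set Ks \<subseteq> K \<and> length Ks = length Vs}"
  have "bij_betw (\<lambda>Ks. combine Ks Vs) ?L (carrier R)"
  proof (rule bij_betw_imageI)
    have mem: "combine Ks Vs \<in> Span K Vs" if "Ks \<in> ?L" for Ks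
      using Span_mem_iff_length_version[OF K Vs(1)] that by blast
    show "inj_on (\<lambda>Ks. combine Ks Vs) ?L"
    proof (rule inj_onI)
      fix Ks Ls assume *: "Ks \<in> ?L" "Ls \<in> ?L" "combine Ks Vs = combine Ls Vs"
      thus "Ks = Ls" using unique_decomposition[OF K Vs(2) mem[OF *(1)]] by auto
    qed
    show "(\<lambda>Ks. combine Ks Vs) ` ?L = carrier R"
      using Span_mem_iff_length_version[OF K Vs(1)] by (auto simp: Vs(3)[symmetric])
  qed
  hence "card (carrier R) = card ?L" by (simp add: bij_betw_same_card)
  also have "\<dots> = card K ^ length Vs"
    using card_lists_length_eq[of K "length Vs"] finite_subset[OF KR fin] by simp
  finally show ?thesis by (simp add: dim)
qed

lemma ideal_max_ideal: "ideal (max_ideal z) (integer_ring z)"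
proof -
  interpret cring "integer_ring z" by (rule cring_integer_ring)
  have "uniformizer z (SOME \<pi>. uniformizer z \<pi>)" using uniformizer_exists by (rule someI_ex)
  hence "to_completion z (SOME \<pi>. uniformizer z \<pi>) \<in> carrier (integer_ring z)"
    by (simp add: integer_ring_carrier vge_def uniformizer_def)
  thus ?thesis unfolding max_ideal_def by (rule cgenideal_ideal)
qed

definition residue :: "'k::{field,finite} place \<Rightarrow> 'k poly fract \<Rightarrow> 'k completed set" where
  "residue z a = max_ideal z +>\<^bsub>integer_ring z\<^esub> to_completion z a"

lemma residue_facts:
  shows cring_residue_field: "cring (residue_field z)"
    and residue_add: "vge z 0 a \<Longrightarrow> vge z 0 b \<Longrightarrow> residue z (a + b) = residue z a \<oplus>\<^bsub>residue_field z\<^esub> residue z b"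
    and residue_mult: "vge z 0 a \<Longrightarrow> vge z 0 b \<Longrightarrow> residue z (a * b) = residue z a \<otimes>\<^bsub>residue_field z\<^esub> residue z b"
    and residue_one: "residue z 1 = \<one>\<^bsub>residue_field z\<^esub>"
    and residue_zero: "residue z 0 = \<zero>\<^bsub>residue_field z\<^esub>"
    and residue_eq_iff: "vge z 0 a \<Longrightarrow> vge z 0 b \<Longrightarrow> residue z a = residue z b \<longleftrightarrow> vge z 1 (a - b)"
    and carrier_residue_field: "carrier (residue_field z) = residue z ` {a. vge z 0 a}"
proof -
  interpret O: cring "integer_ring z" by (rule cring_integer_ring)
  interpret m: ideal "max_ideal z" "integer_ring z" by (rule ideal_max_ideal)
  have car: "to_completion z a \<in> carrier (integer_ring z)" if "vge z 0 a" for a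
    using that by (simp add: integer_ring_carrier)
  show cr: "cring (residue_field z)"
    unfolding residue_field_def by (rule m.quotient_is_cring) (rule O.is_cring)
  have hom: "((+>\<^bsub>integer_ring z\<^esub>) (max_ideal z)) \<in> ring_hom (integer_ring z) (residue_field z)"
    unfolding residue_field_def by (rule m.rcos_ring_hom)
  show "residue z (a + b) = residue z a \<oplus>\<^bsub>residue_field z\<^esub> residue z b" if "vge z 0 a" "vge z 0 b" for a b
    using ring_hom_add[OF hom car[OF that(1)] car[OF that(2)]] by (simp add: residue_def to_completion_add)
  show "residue z (a * b) = residue z a \<otimes>\<^bsub>residue_field z\<^esub> residue z b" if "vge z 0 a" "vge z 0 b" for a b
    using ring_hom_mult[OF hom car[OF that(1)] car[OF that(2)]] by (simp add: residue_def to_completion_mult)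
  show "residue z 1 = \<one>\<^bsub>residue_field z\<^esub>"
    using ring_hom_one[OF hom] by (simp add: residue_def)
  show "residue z 0 = \<zero>\<^bsub>residue_field z\<^esub>"
    using ring_hom_zero[OF hom O.ring_axioms] cr by (simp add: residue_def cring_def)
  have eq: "max_ideal z +>\<^bsub>integer_ring z\<^esub> A = max_ideal z +>\<^bsub>integer_ring z\<^esub> B \<longleftrightarrow>
      cge z 1 (A \<ominus>\<^bsub>completion z\<^esub> B)" if "cge z 0 A" "cge z 0 B" for A B
    using O.quotient_eq_iff_same_a_r_cos[OF m.ideal_axioms, of A B] that
    by (simp add: integer_ring_carrier max_ideal_iff integer_ring_diff)
  show "residue z a = residue z b \<longleftrightarrow> vge z 1 (a - b)" if "vge z 0 a" "vge z 0 b" for a b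
    using eq[of "to_completion z a" "to_completion z b"] that
    by (simp add: residue_def flip: to_completion_diff)
  have "\<exists>a. vge z 0 a \<and> max_ideal z +>\<^bsub>integer_ring z\<^esub> A = residue z a" if A: "cge z 0 A" for A
  proof -
    interpret C: cring "completion z" by (rule cring_completion)
    obtain a where a: "cge z 1 (A \<ominus>\<^bsub>completion z\<^esub> to_completion z a)"
      using completion_dense cge_closed[OF A] by blast
    have "to_completion z a = A \<ominus>\<^bsub>completion z\<^esub> (A \<ominus>\<^bsub>completion z\<^esub> to_completion z a)"
      using cge_closed[OF A] to_completion_closed[of z a] by algebra
    moreover have "cge z 0 (A \<ominus>\<^bsub>completion z\<^esub> (A \<ominus>\<^bsub>completion z\<^esub> to_completion z a))"
      using A cge_mono[OF a] by auto
    ultimately have "cge z 0 (to_completion z a)" by simp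
    hence "vge z 0 a" "cge z 0 (to_completion z a)" by simp_all
    thus ?thesis using eq[OF A, of "to_completion z a"] a by (intro exI[of _ a]) (simp add: residue_def)
  qed
  moreover have "carrier (residue_field z) =
      (\<lambda>A. max_ideal z +>\<^bsub>integer_ring z\<^esub> A) ` {A. cge z 0 A}"
    by (auto simp: residue_field_def FactRing_def A_RCOSETS_def' integer_ring_carrier)
  ultimately show "carrier (residue_field z) = residue z ` {a. vge z 0 a}"
    by (auto simp: residue_def image_iff)
qed

lemma residue_constants_eq: "residue_constants z = range (\<lambda>c. residue z (const_elt c))"
  by (simp add: residue_constants_def residue_def const_elt_def)

lemma subfield_residue_constants: "subfield (residue_constants z) (residue_field z)"
proof -
  interpret R: cring "residue_field z" by (rule cring_residue_field)
  let ?K = "residue_constants z"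
  have sub: "?K \<subseteq> carrier (residue_field z)"
    by (auto simp: residue_constants_eq carrier_residue_field)
  have minus: "\<ominus>\<^bsub>residue_field z\<^esub> residue z (const_elt c) = residue z (const_elt (- c))" for c
  proof (rule R.minus_equality)
    show "residue z (const_elt (- c)) \<oplus>\<^bsub>residue_field z\<^esub> residue z (const_elt c) = \<zero>\<^bsub>residue_field z\<^esub>"
      by (simp add: const_elt_minus residue_zero flip: residue_add)
  qed (use sub in \<open>auto simp: residue_constants_eq\<close>)
  have "subring ?K (residue_field z)"
  proof (rule R.subringI[OF sub])
    show "\<one>\<^bsub>residue_field z\<^esub> \<in> ?K"
      by (auto simp: residue_constants_eq simp flip: residue_one intro!: image_eqI[of _ _ 1])
  next
    fix h assume "h \<in> ?K" thus "\<ominus>\<^bsub>residue_field z\<^esub> h \<in> ?K"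
      using minus by (auto simp: residue_constants_eq)
  next
    fix h1 h2 assume "h1 \<in> ?K" "h2 \<in> ?K"
    then obtain c d where "h1 = residue z (const_elt c)" "h2 = residue z (const_elt d)"
      by (auto simp: residue_constants_eq)
    thus "h1 \<otimes>\<^bsub>residue_field z\<^esub> h2 \<in> ?K" "h1 \<oplus>\<^bsub>residue_field z\<^esub> h2 \<in> ?K"
      by (auto simp: residue_constants_eq simp flip: residue_mult residue_add const_elt_mult const_elt_add)
  qed
  hence "cring (residue_field z\<lparr>carrier := ?K\<rparr>)"
    using R.subcring_iff[OF sub] R.subcringI' by blast
  then interpret K: cring "residue_field z\<lparr>carrier := ?K\<rparr>" .
  have "field (residue_field z\<lparr>carrier := ?K\<rparr>)"
  proof (rule K.cring_fieldI2)
    show "\<zero>\<^bsub>residue_field z\<lparr>carrier := ?K\<rparr>\<^esub> \<noteq> \<one>\<^bsub>residue_field z\<lparr>carrier := ?K\<rparr>\<^esub>"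
      using residue_eq_iff[of z 0 1] by (simp add: residue_zero residue_one)
  next
    fix a assume a: "a \<in> carrier (residue_field z\<lparr>carrier := ?K\<rparr>)"
      "a \<noteq> \<zero>\<^bsub>residue_field z\<lparr>carrier := ?K\<rparr>\<^esub>"
    then obtain c where c: "a = residue z (const_elt c)" by (auto simp: residue_constants_eq)
    hence "c \<noteq> 0" using a by (auto simp: residue_zero)
    hence "a \<otimes>\<^bsub>residue_field z\<^esub> residue z (const_elt (inverse c)) = \<one>\<^bsub>residue_field z\<^esub>"
      by (simp add: c residue_one flip: residue_mult const_elt_mult)
    thus "\<exists>b\<in>carrier (residue_field z\<lparr>carrier := ?K\<rparr>).
        a \<otimes>\<^bsub>residue_field z\<lparr>carrier := ?K\<rparr>\<^esub> b = \<one>\<^bsub>residue_field z\<lparr>carrier := ?K\<rparr>\<^esub>"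
      by (auto simp: residue_constants_eq)
  qed
  thus ?thesis using R.subfield_iff(1) sub by blast
qed

text \<open>The degree of a place can be read off from any complete system of rational residues, because
  \<open>F\<close> is dense in its completion.\<close>

lemma card_residue_system:
  fixes z :: "'k::{field,finite} place"
  assumes "finite B" and int: "\<And>b. b \<in> B \<Longrightarrow> vge z 0 b"
    and ex: "\<And>f. vge z 0 f \<Longrightarrow> \<exists>b\<in>B. vge z 1 (f - b)"
    and uniq: "\<And>b c. b \<in> B \<Longrightarrow> c \<in> B \<Longrightarrow> vge z 1 (b - c) \<Longrightarrow> b = c"
  shows "CARD('k) ^ place_degree z = card B"
proof -
  interpret R: cring "residue_field z" by (rule cring_residue_field)
  have car: "carrier (residue_field z) = residue z ` B"
  proof (intro equalityI subsetI)
    fix u assume "u \<in> carrier (residue_field z)"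
    then obtain a where a: "u = residue z a" "vge z 0 a" by (auto simp: carrier_residue_field)
    then obtain b where "b \<in> B" "vge z 1 (a - b)" using ex by blast
    thus "u \<in> residue z ` B" using a residue_eq_iff[of z a b] int by auto
  qed (use int in \<open>auto simp: carrier_residue_field\<close>)
  have "inj_on (residue z) B"
    by (rule inj_onI) (use residue_eq_iff int uniq in blast)
  hence cB: "card (carrier (residue_field z)) = card B" by (simp add: car card_image)
  have "residue z (const_elt c) = residue z (const_elt d) \<longleftrightarrow> c = d" for c d :: 'k
    by (simp add: residue_eq_iff flip: const_elt_diff)
  hence "inj (\<lambda>c :: 'k. residue z (const_elt c))" by (auto simp: inj_def)
  hence "card (residue_constants z) = CARD('k)"
    by (simp add: residue_constants_eq card_image)
  thus ?thesis
    using R.card_carrier_eq_card_power_dim[OF subfield_residue_constants] cB \<open>finite B\<close>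
    by (simp add: car place_degree_def)
qed

lemma card_field_gt_1: "CARD('k::{field,finite}) > 1"
proof -
  have "card {0, 1 :: 'k} \<le> CARD('k)" by (rule card_mono) auto
  thus ?thesis by simp
qed

context coord
begin

lemma place_degree_eq:
  assumes "z \<noteq> x" shows "place_degree z = degree (prime_at z)"
proof -
  let ?B = "ev s ` small_polys (degree (prime_at z))"
  have "CARD('k) ^ place_degree z = card ?B"
  proof (rule card_residue_system)
    show "finite ?B" using card_small_polys by blast
    show "\<And>b. b \<in> ?B \<Longrightarrow> vge z 0 b" using vge_poly assms by auto
    show "\<And>f. vge z 0 f \<Longrightarrow> \<exists>b\<in>?B. vge z 1 (f - b)" using residue_exists[OF assms] by blast
    show "\<And>b c. b \<in> ?B \<Longrightarrow> c \<in> ?B \<Longrightarrow> vge z 1 (b - c) \<Longrightarrow> b = c"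
      using residue_unique[OF assms] by blast
  qed
  also have "card ?B = CARD('k) ^ degree (prime_at z)"
    using card_small_polys[of "degree (prime_at z)", where ?'k = 'k]
    by (subst card_image) (auto simp: inj_on_def)
  finally show ?thesis using card_field_gt_1[where ?'k = 'k] by (simp add: power_inject_exp)
qed

end

lemma coord_infinity:
  "coord (Abs_place degree_val :: 'k::{field,finite} place) (Fract [:0, 1:] 1)"
proof
  have v: "place_val (Abs_place degree_val) = (degree_val :: 'k poly fract \<Rightarrow> int)"
    by (simp add: Abs_place_inverse is_place_val_degree_val)
  show "place_val (Abs_place degree_val) (Fract [:0, 1 :: 'k:] 1) = - 1"
    by (simp add: v degree_val_Fract)
  have ev: "ev (Fract [:0, 1 :: 'k:] 1) a = Fract a 1" for a
    by (induction a) (simp_all add: ev_pCons const_elt_def Zero_fract_def)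
  fix f :: "'k poly fract"
  obtain a b where "f = Fract a b" "b \<noteq> 0" by (rule Fract_cases)
  thus "\<exists>a b. b \<noteq> 0 \<and> f = ev (Fract [:0, 1:] 1) a / ev (Fract [:0, 1:] 1) b"
    by (intro exI[of _ a] exI[of _ b]) (simp add: ev)
qed

text \<open>For the place where the degree is the valuation, the variable \<open>t\<close> is a coordinate.
  Any other place of degree one has a linear prime \<open>t + c\<^sub>0\<close>, and its inverse
  is a coordinate.\<close>

theorem coord_exists:
  fixes x :: "'k::{field,finite} place"
  assumes "place_degree x = 1" shows "\<exists>s. coord x s"
proof (cases "x = Abs_place degree_val")
  case True
  thus ?thesis using coord_infinity by blast
next
  case False
  define t :: "'k poly fract" where "t = Fract [:0, 1:] 1"
  interpret inf: coord "Abs_place degree_val" t unfolding t_def by (rule coord_infinity)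
  have deg: "degree (inf.prime_at x) = 1" using inf.place_degree_eq[OF False] assms by simp
  obtain c0 r where "inf.prime_at x = pCons c0 r" by (cases "inf.prime_at x")
  moreover from this deg have "degree r = 0" "r \<noteq> 0" by (auto split: if_splits)
  moreover from this obtain c1 where "r = [:c1:]" using degree_eq_zeroE by blast
  ultimately have p: "inf.prime_at x = [:c0, 1:]" using inf.prime_at(2)[OF False] by auto
  define w where "w = const_elt c0 + t"
  have w: "place_val x w = 1"
    using inf.val_prime_at[OF False] by (simp add: p ev_pCons w_def)
  hence w0: "w \<noteq> 0" by auto
  define s where "s = inverse w"
  have vs: "place_val x s = - 1" using w by (simp add: s_def)
  have s0: "s \<noteq> 0" using w0 by (simp add: s_def)
  have nz: "ev s b \<noteq> 0" if "b \<noteq> 0" for b using place_val_ev_pole[of x s b] vs that by simp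
  \<comment> \<open>the field generated by \<open>s\<close>; it contains \<open>t = 1 / s - c\<^sub>0\<close>, hence everything\<close>
  define Q where "Q = {f. \<exists>a b. b \<noteq> 0 \<and> f = ev s a / ev s b}"
  have Q_add: "f + g \<in> Q" if "f \<in> Q" "g \<in> Q" for f g
  proof -
    from that obtain a b c d where *: "b \<noteq> 0" "f = ev s a / ev s b" "d \<noteq> 0" "g = ev s c / ev s d"
      by (auto simp: Q_def)
    have "f + g = ev s (a * d + c * b) / ev s (b * d)"
      using nz[OF *(1)] nz[OF *(3)] by (simp add: * ev_mult ev_add add_frac_eq)
    moreover have "b * d \<noteq> 0" using * by simp
    ultimately show ?thesis unfolding Q_def by blast
  qed
  have Q_mult: "f * g \<in> Q" if "f \<in> Q" "g \<in> Q" for f g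
  proof -
    from that obtain a b c d where *: "b \<noteq> 0" "f = ev s a / ev s b" "d \<noteq> 0" "g = ev s c / ev s d"
      by (auto simp: Q_def)
    have "f * g = ev s (a * c) / ev s (b * d)" by (simp add: * ev_mult)
    moreover have "b * d \<noteq> 0" using * by simp
    ultimately show ?thesis unfolding Q_def by blast
  qed
  have Q_inv: "inverse f \<in> Q" if "f \<in> Q" for f
  proof -
    from that obtain a b where *: "b \<noteq> 0" "f = ev s a / ev s b" by (auto simp: Q_def)
    show ?thesis
    proof (cases "a = 0")
      case True
      hence "inverse f = ev s 0 / ev s 1" "(1 :: 'k poly) \<noteq> 0" using * by simp_all
      thus ?thesis unfolding Q_def by blast
    next
      case False
      moreover have "inverse f = ev s b / ev s a" using * by simp
      ultimately show ?thesis unfolding Q_def by blast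
    qed
  qed
  have Q_ev: "ev s a \<in> Q" for a unfolding Q_def by (intro CollectI exI[of _ a] exI[of _ 1]) simp
  have Q_const_elt: "const_elt c \<in> Q" for c using Q_ev[of "[:c:]"] by (simp add: ev_pCons)
  have "s \<in> Q" using Q_ev[of "[:0, 1:]"] by (simp add: ev_pCons)
  moreover have "t = inverse s + const_elt (- c0)" by (simp add: s_def w_def const_elt_minus)
  ultimately have "t \<in> Q" using Q_add Q_inv Q_const_elt by simp
  hence Q_t: "ev t a \<in> Q" for a
    by (induction a) (use Q_ev[of 0] in \<open>auto simp: ev_pCons intro!: Q_add Q_mult Q_const_elt\<close>)
  have "coord x s"
  proof
    show "place_val x s = - 1" by (rule vs)
    fix f :: "'k poly fract"
    obtain a b where "f = ev t a / ev t b" using inf.quot by blast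
    hence "f \<in> Q" using Q_mult Q_inv Q_t by (simp add: divide_inverse)
    thus "\<exists>a b. b \<noteq> 0 \<and> f = ev s a / ev s b" by (simp add: Q_def)
  qed
  thus ?thesis by blast
qed

section \<open>Rational two by two matrices\<close>

definition mk :: "'a \<Rightarrow> 'a \<Rightarrow> 'a \<Rightarrow> 'a \<Rightarrow> 'a^2^2" where
  "mk a b c d = (\<chi> i j. if i = 1 then if j = 1 then a else b else if j = 1 then c else d)"

lemma mk_sel [simp]:
  "mk a b c d $ 1 $ 1 = a" "mk a b c d $ 1 $ 2 = b" "mk a b c d $ 2 $ 1 = c" "mk a b c d $ 2 $ 2 = d"
  by (simp_all add: mk_def)

lemma mk_eta: "mk (A$1$1) (A$1$2) (A$2$1) (A$2$2) = A"
  by (simp add: vec_eq_iff forall_2)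

lemma mk_cases: obtains a b c d where "A = mk a b c d"
  by (metis mk_eta)

lemma mk_eq_iff [simp]: "mk a b c d = mk a' b' c' d' \<longleftrightarrow> a = a' \<and> b = b' \<and> c = c' \<and> d = d'"
  by (metis mk_sel)

lemma mk_mult [simp]:
  "mk a b c d ** mk a' b' c' d' =
     mk (a * a' + b * c') (a * b' + b * d') (c * a' + d * c') (c * b' + d * d' :: 'a::semiring_1)"
  by (simp add: vec_eq_iff forall_2 matrix_matrix_mult_def sum_2)

lemma mat_1_mk: "mat 1 = mk 1 0 0 1"
  by (simp add: vec_eq_iff forall_2 mat_def)

lemma det_mk [simp]: "det (mk a b c d) = a * d - b * (c :: 'a::comm_ring_1)"
  by (simp add: det_2)

text \<open>The inverse by the cofactor formula, since its entries are needed explicitly.\<close>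

definition rinv :: "'a::field^2^2 \<Rightarrow> 'a^2^2" where
  "rinv A = mk (A$2$2 / det A) (- A$1$2 / det A) (- A$2$1 / det A) (A$1$1 / det A)"

lemma rinv_mk: "rinv (mk a b c d) =
    mk (d / (a * d - b * c)) (- b / (a * d - b * c)) (- c / (a * d - b * c)) (a / (a * d - b * c))"
  by (simp add: rinv_def)

lemma rinv_right: assumes "det A \<noteq> 0" shows "A ** rinv A = mat 1"
proof -
  obtain a b c d where A: "A = mk a b c d" by (rule mk_cases)
  define D where "D = a * d - b * c"
  have D: "det A = D" "a * d = D + b * c" by (simp_all add: A D_def)
  have "A ** rinv A = mk a b c d ** mk (d / D) (- b / D) (- c / D) (a / D)"
    by (simp add: rinv_def D(1)) (simp add: A)
  also have "\<dots> = mat 1" using assms D by (simp add: mat_1_mk field_simps)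
  finally show ?thesis .
qed

lemma rinv_left: "det A \<noteq> 0 \<Longrightarrow> rinv A ** A = mat 1"
  using rinv_right matrix_left_right_inverse by blast

lemma det_rinv: "det A \<noteq> 0 \<Longrightarrow> det (rinv A) = inverse (det A)"
  using det_mul[of A "rinv A"] by (simp add: rinv_right inverse_unique)

lemma rinv_cancel:
  "det A \<noteq> 0 \<Longrightarrow> A ** (rinv A ** B) = B" "det A \<noteq> 0 \<Longrightarrow> rinv A ** (A ** B) = B"
  by (simp_all add: matrix_mul_assoc rinv_right rinv_left)

definition scalar_mat :: "'a::field \<Rightarrow> 'a^2^2" where
  "scalar_mat c = mk c 0 0 c"

lemma scalar_mat_commute: "scalar_mat c ** A = A ** scalar_mat c"
  by (cases A rule: mk_cases) (simp add: scalar_mat_def mult.commute)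

lemma det_scalar_mat [simp]: "det (scalar_mat c) = c * c"
  by (simp add: scalar_mat_def)

lemma scalar_mat_mult: "scalar_mat c ** scalar_mat d = scalar_mat (c * d)"
  by (simp add: scalar_mat_def)

lemma scalar_mat_1: "scalar_mat 1 = mat 1"
  by (simp add: scalar_mat_def mat_1_mk)

subsection \<open>Integral matrices and the principal congruence subgroup\<close>

text \<open>\<open>GL\<^sub>2\<close> of the local ring at \<open>z\<close> and its principal congruence
  subgroup, inside \<open>GL\<^sub>2(F)\<close>. They are the rational points of the compact
  groups at \<open>z\<close>.\<close>

definition GO :: "'k::{field,finite} place \<Rightarrow> ('k poly fract^2^2) set" where
  "GO z = {A. (\<forall>i j. vge z 0 (A$i$j)) \<and> det A \<noteq> 0 \<and> place_val z (det A) = 0}"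

definition GO1 :: "'k::{field,finite} place \<Rightarrow> ('k poly fract^2^2) set" where
  "GO1 z = {A \<in> GO z. \<forall>i j. vge z 1 (A$i$j - mat 1$i$j)}"

lemma mk_in_GO_iff: "mk a b c d \<in> GO z \<longleftrightarrow> vge z 0 a \<and> vge z 0 b \<and> vge z 0 c \<and> vge z 0 d \<and>
    a * d - b * c \<noteq> 0 \<and> place_val z (a * d - b * c) = 0"
  by (auto simp: GO_def forall_2)

lemma GO_det: "A \<in> GO z \<Longrightarrow> det A \<noteq> 0" "A \<in> GO z \<Longrightarrow> place_val z (det A) = 0"
  by (auto simp: GO_def)

lemma vge_matrix_mult:
  assumes "\<And>i j. vge z n (A$i$j)" "\<And>i j. vge z m (B$i$j)" shows "vge z (n + m) ((A ** B)$i$j)"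
  using assms by (simp add: matrix_matrix_mult_def vge_sum vge_mult)

lemma matrix_add_rdistrib': "(A + B) ** C = A ** C + B ** (C :: 'a::semiring_1^'n^'m)"
  by (simp add: vec_eq_iff matrix_matrix_mult_def sum.distrib algebra_simps)

lemma matrix22_nth: "(A ** B)$i$j = A$i$1 * B$1$j + A$i$2 * (B :: 'a::semiring_1^2^2)$2$j"
  by (simp add: matrix_matrix_mult_def sum_2)

lemma GO_mult: assumes "A \<in> GO z" "B \<in> GO z" shows "A ** B \<in> GO z"
  using assms vge_matrix_mult[of z 0 A 0 B] unfolding GO_def
  by (simp add: det_mul place_val_mult)

lemma GO_rinv: assumes "A \<in> GO z" shows "rinv A \<in> GO z"
proof -
  have "det A \<noteq> 0" "place_val z (det A) = 0" using assms by (auto simp: GO_def)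
  moreover from this have "det (rinv A) = inverse (det A)" by (simp add: det_rinv)
  moreover have "\<forall>i j. vge z 0 (rinv A $ i $ j)"
    using assms by (auto simp: GO_def rinv_def forall_2 vge_divide)
  ultimately show ?thesis by (simp add: GO_def)
qed

lemma mat_1_in_GO [simp]: "mat 1 \<in> GO z"
  by (simp add: mat_1_mk mk_in_GO_iff)

text \<open>Congruence to the identity already forces the determinant to be a unit.\<close>

lemma mk_in_GO1_iff:
  "mk a b c d \<in> GO1 z \<longleftrightarrow> vge z 1 (a - 1) \<and> vge z 1 b \<and> vge z 1 c \<and> vge z 1 (d - 1)"
proof
  assume *: "vge z 1 (a - 1) \<and> vge z 1 b \<and> vge z 1 c \<and> vge z 1 (d - 1)"
  have int: "vge z 0 a" "vge z 0 b" "vge z 0 c" "vge z 0 d"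
    using * vge_mono[of z 1 _ 0] vge_add[of z 0 "a - 1" 1] vge_add[of z 0 "d - 1" 1] by auto
  have "vge z 1 ((a - 1) * d + (d - 1) - b * c)" using * int by blast
  also have "(a - 1) * d + (d - 1) - b * c = a * d - b * c - 1" by (simp add: algebra_simps)
  finally have "vge z 1 (a * d - b * c - 1)" .
  from vge_unit[OF this] show "mk a b c d \<in> GO1 z"
    using * int by (simp add: GO1_def mk_in_GO_iff forall_2 mat_1_mk)
qed (auto simp: GO1_def forall_2 mat_1_mk)

lemma GO1_subset_GO: "A \<in> GO1 z \<Longrightarrow> A \<in> GO z"
  by (simp add: GO1_def)

lemma GO1_iff: "A \<in> GO1 z \<longleftrightarrow> (\<exists>N. (\<forall>i j. vge z 1 (N$i$j)) \<and> A = mat 1 + N)"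
proof
  assume "A \<in> GO1 z"
  thus "\<exists>N. (\<forall>i j. vge z 1 (N$i$j)) \<and> A = mat 1 + N"
    by (intro exI[of _ "A - mat 1"]) (simp add: GO1_def)
next
  assume "\<exists>N. (\<forall>i j. vge z 1 (N$i$j)) \<and> A = mat 1 + N"
  hence "mk (A$1$1) (A$1$2) (A$2$1) (A$2$2) \<in> GO1 z"
    by (auto simp: mk_in_GO1_iff mat_1_mk)
  thus "A \<in> GO1 z" by (simp add: mk_eta)
qed

lemma GO1_conj:
  assumes A: "A \<in> GO z" and k: "k \<in> GO1 z" shows "rinv A ** k ** A \<in> GO1 z"
proof -
  obtain N where N: "\<forall>i j. vge z 1 (N$i$j)" "k = mat 1 + N" using k by (auto simp: GO1_iff)
  have "rinv A ** k ** A = mat 1 + rinv A ** N ** A"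
    using rinv_left[OF GO_det(1)[OF A]] by (simp add: N(2) matrix_add_ldistrib matrix_add_rdistrib')
  moreover have "vge z 1 ((rinv A ** N ** A)$i$j)" for i j
    using vge_matrix_mult[of z 1 "rinv A ** N" 0 A] vge_matrix_mult[of z 0 "rinv A" 1 N] N A GO_rinv[OF A]
    by (simp add: GO_def)
  ultimately show ?thesis by (auto simp: GO1_iff)
qed

lemma GO1_mult: assumes "A \<in> GO1 z" "B \<in> GO1 z" shows "A ** B \<in> GO1 z"
proof -
  obtain N where N: "\<forall>i j. vge z 1 (N$i$j)" "B = mat 1 + N" using assms by (auto simp: GO1_iff)
  obtain M where M: "\<forall>i j. vge z 1 (M$i$j)" "A = mat 1 + M" using assms by (auto simp: GO1_iff)
  have "A ** B = mat 1 + (M + A ** N)"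
    by (simp add: N(2) matrix_add_ldistrib) (simp add: M(2))
  moreover have "vge z 1 ((M + A ** N)$i$j)" for i j
    using vge_matrix_mult[of z 0 A 1 N] N M GO1_subset_GO[OF assms(1)] by (auto simp: GO_def)
  ultimately show ?thesis by (auto simp: GO1_iff)
qed

lemma mat_1_in_GO1 [simp]: "mat 1 \<in> GO1 z"
  by (simp add: mat_1_mk mk_in_GO1_iff)

lemma GO1_rinv: assumes "A \<in> GO1 z" shows "rinv A \<in> GO1 z"
proof -
  obtain N where N: "\<forall>i j. vge z 1 (N$i$j)" "A = mat 1 + N" using assms by (auto simp: GO1_iff)
  have R: "rinv A \<in> GO z" using GO_rinv GO1_subset_GO assms by blast
  have "rinv A ** A = mat 1" using rinv_left GO_det(1) GO1_subset_GO assms by blast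
  hence "rinv A + rinv A ** N = mat 1" by (simp add: N(2) matrix_add_ldistrib)
  hence "rinv A = mat 1 + - (rinv A ** N)" by (metis add_diff_cancel_right' diff_conv_add_uminus)
  moreover have "vge z 1 ((- (rinv A ** N))$i$j)" for i j
    using vge_matrix_mult[of z 0 "rinv A" 1 N] N R by (simp add: GO_def)
  ultimately show ?thesis unfolding GO1_iff by blast
qed

lemma vge_row_mult:
  assumes "vge z e p" "vge z e q" "A \<in> GO z"
  shows "vge z e (p * A$1$1 + q * A$2$1)" "vge z e (p * A$1$2 + q * A$2$2)"
  using assms by (auto simp: GO_def intro!: vge_add vge_mult_0')

section \<open>The normal form of a rational matrix\<close>

text \<open>The ring \<open>\<FF>\<^sub>q[s]\<close> and the arithmetic group
  \<open>GL\<^sub>2(\<FF>\<^sub>q[s])\<close>, described by the places other than \<open>x\<close>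
  and hence without the choice of \<open>s\<close>.\<close>

definition Poly_ring :: "'k::{field,finite} place \<Rightarrow> 'k poly fract set" where
  "Poly_ring x = {f. \<forall>z. z \<noteq> x \<longrightarrow> vge z 0 f}"

definition arith_group :: "'k::{field,finite} place \<Rightarrow> ('k poly fract^2^2) set" where
  "arith_group x = {A. \<forall>z. z \<noteq> x \<longrightarrow> A \<in> GO z}"

lemma Poly_ring_closed [intro]:
  "f \<in> Poly_ring x \<Longrightarrow> g \<in> Poly_ring x \<Longrightarrow> f + g \<in> Poly_ring x" "f \<in> Poly_ring x \<Longrightarrow> g \<in> Poly_ring x \<Longrightarrow> f * g \<in> Poly_ring x"
  "f \<in> Poly_ring x \<Longrightarrow> - f \<in> Poly_ring x" "f \<in> Poly_ring x \<Longrightarrow> g \<in> Poly_ring x \<Longrightarrow> f - g \<in> Poly_ring x"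
  by (auto simp: Poly_ring_def)

lemma Poly_ring_const_elt [simp]: "const_elt c \<in> Poly_ring x" by (simp add: Poly_ring_def)
lemma Poly_ring_0 [simp]: "0 \<in> Poly_ring x" by (simp add: Poly_ring_def)
lemma Poly_ring_1 [simp]: "1 \<in> Poly_ring x" by (simp add: Poly_ring_def)

text \<open>The bottom row, \<open>(0, 1)\<close> or \<open>(1, c)\<close>, runs through the lines in
  \<open>\<FF>\<^sub>q\<^sup>2\<close>, so these matrices represent the upper triangular classes
  in \<open>GL\<^sub>2(\<FF>\<^sub>q)\<close>.\<close>

definition line_mat :: "'k::{field,finite} option \<Rightarrow> 'k poly fract^2^2" where
  "line_mat w = (case w of None \<Rightarrow> mat 1 | Some c \<Rightarrow> mk 0 1 1 (const_elt c))"

lemma line_mat_in_GO [simp]: "line_mat w \<in> GO z"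
  by (cases w) (simp_all add: line_mat_def mk_in_GO_iff)

lemma line_mat_in_arith_group [simp]: "line_mat w \<in> arith_group x"
  by (simp add: arith_group_def)

text \<open>For \<open>n = 0\<close> the constant matrices are in the arithmetic group and identify all
  lines; one label is kept.\<close>

definition vertices :: "(nat \<times> 'k option) set" where
  "vertices = {(n, w). n = 0 \<longrightarrow> w = None}"

text \<open>Equality in \<open>GL\<^sub>2(\<FF>\<^sub>q[s]) \ GL\<^sub>2(F) / F\<^sup>\<times>
  K'\<^sub>x\<close>, the shape that the adelic double cosets take after everything has been moved
  to the place \<open>x\<close>.\<close>

definition rat_equiv :: "'k::{field,finite} place \<Rightarrow> 'k poly fract^2^2 \<Rightarrow> 'k poly fract^2^2 \<Rightarrow> bool" where
  "rat_equiv x g h \<longleftrightarrow> (\<exists>\<gamma>\<in>arith_group x. \<exists>c k. c \<noteq> 0 \<and> k \<in> GO1 x \<and> g = \<gamma> ** scalar_mat c ** h ** k)"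

context coord
begin

lemma Poly_ring_iff: "f \<in> Poly_ring x \<longleftrightarrow> (\<exists>a. f = ev s a)"
  using integral_imp_poly vge_poly by (auto simp: Poly_ring_def)

lemma Poly_ring_val: "f \<in> Poly_ring x \<Longrightarrow> f \<noteq> 0 \<Longrightarrow> place_val x f \<le> 0"
  by (auto simp: Poly_ring_iff val_ev)

lemma Poly_ring_const: "f \<in> Poly_ring x \<Longrightarrow> vge x 0 f \<Longrightarrow> \<exists>c. f = const_elt c"
proof -
  assume "f \<in> Poly_ring x" "vge x 0 f"
  then obtain a where a: "f = ev s a" "degree a = 0 \<or> a = 0"
    by (auto simp: Poly_ring_iff vge_def val_ev)
  hence "degree a = 0" by auto
  then obtain c where "a = [:c:]" by (rule degree_eq_zeroE)
  thus ?thesis using a by (auto simp: ev_pCons)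
qed

lemma Poly_ring_part: "\<exists>p\<in>Poly_ring x. vge x 1 ((f :: 'k poly fract) - p)"
  using poly_part[of f] Poly_ring_iff by blast

lemma residue_const: "vge x 0 f \<Longrightarrow> \<exists>c. vge x 1 (f - const_elt c)"
proof -
  assume f: "vge x 0 f"
  obtain p where p: "p \<in> Poly_ring x" "vge x 1 (f - p)" using Poly_ring_part by blast
  have "vge x 0 (f - (f - p))" by (rule vge_diff[OF f vge_mono[OF p(2)]]) simp
  hence "vge x 0 p" by simp
  thus ?thesis using Poly_ring_const[OF p(1)] p(2) by auto
qed

lemma arith_group_entries: "A \<in> arith_group x \<Longrightarrow> A$i$j \<in> Poly_ring x"
  by (simp add: arith_group_def GO_def Poly_ring_def)

lemma exists_other_place: "\<exists>z. z \<noteq> x"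
proof -
  have "prime_elem [:0, 1 :: 'k:]"
    by (rule prime_elem_linear_field_poly) simp
  thus ?thesis using place_of_prime by blast
qed

text \<open>A unit of the polynomial ring is a constant.\<close>

lemma arith_group_det: assumes "A \<in> arith_group x" shows "\<exists>c. c \<noteq> 0 \<and> det A = const_elt c"
proof -
  obtain z where "z \<noteq> x" using exists_other_place by blast
  hence nz: "det A \<noteq> 0" using assms by (auto simp: arith_group_def GO_def)
  have "det A \<in> Poly_ring x" "inverse (det A) \<in> Poly_ring x"
    using assms by (auto simp: arith_group_def GO_def Poly_ring_def vge_def)
  hence "place_val x (det A) = 0" using Poly_ring_val[of "det A"] Poly_ring_val[of "inverse (det A)"] nz by simp
  hence "vge x 0 (det A)" by (simp add: vge_def)
  with \<open>det A \<in> Poly_ring x\<close> nz Poly_ring_const show ?thesis by (metis const_elt_eq_0_iff)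
qed

lemma arith_group_det_nz: "A \<in> arith_group x \<Longrightarrow> det A \<noteq> 0"
  using arith_group_det by fastforce

lemma arith_group_det_val: "A \<in> arith_group x \<Longrightarrow> place_val x (det A) = 0"
  using arith_group_det by fastforce

lemma arith_group_mult: "A \<in> arith_group x \<Longrightarrow> B \<in> arith_group x \<Longrightarrow> A ** B \<in> arith_group x"
  by (simp add: arith_group_def GO_mult)

lemma arith_group_rinv: "A \<in> arith_group x \<Longrightarrow> rinv A \<in> arith_group x"
  by (simp add: arith_group_def GO_rinv)

lemma arith_group_1 [simp]: "mat 1 \<in> arith_group x"
  by (simp add: arith_group_def)

lemma mk_in_arith_group:
  "a \<in> Poly_ring x \<Longrightarrow> b \<in> Poly_ring x \<Longrightarrow> c \<in> Poly_ring x \<Longrightarrow> d \<in> Poly_ring x \<Longrightarrow> a * d - b * c = const_elt e \<Longrightarrow> e \<noteq> 0 \<Longrightarrow>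
    mk a b c d \<in> arith_group x"
  by (simp add: arith_group_def mk_in_GO_iff Poly_ring_def)

lemma rat_equiv_trans: assumes "rat_equiv x g h" "rat_equiv x h i" shows "rat_equiv x g i"
proof -
  obtain \<gamma> c k where 1: "\<gamma> \<in> arith_group x" "c \<noteq> 0" "k \<in> GO1 x" "g = \<gamma> ** scalar_mat c ** h ** k"
    using assms(1) by (auto simp: rat_equiv_def)
  obtain \<delta> d l where 2: "\<delta> \<in> arith_group x" "d \<noteq> 0" "l \<in> GO1 x" "h = \<delta> ** scalar_mat d ** i ** l"
    using assms(2) by (auto simp: rat_equiv_def)
  have "g = \<gamma> ** (scalar_mat c ** \<delta>) ** scalar_mat d ** i ** (l ** k)"
    by (simp add: 1(4) 2(4) matrix_mul_assoc)
  also have "\<dots> = (\<gamma> ** \<delta>) ** scalar_mat (c * d) ** i ** (l ** k)"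
    by (simp only: scalar_mat_commute[of c \<delta>]) (simp add: matrix_mul_assoc flip: scalar_mat_mult)
  finally show ?thesis
    using 1 2 unfolding rat_equiv_def
    by (intro bexI[of _ "\<gamma> ** \<delta>"] exI[of _ "c * d"] exI[of _ "l ** k"] conjI)
       (simp_all add: arith_group_mult GO1_mult)
qed

lemma rat_equiv_sym: assumes "rat_equiv x g h" shows "rat_equiv x h g"
proof -
  obtain \<gamma> c k where 1: "\<gamma> \<in> arith_group x" "c \<noteq> 0" "k \<in> GO1 x" "g = \<gamma> ** scalar_mat c ** h ** k"
    using assms(1) by (auto simp: rat_equiv_def)
  have k: "det k \<noteq> 0" using GO_det GO1_subset_GO 1 by blast
  have "rinv \<gamma> ** scalar_mat (inverse c) ** g ** rinv k =
      rinv \<gamma> ** (scalar_mat (inverse c) ** \<gamma>) ** scalar_mat c ** h ** (k ** rinv k)"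
    by (simp add: 1(4) matrix_mul_assoc)
  also have "\<dots> = (rinv \<gamma> ** \<gamma>) ** (scalar_mat (inverse c) ** scalar_mat c) ** h"
    using k by (simp only: scalar_mat_commute[of _ \<gamma>]) (simp add: matrix_mul_assoc rinv_right)
  also have "\<dots> = h" using 1 arith_group_det_nz by (simp add: rinv_left scalar_mat_mult scalar_mat_1)
  finally show ?thesis
    using 1 unfolding rat_equiv_def
    by (intro bexI[of _ "rinv \<gamma>"] exI[of _ "inverse c"] exI[of _ "rinv k"])
       (auto intro: arith_group_rinv GO1_rinv)
qed

lemma rat_equiv_arith_group: "\<gamma> \<in> arith_group x \<Longrightarrow> rat_equiv x (\<gamma> ** g) g"
  unfolding rat_equiv_def by (intro bexI[of _ \<gamma>] exI[of _ 1] exI[of _ "mat 1"]) (simp_all add: scalar_mat_1)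

lemma rat_equiv_scalar_mat: "c \<noteq> 0 \<Longrightarrow> rat_equiv x (scalar_mat c ** g) g"
  unfolding rat_equiv_def by (intro bexI[of _ "mat 1"] exI[of _ c] exI[of _ "mat 1"]) simp_all

lemma rat_equiv_GO1: "k \<in> GO1 x \<Longrightarrow> rat_equiv x (g ** k) g"
  unfolding rat_equiv_def by (intro bexI[of _ "mat 1"] exI[of _ 1] exI[of _ k]) (simp_all add: scalar_mat_1)

definition vertex_mat :: "nat \<times> 'k option \<Rightarrow> 'k poly fract^2^2" where
  "vertex_mat v = mk (s ^ fst v) 0 0 1 ** line_mat (snd v)"

lemma det_vertex_mat: "det (vertex_mat v) \<noteq> 0"
  using s_nz GO_det(1)[OF line_mat_in_GO[of "snd v" x]] by (simp add: vertex_mat_def det_mul)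

lemma val_det_vertex_mat: "place_val x (det (vertex_mat v)) = - int (fst v)"
  using s_nz GO_det[OF line_mat_in_GO[of "snd v" x]] val_s
  by (simp add: vertex_mat_def det_mul place_val_mult place_val_power)

subsection \<open>Existence of the normal form\<close>

text \<open>A bottom row congruent to \<open>(0, 1)\<close> is made equal to it by a column operation at
  \<open>x\<close>. The upper right entry is then reduced modulo polynomials, and the upper left
  entry is a power of \<open>s\<close> up to a constant and a congruence unit. The exponent cannot
  be negative, since the top row would otherwise be smaller than the bottom row, which is assumed
  to be minimal.\<close>

lemma normal_form_aux:
  assumes C: "vge x 1 C" and D: "vge x 1 (D - 1)" and det: "A * D - U * C \<noteq> 0"
    and red: "\<And>\<gamma>. \<gamma> \<in> arith_group x \<Longrightarrow>
       \<not> (vge x 1 ((\<gamma> ** mk A U C D)$2$1) \<and> vge x 1 ((\<gamma> ** mk A U C D)$2$2))"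
  shows "\<exists>n. \<exists>\<gamma>\<in>arith_group x. \<exists>k\<in>GO1 x. mk A U C D = \<gamma> ** mk (s ^ n) 0 0 1 ** k"
proof -
  have D0: "D \<noteq> 0" "place_val x D = 0" using vge_unit[OF D] by auto
  define k1 where "k1 = mk 1 0 C D"
  define A' where "A' = (A * D - U * C) / D"
  have A'0: "A' \<noteq> 0" using det D0 by (simp add: A'_def)
  have k1: "k1 \<in> GO1 x" using C D D0 by (simp add: k1_def mk_in_GO1_iff vge_divide)
  obtain p where p: "p \<in> Poly_ring x" "vge x 1 (U / D - p)" using Poly_ring_part by blast
  define U' where "U' = U / D - p"
  define n where "n = - place_val x A'"
  define E where "E = s powi n"
  have E: "E \<noteq> 0" "place_val x E = - n" using s_nz val_s by (simp_all add: E_def place_val_powi)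
  have "vge x 0 (A' / E)" using E A'0 by (simp add: vge_divide n_def)
  then obtain \<alpha> where \<alpha>: "vge x 1 (A' / E - const_elt \<alpha>)" using residue_const by blast
  have \<alpha>0: "\<alpha> \<noteq> 0"
  proof
    assume "\<alpha> = 0"
    hence "vge x 1 (A' / E)" using \<alpha> by simp
    thus False using E A'0 by (simp add: place_val_divide vge_def n_def)
  qed
  have eq: "mk A U C D = mk (const_elt \<alpha>) p 0 1 ** mk (A' / const_elt \<alpha>) (U' / const_elt \<alpha>) 0 1 ** k1"
    using D0 \<alpha>0 by (simp add: k1_def A'_def U'_def field_simps)
  have \<gamma>: "mk (const_elt \<alpha>) p 0 1 \<in> arith_group x" using p \<alpha>0 by (intro mk_in_arith_group) auto
  have "n \<ge> 0"
  proof (rule ccontr)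
    assume "\<not> n \<ge> 0"
    \<comment> \<open>exchanging the rows would produce a bottom row that is too small\<close>
    define \<delta> where "\<delta> = mk 0 1 1 0 ** rinv (mk (const_elt \<alpha>) p 0 1)"
    have "mk 0 1 1 0 \<in> arith_group x" by (rule mk_in_arith_group[of _ _ _ _ "- 1"]) (auto simp: const_elt_minus)
    hence "\<delta> \<in> arith_group x" unfolding \<delta>_def by (intro arith_group_mult arith_group_rinv \<gamma>)
    moreover have "\<delta> ** mk A U C D = mk 0 1 1 0 ** (mk (A' / const_elt \<alpha>) (U' / const_elt \<alpha>) 0 1 ** k1)"
      using \<alpha>0 unfolding eq \<delta>_def
      by (simp only: matrix_mul_assoc[symmetric] rinv_cancel(2)[OF arith_group_det_nz[OF \<gamma>]])
    moreover have "vge x 1 A'" using \<open>\<not> n \<ge> 0\<close> by (simp add: vge_def n_def)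
    hence "vge x 1 (A' / const_elt \<alpha>)" "vge x 1 (U' / const_elt \<alpha>)"
      using p \<alpha>0 by (simp_all add: vge_divide U'_def)
    ultimately show False
      using red[of \<delta>] vge_row_mult[OF _ _ GO1_subset_GO[OF k1], of 1 "A' / const_elt \<alpha>" "U' / const_elt \<alpha>"]
      by (simp add: k1_def)
  qed
  then obtain m where m: "n = int m" using nonneg_eq_int by blast
  have Em: "E = s ^ m" by (simp add: E_def m)
  define k2 where "k2 = mk (A' / const_elt \<alpha> / E) (U' / const_elt \<alpha> / E) 0 1"
  have "A' / const_elt \<alpha> / E - 1 = (A' / E - const_elt \<alpha>) / const_elt \<alpha>" using \<alpha>0 E by (simp add: field_simps)
  hence "vge x 1 (A' / const_elt \<alpha> / E - 1)" using \<alpha> \<alpha>0 by (simp add: vge_divide)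
  moreover have "vge x 1 (U' / const_elt \<alpha> / E)"
  proof -
    have "vge x 1 (U' / const_elt \<alpha>)" using p \<alpha>0 by (simp add: vge_divide U'_def)
    hence "vge x (1 + place_val x E) (U' / const_elt \<alpha>)" by (rule vge_mono) (simp add: E m)
    thus ?thesis by (subst vge_divide[OF E(1)])
  qed
  ultimately have "k2 \<in> GO1 x" by (simp add: k2_def mk_in_GO1_iff)
  moreover have "mk (A' / const_elt \<alpha>) (U' / const_elt \<alpha>) 0 1 = mk (s ^ m) 0 0 1 ** k2"
    using E by (simp add: k2_def Em)
  ultimately have "mk A U C D = mk (const_elt \<alpha>) p 0 1 ** mk (s ^ m) 0 0 1 ** (k2 ** k1)" "k2 ** k1 \<in> GO1 x"
    using eq k1 by (simp_all add: matrix_mul_assoc GO1_mult)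
  thus ?thesis using \<gamma> by blast
qed

text \<open>Reduction theory: the arithmetic group moves the bottom row to one of maximal valuation at
  \<open>x\<close>. After scaling, its reduction at \<open>x\<close> is a nonzero vector, and the
  matrix of its line takes it to \<open>(0, 1)\<close>.\<close>

theorem normal_form:
  assumes g: "det g \<noteq> 0" shows "\<exists>v\<in>vertices. rat_equiv x g (vertex_mat v)"
proof -
  define B where "B e \<longleftrightarrow> (\<exists>\<gamma>\<in>arith_group x. vge x e ((\<gamma> ** g)$2$1) \<and> vge x e ((\<gamma> ** g)$2$2))" for e
  \<comment> \<open>if the bottom row of \<open>\<gamma> ** g\<close> could be made arbitrarily small, then so could the one of \<open>\<gamma>\<close>, but polynomials have no zero at \<open>x\<close>\<close>
  have "\<exists>e. B e \<and> \<not> B (e + 1)"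
  proof (rule ccontr)
    assume no: "\<nexists>e. B e \<and> \<not> B (e + 1)"
    define e0 where "e0 = min (place_val x (g$2$1)) (place_val x (g$2$2))"
    have "B e0" unfolding B_def by (rule bexI[of _ "mat 1"]) (auto simp: e0_def vge_def)
    have B_all: "B (e0 + int n)" for n
    proof (induction n)
      case (Suc n)
      thus ?case using no by (metis add.assoc of_nat_Suc add.commute)
    qed (simp add: \<open>B e0\<close>)
    define h where "h = rinv g"
    define m where "m = Min {place_val x (h$1$1), place_val x (h$1$2), place_val x (h$2$1), place_val x (h$2$2)}"
    have m: "vge x m (h$1$1)" "vge x m (h$1$2)" "vge x m (h$2$1)" "vge x m (h$2$2)"
      by (auto simp: m_def vge_def)
    define n where "n = nat (1 - m - e0)"
    obtain \<gamma> where \<gamma>: "\<gamma> \<in> arith_group x" "vge x (e0 + int n) ((\<gamma> ** g)$2$1)" "vge x (e0 + int n) ((\<gamma> ** g)$2$2)"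
      using B_all[of n] by (auto simp: B_def)
    have "\<gamma> = (\<gamma> ** g) ** h" using g by (simp add: h_def matrix_mul_assoc[symmetric] rinv_right)
    hence "\<gamma>$2$i = (\<gamma> ** g)$2$1 * h$1$i + (\<gamma> ** g)$2$2 * h$2$i" for i
      using matrix22_nth[of "\<gamma> ** g" h 2 i] by metis
    moreover have "vge x (e0 + int n + m) ((\<gamma> ** g)$2$1 * h$1$i + (\<gamma> ** g)$2$2 * h$2$i)" for i
      using \<gamma> m exhaust_2[of i] by (auto intro!: vge_add vge_mult)
    ultimately have "vge x (e0 + int n + m) (\<gamma>$2$i)" for i by simp
    moreover have "e0 + int n + m \<ge> 1" by (simp add: n_def)
    ultimately have "\<gamma>$2$i = 0" for i
      using Poly_ring_val[OF arith_group_entries[OF \<gamma>(1)], of 2 i] by (smt (verit) vge_def)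
    thus False using arith_group_det_nz[OF \<gamma>(1)] by (simp add: det_2)
  qed
  then obtain e where e: "B e" "\<not> B (e + 1)" by blast
  then obtain \<gamma> where \<gamma>: "\<gamma> \<in> arith_group x" "vge x e ((\<gamma> ** g)$2$1)" "vge x e ((\<gamma> ** g)$2$2)"
    by (auto simp: B_def)
  define g1 where "g1 = \<gamma> ** g"
  have g1_red: "\<not> (vge x (e + 1) ((\<delta> ** g1)$2$1) \<and> vge x (e + 1) ((\<delta> ** g1)$2$2))" if "\<delta> \<in> arith_group x" for \<delta>
    using e(2) arith_group_mult[OF that \<gamma>(1)] by (auto simp: B_def g1_def matrix_mul_assoc)
  obtain a b c d where g1: "g1 = mk a b c d" by (rule mk_cases)
  define E where "E = s powi e"
  have E: "E \<noteq> 0" "place_val x E = - e" using s_nz val_s by (simp_all add: E_def place_val_powi)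
  have "vge x 0 (E * c)" "vge x 0 (E * d)" using \<gamma> E by (simp_all add: vge_mult_iff g1 flip: g1_def)
  then obtain a1 a2 where a12: "vge x 1 (E * c - const_elt a1)" "vge x 1 (E * d - const_elt a2)"
    using residue_const by metis
  have "a1 \<noteq> 0 \<or> a2 \<noteq> 0"
    using g1_red[of "mat 1"] a12 E by (auto simp: g1 vge_mult_iff add.commute)
  \<comment> \<open>the line spanned by the reduction \<open>(a1, a2)\<close> of the bottom row\<close>
  define w where "w = (if a1 = 0 then None else Some (a2 / a1))"
  define l where "l = (if a1 = 0 then a2 else a1)"
  have l0: "l \<noteq> 0" using \<open>a1 \<noteq> 0 \<or> a2 \<noteq> 0\<close> by (auto simp: l_def)
  define F where "F = E / const_elt l"
  have F: "F \<noteq> 0" "place_val x F = - e" using E l0 by (simp_all add: F_def place_val_divide)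
  define g4 where "g4 = scalar_mat F ** g1 ** rinv (line_mat w)"
  have g1_g4: "scalar_mat F ** g1 = g4 ** line_mat w"
    using GO_det(1)[OF line_mat_in_GO[of w x]] by (simp add: g4_def matrix_mul_assoc[symmetric] rinv_left)
  obtain A U C D where g4: "g4 = mk A U C D" by (rule mk_cases)
  have "vge x 1 C \<and> vge x 1 (D - 1)"
  proof (cases "a1 = 0")
    case True
    have "g4 = scalar_mat F ** g1"
      using True by (simp add: g4_def w_def line_mat_def rinv_mk mat_1_mk) (cases "scalar_mat F ** g1" rule: mk_cases, simp)
    hence CD: "C = F * c" "D = F * d" using g4 by (simp_all add: g1 scalar_mat_def)
    have "F * c = (E * c - const_elt a1) / const_elt l" "F * d - 1 = (E * d - const_elt a2) / const_elt l"
      using True l0 by (simp_all add: F_def l_def field_simps)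
    thus ?thesis using a12 l0 CD by (simp add: vge_divide)
  next
    case False
    have "rinv (line_mat w) = mk (- const_elt (a2 / a1)) 1 1 0"
      using False by (simp add: w_def line_mat_def rinv_mk)
    hence CD: "C = F * c * - const_elt (a2 / a1) + F * d" "D = F * c"
      using g4 by (auto simp: g4_def g1 scalar_mat_def)
    have div: "const_elt (a2 / a1) = const_elt a2 / const_elt a1" by (simp add: divide_inverse const_elt_mult const_elt_inverse)
    have "C = ((E * d - const_elt a2) - (E * c - const_elt a1) * const_elt (a2 / a1)) / const_elt a1" "D - 1 = (E * c - const_elt a1) / const_elt a1"
      using False by (simp_all add: CD F_def l_def div field_simps)
    moreover have "vge x 1 ((E * d - const_elt a2) - (E * c - const_elt a1) * const_elt (a2 / a1))"
      by (rule vge_diff[OF a12(2) vge_mult_0'[OF a12(1)]]) simp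
    ultimately show ?thesis using a12 False by (simp add: vge_divide)
  qed
  moreover have "A * D - U * C \<noteq> 0"
  proof -
    have "det g4 \<noteq> 0"
      using g F arith_group_det_nz[OF \<gamma>(1)] GO_det(1)[OF GO_rinv[OF line_mat_in_GO[of w x]]]
      by (simp add: g4_def g1_def det_mul)
    thus ?thesis by (simp add: g4)
  qed
  moreover have "\<not> (vge x 1 ((\<delta> ** mk A U C D)$2$1) \<and> vge x 1 ((\<delta> ** mk A U C D)$2$2))"
    if \<delta>: "\<delta> \<in> arith_group x" for \<delta>
  proof
    assume *: "vge x 1 ((\<delta> ** mk A U C D)$2$1) \<and> vge x 1 ((\<delta> ** mk A U C D)$2$2)"
    have "scalar_mat F ** (\<delta> ** g1) = (\<delta> ** g4) ** line_mat w"
      by (metis g1_g4 matrix_mul_assoc scalar_mat_commute)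
    moreover have "vge x 1 (((\<delta> ** g4) ** line_mat w)$2$1)" "vge x 1 (((\<delta> ** g4) ** line_mat w)$2$2)"
      using vge_row_mult[OF conjunct1[OF *] conjunct2[OF *] line_mat_in_GO]
      by (simp_all add: g4 matrix22_nth[of _ "line_mat w"])
    moreover have "(scalar_mat F ** (\<delta> ** g1))$2$i = F * (\<delta> ** g1)$2$i" for i
      by (simp add: scalar_mat_def matrix22_nth[of "mk _ _ _ _"])
    ultimately have "vge x 1 (F * (\<delta> ** g1)$2$1)" "vge x 1 (F * (\<delta> ** g1)$2$2)" by simp_all
    thus False using g1_red[OF \<delta>] F by (simp add: vge_mult_iff add.commute)
  qed
  ultimately obtain n \<delta> k where nk: "\<delta> \<in> arith_group x" "k \<in> GO1 x" "g4 = \<delta> ** mk (s ^ n) 0 0 1 ** k"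
    using normal_form_aux[of C D A U] g4 by blast
  define k' where "k' = rinv (line_mat w) ** k ** line_mat w"
  have k': "k' \<in> GO1 x" unfolding k'_def by (rule GO1_conj[OF line_mat_in_GO nk(2)])
  have "scalar_mat F ** g1 = \<delta> ** vertex_mat (n, w) ** k'"
    using GO_det(1)[OF line_mat_in_GO[of w x]]
    by (simp add: g1_g4 nk(3) vertex_mat_def k'_def matrix_mul_assoc[symmetric] rinv_cancel)
  hence "rat_equiv x (scalar_mat F ** g1) (vertex_mat (n, w))"
    using rat_equiv_GO1[OF k', of "\<delta> ** vertex_mat (n, w)"] rat_equiv_arith_group[OF nk(1), of "vertex_mat (n, w)"] by (auto intro: rat_equiv_trans)
  moreover have "rat_equiv x g (scalar_mat F ** g1)"
    using rat_equiv_scalar_mat[OF F(1), of g1] rat_equiv_arith_group[OF \<gamma>(1), of g] by (auto simp: g1_def intro: rat_equiv_trans rat_equiv_sym)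
  ultimately have rat_equiv: "rat_equiv x g (vertex_mat (n, w))" by (rule rat_equiv_trans[rotated])
  show ?thesis
  proof (cases "n = 0")
    case True
    hence "rat_equiv x (vertex_mat (n, w)) (vertex_mat (0, None))"
      using rat_equiv_arith_group[OF line_mat_in_arith_group, of w "mat 1"] by (simp add: vertex_mat_def line_mat_def flip: mat_1_mk)
    with rat_equiv have "rat_equiv x g (vertex_mat (0, None))" by (rule rat_equiv_trans)
    thus ?thesis by (intro bexI[of _ "(0, None)"]) (simp_all add: vertices_def)
  next
    case False
    thus ?thesis using rat_equiv by (intro bexI[of _ "(n, w)"]) (simp_all add: vertices_def)
  qed
qed

end

section \<open>Uniqueness of the normal form and the Hecke neighbours\<close>

context coord
begin

text \<open>The largest value of \<open>2 e - v(det g)\<close>, over the nonzero polynomial combinations of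
  the rows of \<open>g\<close> that are divisible by the \<open>e\<close>-th power of a
  uniformizer, is an invariant of the class; it is the degree difference of the bundle. The
  predicate bounds it from above.\<close>

definition type_le :: "'k poly fract^2^2 \<Rightarrow> int \<Rightarrow> bool" where
  "type_le g N \<longleftrightarrow> (\<forall>a\<in>Poly_ring x. \<forall>b\<in>Poly_ring x. \<forall>e. a \<noteq> 0 \<or> b \<noteq> 0 \<longrightarrow>
     vge x e (a * g$1$1 + b * g$2$1) \<longrightarrow> vge x e (a * g$1$2 + b * g$2$2) \<longrightarrow>
     2 * e - place_val x (det g) \<le> N)"

lemma type_le_GO:
  assumes g: "type_le g N" "det g \<noteq> 0" and k: "k \<in> GO x" shows "type_le (g ** k) N"
  unfolding type_le_def
proof (intro ballI allI impI)
  fix a b e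
  assume *: "a \<in> Poly_ring x" "b \<in> Poly_ring x" "a \<noteq> 0 \<or> b \<noteq> 0"
    "vge x e (a * (g ** k)$1$1 + b * (g ** k)$2$1)" "vge x e (a * (g ** k)$1$2 + b * (g ** k)$2$2)"
  have k0: "det k \<noteq> 0" by (rule GO_det(1)[OF k])
  have g_eq: "g = (g ** k) ** rinv k"
    using k0 by (simp add: matrix_mul_assoc[symmetric] rinv_right)
  have "a * g$1$i + b * g$2$i = (a * (g ** k)$1$1 + b * (g ** k)$2$1) * rinv k $1$i +
      (a * (g ** k)$1$2 + b * (g ** k)$2$2) * rinv k $2$i" for i
    by (subst (1 2) g_eq) (simp only: matrix22_nth[of "g ** k"] algebra_simps)
  with vge_row_mult[OF *(4,5) GO_rinv[OF k]]
  have "vge x e (a * g$1$1 + b * g$2$1)" "vge x e (a * g$1$2 + b * g$2$2)" by simp_all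
  hence "2 * e - place_val x (det g) \<le> N" using g(1) * unfolding type_le_def by blast
  thus "2 * e - place_val x (det (g ** k)) \<le> N"
    using GO_det[OF k] g(2) by (simp add: det_mul place_val_mult)
qed

lemma type_le_scalar_mat:
  assumes g: "type_le g N" "det g \<noteq> 0" and c: "c \<noteq> 0" shows "type_le (scalar_mat c ** g) N"
  unfolding type_le_def
proof (intro ballI allI impI)
  fix a b e
  have nth: "(scalar_mat c ** g)$i$j = c * g$i$j" for i j
    using exhaust_2[of i] by (auto simp: matrix22_nth scalar_mat_def)
  assume *: "a \<in> Poly_ring x" "b \<in> Poly_ring x" "a \<noteq> 0 \<or> b \<noteq> 0"
    "vge x e (a * (scalar_mat c ** g)$1$1 + b * (scalar_mat c ** g)$2$1)"
    "vge x e (a * (scalar_mat c ** g)$1$2 + b * (scalar_mat c ** g)$2$2)"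
  have "vge x e (c * (a * g$1$1 + b * g$2$1))" "vge x e (c * (a * g$1$2 + b * g$2$2))"
    using *(4,5) by (simp_all add: nth algebra_simps)
  hence "vge x (e - place_val x c) (a * g$1$1 + b * g$2$1)" "vge x (e - place_val x c) (a * g$1$2 + b * g$2$2)"
    using c by (simp_all only: vge_mult_iff not_False_eq_True)
  hence "2 * (e - place_val x c) - place_val x (det g) \<le> N"
    using g(1) * unfolding type_le_def by blast
  thus "2 * e - place_val x (det (scalar_mat c ** g)) \<le> N"
    using c g(2) by (simp add: det_mul place_val_mult)
qed

lemma type_le_arith_group:
  assumes g: "type_le g N" "det g \<noteq> 0" and \<gamma>: "\<gamma> \<in> arith_group x" shows "type_le (\<gamma> ** g) N"
  unfolding type_le_def
proof (intro ballI allI impI)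
  fix a b e
  assume *: "a \<in> Poly_ring x" "b \<in> Poly_ring x" "a \<noteq> 0 \<or> b \<noteq> 0"
    "vge x e (a * (\<gamma> ** g)$1$1 + b * (\<gamma> ** g)$2$1)"
    "vge x e (a * (\<gamma> ** g)$1$2 + b * (\<gamma> ** g)$2$2)"
  define a' where "a' = a * \<gamma>$1$1 + b * \<gamma>$2$1"
  define b' where "b' = a * \<gamma>$1$2 + b * \<gamma>$2$2"
  have P: "a' \<in> Poly_ring x" "b' \<in> Poly_ring x"
    using * arith_group_entries[OF \<gamma>] by (auto simp: a'_def b'_def)
  have "a' \<noteq> 0 \<or> b' \<noteq> 0"
  proof (rule ccontr)
    assume "\<not> (a' \<noteq> 0 \<or> b' \<noteq> 0)"
    hence 0: "a' = 0" "b' = 0" by auto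
    have "a * det \<gamma> = a' * \<gamma>$2$2 - b' * \<gamma>$2$1" "b * det \<gamma> = b' * \<gamma>$1$1 - a' * \<gamma>$1$2"
      by (simp_all add: det_2 a'_def b'_def algebra_simps)
    thus False using 0 *(3) arith_group_det_nz[OF \<gamma>] by simp
  qed
  moreover have "a * (\<gamma> ** g)$1$i + b * (\<gamma> ** g)$2$i = a' * g$1$i + b' * g$2$i" for i
    by (simp add: matrix22_nth a'_def b'_def algebra_simps)
  ultimately have "2 * e - place_val x (det g) \<le> N"
    using g(1) P *(4,5) unfolding type_le_def by metis
  thus "2 * e - place_val x (det (\<gamma> ** g)) \<le> N"
    using g(2) arith_group_det_nz[OF \<gamma>] arith_group_det_val[OF \<gamma>] by (simp add: det_mul place_val_mult)
qed

lemma type_le_rat_equiv: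
  assumes "type_le h N" "det h \<noteq> 0" "rat_equiv x g h" shows "type_le g N"
proof -
  obtain \<gamma> c k where *: "\<gamma> \<in> arith_group x" "c \<noteq> 0" "k \<in> GO1 x" "g = \<gamma> ** scalar_mat c ** h ** k"
    using assms(3) by (auto simp: rat_equiv_def)
  have "type_le (scalar_mat c ** h) N" "det (scalar_mat c ** h) \<noteq> 0"
    using type_le_scalar_mat assms * by (simp_all add: det_mul)
  hence "type_le (\<gamma> ** (scalar_mat c ** h)) N" "det (\<gamma> ** (scalar_mat c ** h)) \<noteq> 0"
    using type_le_arith_group arith_group_det_nz * by (simp_all add: det_mul)
  thus ?thesis using type_le_GO[OF _ _ GO1_subset_GO[OF *(3)]] *(4) by (simp add: matrix_mul_assoc)
qed

lemma type_le_vertex_matD: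
  assumes "type_le (vertex_mat v) N" shows "int (fst v) \<le> N"
proof -
  have "vge x 0 (0 * vertex_mat v $1$i + 1 * vertex_mat v $2$i)" for i
    using line_mat_in_GO[of "snd v" x] by (simp add: vertex_mat_def matrix22_nth GO_def)
  hence "2 * 0 - place_val x (det (vertex_mat v)) \<le> N"
    using assms Poly_ring_0 Poly_ring_1 unfolding type_le_def by (metis zero_neq_one)
  thus ?thesis by (simp add: val_det_vertex_mat)
qed

text \<open>In an upper triangular matrix the first column controls combinations that involve the first row,
  and the last entry controls the others.\<close>

lemma type_le_upper:
  assumes B: "B \<noteq> 0" "c \<noteq> 0"
    and N: "place_val x B - place_val x c \<le> N" "place_val x c - place_val x B \<le> N"
  shows "type_le (mk B A 0 c) N"
  unfolding type_le_def
proof (intro ballI allI impI)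
  fix a b e
  assume *: "a \<in> Poly_ring x" "b \<in> Poly_ring x" "a \<noteq> 0 \<or> b \<noteq> 0"
    "vge x e (a * mk B A 0 c $1$1 + b * mk B A 0 c $2$1)"
    "vge x e (a * mk B A 0 c $1$2 + b * mk B A 0 c $2$2)"
  have det: "place_val x (det (mk B A 0 c)) = place_val x B + place_val x c"
    using B by (simp add: place_val_mult)
  have "e \<le> place_val x B \<or> e \<le> place_val x c"
  proof (cases "a = 0")
    case True
    hence "b \<noteq> 0" "vge x e (b * c)" using * by auto
    hence "e \<le> place_val x b + place_val x c" using B by (simp add: vge_def place_val_mult)
    thus ?thesis using Poly_ring_val[OF *(2)] \<open>b \<noteq> 0\<close> by auto
  next
    case False
    hence "vge x e (a * B)" using * by auto
    hence "e \<le> place_val x a + place_val x B" using B False by (simp add: vge_def place_val_mult)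
    thus ?thesis using Poly_ring_val[OF *(1)] False by auto
  qed
  thus "2 * e - place_val x (det (mk B A 0 c)) \<le> N" using N unfolding det by auto
qed

lemma type_le_vertex_mat: "type_le (vertex_mat v) (int (fst v))"
  unfolding vertex_mat_def
proof (rule type_le_GO[OF _ _ line_mat_in_GO])
  show "type_le (mk (s ^ fst v) 0 0 1) (int (fst v))"
    using s_nz val_s by (intro type_le_upper) (simp_all add: place_val_power)
qed (use s_nz in simp)

text \<open>The first component is the smallest bound of the preceding invariant. If it is positive, the
  lower left entry of the arithmetic matrix must vanish, and an upper triangular matrix preserves
  the line at \<open>x\<close>.\<close>

theorem normal_form_unique:
  assumes v: "v \<in> vertices" "v' \<in> vertices" and rat_equiv: "rat_equiv x (vertex_mat v) (vertex_mat v')" shows "v = v'"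
proof -
  have "int (fst v') \<le> int (fst v)" "int (fst v) \<le> int (fst v')"
    using type_le_rat_equiv[OF type_le_vertex_mat det_vertex_mat rat_equiv] type_le_rat_equiv[OF type_le_vertex_mat det_vertex_mat rat_equiv_sym[OF rat_equiv]]
    by (auto dest: type_le_vertex_matD)
  then obtain n w w' where vv: "v = (n, w)" "v' = (n, w')" by (metis nat_int_comparison(3) order_antisym prod.collapse)
  show ?thesis
  proof (cases "n = 0")
    case True
    thus ?thesis using v vv by (simp add: vertices_def)
  next
    case False
    obtain \<gamma> c k where *: "\<gamma> \<in> arith_group x" "c \<noteq> 0" "k \<in> GO1 x" "vertex_mat v = \<gamma> ** scalar_mat c ** vertex_mat v' ** k"
      using rat_equiv by (auto simp: rat_equiv_def)
    have k: "det k \<noteq> 0" using *(3) GO1_subset_GO GO_det by blast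
    define U where "U = line_mat w ** rinv k ** rinv (line_mat w')"
    have U: "U \<in> GO x" unfolding U_def by (intro GO_mult GO_rinv line_mat_in_GO GO1_subset_GO *)
    have "mk (s ^ n) 0 0 1 ** U = vertex_mat v ** rinv k ** rinv (line_mat w')"
      by (simp add: U_def vertex_mat_def vv matrix_mul_assoc)
    also have "\<dots> = \<gamma> ** scalar_mat c ** mk (s ^ n) 0 0 1 ** (line_mat w' ** (k ** rinv k) ** rinv (line_mat w'))"
      unfolding *(4) by (simp add: vertex_mat_def vv matrix_mul_assoc)
    also have "\<dots> = \<gamma> ** scalar_mat c ** mk (s ^ n) 0 0 1"
      using k GO_det(1)[OF line_mat_in_GO[of w' x]] by (simp add: rinv_right)
    finally have eq: "mk (s ^ n) 0 0 1 ** U = \<gamma> ** scalar_mat c ** mk (s ^ n) 0 0 1" .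
    obtain u1 u2 u3 u4 where u: "U = mk u1 u2 u3 u4" by (rule mk_cases)
    obtain g1 g2 g3 g4 where g: "\<gamma> = mk g1 g2 g3 g4" by (rule mk_cases)
    have u3: "u3 = g3 * c * s ^ n" using eq by (simp add: u g scalar_mat_def)
    have "det (mk (s ^ n) 0 0 1 ** U) = det (\<gamma> ** scalar_mat c ** mk (s ^ n) 0 0 1)" using eq by simp
    hence "s ^ n * det U = det \<gamma> * (c * c) * s ^ n" by (simp add: det_mul)
    hence "det U = det \<gamma> * (c * c)" using s_nz by simp
    hence "place_val x c = 0"
      using *(2) GO_det[OF U] arith_group_det_nz[OF *(1)] arith_group_det_val[OF *(1)] by (simp add: place_val_mult)
    have "g3 = 0"
    proof (rule ccontr)
      assume "g3 \<noteq> 0"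
      have "g3 \<in> Poly_ring x" using arith_group_entries[OF *(1), of 2 1] by (simp add: g)
      hence "place_val x g3 \<le> 0" using Poly_ring_val \<open>g3 \<noteq> 0\<close> by blast
      moreover have "vge x 0 u3" using U by (simp add: u mk_in_GO_iff)
      ultimately show False
        using \<open>g3 \<noteq> 0\<close> *(2) s_nz False \<open>place_val x c = 0\<close> val_s
        by (simp add: u3 vge_def place_val_mult place_val_power)
    qed
    hence "u3 = 0" by (simp add: u3)
    have Ukap: "U ** line_mat w' = line_mat w ** rinv k"
      using GO_det(1)[OF line_mat_in_GO[of w' x]] by (simp add: U_def matrix_mul_assoc[symmetric] rinv_left)
    obtain k1 k2 k3 k4 where rk: "rinv k = mk k1 k2 k3 k4" by (rule mk_cases)
    have cong: "vge x 1 (k1 - 1)" "vge x 1 k2" "vge x 1 k3" "vge x 1 (k4 - 1)"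
      using GO1_rinv[OF *(3)] by (auto simp: rk mk_in_GO1_iff)
    have u4: "vge x 0 u4" using U by (simp add: u mk_in_GO_iff)
    have "w = w'"
    proof (cases w)
      case None
      show ?thesis
      proof (cases w')
        case (Some c')
        hence "u4 = k3" "u4 * const_elt c' = k4" using Ukap None \<open>u3 = 0\<close> by (auto simp: line_mat_def u rk mat_1_mk)
        hence "vge x 1 k4" using cong by auto
        hence "vge x 1 (k4 - (k4 - 1))" using cong by blast
        thus ?thesis by simp
      qed (simp add: None)
    next
      case (Some c)
      show ?thesis
      proof (cases w')
        case None
        hence "k1 + const_elt c * k3 = 0" using Ukap Some \<open>u3 = 0\<close> by (simp add: line_mat_def u rk mat_1_mk)
        moreover have "- (k1 - 1) - const_elt c * k3 = 1 - (k1 + const_elt c * k3)" by (simp add: algebra_simps)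
        moreover have "vge x 1 (- (k1 - 1) - const_elt c * k3)"
          by (rule vge_diff) (use cong in \<open>simp_all only: vge_minus\<close>, auto)
        ultimately have "vge x 1 (1 :: 'k poly fract)" by (metis diff_zero)
        thus ?thesis by simp
      next
        case (Some c')
        hence eqs: "u4 = k1 + const_elt c * k3" "u4 * const_elt c' = k2 + const_elt c * k4"
          using Ukap \<open>w = Some c\<close> \<open>u3 = 0\<close> by (auto simp: line_mat_def u rk)
        have "vge x 1 (const_elt c * k3)" by (rule vge_mult_0[OF _ cong(3)]) simp
        hence t1: "vge x 1 (const_elt c * k3 * const_elt c')" by (rule vge_mult_0') simp
        have t2: "vge x 1 ((k1 - 1) * const_elt c')" by (rule vge_mult_0'[OF cong(1)]) simp
        have t3: "vge x 1 (const_elt c * (k4 - 1))" by (rule vge_mult_0[OF _ cong(4)]) simp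
        have "vge x 1 ((k1 - 1) * const_elt c' + const_elt c * k3 * const_elt c' - k2 - const_elt c * (k4 - 1))"
          by (rule vge_diff[OF vge_diff[OF vge_add[OF t2 t1] cong(2)] t3])
        also have "(k1 - 1) * const_elt c' + const_elt c * k3 * const_elt c' - k2 - const_elt c * (k4 - 1) = const_elt (c - c')"
          using eqs by (simp add: const_elt_diff algebra_simps)
        finally show ?thesis using Some \<open>w = Some c\<close> by simp
      qed
    qed
    thus ?thesis using vv by simp
  qed
qed

subsection \<open>Hecke neighbours\<close>

definition unif :: "'k place \<Rightarrow> 'k poly fract" where
  "unif z = ev s (prime_at z)"

lemma unif_nz: "z \<noteq> x \<Longrightarrow> unif z \<noteq> 0"
  using prime_at(1)[of z] by (auto simp: unif_def)

lemma val_unif: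
  "z \<noteq> x \<Longrightarrow> place_val z (unif z) = 1"
  "z \<noteq> x \<Longrightarrow> w \<noteq> x \<Longrightarrow> w \<noteq> z \<Longrightarrow> place_val w (unif z) = 0"
  "z \<noteq> x \<Longrightarrow> place_val x (unif z) = - int (place_degree z)"
  by (simp_all add: unif_def val_prime_at val_prime_at_other val_ev place_degree_eq)

lemma place_degree_pos: "z \<noteq> x \<Longrightarrow> place_degree z > 0"
  by (simp add: place_degree_eq degree_prime_at)

lemma ev_monom: "ev s (Polynomial.monom 1 n) = s ^ n"
  by (induction n) (simp_all add: Polynomial.monom_0 Polynomial.monom_Suc ev_pCons one_pCons[symmetric])

text \<open>The prime polynomial of a place is monic.\<close>

lemma unif_leading: assumes "z \<noteq> x" shows "vge x 1 (unif z / s ^ place_degree z - 1)"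
proof -
  let ?d = "degree (prime_at z)"
  have "vge x (1 - int ?d) (unif z - s ^ ?d)"
  proof (cases "prime_at z = Polynomial.monom 1 ?d")
    case True thus ?thesis by (metis unif_def ev_monom diff_self vge_0)
  next
    case False
    hence nz: "prime_at z - Polynomial.monom 1 ?d \<noteq> 0" by simp
    have "degree (prime_at z - Polynomial.monom 1 ?d) \<le> ?d"
      by (metis degree_diff_le degree_monom_le order_refl)
    moreover have "poly.coeff (prime_at z - Polynomial.monom 1 ?d) ?d = 0" using prime_at(2)[OF assms] by simp
    ultimately have "degree (prime_at z - Polynomial.monom 1 ?d) < ?d"
      using nz by (metis leading_coeff_0_iff le_neq_implies_less)
    thus ?thesis by (simp add: unif_def vge_def val_ev flip: ev_monom ev_diff)
  qed
  moreover have "unif z / s ^ ?d - 1 = (unif z - s ^ ?d) / s ^ ?d" using s_nz by (simp add: field_simps)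
  ultimately show ?thesis
    using s_nz val_s by (simp add: place_degree_eq[OF assms] vge_divide place_val_power)
qed

text \<open>Representatives of the left cosets of the maximal compact subgroup at \<open>y\<close> in the
  double coset of \<open>diag(\<pi>, 1)\<close>: they belong to the lines over the residue field
  of \<open>y\<close>, whose finite points are given by polynomial residues.\<close>

definition hecke_mat :: "'k place \<Rightarrow> 'k poly option \<Rightarrow> 'k poly fract^2^2" where
  "hecke_mat y i = (case i of None \<Rightarrow> mk 1 0 0 (unif y) | Some b \<Rightarrow> mk (unif y) (ev s b) 0 1)"

definition hecke_index :: "'k place \<Rightarrow> 'k poly option set" where
  "hecke_index y = insert None (Some ` small_polys (place_degree y))"

lemma finite_hecke_index: "finite (hecke_index y)"
  using card_small_polys by (auto simp: hecke_index_def)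

lemma det_hecke_mat: "det (hecke_mat y i) = unif y"
  by (cases i) (simp_all add: hecke_mat_def)

lemma hecke_mat_in_GO:
  assumes "y \<noteq> x" "z \<noteq> x" "z \<noteq> y" shows "hecke_mat y i \<in> GO z"
proof -
  have "vge z 0 (unif y)" "vge z 0 (ev s b)" for b
    using vge_poly[OF assms(2)] by (simp_all add: unif_def)
  thus ?thesis using assms unif_nz val_unif(2) by (cases i) (simp_all add: hecke_mat_def mk_in_GO_iff)
qed

text \<open>Multiplying by a rational matrix moves a Hecke coset from \<open>y\<close> to \<open>x\<close>,
  where its inverse appears.\<close>

definition neighbour :: "'k place \<Rightarrow> nat \<times> 'k option \<Rightarrow> 'k poly option \<Rightarrow> nat \<times> 'k option" where
  "neighbour y v i = (SOME v'. v' \<in> vertices \<and> rat_equiv x (rinv (hecke_mat y i) ** vertex_mat v) (vertex_mat v'))"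

lemma neighbour:
  assumes "y \<noteq> x"
  shows neighbour_in_vertices: "neighbour y v i \<in> vertices" and neighbour_rat_equiv: "rat_equiv x (rinv (hecke_mat y i) ** vertex_mat v) (vertex_mat (neighbour y v i))"
proof -
  have "det (rinv (hecke_mat y i) ** vertex_mat v) \<noteq> 0"
    using det_vertex_mat unif_nz[OF assms] by (simp add: det_mul det_rinv det_hecke_mat)
  hence "\<exists>v'. v' \<in> vertices \<and> rat_equiv x (rinv (hecke_mat y i) ** vertex_mat v) (vertex_mat v')" using normal_form by blast
  hence "neighbour y v i \<in> vertices \<and> rat_equiv x (rinv (hecke_mat y i) ** vertex_mat v) (vertex_mat (neighbour y v i))"
    unfolding neighbour_def by (rule someI_ex)
  thus "neighbour y v i \<in> vertices" "rat_equiv x (rinv (hecke_mat y i) ** vertex_mat v) (vertex_mat (neighbour y v i))" by auto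
qed

text \<open>Up to the centre, \<open>diag(1, \<pi>)\<inverse>\<close> is \<open>diag(\<pi>, 1)\<close>, and
  the polynomial \<open>\<pi>\<close> of degree \<open>d\<close> is \<open>s\<^sup>d\<close> times
  a congruence unit.\<close>

lemma neighbour_None:
  assumes "y \<noteq> x" "v \<in> vertices"
  shows "neighbour y v None = (fst v + place_degree y, snd v)"
proof (rule normal_form_unique)
  let ?v' = "(fst v + place_degree y, snd v)"
  define k where "k = mk (unif y / s ^ place_degree y) 0 0 1"
  define k' where "k' = rinv (line_mat (snd v)) ** k ** line_mat (snd v)"
  have "k \<in> GO1 x" using unif_leading[OF assms(1)] by (simp add: k_def mk_in_GO1_iff)
  hence k': "k' \<in> GO1 x" unfolding k'_def by (rule GO1_conj[OF line_mat_in_GO])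
  have "rinv (hecke_mat y None) = scalar_mat (inverse (unif y)) ** mk (unif y) 0 0 1"
    using unif_nz[OF assms(1)] by (simp add: hecke_mat_def rinv_mk scalar_mat_def divide_inverse)
  hence "rinv (hecke_mat y None) ** vertex_mat v =
      scalar_mat (inverse (unif y)) ** ((mk (unif y) 0 0 1 ** mk (s ^ fst v) 0 0 1) ** line_mat (snd v))"
    by (simp add: vertex_mat_def matrix_mul_assoc del: mk_mult)
  also have "mk (unif y) 0 0 1 ** mk (s ^ fst v) 0 0 1 = mk (s ^ fst ?v') 0 0 1 ** k"
    using s_nz by (simp add: k_def power_add)
  also have "\<dots> ** line_mat (snd v) = vertex_mat ?v' ** k'"
    using GO_det(1)[OF line_mat_in_GO[of "snd v" x]]
    by (simp add: vertex_mat_def k'_def matrix_mul_assoc[symmetric] rinv_cancel)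
  finally have "rat_equiv x (rinv (hecke_mat y None) ** vertex_mat v) (vertex_mat ?v')"
    using rat_equiv_scalar_mat[of "inverse (unif y)" "vertex_mat ?v' ** k'"] rat_equiv_GO1[OF k', of "vertex_mat ?v'"] unif_nz[OF assms(1)]
    by (auto intro: rat_equiv_trans)
  thus "rat_equiv x (vertex_mat (neighbour y v None)) (vertex_mat ?v')"
    using neighbour_rat_equiv[OF assms(1), where v = v and i = None] by (blast intro: rat_equiv_trans rat_equiv_sym)
  show "neighbour y v None \<in> vertices" by (rule neighbour_in_vertices[OF assms(1)])
  show "?v' \<in> vertices" using place_degree_pos[OF assms(1)] by (simp add: vertices_def)
qed

text \<open>The matrix of this neighbour is upper triangular with diagonal valuations \<open>d - n\<close>
  and \<open>0\<close>.\<close>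

lemma neighbour_Some:
  assumes "y \<noteq> x"
  shows "int (fst (neighbour y v (Some b))) \<le> \<bar>int (fst v) - int (place_degree y)\<bar>"
proof -
  let ?N = "\<bar>int (fst v) - int (place_degree y)\<bar>"
  let ?g = "rinv (hecke_mat y (Some b)) ** vertex_mat v"
  have "rinv (hecke_mat y (Some b)) ** mk (s ^ fst v) 0 0 1 = mk (s ^ fst v / unif y) (- ev s b / unif y) 0 1"
    using unif_nz[OF assms] by (simp add: hecke_mat_def rinv_mk)
  hence g: "?g = mk (s ^ fst v / unif y) (- ev s b / unif y) 0 1 ** line_mat (snd v)"
    by (simp add: vertex_mat_def matrix_mul_assoc)
  have "type_le ?g ?N"
    unfolding g
  proof (rule type_le_GO[OF _ _ line_mat_in_GO])
    show "type_le (mk (s ^ fst v / unif y) (- ev s b / unif y) 0 1) ?N"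
      using s_nz unif_nz[OF assms] val_s val_unif(3)[OF assms]
      by (intro type_le_upper) (auto simp: place_val_divide place_val_power)
  qed (use s_nz unif_nz[OF assms] in simp)
  moreover have "det ?g \<noteq> 0"
    using det_vertex_mat unif_nz[OF assms] by (simp add: det_mul det_rinv det_hecke_mat)
  ultimately have "type_le (vertex_mat (neighbour y v (Some b))) ?N"
    using neighbour_rat_equiv[OF assms, where v = v and i = "Some b"] by (blast intro: type_le_rat_equiv rat_equiv_sym)
  thus ?thesis by (rule type_le_vertex_matD)
qed

end

section \<open>The groups \<open>GL\<^sub>2\<close> of a commutative ring\<close>

lemma GL2_simps:
  shows GL2_mult [simp]: "mk a b c d \<otimes>\<^bsub>GL2 R\<^esub> mk a' b' c' d' =
      mk (a \<otimes>\<^bsub>R\<^esub> a' \<oplus>\<^bsub>R\<^esub> b \<otimes>\<^bsub>R\<^esub> c') (a \<otimes>\<^bsub>R\<^esub> b' \<oplus>\<^bsub>R\<^esub> b \<otimes>\<^bsub>R\<^esub> d')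
         (c \<otimes>\<^bsub>R\<^esub> a' \<oplus>\<^bsub>R\<^esub> d \<otimes>\<^bsub>R\<^esub> c') (c \<otimes>\<^bsub>R\<^esub> b' \<oplus>\<^bsub>R\<^esub> d \<otimes>\<^bsub>R\<^esub> d')"
    and GL2_one: "\<one>\<^bsub>GL2 R\<^esub> = mk \<one>\<^bsub>R\<^esub> \<zero>\<^bsub>R\<^esub> \<zero>\<^bsub>R\<^esub> \<one>\<^bsub>R\<^esub>"
    and det2_mk [simp]: "det2 R (mk a b c d) = a \<otimes>\<^bsub>R\<^esub> d \<ominus>\<^bsub>R\<^esub> b \<otimes>\<^bsub>R\<^esub> c"
    and GL2_carrier: "mk a b c d \<in> carrier (GL2 R) \<longleftrightarrow> a \<in> carrier R \<and> b \<in> carrier R \<and>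
      c \<in> carrier R \<and> d \<in> carrier R \<and> a \<otimes>\<^bsub>R\<^esub> d \<ominus>\<^bsub>R\<^esub> b \<otimes>\<^bsub>R\<^esub> c \<in> Units R"
  by (auto simp: GL2_def det2_def vec_eq_iff forall_2)

context cring
begin

lemma GL2_det_mult:
  assumes "a \<in> carrier R" "b \<in> carrier R" "c \<in> carrier R" "d \<in> carrier R"
    "a' \<in> carrier R" "b' \<in> carrier R" "c' \<in> carrier R" "d' \<in> carrier R"
  shows "(a \<otimes> a' \<oplus> b \<otimes> c') \<otimes> (c \<otimes> b' \<oplus> d \<otimes> d') \<ominus> (a \<otimes> b' \<oplus> b \<otimes> d') \<otimes> (c \<otimes> a' \<oplus> d \<otimes> c') =
    (a \<otimes> d \<ominus> b \<otimes> c) \<otimes> (a' \<otimes> d' \<ominus> b' \<otimes> c')"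
  using assms by algebra

lemma GL2_inverse:
  assumes car: "a \<in> carrier R" "b \<in> carrier R" "c \<in> carrier R" "d \<in> carrier R"
    and u: "u \<in> carrier R" "u \<otimes> (a \<otimes> d \<ominus> b \<otimes> c) = \<one>"
  shows "mk (u \<otimes> d) (\<ominus> (u \<otimes> b)) (\<ominus> (u \<otimes> c)) (u \<otimes> a) \<otimes>\<^bsub>GL2 R\<^esub> mk a b c d = \<one>\<^bsub>GL2 R\<^esub>"
    "(u \<otimes> d) \<otimes> (u \<otimes> a) \<ominus> (\<ominus> (u \<otimes> b)) \<otimes> (\<ominus> (u \<otimes> c)) = u"
proof -
  have "u \<otimes> d \<otimes> a \<oplus> \<ominus> (u \<otimes> b) \<otimes> c = u \<otimes> (a \<otimes> d \<ominus> b \<otimes> c)"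
    "u \<otimes> d \<otimes> b \<oplus> \<ominus> (u \<otimes> b) \<otimes> d = \<zero>" "\<ominus> (u \<otimes> c) \<otimes> a \<oplus> u \<otimes> a \<otimes> c = \<zero>"
    "\<ominus> (u \<otimes> c) \<otimes> b \<oplus> u \<otimes> a \<otimes> d = u \<otimes> (a \<otimes> d \<ominus> b \<otimes> c)"
    using car u(1) by algebra+
  thus "mk (u \<otimes> d) (\<ominus> (u \<otimes> b)) (\<ominus> (u \<otimes> c)) (u \<otimes> a) \<otimes>\<^bsub>GL2 R\<^esub> mk a b c d = \<one>\<^bsub>GL2 R\<^esub>"
    by (simp add: GL2_one u(2))
  have "(u \<otimes> d) \<otimes> (u \<otimes> a) \<ominus> (\<ominus> (u \<otimes> b)) \<otimes> (\<ominus> (u \<otimes> c)) = u \<otimes> (u \<otimes> (a \<otimes> d \<ominus> b \<otimes> c))"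
    using car u(1) by algebra
  thus "(u \<otimes> d) \<otimes> (u \<otimes> a) \<ominus> (\<ominus> (u \<otimes> b)) \<otimes> (\<ominus> (u \<otimes> c)) = u"
    using u by simp
qed

lemma group_GL2: "group (GL2 R)"
proof (rule groupI)
  fix A B assume *: "A \<in> carrier (GL2 R)" "B \<in> carrier (GL2 R)"
  obtain a b c d where A: "A = mk a b c d" by (rule mk_cases)
  obtain a' b' c' d' where B: "B = mk a' b' c' d'" by (rule mk_cases)
  have car: "a \<in> carrier R" "b \<in> carrier R" "c \<in> carrier R" "d \<in> carrier R"
    "a' \<in> carrier R" "b' \<in> carrier R" "c' \<in> carrier R" "d' \<in> carrier R"
    using * by (simp_all add: A B GL2_carrier)
  have "(a \<otimes> d \<ominus> b \<otimes> c) \<otimes> (a' \<otimes> d' \<ominus> b' \<otimes> c') \<in> Units R"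
    using * by (simp add: A B GL2_carrier)
  thus "A \<otimes>\<^bsub>GL2 R\<^esub> B \<in> carrier (GL2 R)"
    using car by (simp add: A B GL2_carrier GL2_det_mult)
next
  fix A B C assume *: "A \<in> carrier (GL2 R)" "B \<in> carrier (GL2 R)" "C \<in> carrier (GL2 R)"
  obtain a b c d where A: "A = mk a b c d" by (rule mk_cases)
  obtain a' b' c' d' where B: "B = mk a' b' c' d'" by (rule mk_cases)
  obtain p q r t where C: "C = mk p q r t" by (rule mk_cases)
  have car: "a \<in> carrier R" "b \<in> carrier R" "c \<in> carrier R" "d \<in> carrier R"
    "a' \<in> carrier R" "b' \<in> carrier R" "c' \<in> carrier R" "d' \<in> carrier R"
    "p \<in> carrier R" "q \<in> carrier R" "r \<in> carrier R" "t \<in> carrier R"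
    using * by (simp_all add: A B C GL2_carrier)
  have assoc: "(u1 \<otimes> v1 \<oplus> u2 \<otimes> v3) \<otimes> w1 \<oplus> (u1 \<otimes> v2 \<oplus> u2 \<otimes> v4) \<otimes> w3 =
      u1 \<otimes> (v1 \<otimes> w1 \<oplus> v2 \<otimes> w3) \<oplus> u2 \<otimes> (v3 \<otimes> w1 \<oplus> v4 \<otimes> w3)"
    if "u1 \<in> carrier R" "u2 \<in> carrier R" "v1 \<in> carrier R" "v2 \<in> carrier R" "v3 \<in> carrier R"
      "v4 \<in> carrier R" "w1 \<in> carrier R" "w3 \<in> carrier R" for u1 u2 v1 v2 v3 v4 w1 w3
    using that by algebra
  show "(A \<otimes>\<^bsub>GL2 R\<^esub> B) \<otimes>\<^bsub>GL2 R\<^esub> C = A \<otimes>\<^bsub>GL2 R\<^esub> (B \<otimes>\<^bsub>GL2 R\<^esub> C)"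
    using car by (simp add: A B C assoc)
next
  show "\<one>\<^bsub>GL2 R\<^esub> \<in> carrier (GL2 R)" by (simp add: GL2_one GL2_carrier a_minus_def)
next
  fix A assume *: "A \<in> carrier (GL2 R)"
  obtain a b c d where A: "A = mk a b c d" by (rule mk_cases)
  have car: "a \<in> carrier R" "b \<in> carrier R" "c \<in> carrier R" "d \<in> carrier R"
    and D: "a \<otimes> d \<ominus> b \<otimes> c \<in> Units R"
    using * by (simp_all add: A GL2_carrier)
  show "\<one>\<^bsub>GL2 R\<^esub> \<otimes>\<^bsub>GL2 R\<^esub> A = A" using car by (simp add: A GL2_one)
  define u where "u = inv (a \<otimes> d \<ominus> b \<otimes> c)"
  have u: "u \<in> carrier R" "u \<in> Units R" "u \<otimes> (a \<otimes> d \<ominus> b \<otimes> c) = \<one>"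
    using D by (simp_all add: u_def)
  show "\<exists>B\<in>carrier (GL2 R). B \<otimes>\<^bsub>GL2 R\<^esub> A = \<one>\<^bsub>GL2 R\<^esub>"
    by (rule bexI[of _ "mk (u \<otimes> d) (\<ominus> (u \<otimes> b)) (\<ominus> (u \<otimes> c)) (u \<otimes> a)"])
       (use GL2_inverse[OF car u(1,3)] car u in \<open>simp_all add: A GL2_carrier\<close>)
qed

end

section \<open>Local groups\<close>

abbreviation Gz :: "'k::{field,finite} place \<Rightarrow> ('k completed^2^2) monoid" where
  "Gz z \<equiv> GL2 (completion z)"

abbreviation Kz :: "'k::{field,finite} place \<Rightarrow> ('k completed^2^2) set" where
  "Kz z \<equiv> carrier (GL2 (integer_ring z))"

lemma group_Gz: "group (Gz z)"
  using cring.group_GL2[OF cring_completion] .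

lemma Gz_carrier_iff: "mk a b c d \<in> carrier (Gz z) \<longleftrightarrow> a \<in> carrier (completion z) \<and>
    b \<in> carrier (completion z) \<and> c \<in> carrier (completion z) \<and> d \<in> carrier (completion z) \<and>
    a \<otimes>\<^bsub>completion z\<^esub> d \<ominus>\<^bsub>completion z\<^esub> b \<otimes>\<^bsub>completion z\<^esub> c \<noteq> \<zero>\<^bsub>completion z\<^esub>"
proof -
  interpret cring "completion z" by (rule cring_completion)
  show ?thesis by (auto simp: GL2_carrier completion_Units_iff)
qed

lemma integer_ring_Units_iff:
  "A \<in> Units (integer_ring z) \<longleftrightarrow>
     A \<in> carrier (completion z) \<and> A \<noteq> \<zero>\<^bsub>completion z\<^esub> \<and> completion_val z A = 0"
proof
  assume "A \<in> Units (integer_ring z)"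
  then obtain B where B: "cge z 0 A" "cge z 0 B" "A \<otimes>\<^bsub>completion z\<^esub> B = \<one>\<^bsub>completion z\<^esub>"
    by (auto simp: Units_def integer_ring_carrier)
  interpret cring "completion z" by (rule cring_completion)
  have nz: "A \<noteq> \<zero>\<^bsub>completion z\<^esub>" "B \<noteq> \<zero>\<^bsub>completion z\<^esub>"
    using B(3) completion_one_neq_zero[of z] l_null[OF cge_closed[OF B(2)]] r_null[OF cge_closed[OF B(1)]]
    by metis+
  show "A \<in> carrier (completion z) \<and> A \<noteq> \<zero>\<^bsub>completion z\<^esub> \<and> completion_val z A = 0"
    using completion_val_mult[of A z B] B nz by (auto simp: cge_def)
next
  assume A: "A \<in> carrier (completion z) \<and> A \<noteq> \<zero>\<^bsub>completion z\<^esub> \<and> completion_val z A = 0"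
  interpret cring "completion z" by (rule cring_completion)
  show "A \<in> Units (integer_ring z)"
    using A completion_inv[of A z] m_comm[of A "inv\<^bsub>completion z\<^esub> A"]
    by (auto simp: Units_def integer_ring_carrier cge_def intro!: bexI[of _ "inv\<^bsub>completion z\<^esub> A"])
qed

text \<open>The units of the ring of integers are the elements of valuation \<open>0\<close>.\<close>

lemma Kz_iff: "mk a b c d \<in> Kz z \<longleftrightarrow> cge z 0 a \<and> cge z 0 b \<and> cge z 0 c \<and> cge z 0 d \<and>
    a \<otimes>\<^bsub>completion z\<^esub> d \<ominus>\<^bsub>completion z\<^esub> b \<otimes>\<^bsub>completion z\<^esub> c \<noteq> \<zero>\<^bsub>completion z\<^esub> \<and>
    completion_val z (a \<otimes>\<^bsub>completion z\<^esub> d \<ominus>\<^bsub>completion z\<^esub> b \<otimes>\<^bsub>completion z\<^esub> c) = 0"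
proof -
  interpret cring "completion z" by (rule cring_completion)
  show ?thesis
  proof (cases "cge z 0 a \<and> cge z 0 b \<and> cge z 0 c \<and> cge z 0 d")
    case True
    hence "a \<otimes>\<^bsub>completion z\<^esub> d \<ominus>\<^bsub>integer_ring z\<^esub> b \<otimes>\<^bsub>completion z\<^esub> c =
        a \<otimes>\<^bsub>completion z\<^esub> d \<ominus>\<^bsub>completion z\<^esub> b \<otimes>\<^bsub>completion z\<^esub> c"
      by (simp add: integer_ring_diff cge_mult_0)
    moreover have "a \<otimes>\<^bsub>completion z\<^esub> d \<ominus>\<^bsub>completion z\<^esub> b \<otimes>\<^bsub>completion z\<^esub> c \<in> carrier (completion z)"
      using True cge_closed[of z 0] by (intro minus_closed m_closed) blast+
    ultimately show ?thesis
      unfolding GL2_carrier integer_ring_carrier integer_ring_Units_iff using True by simp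
  next
    case False
    thus ?thesis unfolding GL2_carrier integer_ring_carrier by blast
  qed
qed

lemma GL2_integer_ring_simps:
  "A \<otimes>\<^bsub>GL2 (integer_ring z)\<^esub> B = A \<otimes>\<^bsub>Gz z\<^esub> B" "\<one>\<^bsub>GL2 (integer_ring z)\<^esub> = \<one>\<^bsub>Gz z\<^esub>"
  by (simp add: GL2_def) (simp add: GL2_one)

lemma Kz_subgroup: "subgroup (Kz z) (Gz z)"
proof -
  interpret G: group "Gz z" by (rule group_Gz)
  interpret K: group "GL2 (integer_ring z)" by (rule cring.group_GL2[OF cring_integer_ring])
  have sub: "Kz z \<subseteq> carrier (Gz z)"
  proof
    fix A assume "A \<in> Kz z"
    thus "A \<in> carrier (Gz z)"
      by (cases A rule: mk_cases) (auto simp: Kz_iff Gz_carrier_iff cge_closed)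
  qed
  show ?thesis
  proof (rule G.subgroupI)
    show "Kz z \<noteq> {}" using K.one_closed by blast
    fix A assume A: "A \<in> Kz z"
    have "inv\<^bsub>GL2 (integer_ring z)\<^esub> A \<otimes>\<^bsub>Gz z\<^esub> A = \<one>\<^bsub>Gz z\<^esub>"
      using K.l_inv[OF A] by (simp add: GL2_integer_ring_simps)
    hence "inv\<^bsub>Gz z\<^esub> A = inv\<^bsub>GL2 (integer_ring z)\<^esub> A"
      using A sub by (intro G.inv_equality) auto
    thus "inv\<^bsub>Gz z\<^esub> A \<in> Kz z" using A by simp
    fix B assume "B \<in> Kz z"
    thus "A \<otimes>\<^bsub>Gz z\<^esub> B \<in> Kz z" using K.m_closed[OF A] by (simp add: GL2_integer_ring_simps)
  qed (rule sub)
qed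

lemma local_congruence_iff:
  "mk a b c d \<in> local_congruence z \<longleftrightarrow> a \<in> carrier (completion z) \<and> d \<in> carrier (completion z) \<and>
     cge z 1 (a \<ominus>\<^bsub>completion z\<^esub> \<one>\<^bsub>completion z\<^esub>) \<and> cge z 1 b \<and> cge z 1 c \<and>
     cge z 1 (d \<ominus>\<^bsub>completion z\<^esub> \<one>\<^bsub>completion z\<^esub>)"
proof -
  interpret C: cring "completion z" by (rule cring_completion)
  have minus0: "A \<ominus>\<^bsub>completion z\<^esub> \<zero>\<^bsub>completion z\<^esub> = A" if "A \<in> carrier (completion z)" for A
    using that by (simp add: a_minus_def)
  have *: "mk a b c d \<in> local_congruence z \<longleftrightarrow> mk a b c d \<in> Kz z \<and>
     cge z 1 (a \<ominus>\<^bsub>completion z\<^esub> \<one>\<^bsub>completion z\<^esub>) \<and> cge z 1 b \<and> cge z 1 c \<and>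
     cge z 1 (d \<ominus>\<^bsub>completion z\<^esub> \<one>\<^bsub>completion z\<^esub>)"
    by (auto simp: local_congruence_def forall_2 max_ideal_iff GL2_one Kz_iff minus0 cge_closed)
  have "mk a b c d \<in> Kz z" if car: "a \<in> carrier (completion z)" "d \<in> carrier (completion z)" and
    1: "cge z 1 (a \<ominus>\<^bsub>completion z\<^esub> \<one>\<^bsub>completion z\<^esub>)" "cge z 1 b" "cge z 1 c"
     "cge z 1 (d \<ominus>\<^bsub>completion z\<^esub> \<one>\<^bsub>completion z\<^esub>)"
  proof -
    have int: "cge z 0 u" if "u \<in> carrier (completion z)" "cge z 1 (u \<ominus>\<^bsub>completion z\<^esub> \<one>\<^bsub>completion z\<^esub>)" for u
    proof -
      have "cge z 0 ((u \<ominus>\<^bsub>completion z\<^esub> \<one>\<^bsub>completion z\<^esub>) \<oplus>\<^bsub>completion z\<^esub> \<one>\<^bsub>completion z\<^esub>)"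
        using cge_mono[OF that(2)] by (intro cge_add) auto
      also have "(u \<ominus>\<^bsub>completion z\<^esub> \<one>\<^bsub>completion z\<^esub>) \<oplus>\<^bsub>completion z\<^esub> \<one>\<^bsub>completion z\<^esub> = u"
        using that(1) C.one_closed by algebra
      finally show ?thesis .
    qed
    have bc: "b \<in> carrier (completion z)" "c \<in> carrier (completion z)" using 1 cge_closed by auto
    define D where "D = a \<otimes>\<^bsub>completion z\<^esub> d \<ominus>\<^bsub>completion z\<^esub> b \<otimes>\<^bsub>completion z\<^esub> c"
    have "D \<ominus>\<^bsub>completion z\<^esub> \<one>\<^bsub>completion z\<^esub> =
        ((a \<ominus>\<^bsub>completion z\<^esub> \<one>\<^bsub>completion z\<^esub>) \<otimes>\<^bsub>completion z\<^esub> d \<oplus>\<^bsub>completion z\<^esub> (d \<ominus>\<^bsub>completion z\<^esub> \<one>\<^bsub>completion z\<^esub>))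
        \<ominus>\<^bsub>completion z\<^esub> b \<otimes>\<^bsub>completion z\<^esub> c"
      unfolding D_def using car bc C.one_closed C.r_one[OF car(2)] C.l_one[OF car(2)] by algebra
    moreover have "cge z 1 \<dots>"
      by (rule cge_diff[OF cge_add[OF cge_mult_0'[OF 1(1) int[OF car(2) 1(4)]] 1(4)]
            cge_mult_0'[OF 1(2) cge_mono[OF 1(3)]]]) simp
    ultimately have "cge z 1 (D \<ominus>\<^bsub>completion z\<^esub> \<one>\<^bsub>completion z\<^esub>)" by simp
    moreover have "D \<in> carrier (completion z)" using car bc by (simp add: D_def)
    ultimately have "D \<noteq> \<zero>\<^bsub>completion z\<^esub>" "completion_val z D = 0" using cge_unit by blast+
    thus ?thesis using 1 int car cge_mono[of z 1 _ 0] by (simp add: Kz_iff D_def)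
  qed
  thus ?thesis unfolding * by (auto simp: Kz_iff cge_closed)
qed

lemma local_congruence_subset: "local_congruence z \<subseteq> Kz z"
  by (auto simp: local_congruence_def)

lemma local_congruence_subgroup: "subgroup (local_congruence z) (Gz z)"
proof -
  interpret C: cring "completion z" by (rule cring_completion)
  interpret G: group "Gz z" by (rule group_Gz)
  interpret K: subgroup "Kz z" "Gz z" by (rule Kz_subgroup)
  let ?c = "completion z"
  have shift: "cge z 1 (a \<otimes>\<^bsub>?c\<^esub> p \<oplus>\<^bsub>?c\<^esub> b \<otimes>\<^bsub>?c\<^esub> r \<ominus>\<^bsub>?c\<^esub> p)"
    if "a \<in> carrier ?c" "cge z 1 (a \<ominus>\<^bsub>?c\<^esub> \<one>\<^bsub>?c\<^esub>)" "cge z 1 b" "cge z 0 p" "cge z 0 r" for a b p r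
  proof -
    have "a \<otimes>\<^bsub>?c\<^esub> p \<oplus>\<^bsub>?c\<^esub> b \<otimes>\<^bsub>?c\<^esub> r \<ominus>\<^bsub>?c\<^esub> p = (a \<ominus>\<^bsub>?c\<^esub> \<one>\<^bsub>?c\<^esub>) \<otimes>\<^bsub>?c\<^esub> p \<oplus>\<^bsub>?c\<^esub> b \<otimes>\<^bsub>?c\<^esub> r"
      using that(1) cge_closed[OF that(3)] cge_closed[OF that(4)] cge_closed[OF that(5)] C.one_closed
        C.r_one[OF cge_closed[OF that(4)]] by algebra
    moreover have "cge z 1 \<dots>" using that by (intro cge_add cge_mult_0')
    ultimately show ?thesis by simp
  qed
  have trans: "cge z 1 (u \<ominus>\<^bsub>?c\<^esub> w)"
    if "cge z 1 (u \<ominus>\<^bsub>?c\<^esub> v)" "cge z 1 (v \<ominus>\<^bsub>?c\<^esub> w)" "u \<in> carrier ?c" "v \<in> carrier ?c" "w \<in> carrier ?c" for u v w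
  proof -
    have "u \<ominus>\<^bsub>?c\<^esub> w = (u \<ominus>\<^bsub>?c\<^esub> v) \<oplus>\<^bsub>?c\<^esub> (v \<ominus>\<^bsub>?c\<^esub> w)" using that(3,4,5) by algebra
    thus ?thesis using that(1,2) by auto
  qed
  \<comment> \<open>\<open>A B \<equiv> B\<close> whenever \<open>A \<equiv> 1\<close>\<close>
  have AB: "local_congruence z \<subseteq> carrier (Gz z)"
    using local_congruence_subset K.subset by blast
  show ?thesis
  proof (rule G.subgroupI[OF AB])
    have one0: "\<one>\<^bsub>?c\<^esub> \<ominus>\<^bsub>?c\<^esub> \<one>\<^bsub>?c\<^esub> = \<zero>\<^bsub>?c\<^esub>" using C.one_closed by algebra
    have "\<one>\<^bsub>Gz z\<^esub> \<in> local_congruence z" by (simp add: GL2_one local_congruence_iff one0)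
    thus "local_congruence z \<noteq> {}" by blast
  next
    fix A assume A: "A \<in> local_congruence z"
    hence AK: "A \<in> Kz z" using local_congruence_subset by blast
    define B where "B = inv\<^bsub>Gz z\<^esub> A"
    have BK: "B \<in> Kz z" and AB1: "A \<otimes>\<^bsub>Gz z\<^esub> B = \<one>\<^bsub>Gz z\<^esub>" using AK by (auto simp: B_def)
    obtain a b c d where A': "A = mk a b c d" by (rule mk_cases)
    obtain p q r t where B': "B = mk p q r t" by (rule mk_cases)
    have a: "a \<in> carrier ?c" "d \<in> carrier ?c" "cge z 1 (a \<ominus>\<^bsub>?c\<^esub> \<one>\<^bsub>?c\<^esub>)" "cge z 1 b" "cge z 1 c"
      "cge z 1 (d \<ominus>\<^bsub>?c\<^esub> \<one>\<^bsub>?c\<^esub>)"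
      using A by (auto simp: A' local_congruence_iff)
    have p: "cge z 0 p" "cge z 0 q" "cge z 0 r" "cge z 0 t" using BK by (auto simp: B' Kz_iff)
    have eqs: "a \<otimes>\<^bsub>?c\<^esub> p \<oplus>\<^bsub>?c\<^esub> b \<otimes>\<^bsub>?c\<^esub> r = \<one>\<^bsub>?c\<^esub>" "a \<otimes>\<^bsub>?c\<^esub> q \<oplus>\<^bsub>?c\<^esub> b \<otimes>\<^bsub>?c\<^esub> t = \<zero>\<^bsub>?c\<^esub>"
      "d \<otimes>\<^bsub>?c\<^esub> r \<oplus>\<^bsub>?c\<^esub> c \<otimes>\<^bsub>?c\<^esub> p = \<zero>\<^bsub>?c\<^esub>" "d \<otimes>\<^bsub>?c\<^esub> t \<oplus>\<^bsub>?c\<^esub> c \<otimes>\<^bsub>?c\<^esub> q = \<one>\<^bsub>?c\<^esub>"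
      using AB1 a p by (simp_all add: A' B' GL2_one cge_closed C.a_comm)
    have neg: "cge z 1 (v \<ominus>\<^bsub>?c\<^esub> u)" if "cge z 1 (u \<ominus>\<^bsub>?c\<^esub> v)" "u \<in> carrier ?c" "v \<in> carrier ?c" for u v
    proof -
      have "v \<ominus>\<^bsub>?c\<^esub> u = \<ominus>\<^bsub>?c\<^esub> (u \<ominus>\<^bsub>?c\<^esub> v)" using that(2,3) by algebra
      thus ?thesis using that(1) by auto
    qed
    have m0: "v \<ominus>\<^bsub>?c\<^esub> \<zero>\<^bsub>?c\<^esub> = v" if "v \<in> carrier ?c" for v using that C.zero_closed by algebra
    note cl = p[THEN cge_closed]
    have "cge z 1 (p \<ominus>\<^bsub>?c\<^esub> \<one>\<^bsub>?c\<^esub>)" "cge z 1 q" "cge z 1 r" "cge z 1 (t \<ominus>\<^bsub>?c\<^esub> \<one>\<^bsub>?c\<^esub>)"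
      using neg[OF shift[OF a(1,3,4) p(1,3)]] neg[OF shift[OF a(1,3,4) p(2,4)]]
        neg[OF shift[OF a(2,6,5) p(3,1)]] neg[OF shift[OF a(2,6,5) p(4,2)]] cl
      by (simp_all add: eqs m0)
    thus "inv\<^bsub>Gz z\<^esub> A \<in> local_congruence z"
      using cl by (simp add: B' local_congruence_iff flip: B_def)
  next
    fix A B assume A: "A \<in> local_congruence z" and B: "B \<in> local_congruence z"
    hence BK: "B \<in> Kz z" using local_congruence_subset by blast
    obtain a b c d where A': "A = mk a b c d" by (rule mk_cases)
    obtain p q r t where B': "B = mk p q r t" by (rule mk_cases)
    have a: "a \<in> carrier ?c" "d \<in> carrier ?c" "cge z 1 (a \<ominus>\<^bsub>?c\<^esub> \<one>\<^bsub>?c\<^esub>)" "cge z 1 b" "cge z 1 c"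
      "cge z 1 (d \<ominus>\<^bsub>?c\<^esub> \<one>\<^bsub>?c\<^esub>)"
      using A by (auto simp: A' local_congruence_iff)
    have p1: "cge z 1 (p \<ominus>\<^bsub>?c\<^esub> \<one>\<^bsub>?c\<^esub>)" "cge z 1 q" "cge z 1 r" "cge z 1 (t \<ominus>\<^bsub>?c\<^esub> \<one>\<^bsub>?c\<^esub>)"
      using B by (auto simp: B' local_congruence_iff)
    have p: "cge z 0 p" "cge z 0 q" "cge z 0 r" "cge z 0 t" using BK by (auto simp: B' Kz_iff)
    note cl = p[THEN cge_closed] a(1,2) cge_closed[OF a(4)] cge_closed[OF a(5)]
    have m0: "v \<ominus>\<^bsub>?c\<^esub> \<zero>\<^bsub>?c\<^esub> = v" if "v \<in> carrier ?c" for v using that C.zero_closed by algebra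
    have "cge z 1 (a \<otimes>\<^bsub>?c\<^esub> p \<oplus>\<^bsub>?c\<^esub> b \<otimes>\<^bsub>?c\<^esub> r \<ominus>\<^bsub>?c\<^esub> \<one>\<^bsub>?c\<^esub>)"
      by (rule trans[OF shift[OF a(1,3,4) p(1,3)] p1(1)]) (use cl in auto)
    moreover have "cge z 1 (a \<otimes>\<^bsub>?c\<^esub> q \<oplus>\<^bsub>?c\<^esub> b \<otimes>\<^bsub>?c\<^esub> t \<ominus>\<^bsub>?c\<^esub> \<zero>\<^bsub>?c\<^esub>)"
      by (rule trans[OF shift[OF a(1,3,4) p(2,4)]]) (use cl p1 m0 in auto)
    moreover have "cge z 1 (d \<otimes>\<^bsub>?c\<^esub> r \<oplus>\<^bsub>?c\<^esub> c \<otimes>\<^bsub>?c\<^esub> p \<ominus>\<^bsub>?c\<^esub> \<zero>\<^bsub>?c\<^esub>)"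
      by (rule trans[OF shift[OF a(2,6,5) p(3,1)]]) (use cl p1 m0 in auto)
    moreover have "cge z 1 (d \<otimes>\<^bsub>?c\<^esub> t \<oplus>\<^bsub>?c\<^esub> c \<otimes>\<^bsub>?c\<^esub> q \<ominus>\<^bsub>?c\<^esub> \<one>\<^bsub>?c\<^esub>)"
      by (rule trans[OF shift[OF a(2,6,5) p(4,2)] p1(4)]) (use cl in auto)
    ultimately show "A \<otimes>\<^bsub>Gz z\<^esub> B \<in> local_congruence z"
      using cl by (simp add: A' B' local_congruence_iff m0 C.a_comm)
  qed
qed

subsection \<open>Rational matrices in the local groups\<close>

definition loc :: "'k::{field,finite} place \<Rightarrow> 'k poly fract^2^2 \<Rightarrow> 'k completed^2^2" where
  "loc z A = (\<chi> i j. to_completion z (A$i$j))"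

lemma loc_mk [simp]: "loc z (mk a b c d) =
    mk (to_completion z a) (to_completion z b) (to_completion z c) (to_completion z d)"
  by (simp add: loc_def vec_eq_iff forall_2)

lemma loc_mult: "loc z (A ** B) = loc z A \<otimes>\<^bsub>Gz z\<^esub> loc z B"
  by (cases A rule: mk_cases; cases B rule: mk_cases)
     (simp add: to_completion_add to_completion_mult)

lemma loc_1 [simp]: "loc z (mat 1) = \<one>\<^bsub>Gz z\<^esub>"
  by (simp add: mat_1_mk GL2_one)

lemma det2_loc: "det2 (completion z) (loc z A) = to_completion z (det A)"
  by (cases A rule: mk_cases) (simp add: to_completion_diff to_completion_mult)

lemma loc_carrier [simp]: "loc z A \<in> carrier (Gz z) \<longleftrightarrow> det A \<noteq> 0"
  by (cases A rule: mk_cases) (simp add: Gz_carrier_iff flip: to_completion_diff to_completion_mult)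

lemma loc_Kz [simp]: "loc z A \<in> Kz z \<longleftrightarrow> A \<in> GO z"
  by (cases A rule: mk_cases) (auto simp: Kz_iff mk_in_GO_iff simp flip: to_completion_diff to_completion_mult)

lemma loc_congruence [simp]: "loc z A \<in> local_congruence z \<longleftrightarrow> A \<in> GO1 z"
proof -
  have "to_completion z a \<ominus>\<^bsub>completion z\<^esub> \<one>\<^bsub>completion z\<^esub> = to_completion z (a - 1)" for a
    by (simp add: to_completion_diff)
  thus ?thesis by (cases A rule: mk_cases) (simp add: local_congruence_iff mk_in_GO1_iff)
qed

lemma loc_eq_iff [simp]: "loc z A = loc z B \<longleftrightarrow> A = B"
  by (cases A rule: mk_cases; cases B rule: mk_cases) simp

lemma loc_rinv: "det A \<noteq> 0 \<Longrightarrow> loc z (rinv A) = inv\<^bsub>Gz z\<^esub> loc z A"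
proof -
  assume A: "det A \<noteq> 0"
  interpret group "Gz z" by (rule group_Gz)
  show ?thesis
    using A det_rinv[OF A] by (intro inv_equality[symmetric]) (simp_all add: rinv_left flip: loc_mult)
qed

text \<open>A rational approximation of \<open>M\<close> that is close compared with
  \<open>M\<inverse>\<close> differs from \<open>M\<close> by a congruence matrix.\<close>

lemma local_approx:
  assumes M: "M \<in> carrier (Gz z)"
  shows "\<exists>A. det A \<noteq> 0 \<and> (\<exists>k\<in>local_congruence z. M = loc z A \<otimes>\<^bsub>Gz z\<^esub> k)"
proof -
  interpret C: cring "completion z" by (rule cring_completion)
  interpret G: group "Gz z" by (rule group_Gz)
  interpret L: subgroup "local_congruence z" "Gz z" by (rule local_congruence_subgroup)
  let ?c = "completion z" and ?\<iota> = "to_completion z"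
  obtain a b c d where M': "M = mk a b c d" by (rule mk_cases)
  obtain p q r t where I: "inv\<^bsub>Gz z\<^esub> M = mk p q r t" by (rule mk_cases)
  have inv: "inv\<^bsub>Gz z\<^esub> M \<in> carrier (Gz z)" "inv\<^bsub>Gz z\<^esub> M \<otimes>\<^bsub>Gz z\<^esub> M = \<one>\<^bsub>Gz z\<^esub>" using M by auto
  have cl: "a \<in> carrier ?c" "b \<in> carrier ?c" "c \<in> carrier ?c" "d \<in> carrier ?c"
    "p \<in> carrier ?c" "q \<in> carrier ?c" "r \<in> carrier ?c" "t \<in> carrier ?c"
    using M inv(1) unfolding M' I[unfolded M'] Gz_carrier_iff by blast+
  have eqs: "p \<otimes>\<^bsub>?c\<^esub> a \<oplus>\<^bsub>?c\<^esub> q \<otimes>\<^bsub>?c\<^esub> c = \<one>\<^bsub>?c\<^esub>" "p \<otimes>\<^bsub>?c\<^esub> b \<oplus>\<^bsub>?c\<^esub> q \<otimes>\<^bsub>?c\<^esub> d = \<zero>\<^bsub>?c\<^esub>"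
    "r \<otimes>\<^bsub>?c\<^esub> a \<oplus>\<^bsub>?c\<^esub> t \<otimes>\<^bsub>?c\<^esub> c = \<zero>\<^bsub>?c\<^esub>" "r \<otimes>\<^bsub>?c\<^esub> b \<oplus>\<^bsub>?c\<^esub> t \<otimes>\<^bsub>?c\<^esub> d = \<one>\<^bsub>?c\<^esub>"
    using inv(2) unfolding I unfolding M' by (simp_all add: GL2_one)
  define m where "m = Min {completion_val z p, completion_val z q, completion_val z r, completion_val z t}"
  have m: "cge z m p" "cge z m q" "cge z m r" "cge z m t"
    using cl by (auto simp: m_def intro: cge_mono[OF cge_val])
  obtain a' where a': "cge z (1 - m) (a \<ominus>\<^bsub>?c\<^esub> ?\<iota> a')" using completion_dense cl(1) by blast
  obtain b' where b': "cge z (1 - m) (b \<ominus>\<^bsub>?c\<^esub> ?\<iota> b')" using completion_dense cl(2) by blast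
  obtain c' where c': "cge z (1 - m) (c \<ominus>\<^bsub>?c\<^esub> ?\<iota> c')" using completion_dense cl(3) by blast
  obtain d' where d': "cge z (1 - m) (d \<ominus>\<^bsub>?c\<^esub> ?\<iota> d')" using completion_dense cl(4) by blast
  have err: "cge z 1 (u \<otimes>\<^bsub>?c\<^esub> ?\<iota> f \<oplus>\<^bsub>?c\<^esub> v \<otimes>\<^bsub>?c\<^esub> ?\<iota> g \<ominus>\<^bsub>?c\<^esub> (u \<otimes>\<^bsub>?c\<^esub> e \<oplus>\<^bsub>?c\<^esub> v \<otimes>\<^bsub>?c\<^esub> h))"
    if "cge z m u" "cge z m v" "cge z (1 - m) (e \<ominus>\<^bsub>?c\<^esub> ?\<iota> f)" "cge z (1 - m) (h \<ominus>\<^bsub>?c\<^esub> ?\<iota> g)"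
      "e \<in> carrier ?c" "h \<in> carrier ?c" for u v e f g h
  proof -
    have "u \<otimes>\<^bsub>?c\<^esub> ?\<iota> f \<oplus>\<^bsub>?c\<^esub> v \<otimes>\<^bsub>?c\<^esub> ?\<iota> g \<ominus>\<^bsub>?c\<^esub> (u \<otimes>\<^bsub>?c\<^esub> e \<oplus>\<^bsub>?c\<^esub> v \<otimes>\<^bsub>?c\<^esub> h) =
        \<ominus>\<^bsub>?c\<^esub> (u \<otimes>\<^bsub>?c\<^esub> (e \<ominus>\<^bsub>?c\<^esub> ?\<iota> f) \<oplus>\<^bsub>?c\<^esub> v \<otimes>\<^bsub>?c\<^esub> (h \<ominus>\<^bsub>?c\<^esub> ?\<iota> g))"
      using cge_closed[OF that(1)] cge_closed[OF that(2)] that(5,6)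
        to_completion_closed[of z f] to_completion_closed[of z g] by algebra
    thus ?thesis
      using cge_mult[OF that(1,3)] cge_mult[OF that(2,4)] by auto
  qed
  define A where "A = mk a' b' c' d'"
  have z0: "u \<ominus>\<^bsub>?c\<^esub> \<zero>\<^bsub>?c\<^esub> = u" if "u \<in> carrier ?c" for u using that C.zero_closed by algebra
  have T: "inv\<^bsub>Gz z\<^esub> M \<otimes>\<^bsub>Gz z\<^esub> loc z A \<in> local_congruence z" (is "?T \<in> _")
    using err[OF m(1,2) a' c' cl(1,3)] err[OF m(1,2) b' d' cl(2,4)]
      err[OF m(3,4) a' c' cl(1,3)] err[OF m(3,4) b' d' cl(2,4)] cl
    by (simp add: I A_def local_congruence_iff eqs z0)
  have TG: "?T \<in> carrier (Gz z)" using T L.subset by blast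
  have lA: "M \<otimes>\<^bsub>Gz z\<^esub> ?T = loc z A"
  proof -
    have "mk (p \<otimes>\<^bsub>?c\<^esub> ?\<iota> a' \<oplus>\<^bsub>?c\<^esub> q \<otimes>\<^bsub>?c\<^esub> ?\<iota> c') (p \<otimes>\<^bsub>?c\<^esub> ?\<iota> b' \<oplus>\<^bsub>?c\<^esub> q \<otimes>\<^bsub>?c\<^esub> ?\<iota> d')
        (r \<otimes>\<^bsub>?c\<^esub> ?\<iota> a' \<oplus>\<^bsub>?c\<^esub> t \<otimes>\<^bsub>?c\<^esub> ?\<iota> c') (r \<otimes>\<^bsub>?c\<^esub> ?\<iota> b' \<oplus>\<^bsub>?c\<^esub> t \<otimes>\<^bsub>?c\<^esub> ?\<iota> d') = ?T"
      by (simp add: I A_def)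
    have MI: "a \<otimes>\<^bsub>?c\<^esub> p \<oplus>\<^bsub>?c\<^esub> b \<otimes>\<^bsub>?c\<^esub> r = \<one>\<^bsub>?c\<^esub>" "a \<otimes>\<^bsub>?c\<^esub> q \<oplus>\<^bsub>?c\<^esub> b \<otimes>\<^bsub>?c\<^esub> t = \<zero>\<^bsub>?c\<^esub>"
      "c \<otimes>\<^bsub>?c\<^esub> p \<oplus>\<^bsub>?c\<^esub> d \<otimes>\<^bsub>?c\<^esub> r = \<zero>\<^bsub>?c\<^esub>" "c \<otimes>\<^bsub>?c\<^esub> q \<oplus>\<^bsub>?c\<^esub> d \<otimes>\<^bsub>?c\<^esub> t = \<one>\<^bsub>?c\<^esub>"
      using G.r_inv[OF M] unfolding I unfolding M' by (simp_all add: GL2_one)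
    have assoc: "u \<otimes>\<^bsub>?c\<^esub> (p \<otimes>\<^bsub>?c\<^esub> f \<oplus>\<^bsub>?c\<^esub> q \<otimes>\<^bsub>?c\<^esub> g) \<oplus>\<^bsub>?c\<^esub> v \<otimes>\<^bsub>?c\<^esub> (r \<otimes>\<^bsub>?c\<^esub> f \<oplus>\<^bsub>?c\<^esub> t \<otimes>\<^bsub>?c\<^esub> g) =
        (u \<otimes>\<^bsub>?c\<^esub> p \<oplus>\<^bsub>?c\<^esub> v \<otimes>\<^bsub>?c\<^esub> r) \<otimes>\<^bsub>?c\<^esub> f \<oplus>\<^bsub>?c\<^esub> (u \<otimes>\<^bsub>?c\<^esub> q \<oplus>\<^bsub>?c\<^esub> v \<otimes>\<^bsub>?c\<^esub> t) \<otimes>\<^bsub>?c\<^esub> g"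
      if "u \<in> carrier ?c" "v \<in> carrier ?c" "f \<in> carrier ?c" "g \<in> carrier ?c" for u v f g
      using that cl(5-8) by algebra
    show ?thesis
      using cl by (simp add: I A_def) (simp add: M' assoc MI)
  qed
  hence "loc z A \<in> carrier (Gz z)" using M TG by (metis G.m_closed)
  moreover have "M = loc z A \<otimes>\<^bsub>Gz z\<^esub> inv\<^bsub>Gz z\<^esub> ?T"
    using lA M TG by (metis G.inv_solve_right' G.m_closed)
  ultimately show ?thesis using T by auto
qed

lemma local_approx_scalar:
  assumes A: "A \<in> carrier (completion z)" "A \<noteq> \<zero>\<^bsub>completion z\<^esub>"
  shows "\<exists>c. c \<noteq> 0 \<and> (\<exists>u. mk u \<zero>\<^bsub>completion z\<^esub> \<zero>\<^bsub>completion z\<^esub> u \<in> local_congruence z \<and>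
    A = to_completion z c \<otimes>\<^bsub>completion z\<^esub> u)"
proof -
  interpret C: cring "completion z" by (rule cring_completion)
  let ?c = "completion z" and ?\<iota> = "to_completion z"
  define I where "I = inv\<^bsub>?c\<^esub> A"
  have I: "I \<in> carrier ?c" "I \<noteq> \<zero>\<^bsub>?c\<^esub>" "completion_val z I = - completion_val z A" "A \<otimes>\<^bsub>?c\<^esub> I = \<one>\<^bsub>?c\<^esub>"
    using completion_inv[OF A] by (simp_all add: I_def)
  obtain c where c: "cge z (1 + completion_val z A) (A \<ominus>\<^bsub>?c\<^esub> ?\<iota> c)" using completion_dense A(1) by blast
  define T where "T = I \<otimes>\<^bsub>?c\<^esub> ?\<iota> c"
  have T: "T \<in> carrier ?c" using I by (simp add: T_def)
  have "T \<ominus>\<^bsub>?c\<^esub> A \<otimes>\<^bsub>?c\<^esub> I = \<ominus>\<^bsub>?c\<^esub> (I \<otimes>\<^bsub>?c\<^esub> (A \<ominus>\<^bsub>?c\<^esub> ?\<iota> c))"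
    unfolding T_def using I(1) A(1) to_completion_closed[of z c] by algebra
  moreover have "cge z 1 (\<ominus>\<^bsub>?c\<^esub> (I \<otimes>\<^bsub>?c\<^esub> (A \<ominus>\<^bsub>?c\<^esub> ?\<iota> c)))"
    using cge_mult[OF cge_val[OF I(1)] c] I(3) by auto
  ultimately have T1: "cge z 1 (T \<ominus>\<^bsub>?c\<^esub> \<one>\<^bsub>?c\<^esub>)" by (simp add: I(4))
  have T0: "T \<noteq> \<zero>\<^bsub>?c\<^esub>" "completion_val z T = 0" using cge_unit[OF T1 T] by auto
  define u where "u = inv\<^bsub>?c\<^esub> T"
  have u: "u \<in> carrier ?c" "completion_val z u = 0" "T \<otimes>\<^bsub>?c\<^esub> u = \<one>\<^bsub>?c\<^esub>"
    using completion_inv[OF T T0(1)] T0(2) by (simp_all add: u_def)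
  have "u \<ominus>\<^bsub>?c\<^esub> T \<otimes>\<^bsub>?c\<^esub> u = \<ominus>\<^bsub>?c\<^esub> ((T \<ominus>\<^bsub>?c\<^esub> \<one>\<^bsub>?c\<^esub>) \<otimes>\<^bsub>?c\<^esub> u)"
    using u(1) T C.one_closed C.r_one[OF u(1)] by algebra
  moreover have "cge z 0 u" using u by (simp add: cge_def)
  hence "cge z 1 (\<ominus>\<^bsub>?c\<^esub> ((T \<ominus>\<^bsub>?c\<^esub> \<one>\<^bsub>?c\<^esub>) \<otimes>\<^bsub>?c\<^esub> u))" using T1 by blast
  ultimately have u1: "cge z 1 (u \<ominus>\<^bsub>?c\<^esub> \<one>\<^bsub>?c\<^esub>)" by (simp add: u(3))
  have "?\<iota> c = (A \<otimes>\<^bsub>?c\<^esub> I) \<otimes>\<^bsub>?c\<^esub> ?\<iota> c" by (simp add: I(4))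
  also have "\<dots> = A \<otimes>\<^bsub>?c\<^esub> T"
    unfolding T_def by (rule C.m_assoc[OF A(1) I(1) to_completion_closed])
  finally have cA: "?\<iota> c = A \<otimes>\<^bsub>?c\<^esub> T" .
  hence "?\<iota> c \<otimes>\<^bsub>?c\<^esub> u = A" using A T u by (simp add: C.m_assoc)
  moreover have "?\<iota> c \<noteq> \<zero>\<^bsub>?c\<^esub>"
    using completion_val_mult(1)[OF A(1) T A(2) T0(1)] by (simp only: cA not_False_eq_True)
  hence "c \<noteq> 0" by simp
  ultimately show ?thesis
    using u1 u by (intro exI[of _ c] conjI exI[of _ u]) (simp_all add: local_congruence_iff)
qed

section \<open>The adelic group\<close>

lemma adeles_simps [simp]:
  "(a \<otimes>\<^bsub>adeles\<^esub> b) z = a z \<otimes>\<^bsub>completion z\<^esub> b z" "(a \<oplus>\<^bsub>adeles\<^esub> b) z = a z \<oplus>\<^bsub>completion z\<^esub> b z"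
  "\<one>\<^bsub>adeles\<^esub> z = \<one>\<^bsub>completion z\<^esub>" "\<zero>\<^bsub>adeles\<^esub> z = \<zero>\<^bsub>completion z\<^esub>"
  by (simp_all add: adeles_def)

lemma adeles_carrier_iff:
  "a \<in> carrier adeles \<longleftrightarrow> (\<forall>z. a z \<in> carrier (completion z)) \<and> finite {z. \<not> cge z 0 (a z)}"
  by (simp add: adeles_def integer_ring_carrier)

lemma adeles_carrierI:
  assumes "\<And>z. a z \<in> carrier (completion z)" "finite S" "\<And>z. z \<notin> S \<Longrightarrow> cge z 0 (a z)"
  shows "a \<in> carrier adeles"
  unfolding adeles_carrier_iff
proof (intro conjI allI)
  show "finite {z. \<not> cge z 0 (a z)}"
    by (rule finite_subset[OF _ assms(2)]) (use assms(3) in blast)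
qed (rule assms(1))

lemma adeles_minus_closed:
  assumes "a \<in> carrier adeles" shows "(\<lambda>z. \<ominus>\<^bsub>completion z\<^esub> a z) \<in> carrier adeles"
proof (rule adeles_carrierI)
  show "\<ominus>\<^bsub>completion z\<^esub> a z \<in> carrier (completion z)" for z
    using assms abelian_group.a_inv_closed[of "completion z"] cring_completion[of z]
    by (simp add: adeles_carrier_iff cring_def ring_def)
  show "finite {z. \<not> cge z 0 (a z)}" using assms by (simp add: adeles_carrier_iff)
qed auto

lemma cring_adeles: "cring (adeles :: 'k::{field,finite} adele ring)"
proof (rule cringI)
  interpret C: cring "completion z" for z :: "'k place" by (rule cring_completion)
  have add: "a \<oplus>\<^bsub>adeles\<^esub> b \<in> carrier adeles" and mult: "a \<otimes>\<^bsub>adeles\<^esub> b \<in> carrier adeles"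
    if "a \<in> carrier adeles" "b \<in> carrier adeles" for a b :: "'k adele"
  proof -
    have fin: "finite ({z. \<not> cge z 0 (a z)} \<union> {z. \<not> cge z 0 (b z)})"
      using that by (simp add: adeles_carrier_iff)
    show "a \<oplus>\<^bsub>adeles\<^esub> b \<in> carrier adeles"
      by (rule adeles_carrierI[OF _ fin]) (use that in \<open>auto simp: adeles_carrier_iff\<close>)
    show "a \<otimes>\<^bsub>adeles\<^esub> b \<in> carrier adeles"
      by (rule adeles_carrierI[OF _ fin]) (use that in \<open>auto simp: adeles_carrier_iff\<close>)
  qed
  have zero: "\<zero>\<^bsub>adeles\<^esub> \<in> carrier (adeles :: 'k adele ring)" and one: "\<one>\<^bsub>adeles\<^esub> \<in> carrier (adeles :: 'k adele ring)"
    by (simp_all add: adeles_carrier_iff)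
  show "abelian_group (adeles :: 'k adele ring)"
  proof (rule abelian_groupI)
    fix a :: "'k adele" assume a: "a \<in> carrier adeles"
    show "\<exists>b\<in>carrier adeles. b \<oplus>\<^bsub>adeles\<^esub> a = \<zero>\<^bsub>adeles\<^esub>"
      by (rule bexI[OF _ adeles_minus_closed[OF a]])
         (use a in \<open>auto simp: adeles_carrier_iff C.l_neg intro!: ext\<close>)
  next
    fix a b c :: "'k adele" assume abc: "a \<in> carrier adeles" "b \<in> carrier adeles" "c \<in> carrier adeles"
    show "a \<oplus>\<^bsub>adeles\<^esub> b \<oplus>\<^bsub>adeles\<^esub> c = a \<oplus>\<^bsub>adeles\<^esub> (b \<oplus>\<^bsub>adeles\<^esub> c)" "a \<oplus>\<^bsub>adeles\<^esub> b = b \<oplus>\<^bsub>adeles\<^esub> a"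
      "\<zero>\<^bsub>adeles\<^esub> \<oplus>\<^bsub>adeles\<^esub> a = a"
      using abc by (auto simp: adeles_carrier_iff C.a_ac intro!: ext)
  qed (assumption | rule add zero)+
  show "Group.comm_monoid (adeles :: 'k adele ring)"
  proof (rule comm_monoidI)
    fix a b c :: "'k adele" assume abc: "a \<in> carrier adeles" "b \<in> carrier adeles" "c \<in> carrier adeles"
    show "a \<otimes>\<^bsub>adeles\<^esub> b \<otimes>\<^bsub>adeles\<^esub> c = a \<otimes>\<^bsub>adeles\<^esub> (b \<otimes>\<^bsub>adeles\<^esub> c)" "a \<otimes>\<^bsub>adeles\<^esub> b = b \<otimes>\<^bsub>adeles\<^esub> a"
      "\<one>\<^bsub>adeles\<^esub> \<otimes>\<^bsub>adeles\<^esub> a = a"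
      using abc by (auto simp: adeles_carrier_iff C.m_ac intro!: ext)
  qed (assumption | rule mult one)+
  show "(a \<oplus>\<^bsub>adeles\<^esub> b) \<otimes>\<^bsub>adeles\<^esub> c = a \<otimes>\<^bsub>adeles\<^esub> c \<oplus>\<^bsub>adeles\<^esub> b \<otimes>\<^bsub>adeles\<^esub> c"
    if "a \<in> carrier adeles" "b \<in> carrier adeles" "c \<in> carrier adeles" for a b c :: "'k adele"
    using that by (auto simp: adeles_carrier_iff C.l_distr intro!: ext)
qed

lemma adeles_diff:
  fixes b :: "'k::{field,finite} adele"
  assumes "b \<in> carrier adeles"
  shows "(a \<ominus>\<^bsub>adeles\<^esub> b) z = a z \<ominus>\<^bsub>completion z\<^esub> b z"
proof -
  interpret A: cring "adeles :: 'k adele ring" by (rule cring_adeles)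
  interpret C: cring "completion z" for z :: "'k place" by (rule cring_completion)
  have "\<ominus>\<^bsub>adeles\<^esub> b = (\<lambda>z. \<ominus>\<^bsub>completion z\<^esub> b z)"
    by (rule A.minus_equality)
       (use assms adeles_minus_closed in \<open>auto simp: adeles_carrier_iff C.l_neg intro!: ext\<close>)
  thus ?thesis by (simp add: a_minus_def)
qed

definition assemble :: "('k::{field,finite} place \<Rightarrow> 'k completed^2^2) \<Rightarrow> 'k adele^2^2" where
  "assemble M = (\<chi> i j. (\<lambda>z. M z $ i $ j))"

lemma component_assemble [simp]: "component (assemble M) z = M z"
  by (simp add: component_def assemble_def vec_eq_iff)

lemma component_eqI: "(\<And>z. component g z = component h z) \<Longrightarrow> g = h"
  by (simp add: component_def vec_eq_iff fun_eq_iff)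

lemma component_mk: "component (mk a b c d) z = mk (a z) (b z) (c z) (d z)"
  by (simp add: component_def vec_eq_iff forall_2)

lemma component_mult [simp]: "component (g \<otimes>\<^bsub>GA\<^esub> h) z = component g z \<otimes>\<^bsub>Gz z\<^esub> component h z"
  by (cases g rule: mk_cases; cases h rule: mk_cases) (simp add: component_mk)

lemma component_one [simp]: "component \<one>\<^bsub>GA\<^esub> z = \<one>\<^bsub>Gz z\<^esub>"
  by (simp add: GL2_one component_mk)

lemma group_GA: "group GA"
  using cring.group_GL2[OF cring_adeles] .

text \<open>\<open>GL\<^sub>2(\<A>)\<close> is the restricted product of the local groups. This lets all
  adelic computations be done place by place.\<close>

lemma GA_iff:
  fixes g :: "'k::{field,finite} adele^2^2"
  shows "g \<in> carrier GA \<longleftrightarrow>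
  (\<forall>z. component g z \<in> carrier (Gz z)) \<and> finite {z. component g z \<notin> Kz z}"
proof -
  interpret A: cring "adeles :: 'k adele ring" by (rule cring_adeles)
  interpret C: cring "completion z" for z :: "'k place" by (rule cring_completion)
  obtain a b c d where g: "g = mk a b c d" by (rule mk_cases)
  define D where "D z = a z \<otimes>\<^bsub>completion z\<^esub> d z \<ominus>\<^bsub>completion z\<^esub> b z \<otimes>\<^bsub>completion z\<^esub> c z" for z
  have D: "(a \<otimes>\<^bsub>adeles\<^esub> d \<ominus>\<^bsub>adeles\<^esub> b \<otimes>\<^bsub>adeles\<^esub> c) = D"
    if "a \<in> carrier adeles" "b \<in> carrier adeles" "c \<in> carrier adeles" "d \<in> carrier adeles"
    using that by (intro ext) (simp add: adeles_diff D_def)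
  show ?thesis
  proof
    assume "g \<in> carrier GA"
    hence car: "a \<in> carrier adeles" "b \<in> carrier adeles" "c \<in> carrier adeles" "d \<in> carrier adeles"
      and "D \<in> Units adeles"
      by (auto simp: g GL2_carrier D)
    then obtain E where E: "D \<in> carrier adeles" "E \<in> carrier adeles" "D \<otimes>\<^bsub>adeles\<^esub> E = \<one>\<^bsub>adeles\<^esub>"
      by (auto simp: Units_def A.m_comm)
    have DE: "D z \<otimes>\<^bsub>completion z\<^esub> E z = \<one>\<^bsub>completion z\<^esub>" for z using arg_cong[OF E(3), of "\<lambda>f. f z"] by simp
    have cz: "a z \<in> carrier (completion z)" "b z \<in> carrier (completion z)" "c z \<in> carrier (completion z)"
      "d z \<in> carrier (completion z)" "D z \<in> carrier (completion z)" "E z \<in> carrier (completion z)" for z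
      using car E(1,2) by (simp_all add: adeles_carrier_iff)
    have D0: "D z \<noteq> \<zero>\<^bsub>completion z\<^esub>" "E z \<noteq> \<zero>\<^bsub>completion z\<^esub>" for z
      using DE[of z] cz completion_one_neq_zero[of z] C.l_null[OF cz(6)] C.r_null[OF cz(5)] by metis+
    have Gz: "component g z \<in> carrier (Gz z)" for z
      unfolding g component_mk Gz_carrier_iff using cz D0(1)[of z, unfolded D_def] by blast
    have "component g z \<in> Kz z" if "cge z 0 (a z)" "cge z 0 (b z)" "cge z 0 (c z)" "cge z 0 (d z)"
      "cge z 0 (D z)" "cge z 0 (E z)" for z
    proof -
      have "completion_val z (D z) + completion_val z (E z) = 0"
        using completion_val_mult(2)[OF cz(5,6) D0, of z] by (simp only: DE completion_val_one)
      hence "completion_val z (D z) = 0" using that(5,6) D0[of z] by (simp add: cge_def)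
      thus ?thesis unfolding g component_mk Kz_iff using that D0(1)[of z] unfolding D_def by blast
    qed
    hence "{z. component g z \<notin> Kz z} \<subseteq> {z. \<not> cge z 0 (a z)} \<union> {z. \<not> cge z 0 (b z)} \<union>
      {z. \<not> cge z 0 (c z)} \<union> {z. \<not> cge z 0 (d z)} \<union> {z. \<not> cge z 0 (D z)} \<union> {z. \<not> cge z 0 (E z)}"
      by blast
    moreover have "finite ({z. \<not> cge z 0 (a z)} \<union> {z. \<not> cge z 0 (b z)} \<union>
      {z. \<not> cge z 0 (c z)} \<union> {z. \<not> cge z 0 (d z)} \<union> {z. \<not> cge z 0 (D z)} \<union> {z. \<not> cge z 0 (E z)})"
      using car E(1,2) by (simp add: adeles_carrier_iff)
    ultimately show "(\<forall>z. component g z \<in> carrier (Gz z)) \<and> finite {z. component g z \<notin> Kz z}"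
      using Gz finite_subset by blast
  next
    assume *: "(\<forall>z. component g z \<in> carrier (Gz z)) \<and> finite {z. component g z \<notin> Kz z}"
    hence fin: "finite {z. component g z \<notin> Kz z}" by blast
    have cz: "a z \<in> carrier (completion z)" "b z \<in> carrier (completion z)" "c z \<in> carrier (completion z)"
      "d z \<in> carrier (completion z)" "D z \<noteq> \<zero>\<^bsub>completion z\<^esub>" for z
      using * unfolding g component_mk Gz_carrier_iff D_def by blast+
    have Dz: "D z \<in> carrier (completion z)" for z using cz by (simp add: D_def)
    have int: "cge z 0 (a z)" "cge z 0 (b z)" "cge z 0 (c z)" "cge z 0 (d z)" "completion_val z (D z) = 0"
      if "z \<notin> {z. component g z \<notin> Kz z}" for z
      using that unfolding g component_mk mem_Collect_eq not_not Kz_iff D_def by blast+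
    have car: "a \<in> carrier adeles" "b \<in> carrier adeles" "c \<in> carrier adeles" "d \<in> carrier adeles"
      using adeles_carrierI[OF _ fin] cz int by blast+
    define E where "E z = inv\<^bsub>completion z\<^esub> D z" for z
    have "D \<in> carrier adeles"
      by (rule adeles_carrierI[OF Dz fin]) (use Dz int in \<open>auto simp: cge_def\<close>)
    moreover have "E \<in> carrier adeles"
      by (rule adeles_carrierI[OF _ fin])
         (use completion_inv[OF Dz cz(5)] int in \<open>auto simp: cge_def E_def\<close>)
    moreover have "D \<otimes>\<^bsub>adeles\<^esub> E = \<one>\<^bsub>adeles\<^esub>"
      using completion_inv[OF Dz cz(5)] by (intro ext) (simp add: E_def)
    ultimately have "D \<in> Units adeles"
      using A.m_comm by (auto simp: Units_def intro!: bexI[of _ E])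
    thus "g \<in> carrier GA" using car by (simp add: g GL2_carrier D)
  qed
qed

lemma GA_componentI:
  assumes "\<And>z. M z \<in> carrier (Gz z)" "finite S" "\<And>z. z \<notin> S \<Longrightarrow> M z \<in> Kz z"
  shows "assemble M \<in> carrier GA"
  unfolding GA_iff component_assemble
proof (intro conjI allI)
  show "finite {z. M z \<notin> Kz z}"
    by (rule finite_subset[OF _ assms(2)]) (use assms(3) in blast)
qed (rule assms(1))

lemma component_in_Gz: "g \<in> carrier GA \<Longrightarrow> component g z \<in> carrier (Gz z)"
  by (simp add: GA_iff)

lemma component_inv:
  fixes g :: "'k::{field,finite} adele^2^2"
  assumes "g \<in> carrier GA" shows "component (inv\<^bsub>GA\<^esub> g) z = inv\<^bsub>Gz z\<^esub> component g z"
proof -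
  interpret G: group "GA :: ('k adele^2^2) monoid" by (rule group_GA)
  interpret L: group "Gz z" by (rule group_Gz)
  have "component (inv\<^bsub>GA\<^esub> g) z \<otimes>\<^bsub>Gz z\<^esub> component g z = \<one>\<^bsub>Gz z\<^esub>"
    using G.l_inv[OF assms] by (metis component_mult component_one)
  thus ?thesis using assms by (intro L.inv_equality[symmetric]) (simp_all add: component_in_Gz)
qed

lemma at_place_assemble: "at_place y M = assemble (\<lambda>z. if z = y then M else \<one>\<^bsub>Gz z\<^esub>)"
  by (auto simp: at_place_def assemble_def vec_eq_iff fun_eq_iff)

lemma Kz_one [simp]: "\<one>\<^bsub>Gz z\<^esub> \<in> Kz z"
  using subgroup.one_closed[OF Kz_subgroup] .

lemma Kz_subset: "A \<in> Kz z \<Longrightarrow> A \<in> carrier (Gz z)"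
  using subgroup.subset[OF Kz_subgroup] by blast

lemma at_place_carrier: "M \<in> carrier (Gz y) \<Longrightarrow> at_place y M \<in> carrier GA"
  unfolding at_place_assemble
  by (rule GA_componentI[of _ "{y}"]) (auto simp: Kz_subset)

lemma component_at_place:
  "component (at_place y M) z = (if z = y then M else \<one>\<^bsub>Gz z\<^esub>)"
  by (simp add: at_place_assemble)

lemma congruence_subgroup_iff: "g \<in> congruence_subgroup x \<longleftrightarrow>
    component g x \<in> local_congruence x \<and> (\<forall>z. z \<noteq> x \<longrightarrow> component g z \<in> Kz z)"
proof -
  have "g \<in> carrier GA" if *: "component g x \<in> local_congruence x" "\<forall>z. z \<noteq> x \<longrightarrow> component g z \<in> Kz z"
  proof -
    have K: "component g z \<in> Kz z" for z using * local_congruence_subset by (cases "z = x") auto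
    hence "{z. component g z \<notin> Kz z} = {}" by blast
    thus ?thesis using K by (auto simp: GA_iff intro: Kz_subset)
  qed
  thus ?thesis by (auto simp: congruence_subgroup_def)
qed

lemma congruence_subgroup_Kz: "g \<in> congruence_subgroup x \<Longrightarrow> component g z \<in> Kz z"
  using local_congruence_subset by (cases "z = x") (auto simp: congruence_subgroup_iff)

lemma congruence_subgroup_subset: "congruence_subgroup x \<subseteq> carrier GA"
  by (auto simp: congruence_subgroup_def)

lemma congruence_subgroup_subgroup:
  fixes x :: "'k::{field,finite} place"
  shows "subgroup (congruence_subgroup x) GA"
proof -
  interpret G: group "GA :: ('k adele^2^2) monoid" by (rule group_GA)
  note L = local_congruence_subgroup[of x] and K = Kz_subgroup
  show ?thesis
  proof (rule G.subgroupI[OF congruence_subgroup_subset])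
    have "\<one>\<^bsub>GA\<^esub> \<in> congruence_subgroup x"
      by (simp add: congruence_subgroup_iff subgroup.one_closed[OF L])
    thus "congruence_subgroup x \<noteq> {}" by blast
  next
    fix g assume g: "g \<in> congruence_subgroup x"
    hence "g \<in> carrier GA" using congruence_subgroup_subset by blast
    thus "inv\<^bsub>GA\<^esub> g \<in> congruence_subgroup x"
      using g by (auto simp: congruence_subgroup_iff component_inv
          intro: subgroup.m_inv_closed[OF L] subgroup.m_inv_closed[OF K])
    fix h assume "h \<in> congruence_subgroup x"
    thus "g \<otimes>\<^bsub>GA\<^esub> h \<in> congruence_subgroup x"
      using g by (auto simp: congruence_subgroup_iff
          intro: subgroup.m_closed[OF L] subgroup.m_closed[OF K])
  qed
qed

subsection \<open>The centre\<close>

text \<open>At each place the component commutes with the elementary unipotent matrices.\<close>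

lemma center_component:
  assumes "\<zeta> \<in> monoid_center GA"
  shows "\<exists>a\<in>carrier (completion z). a \<noteq> \<zero>\<^bsub>completion z\<^esub> \<and>
    component \<zeta> z = mk a \<zero>\<^bsub>completion z\<^esub> \<zero>\<^bsub>completion z\<^esub> a"
proof -
  interpret C: cring "completion z" by (rule cring_completion)
  let ?c = "completion z"
  have G: "\<zeta> \<in> carrier GA" and comm: "\<And>g. g \<in> carrier GA \<Longrightarrow> \<zeta> \<otimes>\<^bsub>GA\<^esub> g = g \<otimes>\<^bsub>GA\<^esub> \<zeta>"
    using assms by (auto simp: monoid_center_def)
  obtain a b c d where \<zeta>: "component \<zeta> z = mk a b c d" by (rule mk_cases)
  have cl: "a \<in> carrier ?c" "b \<in> carrier ?c" "c \<in> carrier ?c" "d \<in> carrier ?c"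
    and det: "a \<otimes>\<^bsub>?c\<^esub> d \<ominus>\<^bsub>?c\<^esub> b \<otimes>\<^bsub>?c\<^esub> c \<noteq> \<zero>\<^bsub>?c\<^esub>"
    using component_in_Gz[OF G, of z] unfolding \<zeta> Gz_carrier_iff by blast+
  have commz: "mk a b c d \<otimes>\<^bsub>Gz z\<^esub> loc z A = loc z A \<otimes>\<^bsub>Gz z\<^esub> mk a b c d" if "det A \<noteq> 0" for A
  proof -
    have "at_place z (loc z A) \<in> carrier GA" using that by (intro at_place_carrier) simp
    from arg_cong[OF comm[OF this], of "\<lambda>g. component g z"] show ?thesis
      by (simp add: component_at_place \<zeta>)
  qed
  have cancel: "u = \<zero>\<^bsub>?c\<^esub>" if "u \<oplus>\<^bsub>?c\<^esub> v = v" "u \<in> carrier ?c" "v \<in> carrier ?c" for u v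
  proof -
    have "u = (u \<oplus>\<^bsub>?c\<^esub> v) \<ominus>\<^bsub>?c\<^esub> v" using that(2,3) by algebra
    also have "\<dots> = \<zero>\<^bsub>?c\<^esub>" unfolding that(1) using that(3) by algebra
    finally show ?thesis .
  qed
  have "mk a (a \<oplus>\<^bsub>?c\<^esub> b) c (c \<oplus>\<^bsub>?c\<^esub> d) = mk (a \<oplus>\<^bsub>?c\<^esub> c) (b \<oplus>\<^bsub>?c\<^esub> d) c d"
    using commz[of "mk 1 1 0 1"] cl by simp
  hence u: "a \<oplus>\<^bsub>?c\<^esub> c = a" "a \<oplus>\<^bsub>?c\<^esub> b = b \<oplus>\<^bsub>?c\<^esub> d" by (metis mk_eq_iff)+
  have "mk (a \<oplus>\<^bsub>?c\<^esub> b) b (c \<oplus>\<^bsub>?c\<^esub> d) d = mk a b (a \<oplus>\<^bsub>?c\<^esub> c) (b \<oplus>\<^bsub>?c\<^esub> d)"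
    using commz[of "mk 1 0 1 1"] cl by simp
  hence v: "a \<oplus>\<^bsub>?c\<^esub> b = a" by (metis mk_eq_iff)
  have "c = \<zero>\<^bsub>?c\<^esub>" using cancel[of c a] u(1) C.a_comm[OF cl(1,3)] cl by metis
  moreover have b: "b = \<zero>\<^bsub>?c\<^esub>" using cancel[of b a] v C.a_comm[OF cl(1,2)] cl by metis
  moreover have "a = d" using v u(2) b C.l_zero[OF cl(4)] by metis
  moreover have "a \<noteq> \<zero>\<^bsub>?c\<^esub>"
  proof (rule notI)
    assume "a = \<zero>\<^bsub>?c\<^esub>"
    hence "a \<otimes>\<^bsub>?c\<^esub> d \<ominus>\<^bsub>?c\<^esub> b \<otimes>\<^bsub>?c\<^esub> c = \<zero>\<^bsub>?c\<^esub>"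
      using cl \<open>b = \<zero>\<^bsub>?c\<^esub>\<close> by (simp add: a_minus_def)
    thus False using det by contradiction
  qed
  ultimately show ?thesis using \<zeta> cl by blast
qed

lemma center_subset: "monoid_center GA \<subseteq> carrier GA"
  by (auto simp: monoid_center_def)

lemma center_commute: "\<zeta> \<in> monoid_center GA \<Longrightarrow> g \<in> carrier GA \<Longrightarrow> g \<otimes>\<^bsub>GA\<^esub> \<zeta> = \<zeta> \<otimes>\<^bsub>GA\<^esub> g"
  by (auto simp: monoid_center_def)

lemma center_mult:
  fixes \<zeta> \<xi> :: "'k::{field,finite} adele^2^2"
  assumes "\<zeta> \<in> monoid_center GA" "\<xi> \<in> monoid_center GA" shows "\<zeta> \<otimes>\<^bsub>GA\<^esub> \<xi> \<in> monoid_center GA"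
proof -
  interpret G: group "GA :: ('k adele^2^2) monoid" by (rule group_GA)
  have c: "\<zeta> \<in> carrier GA" "\<xi> \<in> carrier GA" using assms center_subset by auto
  have "\<zeta> \<otimes>\<^bsub>GA\<^esub> \<xi> \<otimes>\<^bsub>GA\<^esub> g = g \<otimes>\<^bsub>GA\<^esub> (\<zeta> \<otimes>\<^bsub>GA\<^esub> \<xi>)" if "g \<in> carrier GA" for g :: "'k adele^2^2"
    using that c assms by (metis G.m_assoc center_commute)
  thus ?thesis using c by (simp add: monoid_center_def)
qed

lemma center_inv:
  fixes \<zeta> :: "'k::{field,finite} adele^2^2"
  assumes "\<zeta> \<in> monoid_center GA" shows "inv\<^bsub>GA\<^esub> \<zeta> \<in> monoid_center GA"
proof -
  interpret G: group "GA :: ('k adele^2^2) monoid" by (rule group_GA)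
  have c: "\<zeta> \<in> carrier GA" using assms center_subset by auto
  have "inv\<^bsub>GA\<^esub> \<zeta> \<otimes>\<^bsub>GA\<^esub> g = g \<otimes>\<^bsub>GA\<^esub> inv\<^bsub>GA\<^esub> \<zeta>" if "g \<in> carrier GA" for g :: "'k adele^2^2"
    using that c assms center_commute[OF assms that]
    by (metis G.inv_closed G.inv_solve_left G.inv_solve_right G.m_closed G.m_assoc)
  thus ?thesis using c by (simp add: monoid_center_def)
qed

lemma center_one: "\<one>\<^bsub>GA\<^esub> \<in> monoid_center (GA :: ('k::{field,finite} adele^2^2) monoid)"
proof -
  interpret G: group "GA :: ('k adele^2^2) monoid" by (rule group_GA)
  show ?thesis by (simp add: monoid_center_def)
qed

lemma scalar_commute:
  assumes "a \<in> carrier (completion z)" "M \<in> carrier (Gz z)"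
  shows "mk a \<zero>\<^bsub>completion z\<^esub> \<zero>\<^bsub>completion z\<^esub> a \<otimes>\<^bsub>Gz z\<^esub> M = M \<otimes>\<^bsub>Gz z\<^esub> mk a \<zero>\<^bsub>completion z\<^esub> \<zero>\<^bsub>completion z\<^esub> a"
proof -
  interpret C: cring "completion z" by (rule cring_completion)
  show ?thesis
    using assms by (cases M rule: mk_cases) (simp add: Gz_carrier_iff C.m_comm)
qed

lemma center_intro:
  fixes \<zeta> :: "'k::{field,finite} adele^2^2"
  assumes "\<zeta> \<in> carrier GA" "\<And>z. \<exists>c. component \<zeta> z = loc z (scalar_mat c)"
  shows "\<zeta> \<in> monoid_center GA"
  unfolding monoid_center_def
proof (intro CollectI conjI ballI component_eqI)
  show "\<zeta> \<in> carrier GA" by fact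
  fix g :: "'k adele^2^2" and z assume "g \<in> carrier GA"
  obtain c where "component \<zeta> z = loc z (scalar_mat c)" using assms(2) by blast
  thus "component (\<zeta> \<otimes>\<^bsub>GA\<^esub> g) z = component (g \<otimes>\<^bsub>GA\<^esub> \<zeta>) z"
    using scalar_commute[of "to_completion z c" z "component g z"] component_in_Gz[OF \<open>g \<in> carrier GA\<close>]
    by (simp add: scalar_mat_def)
qed

text \<open>By density, a local scalar is rational up to a unit congruent to \<open>1\<close>.\<close>

lemma center_rational:
  assumes "\<zeta> \<in> monoid_center GA"
  shows "\<exists>c. c \<noteq> 0 \<and> (\<exists>u. u \<in> carrier (completion z) \<and>
    mk u \<zero>\<^bsub>completion z\<^esub> \<zero>\<^bsub>completion z\<^esub> u \<in> local_congruence z \<and>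
    component \<zeta> z = loc z (scalar_mat c) \<otimes>\<^bsub>Gz z\<^esub> mk u \<zero>\<^bsub>completion z\<^esub> \<zero>\<^bsub>completion z\<^esub> u)"
proof -
  interpret C: cring "completion z" by (rule cring_completion)
  obtain a where a: "a \<in> carrier (completion z)" "a \<noteq> \<zero>\<^bsub>completion z\<^esub>"
    "component \<zeta> z = mk a \<zero>\<^bsub>completion z\<^esub> \<zero>\<^bsub>completion z\<^esub> a"
    using center_component[OF assms] by blast
  obtain c u where c: "c \<noteq> 0" "mk u \<zero>\<^bsub>completion z\<^esub> \<zero>\<^bsub>completion z\<^esub> u \<in> local_congruence z"
    "a = to_completion z c \<otimes>\<^bsub>completion z\<^esub> u"
    using local_approx_scalar[OF a(1,2)] by blast
  have u: "u \<in> carrier (completion z)" using c(2) by (simp add: local_congruence_iff)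
  have "component \<zeta> z = loc z (scalar_mat c) \<otimes>\<^bsub>Gz z\<^esub> mk u \<zero>\<^bsub>completion z\<^esub> \<zero>\<^bsub>completion z\<^esub> u"
    using u by (simp add: a(3) c(3) scalar_mat_def)
  thus ?thesis using c u by blast
qed

section \<open>Double cosets of the adelic group\<close>

context coord
begin

abbreviation GAk :: "('k adele^2^2) monoid" where "GAk \<equiv> GA"

abbreviation K' :: "('k adele^2^2) set" where "K' \<equiv> congruence_subgroup x"

interpretation G: group GAk by (rule group_GA)

interpretation K: subgroup K' GAk by (rule congruence_subgroup_subgroup)

text \<open>Rational matrices enter the adelic group diagonally, and by \<open>local_emb\<close> at a single
  place.\<close>

definition diag_emb :: "'k poly fract^2^2 \<Rightarrow> 'k adele^2^2" where
  "diag_emb A = assemble (\<lambda>z. loc z A)"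

definition local_emb :: "'k place \<Rightarrow> 'k poly fract^2^2 \<Rightarrow> 'k adele^2^2" where
  "local_emb z A = at_place z (loc z A)"

lemma component_diag_emb [simp]: "component (diag_emb A) z = loc z A"
  by (simp add: diag_emb_def)

lemma component_local_emb: "component (local_emb y A) z = (if z = y then loc z A else \<one>\<^bsub>Gz z\<^esub>)"
  by (simp add: local_emb_def component_at_place)

lemma finite_bad_places:
  fixes A :: "'k poly fract^2^2"
  assumes "det A \<noteq> 0" shows "finite {z. A \<notin> GO z}"
proof -
  have fin: "finite {z. \<not> vge z 0 f}" for f :: "'k poly fract"
  proof (cases "f = 0")
    case False
    have "{z. \<not> vge z 0 f} \<subseteq> {z. place_val z f \<noteq> 0}" by (auto simp: vge_def)
    thus ?thesis using finite_support[OF False] by (rule finite_subset)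
  qed simp
  have "{z. A \<notin> GO z} \<subseteq> {z. \<not> vge z 0 (A$1$1)} \<union> {z. \<not> vge z 0 (A$1$2)} \<union>
     {z. \<not> vge z 0 (A$2$1)} \<union> {z. \<not> vge z 0 (A$2$2)} \<union> {z. place_val z (det A) \<noteq> 0}"
    using assms by (auto simp: GO_def forall_2)
  thus ?thesis by (rule finite_subset) (use fin finite_support[OF assms] in simp)
qed

lemma diag_emb_carrier [simp]: "det A \<noteq> 0 \<Longrightarrow> diag_emb A \<in> carrier GAk"
  unfolding diag_emb_def by (rule GA_componentI[OF _ finite_bad_places]) auto

lemma local_emb_carrier [simp]: "det A \<noteq> 0 \<Longrightarrow> local_emb y A \<in> carrier GAk"
  unfolding local_emb_def by (rule at_place_carrier) simp

lemma diag_emb_mult: "diag_emb (A ** B) = diag_emb A \<otimes>\<^bsub>GAk\<^esub> diag_emb B"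
  by (rule component_eqI) (simp add: loc_mult)

lemma diag_emb_1 [simp]: "diag_emb (mat 1) = \<one>\<^bsub>GAk\<^esub>"
  by (rule component_eqI) simp

lemma diag_emb_rinv: "det A \<noteq> 0 \<Longrightarrow> diag_emb (rinv A) = inv\<^bsub>GAk\<^esub> diag_emb A"
  by (rule component_eqI) (simp add: component_inv loc_rinv)

lemma GF_eq: "GF = {diag_emb A | A. det A \<noteq> 0}"
proof -
  have "diag_emb A = (\<chi> i j. (\<lambda>z. to_completion z (A$i$j)))" for A
    by (simp add: diag_emb_def assemble_def loc_def)
  thus ?thesis by (auto simp: GF_def invertible_det_nz)
qed

lemma local_emb_mult: "local_emb y (A ** B) = local_emb y A \<otimes>\<^bsub>GAk\<^esub> local_emb y B"
proof (rule component_eqI)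
  fix z :: "'k place"
  interpret L: group "Gz z" by (rule group_Gz)
  show "component (local_emb y (A ** B)) z = component (local_emb y A \<otimes>\<^bsub>GAk\<^esub> local_emb y B) z"
    by (simp add: component_local_emb loc_mult)
qed

lemma K'_closed: "k \<in> K' \<Longrightarrow> k \<in> carrier GAk"
  using K.subset by blast

text \<open>Equality of double cosets of \<open>GL\<^sub>2(F)\<close>, the centre and \<open>K'\<close>.
  These are exactly the identifications that automorphic functions respect.\<close>

definition adele_equiv :: "'k adele^2^2 \<Rightarrow> 'k adele^2^2 \<Rightarrow> bool" where
  "adele_equiv g h \<longleftrightarrow> (\<exists>A \<zeta> k. det A \<noteq> 0 \<and> \<zeta> \<in> monoid_center GAk \<and> k \<in> K' \<and>
     g = diag_emb A \<otimes>\<^bsub>GAk\<^esub> (\<zeta> \<otimes>\<^bsub>GAk\<^esub> (h \<otimes>\<^bsub>GAk\<^esub> k)))"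

lemma adele_equivI: "det A \<noteq> 0 \<Longrightarrow> \<zeta> \<in> monoid_center GAk \<Longrightarrow> k \<in> K' \<Longrightarrow>
    g = diag_emb A \<otimes>\<^bsub>GAk\<^esub> (\<zeta> \<otimes>\<^bsub>GAk\<^esub> (h \<otimes>\<^bsub>GAk\<^esub> k)) \<Longrightarrow> adele_equiv g h"
  by (auto simp: adele_equiv_def)

lemma center_lcomm:
  assumes "\<zeta> \<in> monoid_center GAk" "g \<in> carrier GAk" "h \<in> carrier GAk"
  shows "\<zeta> \<otimes>\<^bsub>GAk\<^esub> (g \<otimes>\<^bsub>GAk\<^esub> h) = g \<otimes>\<^bsub>GAk\<^esub> (\<zeta> \<otimes>\<^bsub>GAk\<^esub> h)"
proof -
  have "\<zeta> \<in> carrier GAk" using assms center_subset by blast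
  thus ?thesis using assms by (metis G.m_assoc center_commute)
qed

lemma adele_equiv_trans:
  assumes "adele_equiv g h" "adele_equiv h i" "i \<in> carrier GAk" shows "adele_equiv g i"
proof -
  obtain A \<zeta> k where 1: "det A \<noteq> 0" "\<zeta> \<in> monoid_center GAk" "k \<in> K'"
    "g = diag_emb A \<otimes>\<^bsub>GAk\<^esub> (\<zeta> \<otimes>\<^bsub>GAk\<^esub> (h \<otimes>\<^bsub>GAk\<^esub> k))"
    using assms(1) unfolding adele_equiv_def by blast
  obtain B \<xi> l where 2: "det B \<noteq> 0" "\<xi> \<in> monoid_center GAk" "l \<in> K'"
    "h = diag_emb B \<otimes>\<^bsub>GAk\<^esub> (\<xi> \<otimes>\<^bsub>GAk\<^esub> (i \<otimes>\<^bsub>GAk\<^esub> l))"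
    using assms(2) unfolding adele_equiv_def by blast
  have c: "\<zeta> \<in> carrier GAk" "\<xi> \<in> carrier GAk" "k \<in> carrier GAk" "l \<in> carrier GAk"
    using 1 2 center_subset K'_closed by auto
  have "g = diag_emb (A ** B) \<otimes>\<^bsub>GAk\<^esub> ((\<zeta> \<otimes>\<^bsub>GAk\<^esub> \<xi>) \<otimes>\<^bsub>GAk\<^esub> (i \<otimes>\<^bsub>GAk\<^esub> (l \<otimes>\<^bsub>GAk\<^esub> k)))"
    using c 1(1) 2(1) assms(3) unfolding 1(4) 2(4)
    by (simp add: diag_emb_mult G.m_assoc center_lcomm[OF 1(2)])
  thus ?thesis
    by (rule adele_equivI[rotated 3]) (use 1 2 in \<open>auto simp: det_mul intro: center_mult\<close>)
qed

lemma adele_equiv_sym: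
  assumes "adele_equiv g h" "h \<in> carrier GAk" shows "adele_equiv h g"
proof -
  obtain A \<zeta> k where 1: "det A \<noteq> 0" "\<zeta> \<in> monoid_center GAk" "k \<in> K'"
    "g = diag_emb A \<otimes>\<^bsub>GAk\<^esub> (\<zeta> \<otimes>\<^bsub>GAk\<^esub> (h \<otimes>\<^bsub>GAk\<^esub> k))"
    using assms(1) unfolding adele_equiv_def by blast
  have c: "\<zeta> \<in> carrier GAk" "k \<in> carrier GAk" "diag_emb A \<in> carrier GAk" using 1 center_subset K'_closed by auto
  have i: "inv\<^bsub>GAk\<^esub> \<zeta> \<in> monoid_center GAk" using 1(2) by (rule center_inv)
  have cancel: "inv\<^bsub>GAk\<^esub> a \<otimes>\<^bsub>GAk\<^esub> (a \<otimes>\<^bsub>GAk\<^esub> b) = b" if "a \<in> carrier GAk" "b \<in> carrier GAk" for a b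
    using that by (simp flip: G.m_assoc)
  have g: "g \<in> carrier GAk" using c assms(2) by (simp add: 1(4))
  have "diag_emb (rinv A) \<otimes>\<^bsub>GAk\<^esub> (inv\<^bsub>GAk\<^esub> \<zeta> \<otimes>\<^bsub>GAk\<^esub> (g \<otimes>\<^bsub>GAk\<^esub> inv\<^bsub>GAk\<^esub> k)) =
      inv\<^bsub>GAk\<^esub> \<zeta> \<otimes>\<^bsub>GAk\<^esub> (inv\<^bsub>GAk\<^esub> diag_emb A \<otimes>\<^bsub>GAk\<^esub> (g \<otimes>\<^bsub>GAk\<^esub> inv\<^bsub>GAk\<^esub> k))"
    using c g by (simp add: diag_emb_rinv[OF 1(1)] center_lcomm[OF i])
  also have "\<dots> = h"
    using c assms(2) by (simp add: 1(4) G.m_assoc cancel)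
  finally show ?thesis
    using i 1(3) by (intro adele_equivI[of "rinv A" "inv\<^bsub>GAk\<^esub> \<zeta>" "inv\<^bsub>GAk\<^esub> k"]) (simp_all add: det_rinv 1(1))
qed

lemma adele_equiv_refl: "g \<in> carrier GAk \<Longrightarrow> adele_equiv g g"
  by (rule adele_equivI[of "mat 1" "\<one>\<^bsub>GAk\<^esub>" "\<one>\<^bsub>GAk\<^esub>"]) (simp_all add: center_one)

lemma adele_equiv_diag_emb: "det A \<noteq> 0 \<Longrightarrow> g \<in> carrier GAk \<Longrightarrow> adele_equiv (diag_emb A \<otimes>\<^bsub>GAk\<^esub> g) g"
  by (rule adele_equivI[of A "\<one>\<^bsub>GAk\<^esub>" "\<one>\<^bsub>GAk\<^esub>"]) (simp_all add: center_one)

lemma adele_equiv_center: "\<zeta> \<in> monoid_center GAk \<Longrightarrow> g \<in> carrier GAk \<Longrightarrow> adele_equiv (\<zeta> \<otimes>\<^bsub>GAk\<^esub> g) g"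
  using center_subset by (intro adele_equivI[of "mat 1" \<zeta> "\<one>\<^bsub>GAk\<^esub>"]) auto

lemma adele_equiv_K': "k \<in> K' \<Longrightarrow> g \<in> carrier GAk \<Longrightarrow> adele_equiv (g \<otimes>\<^bsub>GAk\<^esub> k) g"
  using K'_closed by (intro adele_equivI[of "mat 1" "\<one>\<^bsub>GAk\<^esub>" k]) (auto simp: center_one)

subsection \<open>Every double coset has a rational representative at \<open>x\<close>\<close>

text \<open>The principal part at \<open>w\<close> can be removed by a rational function without poles at
  other places except \<open>x\<close>: the polar coefficients are removed one at a time.\<close>

lemma partial_fraction:
  assumes w: "w \<noteq> x"
  shows "vge w (- int n) f \<Longrightarrow> \<exists>r. vge w 0 (f - r) \<and> (\<forall>z. z \<noteq> x \<longrightarrow> z \<noteq> w \<longrightarrow> vge z 0 r)"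
proof (induction n arbitrary: f)
  case 0
  thus ?case by (intro exI[of _ 0]) simp
next
  case (Suc n)
  let ?p = "unif w ^ Suc n"
  have p: "?p \<noteq> 0" "place_val w ?p = int (Suc n)"
    using unif_nz[OF w] by (simp_all add: place_val_power val_unif(1)[OF w] del: power_Suc)
  have "vge w 0 (?p * f)" using Suc.prems p by (simp add: vge_mult_iff del: power_Suc)
  then obtain a where a: "vge w 1 (?p * f - ev s a)" using residue_exists[OF w] by blast
  have "f - ev s a / ?p = (?p * f - ev s a) / ?p" using p(1) by (simp add: field_simps del: power_Suc)
  hence "vge w (- int n) (f - ev s a / ?p)" using a p by (simp add: vge_divide del: power_Suc)
  then obtain r where r: "vge w 0 (f - ev s a / ?p - r)" "\<forall>z. z \<noteq> x \<longrightarrow> z \<noteq> w \<longrightarrow> vge z 0 r"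
    using Suc.IH by blast
  have "vge z 0 (ev s a / ?p)" if "z \<noteq> x" "z \<noteq> w" for z
  proof -
    have "place_val z ?p = 0"
      using unif_nz[OF w] val_unif(2)[OF w that] by (simp add: place_val_power del: power_Suc)
    thus ?thesis using p vge_poly[OF that(1)] by (simp add: vge_divide del: power_Suc)
  qed
  thus ?case using r by (intro exI[of _ "ev s a / ?p + r"]) (auto simp: algebra_simps)
qed

text \<open>At a single place a matrix is made integral without affecting the places other than
  \<open>x\<close>. Column operations make it upper triangular; a diagonal matrix of powers of the
  prime of \<open>w\<close> normalises the diagonal, and the upper right entry is a principal
  part.\<close>

lemma rational_clear:
  assumes w: "w \<noteq> x" and A: "det A \<noteq> 0"
  shows "\<exists>B. det B \<noteq> 0 \<and> (\<forall>z. z \<noteq> x \<longrightarrow> z \<noteq> w \<longrightarrow> B \<in> GO z) \<and> B ** A \<in> GO w"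
proof -
  let ?P = "\<lambda>A. \<exists>B. det B \<noteq> 0 \<and> (\<forall>z. z \<noteq> x \<longrightarrow> z \<noteq> w \<longrightarrow> B \<in> GO z) \<and> B ** A \<in> GO w"
  have right: "?P A" if k: "k \<in> GO w" and P: "?P (A ** k)" for A k
  proof -
    obtain B where B: "det B \<noteq> 0" "\<forall>z. z \<noteq> x \<longrightarrow> z \<noteq> w \<longrightarrow> B \<in> GO z" "B ** (A ** k) \<in> GO w"
      using P by blast
    have "B ** A = B ** (A ** k) ** rinv k"
      using GO_det(1)[OF k] by (simp add: matrix_mul_assoc[symmetric] rinv_right)
    hence "B ** A \<in> GO w" using GO_mult[OF B(3) GO_rinv[OF k]] by simp
    thus ?thesis using B by blast
  qed
  have upper: "?P (mk a b 0 d)" if ad: "a \<noteq> 0" "d \<noteq> 0" for a b d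
  proof -
    define i where "i = place_val w a"
    define j where "j = place_val w d"
    define p where "p = unif w powi (- i)"
    define q where "q = unif w powi (- j)"
    have pq: "p \<noteq> 0" "q \<noteq> 0" "place_val w p = - i" "place_val w q = - j"
      using unif_nz[OF w] val_unif(1)[OF w] by (simp_all add: p_def q_def place_val_powi)
    have pq0: "place_val z p = 0" "place_val z q = 0" if "z \<noteq> x" "z \<noteq> w" for z
      using unif_nz[OF w] val_unif(2)[OF w that] by (simp_all add: p_def q_def place_val_powi)
    have "vge w (- int (nat (- place_val w (p * b / (q * d))))) (p * b / (q * d))"
      unfolding vge_def by linarith
    then obtain r where r: "vge w 0 (p * b / (q * d) - r)" "\<forall>z. z \<noteq> x \<longrightarrow> z \<noteq> w \<longrightarrow> vge z 0 r"
      using partial_fraction[OF w] by blast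
    define B where "B = mk p (- r * q) 0 q"
    have "det B \<noteq> 0" using pq by (simp add: B_def)
    moreover have "B \<in> GO z" if "z \<noteq> x" "z \<noteq> w" for z
      using pq pq0[OF that] r(2) that
      by (auto simp: B_def mk_in_GO_iff place_val_mult vge_def[of z 0 p] vge_def[of z 0 q])
    moreover have "B ** mk a b 0 d \<in> GO w"
    proof -
      have "place_val w (p * a) = 0" "place_val w (q * d) = 0"
        using pq ad by (simp_all add: place_val_mult i_def j_def)
      moreover have "p * b - r * q * d = (p * b / (q * d) - r) * (q * d)"
        using pq ad by (simp add: field_simps)
      ultimately show ?thesis
        using pq ad r(1) by (auto simp: B_def mk_in_GO_iff place_val_mult vge_def[of w 0 "p * a"]
            vge_def[of w 0 "q * d"] vge_mult_0')
    qed
    ultimately show ?thesis by blast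
  qed
  have lower: "?P (mk a b c d)" if "a * d - b * c \<noteq> 0" "d \<noteq> 0" "vge w 0 (c / d)" for a b c d
  proof (rule right)
    show k: "mk 1 0 (- (c / d)) 1 \<in> GO w" using that(3) by (simp add: mk_in_GO_iff)
    have "a - b * (c / d) \<noteq> 0" using that by (simp add: field_simps)
    moreover have "mk a b c d ** mk 1 0 (- (c / d)) 1 = mk (a - b * (c / d)) b 0 d"
      using that by simp
    ultimately show "?P (mk a b c d ** mk 1 0 (- (c / d)) 1)" using upper that(2) by metis
  qed
  obtain a b c d where A': "A = mk a b c d" by (rule mk_cases)
  show ?thesis
  proof (cases "d \<noteq> 0 \<and> vge w 0 (c / d)")
    case True
    thus ?thesis using lower A by (simp add: A')
  next
    case False
    have "c \<noteq> 0" using False A by (auto simp: A')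
    moreover have "vge w 0 (d / c)"
      using False \<open>c \<noteq> 0\<close> by (cases "d = 0") (auto simp: vge_def place_val_divide)
    moreover have "b * c - a * d \<noteq> 0" using A by (auto simp: A')
    ultimately have "?P (mk b a d c)" by (intro lower)
    moreover have "A ** mk 0 1 1 0 = mk b a d c" by (simp add: A')
    moreover have "mk 0 1 1 0 \<in> GO w" by (simp add: mk_in_GO_iff)
    ultimately show ?thesis using right[of "mk 0 1 1 0" A] by simp
  qed
qed

lemma clear_places:
  assumes "finite S" "g \<in> carrier GAk" "{z. z \<noteq> x \<and> component g z \<notin> Kz z} = S"
  shows "\<exists>B. det B \<noteq> 0 \<and> (\<forall>z. z \<noteq> x \<longrightarrow> component (diag_emb B \<otimes>\<^bsub>GAk\<^esub> g) z \<in> Kz z)"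
  using assms
proof (induction S arbitrary: g rule: finite_induct)
  case empty
  thus ?case by (intro exI[of _ "mat 1"]) auto
next
  case (insert w S)
  hence w: "w \<noteq> x" by auto
  obtain A k where A: "det A \<noteq> 0" "k \<in> local_congruence w" "component g w = loc w A \<otimes>\<^bsub>Gz w\<^esub> k"
    using local_approx[OF component_in_Gz[OF insert.prems(1)]] by blast
  have k: "k \<in> Kz w" "k \<in> carrier (Gz w)" using A(2) local_congruence_subset Kz_subset by auto
  obtain B where B: "det B \<noteq> 0" "\<forall>z. z \<noteq> x \<longrightarrow> z \<noteq> w \<longrightarrow> B \<in> GO z" "B ** A \<in> GO w"
    using rational_clear[OF w A(1)] by blast
  interpret L: group "Gz w" by (rule group_Gz)
  define g' where "g' = diag_emb B \<otimes>\<^bsub>GAk\<^esub> g"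
  have g': "g' \<in> carrier GAk" using B insert.prems by (simp add: g'_def)
  have "component g' w = loc w (B ** A) \<otimes>\<^bsub>Gz w\<^esub> k"
    using A B k by (simp add: g'_def loc_mult L.m_assoc)
  hence w_ok: "component g' w \<in> Kz w"
    using subgroup.m_closed[OF Kz_subgroup _ k(1)] B by simp
  have other: "component g' z \<in> Kz z \<longleftrightarrow> component g z \<in> Kz z" if "z \<noteq> x" "z \<noteq> w" for z
  proof -
    interpret Lz: group "Gz z" by (rule group_Gz)
    have lB: "loc z B \<in> Kz z" using B(2) that by simp
    have eq1: "component g z = inv\<^bsub>Gz z\<^esub> loc z B \<otimes>\<^bsub>Gz z\<^esub> component g' z"
      using component_in_Gz[OF insert.prems(1), of z] B(1) by (simp add: g'_def flip: Lz.m_assoc)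
    have eq2: "component g' z = loc z B \<otimes>\<^bsub>Gz z\<^esub> component g z" by (simp add: g'_def)
    show ?thesis
    proof
      assume "component g' z \<in> Kz z"
      thus "component g z \<in> Kz z"
        unfolding eq1 by (rule subgroup.m_closed[OF Kz_subgroup subgroup.m_inv_closed[OF Kz_subgroup lB]])
    next
      assume "component g z \<in> Kz z"
      thus "component g' z \<in> Kz z"
        unfolding eq2 by (rule subgroup.m_closed[OF Kz_subgroup lB])
    qed
  qed
  have "{z. z \<noteq> x \<and> component g' z \<notin> Kz z} = {z. z \<noteq> x \<and> component g z \<notin> Kz z} - {w}"
  proof (rule Set.set_eqI)
    fix z show "z \<in> {z. z \<noteq> x \<and> component g' z \<notin> Kz z} \<longleftrightarrow>
        z \<in> {z. z \<noteq> x \<and> component g z \<notin> Kz z} - {w}"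
      using w_ok other[of z] by (cases "z = w"; cases "z = x") simp_all
  qed
  hence "{z. z \<noteq> x \<and> component g' z \<notin> Kz z} = S"
    using insert.prems(2) insert.hyps(2) by simp
  then obtain C where C: "det C \<noteq> 0" "\<forall>z. z \<noteq> x \<longrightarrow> component (diag_emb C \<otimes>\<^bsub>GAk\<^esub> g') z \<in> Kz z"
    using insert.IH[OF g'] by blast
  moreover have "diag_emb C \<otimes>\<^bsub>GAk\<^esub> g' = diag_emb (C ** B) \<otimes>\<^bsub>GAk\<^esub> g"
    using B C insert.prems by (simp add: g'_def diag_emb_mult G.m_assoc)
  ultimately show ?case using B by (intro exI[of _ "C ** B"]) (simp add: det_mul)
qed

lemma center_at: "c \<noteq> 0 \<Longrightarrow> local_emb y (scalar_mat c) \<in> monoid_center GAk"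
proof (rule center_intro)
  show "\<exists>d. component (local_emb y (scalar_mat c)) z = loc z (scalar_mat d)" if "c \<noteq> 0" for z
    using that by (auto simp: component_local_emb scalar_mat_1 intro: exI[of _ c] exI[of _ 1])
qed simp

text \<open>An arithmetic matrix at \<open>x\<close> is a global matrix times an element of the compact
  groups at the other places.\<close>

lemma local_emb_rat_equiv:
  assumes "rat_equiv x A B" "det B \<noteq> 0" shows "adele_equiv (local_emb x A) (local_emb x B)"
proof -
  obtain \<gamma> c k where *: "\<gamma> \<in> arith_group x" "c \<noteq> 0" "k \<in> GO1 x" "A = \<gamma> ** scalar_mat c ** B ** k"
    using assms(1) by (auto simp: rat_equiv_def)
  have \<gamma>: "det \<gamma> \<noteq> 0" using arith_group_det_nz *(1) .
  define \<kappa> where "\<kappa> = assemble (\<lambda>z. if z = x then loc x k else inv\<^bsub>Gz z\<^esub> loc z \<gamma>)"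
  have "\<kappa> \<in> K'"
    using * by (simp add: \<kappa>_def congruence_subgroup_iff arith_group_def subgroup.m_inv_closed[OF Kz_subgroup])
  moreover have "local_emb x A = diag_emb \<gamma> \<otimes>\<^bsub>GAk\<^esub> (local_emb x (scalar_mat c) \<otimes>\<^bsub>GAk\<^esub> (local_emb x B \<otimes>\<^bsub>GAk\<^esub> \<kappa>))"
  proof (rule component_eqI)
    fix z :: "'k place"
    interpret L: group "Gz x" by (rule group_Gz)
    interpret Lz: group "Gz z" by (rule group_Gz)
    have k: "det k \<noteq> 0" using GO_det(1) GO1_subset_GO *(3) by blast
    show "component (local_emb x A) z = component (diag_emb \<gamma> \<otimes>\<^bsub>GAk\<^esub> (local_emb x (scalar_mat c) \<otimes>\<^bsub>GAk\<^esub> (local_emb x B \<otimes>\<^bsub>GAk\<^esub> \<kappa>))) z"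
      using \<gamma> *(2) assms(2) k
      by (cases "z = x") (simp_all add: component_local_emb \<kappa>_def *(4) loc_mult L.m_assoc)
  qed
  ultimately show ?thesis using adele_equivI \<gamma> center_at *(2) by blast
qed

text \<open>The projective line minus \<open>x\<close> has class number one, for \<open>GL\<^sub>2\<close>:
  after clearing the finitely many bad places only the component at \<open>x\<close> remains.\<close>

lemma adele_equiv_rep:
  assumes g: "g \<in> carrier GAk" shows "\<exists>v\<in>vertices. adele_equiv g (local_emb x (vertex_mat v))"
proof -
  have "finite {z. z \<noteq> x \<and> component g z \<notin> Kz z}"
    by (rule finite_subset[of _ "{z. component g z \<notin> Kz z}"]) (use g in \<open>auto simp: GA_iff\<close>)
  then obtain B where B: "det B \<noteq> 0" "\<forall>z. z \<noteq> x \<longrightarrow> component (diag_emb B \<otimes>\<^bsub>GAk\<^esub> g) z \<in> Kz z"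
    using clear_places g by blast
  define g' where "g' = diag_emb B \<otimes>\<^bsub>GAk\<^esub> g"
  have g': "g' \<in> carrier GAk" using B g by (simp add: g'_def)
  obtain A k where A: "det A \<noteq> 0" "k \<in> local_congruence x" "component g' x = loc x A \<otimes>\<^bsub>Gz x\<^esub> k"
    using local_approx[OF component_in_Gz[OF g']] by blast
  define \<kappa> where "\<kappa> = assemble (\<lambda>z. if z = x then k else component g' z)"
  have "\<kappa> \<in> K'" using A B by (simp add: \<kappa>_def congruence_subgroup_iff g'_def)
  have "g' = local_emb x A \<otimes>\<^bsub>GAk\<^esub> \<kappa>"
  proof (rule component_eqI)
    fix z :: "'k place"
    interpret L: group "Gz z" by (rule group_Gz)
    show "component g' z = component (local_emb x A \<otimes>\<^bsub>GAk\<^esub> \<kappa>) z"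
      using A component_in_Gz[OF g'] by (simp add: component_local_emb \<kappa>_def)
  qed
  hence "adele_equiv g' (local_emb x A)" using adele_equiv_K'[OF \<open>\<kappa> \<in> K'\<close>, of "local_emb x A"] A by simp
  moreover have "adele_equiv g g'" using adele_equiv_sym[OF adele_equiv_diag_emb[OF B(1) g] g] by (simp add: g'_def)
  moreover obtain v where v: "v \<in> vertices" "rat_equiv x A (vertex_mat v)" using normal_form[OF A(1)] by blast
  ultimately show ?thesis
    using local_emb_rat_equiv[OF v(2) det_vertex_mat] A(1) det_vertex_mat by (meson adele_equiv_trans local_emb_carrier)
qed

subsection \<open>Uniqueness of the representative\<close>

text \<open>Every divisor outside \<open>x\<close> is principal there.\<close>

lemma principal_idele:
  assumes "\<And>z. c z \<noteq> 0" "finite {z. place_val z (c z) \<noteq> 0}"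
  shows "\<exists>f. f \<noteq> 0 \<and> (\<forall>z. z \<noteq> x \<longrightarrow> place_val z f = place_val z (c z))"
proof -
  define S where "S = {z. z \<noteq> x \<and> place_val z (c z) \<noteq> 0}"
  have S: "finite S" using assms(2) by (rule finite_subset[rotated]) (auto simp: S_def)
  define f where "f = (\<Prod>w\<in>S. unif w powi place_val w (c w))"
  have nz: "unif w powi place_val w (c w) \<noteq> 0" if "w \<in> S" for w
    using that unif_nz by (simp add: S_def)
  have "f \<noteq> 0" using nz S by (simp add: f_def)
  moreover have "place_val z f = place_val z (c z)" if z: "z \<noteq> x" for z
  proof -
    have "place_val z f = (\<Sum>w\<in>S. place_val z (unif w powi place_val w (c w)))"
      unfolding f_def using S nz by (rule place_val_prod)
    also have "\<dots> = (\<Sum>w\<in>S. if w = z then place_val z (c z) else 0)"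
      using val_unif(1,2) z unif_nz by (intro sum.cong) (auto simp: S_def place_val_powi)
    also have "\<dots> = place_val z (c z)" using S z by (auto simp: S_def sum.delta)
    finally show ?thesis .
  qed
  ultimately show ?thesis by blast
qed

lemma scalar_mat_val_GO:
  assumes "place_val z f = place_val z c" "f \<noteq> 0" "c \<noteq> 0" "A ** scalar_mat c \<in> GO z"
  shows "A ** scalar_mat f \<in> GO z"
proof -
  have "A ** scalar_mat f = A ** scalar_mat c ** scalar_mat (f / c)"
    using assms by (simp add: matrix_mul_assoc[symmetric] scalar_mat_mult)
  moreover have "scalar_mat (f / c) \<in> GO z"
    using assms by (simp add: scalar_mat_def mk_in_GO_iff place_val_mult place_val_divide vge_def)
  ultimately show ?thesis using GO_mult assms(4) by simp
qed

text \<open>Outside \<open>x\<close> the global matrix times the local scalars is integral. A single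
  rational function has the valuations of these scalars, and multiplied by it the global matrix
  becomes arithmetic; the rest of the relation happens at \<open>x\<close>.\<close>

lemma adele_equiv_imp_rat_equiv:
  assumes "adele_equiv (local_emb x A) (local_emb x B)" "det A \<noteq> 0" "det B \<noteq> 0" shows "rat_equiv x A B"
proof -
  obtain \<gamma> \<zeta> k where *: "det \<gamma> \<noteq> 0" "\<zeta> \<in> monoid_center GAk" "k \<in> K'"
    "local_emb x A = diag_emb \<gamma> \<otimes>\<^bsub>GAk\<^esub> (\<zeta> \<otimes>\<^bsub>GAk\<^esub> (local_emb x B \<otimes>\<^bsub>GAk\<^esub> k))"
    using assms(1) unfolding adele_equiv_def by blast
  have "\<forall>z. \<exists>c u. c \<noteq> 0 \<and> u \<in> carrier (completion z) \<and>
    mk u \<zero>\<^bsub>completion z\<^esub> \<zero>\<^bsub>completion z\<^esub> u \<in> local_congruence z \<and>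
    component \<zeta> z = loc z (scalar_mat c) \<otimes>\<^bsub>Gz z\<^esub> mk u \<zero>\<^bsub>completion z\<^esub> \<zero>\<^bsub>completion z\<^esub> u"
    using center_rational[OF *(2)] by meson
  then obtain c u where c: "\<And>z. c z \<noteq> 0" "\<And>z. u z \<in> carrier (completion z)"
    "\<And>z. mk (u z) \<zero>\<^bsub>completion z\<^esub> \<zero>\<^bsub>completion z\<^esub> (u z) \<in> local_congruence z"
    "\<And>z. component \<zeta> z = loc z (scalar_mat (c z)) \<otimes>\<^bsub>Gz z\<^esub> mk (u z) \<zero>\<^bsub>completion z\<^esub> \<zero>\<^bsub>completion z\<^esub> (u z)"
    by metis
  define U where "U z = mk (u z) \<zero>\<^bsub>completion z\<^esub> \<zero>\<^bsub>completion z\<^esub> (u z)" for z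
  have U1: "U z \<in> local_congruence z" for z using c(3) by (simp add: U_def)
  have U2: "U z \<in> Kz z" for z using U1 local_congruence_subset by blast
  have U: "U z \<in> local_congruence z" "U z \<in> Kz z" "U z \<in> carrier (Gz z)" for z
    by (rule U1 U2 Kz_subset[OF U2])+
  have k1: "component k z \<in> Kz z" for z by (rule congruence_subgroup_Kz[OF *(3)])
  have kz: "component k z \<in> Kz z" "component k z \<in> carrier (Gz z)" for z
    by (rule k1 Kz_subset[OF k1])+
  have comp: "component (local_emb x A) z =
      loc z \<gamma> \<otimes>\<^bsub>Gz z\<^esub> ((loc z (scalar_mat (c z)) \<otimes>\<^bsub>Gz z\<^esub> U z) \<otimes>\<^bsub>Gz z\<^esub> (component (local_emb x B) z \<otimes>\<^bsub>Gz z\<^esub> component k z))" for z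
    by (subst *(4)) (simp add: c(4) U_def)
  have GOz: "\<gamma> ** scalar_mat (c z) \<in> GO z" if "z \<noteq> x" for z
  proof -
    interpret L: group "Gz z" by (rule group_Gz)
    have "\<one>\<^bsub>Gz z\<^esub> = loc z (\<gamma> ** scalar_mat (c z)) \<otimes>\<^bsub>Gz z\<^esub> (U z \<otimes>\<^bsub>Gz z\<^esub> component k z)"
      using comp[of z] that *(1) c(1)[of z] U(3)[of z] kz(2)[of z]
      by (simp add: component_local_emb loc_mult L.m_assoc)
    hence "loc z (\<gamma> ** scalar_mat (c z)) = inv\<^bsub>Gz z\<^esub> (U z \<otimes>\<^bsub>Gz z\<^esub> component k z)"
      using *(1) c(1)[of z] U(3)[of z] kz(2)[of z]
      by (intro L.inv_equality[symmetric]) (simp_all add: det_mul)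
    moreover have "inv\<^bsub>Gz z\<^esub> (U z \<otimes>\<^bsub>Gz z\<^esub> component k z) \<in> Kz z"
      by (intro subgroup.m_inv_closed[OF Kz_subgroup] subgroup.m_closed[OF Kz_subgroup] U kz)
    ultimately show ?thesis using loc_Kz by metis
  qed
  have "finite {z. place_val z (c z) \<noteq> 0}"
  proof (rule finite_subset)
    show "{z. place_val z (c z) \<noteq> 0} \<subseteq> insert x {z. place_val z (det \<gamma>) \<noteq> 0}"
    proof
      fix z assume z: "z \<in> {z. place_val z (c z) \<noteq> 0}"
      show "z \<in> insert x {z. place_val z (det \<gamma>) \<noteq> 0}"
        using GO_det(2)[OF GOz, of z] z *(1) c(1)[of z] by (auto simp: det_mul place_val_mult)
    qed
  qed (use finite_support[OF *(1)] in simp)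
  then obtain f where f: "f \<noteq> 0" "\<forall>z. z \<noteq> x \<longrightarrow> place_val z f = place_val z (c z)"
    using principal_idele[of c] c(1) by blast
  have \<gamma>f: "\<gamma> ** scalar_mat f \<in> arith_group x"
    unfolding arith_group_def using scalar_mat_val_GO GOz f c(1) by blast
  define M where "M = \<gamma> ** scalar_mat (c x) ** B"
  have M: "det M \<noteq> 0" using *(1) c(1)[of x] assms(3) by (simp add: M_def det_mul)
  interpret L: group "Gz x" by (rule group_Gz)
  have com: "U x \<otimes>\<^bsub>Gz x\<^esub> (loc x B \<otimes>\<^bsub>Gz x\<^esub> component k x) = loc x B \<otimes>\<^bsub>Gz x\<^esub> (U x \<otimes>\<^bsub>Gz x\<^esub> component k x)"
    using scalar_commute[OF c(2), of "loc x B" x] assms(3) U(3)[of x] kz(2)[of x]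
    by (simp add: U_def flip: L.m_assoc)
  have "loc x A = loc x M \<otimes>\<^bsub>Gz x\<^esub> (U x \<otimes>\<^bsub>Gz x\<^esub> component k x)"
    using comp[of x] *(1) c(1)[of x] U(3)[of x] kz(2)[of x] assms(3)
    by (simp add: component_local_emb loc_mult L.m_assoc com M_def)
  hence "loc x (rinv M ** A) = U x \<otimes>\<^bsub>Gz x\<^esub> component k x"
    using M U(3)[of x] kz(2)[of x] by (simp add: loc_mult loc_rinv flip: L.m_assoc)
  moreover have "U x \<otimes>\<^bsub>Gz x\<^esub> component k x \<in> local_congruence x"
    using *(3) by (intro subgroup.m_closed[OF local_congruence_subgroup] U) (simp add: congruence_subgroup_iff)
  ultimately have "rinv M ** A \<in> GO1 x" using loc_congruence by metis
  moreover have "A = (\<gamma> ** scalar_mat f) ** scalar_mat (c x / f) ** B ** (rinv M ** A)"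
  proof -
    have "(\<gamma> ** scalar_mat f) ** scalar_mat (c x / f) ** B = M"
      using f by (simp add: M_def matrix_mul_assoc[symmetric]) (simp add: matrix_mul_assoc scalar_mat_mult)
    thus ?thesis by (simp add: rinv_cancel(1)[OF M])
  qed
  ultimately show ?thesis
    unfolding rat_equiv_def using \<gamma>f f(1) c(1)[of x]
    by (intro bexI[of _ "\<gamma> ** scalar_mat f"] exI[of _ "c x / f"] exI[of _ "rinv M ** A"] conjI) simp_all
qed

definition vertex :: "'k adele^2^2 \<Rightarrow> nat \<times> 'k option" where
  "vertex g = (SOME v. v \<in> vertices \<and> adele_equiv g (local_emb x (vertex_mat v)))"

lemma vertex: assumes "g \<in> carrier GAk" shows "vertex g \<in> vertices" "adele_equiv g (local_emb x (vertex_mat (vertex g)))"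
proof -
  have "\<exists>v. v \<in> vertices \<and> adele_equiv g (local_emb x (vertex_mat v))" using adele_equiv_rep[OF assms] by blast
  hence "vertex g \<in> vertices \<and> adele_equiv g (local_emb x (vertex_mat (vertex g)))" unfolding vertex_def by (rule someI_ex)
  thus "vertex g \<in> vertices" "adele_equiv g (local_emb x (vertex_mat (vertex g)))" by auto
qed

lemma vertex_eqI:
  assumes "g \<in> carrier GAk" "v \<in> vertices" "adele_equiv g (local_emb x (vertex_mat v))" shows "vertex g = v"
proof (rule normal_form_unique[OF vertex(1)[OF assms(1)] assms(2)])
  have "adele_equiv (local_emb x (vertex_mat (vertex g))) (local_emb x (vertex_mat v))"
    by (rule adele_equiv_trans[OF adele_equiv_sym[OF vertex(2)[OF assms(1)]] assms(3)]) (simp_all add: det_vertex_mat)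
  thus "rat_equiv x (vertex_mat (vertex g)) (vertex_mat v)" by (rule adele_equiv_imp_rat_equiv[OF _ det_vertex_mat det_vertex_mat])
qed

lemma vertex_vertex_mat: "v \<in> vertices \<Longrightarrow> vertex (local_emb x (vertex_mat v)) = v"
  by (rule vertex_eqI) (simp_all add: det_vertex_mat adele_equiv_refl)

lemma vertex_cong: "g \<in> carrier GAk \<Longrightarrow> h \<in> carrier GAk \<Longrightarrow> adele_equiv g h \<Longrightarrow> vertex g = vertex h"
  by (rule vertex_eqI[OF _ vertex(1)]) (auto intro: adele_equiv_trans[OF _ vertex(2)] simp: det_vertex_mat)

text \<open>The invariance conditions say that a function depends only on the double coset, that is, on the
  vertex.\<close>

lemma automorphic_iff:
  "f \<in> automorphic K' \<longleftrightarrow> (\<exists>F. f = (\<lambda>g. if g \<in> carrier GAk then F (vertex g) else 0)) \<and>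
     (\<exists>C N :: real. \<forall>g\<in>carrier GAk. cmod (f g) \<le> C * height g powr N)"
proof
  assume f: "f \<in> automorphic K'"
  have zero: "\<And>g. g \<notin> carrier GAk \<Longrightarrow> f g = 0" using f by (simp add: automorphic_def)
  have inv: "f g = f h" if gh: "adele_equiv g h" and h: "h \<in> carrier GAk" for g h
  proof -
    obtain A \<zeta> k where *: "det A \<noteq> 0" "\<zeta> \<in> monoid_center GAk" "k \<in> K'"
      "g = diag_emb A \<otimes>\<^bsub>GAk\<^esub> (\<zeta> \<otimes>\<^bsub>GAk\<^esub> (h \<otimes>\<^bsub>GAk\<^esub> k))"
      using gh unfolding adele_equiv_def by blast
    have c: "k \<in> carrier GAk" "\<zeta> \<in> carrier GAk" "diag_emb A \<in> GF"
      using * K'_closed center_subset by (auto simp: GF_eq)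
    have "f g = f (\<zeta> \<otimes>\<^bsub>GAk\<^esub> (h \<otimes>\<^bsub>GAk\<^esub> k))"
      using f c h unfolding *(4) automorphic_def by simp
    also have "\<dots> = f (h \<otimes>\<^bsub>GAk\<^esub> k)" using f c *(2) h unfolding automorphic_def by simp
    also have "\<dots> = f h" using f c *(3) h unfolding automorphic_def by simp
    finally show ?thesis .
  qed
  have "f = (\<lambda>g. if g \<in> carrier GAk then f (local_emb x (vertex_mat (vertex g))) else 0)"
  proof
    fix g
    show "f g = (if g \<in> carrier GAk then f (local_emb x (vertex_mat (vertex g))) else 0)"
      using zero[of g] inv[OF vertex(2) local_emb_carrier[OF det_vertex_mat], of g] by (cases "g \<in> carrier GAk") simp_all
  qed
  thus "(\<exists>F. f = (\<lambda>g. if g \<in> carrier GAk then F (vertex g) else 0)) \<and>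
     (\<exists>C N :: real. \<forall>g\<in>carrier GAk. cmod (f g) \<le> C * height g powr N)"
    using f by (intro conjI exI[of _ "\<lambda>v. f (local_emb x (vertex_mat v))"]) (auto simp: automorphic_def)
next
  assume "(\<exists>F. f = (\<lambda>g. if g \<in> carrier GAk then F (vertex g) else 0)) \<and>
     (\<exists>C N :: real. \<forall>g\<in>carrier GAk. cmod (f g) \<le> C * height g powr N)"
  then obtain F where F: "f = (\<lambda>g. if g \<in> carrier GAk then F (vertex g) else 0)"
    and gr: "\<exists>C N :: real. \<forall>g\<in>carrier GAk. cmod (f g) \<le> C * height g powr N" by blast
  show "f \<in> automorphic K'"
    unfolding automorphic_def
  proof (intro CollectI conjI ballI allI impI gr)
    show "f g = 0" if "g \<notin> carrier GAk" for g using that by (simp add: F)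
  next
    fix \<gamma> g :: "'k adele^2^2" assume "\<gamma> \<in> GF" "g \<in> carrier GAk"
    then obtain A where A: "\<gamma> = diag_emb A" "det A \<noteq> 0" by (auto simp: GF_eq)
    have "vertex (diag_emb A \<otimes>\<^bsub>GAk\<^esub> g) = vertex g"
      using A \<open>g \<in> carrier GAk\<close> by (intro vertex_cong adele_equiv_diag_emb) auto
    thus "f (\<gamma> \<otimes>\<^bsub>GAk\<^esub> g) = f g" using A \<open>g \<in> carrier GAk\<close> by (simp add: F)
  next
    fix \<zeta> g :: "'k adele^2^2" assume *: "\<zeta> \<in> monoid_center GAk" "g \<in> carrier GAk"
    have c: "\<zeta> \<in> carrier GAk" using * center_subset by blast
    have "vertex (\<zeta> \<otimes>\<^bsub>GAk\<^esub> g) = vertex g" using * c by (intro vertex_cong adele_equiv_center) auto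
    thus "f (\<zeta> \<otimes>\<^bsub>GAk\<^esub> g) = f g" using * c by (simp add: F)
  next
    fix k g :: "'k adele^2^2" assume *: "k \<in> K'" "g \<in> carrier GAk"
    have c: "k \<in> carrier GAk" using * K'_closed by blast
    have "vertex (g \<otimes>\<^bsub>GAk\<^esub> k) = vertex g" using * c by (intro vertex_cong adele_equiv_K') auto
    thus "f (g \<otimes>\<^bsub>GAk\<^esub> k) = f g" using * c by (simp add: F)
  qed
qed

end

section \<open>Hecke cosets\<close>

context coord
begin

interpretation G: group GAk by (rule group_GA)

interpretation K: subgroup K' GAk by (rule congruence_subgroup_subgroup)

lemma unif_matrix_loc: "unif_matrix y \<pi> = loc y (mk \<pi> 0 0 1)"
  by (simp add: unif_matrix_def loc_def vec_eq_iff forall_2)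

lemma local_emb_in_K': "y \<noteq> x \<Longrightarrow> A \<in> GO y \<Longrightarrow> local_emb y A \<in> K'"
  by (auto simp: congruence_subgroup_iff component_local_emb subgroup.one_closed[OF local_congruence_subgroup])

text \<open>Row reduction over the residue field of \<open>y\<close>: the last column of \<open>A\<close>
  determines the coset.\<close>

lemma hecke_rational:
  assumes y: "y \<noteq> x" and \<pi>: "uniformizer y \<pi>" and A: "A \<in> GO y"
  shows "\<exists>i\<in>hecke_index y. rinv (hecke_mat y i) ** A ** mk \<pi> 0 0 1 \<in> GO y"
proof -
  let ?p = "unif y"
  have p: "?p \<noteq> 0" "place_val y ?p = 1" using unif_nz[OF y] val_unif(1)[OF y] by auto
  have \<pi>: "\<pi> \<noteq> 0" "place_val y \<pi> = 1" using \<pi> by (auto simp: uniformizer_def)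
  obtain a b c d where A': "A = mk a b c d" by (rule mk_cases)
  have int: "vge y 0 a" "vge y 0 b" "vge y 0 c" "vge y 0 d" using A by (auto simp: A' mk_in_GO_iff)
  have det: "det A \<noteq> 0" "place_val y (det A) = 0" using A by (auto simp: GO_def)
  have GOI: "rinv (hecke_mat y i) ** A ** mk \<pi> 0 0 1 \<in> GO y"
    if "rinv (hecke_mat y i) ** A ** mk \<pi> 0 0 1 = mk a1 a2 a3 a4" "vge y 0 a1" "vge y 0 a2" "vge y 0 a3" "vge y 0 a4"
    for i a1 a2 a3 a4
  proof -
    have "det (rinv (hecke_mat y i) ** A ** mk \<pi> 0 0 1) = inverse ?p * det A * \<pi>"
      using p by (simp add: det_mul det_rinv det_hecke_mat)
    moreover have "inverse ?p * det A * \<pi> \<noteq> 0" "place_val y (inverse ?p * det A * \<pi>) = 0"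
      using p \<pi> det by (simp_all add: place_val_mult)
    ultimately show ?thesis using that unfolding GO_def by (simp add: forall_2)
  qed
  have q: "vge y 0 (\<pi> / ?p)" "vge y 0 \<pi>" using p \<pi> by (simp_all add: vge_divide) (simp_all add: vge_def)
  show ?thesis
  proof (cases "vge y 1 d")
    case True
    have eq: "rinv (hecke_mat y None) ** A ** mk \<pi> 0 0 1 = mk (a * \<pi>) b (c * (\<pi> / ?p)) (d / ?p)"
      using p by (simp add: hecke_mat_def rinv_mk A')
    have "vge y 0 (d / ?p)" using True p by (simp add: vge_divide)
    hence "rinv (hecke_mat y None) ** A ** mk \<pi> 0 0 1 \<in> GO y"
      by (rule GOI[OF eq vge_mult_0[OF int(1) q(2)] int(2) vge_mult_0[OF int(3) q(1)]])
    thus ?thesis by (auto simp: hecke_index_def)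
  next
    case False
    hence d: "d \<noteq> 0" "place_val y d = 0" using int by (auto simp: vge_def)
    have "vge y 0 (b / d)" using int d by (simp add: vge_divide)
    then obtain e where e: "e \<in> small_polys (place_degree y)" "vge y 1 (b / d - ev s e)"
      using residue_exists[OF y] place_degree_eq[OF y] by auto
    have eq: "rinv (hecke_mat y (Some e)) ** A ** mk \<pi> 0 0 1 =
        mk ((a - ev s e * c) * (\<pi> / ?p)) ((b / d - ev s e) * d / ?p) (c * \<pi>) d"
      using p d by (simp add: hecke_mat_def rinv_mk A' field_simps)
    have "vge y 1 ((b / d - ev s e) * d)" by (rule vge_mult_0'[OF e(2) int(4)])
    hence "vge y 0 ((b / d - ev s e) * d / ?p)" using p by (subst vge_divide) simp_all
    moreover have "vge y 0 ((a - ev s e * c) * (\<pi> / ?p))"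
      by (rule vge_mult_0[OF vge_diff[OF int(1) vge_mult_0[OF vge_poly[OF y] int(3)]] q(1)])
    ultimately have "rinv (hecke_mat y (Some e)) ** A ** mk \<pi> 0 0 1 \<in> GO y"
      using GOI[OF eq _ _ vge_mult_0[OF int(3) q(2)] int(4)] by blast
    thus ?thesis using e by (auto simp: hecke_index_def)
  qed
qed

text \<open>A matrix congruent to the identity can be moved past \<open>diag(\<pi>, 1)\<close>, because its
  upper right entry is divisible by \<open>\<pi>\<close>.\<close>

lemma conj_uniformizer:
  assumes \<pi>: "uniformizer y \<pi>" and \<kappa>: "\<kappa> \<in> local_congruence y"
  shows "\<exists>\<kappa>'\<in>Kz y. \<kappa> \<otimes>\<^bsub>Gz y\<^esub> loc y (mk \<pi> 0 0 1) = loc y (mk \<pi> 0 0 1) \<otimes>\<^bsub>Gz y\<^esub> \<kappa>'"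
proof -
  interpret C: cring "completion y" by (rule cring_completion)
  let ?c = "completion y" and ?\<iota> = "to_completion y"
  have \<pi>: "\<pi> \<noteq> 0" "place_val y \<pi> = 1" using \<pi> by (auto simp: uniformizer_def)
  obtain a b c d where k: "\<kappa> = mk a b c d" by (rule mk_cases)
  have k1: "cge y 1 b" "cge y 1 c" using \<kappa> by (auto simp: k local_congruence_iff)
  have "\<kappa> \<in> Kz y" using \<kappa> local_congruence_subset by blast
  hence int: "cge y 0 a" "cge y 0 d"
    and det: "a \<otimes>\<^bsub>?c\<^esub> d \<ominus>\<^bsub>?c\<^esub> b \<otimes>\<^bsub>?c\<^esub> c \<noteq> \<zero>\<^bsub>?c\<^esub>"
     "completion_val y (a \<otimes>\<^bsub>?c\<^esub> d \<ominus>\<^bsub>?c\<^esub> b \<otimes>\<^bsub>?c\<^esub> c) = 0"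
    unfolding k Kz_iff by blast+
  have cl: "a \<in> carrier ?c" "b \<in> carrier ?c" "c \<in> carrier ?c" "d \<in> carrier ?c"
    using int k1 by (auto intro: cge_closed)
  define b' where "b' = ?\<iota> (1 / \<pi>) \<otimes>\<^bsub>?c\<^esub> b"
  define c' where "c' = ?\<iota> \<pi> \<otimes>\<^bsub>?c\<^esub> c"
  have cl': "b' \<in> carrier ?c" "c' \<in> carrier ?c" using cl by (simp_all add: b'_def c'_def)
  have inv: "?\<iota> \<pi> \<otimes>\<^bsub>?c\<^esub> ?\<iota> (1 / \<pi>) = \<one>\<^bsub>?c\<^esub>" using \<pi> by (simp flip: to_completion_mult)
  have b': "?\<iota> \<pi> \<otimes>\<^bsub>?c\<^esub> b' = b" using cl inv by (simp add: b'_def flip: C.m_assoc)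
  have "b' \<otimes>\<^bsub>?c\<^esub> c' = (?\<iota> \<pi> \<otimes>\<^bsub>?c\<^esub> b') \<otimes>\<^bsub>?c\<^esub> c"
    using cl cl' to_completion_closed[of y \<pi>] unfolding c'_def by algebra
  hence bc: "b' \<otimes>\<^bsub>?c\<^esub> c' = b \<otimes>\<^bsub>?c\<^esub> c" by (simp add: b')
  have "cge y (- 1) (?\<iota> (1 / \<pi>))" "cge y 1 (?\<iota> \<pi>)" using \<pi> by (simp_all add: vge_def place_val_divide)
  hence "cge y 0 b'" "cge y 0 c'"
    using cge_mult[of y "-1" _ 1 b] cge_mult[of y 1 _ 1 c] k1 cge_mono[of y 2 c' 0]
    by (simp_all add: b'_def c'_def)
  hence "mk a b' c' d \<in> Kz y" using int det unfolding Kz_iff bc by blast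
  moreover have "\<kappa> \<otimes>\<^bsub>Gz y\<^esub> loc y (mk \<pi> 0 0 1) = loc y (mk \<pi> 0 0 1) \<otimes>\<^bsub>Gz y\<^esub> mk a b' c' d"
    using cl cl' by (simp add: k b' c'_def C.m_comm)
  ultimately show ?thesis by blast
qed

definition hecke_set :: "'k place \<Rightarrow> 'k poly fract \<Rightarrow> ('k adele^2^2) set" where
  "hecke_set y \<pi> = (K' #>\<^bsub>GAk\<^esub> at_place y (unif_matrix y \<pi>)) <#>\<^bsub>GAk\<^esub> K'"

lemma hecke_set_iff: "g \<in> hecke_set y \<pi> \<longleftrightarrow>
    (\<exists>k1\<in>K'. \<exists>k2\<in>K'. g = k1 \<otimes>\<^bsub>GAk\<^esub> local_emb y (mk \<pi> 0 0 1) \<otimes>\<^bsub>GAk\<^esub> k2)"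
  by (auto simp: hecke_set_def r_coset_def set_mult_def local_emb_def unif_matrix_loc)

definition hecke_coset :: "'k place \<Rightarrow> 'k poly option \<Rightarrow> ('k adele^2^2) set" where
  "hecke_coset y i = local_emb y (hecke_mat y i) <#\<^bsub>GAk\<^esub> K'"

lemma hecke_coset_iff: "g \<in> hecke_coset y i \<longleftrightarrow> (\<exists>k\<in>K'. g = local_emb y (hecke_mat y i) \<otimes>\<^bsub>GAk\<^esub> k)"
  by (auto simp: hecke_coset_def l_coset_def)

lemma hecke_set_subset:
  assumes y: "y \<noteq> x" and \<pi>: "uniformizer y \<pi>" and g: "g \<in> hecke_set y \<pi>"
  shows "\<exists>i\<in>hecke_index y. g \<in> hecke_coset y i"
proof -
  obtain k1 k2 where k: "k1 \<in> K'" "k2 \<in> K'" "g = k1 \<otimes>\<^bsub>GAk\<^esub> local_emb y (mk \<pi> 0 0 1) \<otimes>\<^bsub>GAk\<^esub> k2"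
    using g by (auto simp: hecke_set_iff)
  have \<pi>0: "\<pi> \<noteq> 0" using \<pi> by (simp add: uniformizer_def)
  interpret L: group "Gz y" by (rule group_Gz)
  have kz: "component k1 z \<in> Kz z" "component k2 z \<in> Kz z" for z
    using congruence_subgroup_Kz[OF k(1)] congruence_subgroup_Kz[OF k(2)] by auto
  obtain A \<kappa> where A: "det A \<noteq> 0" "\<kappa> \<in> local_congruence y" "component k1 y = loc y A \<otimes>\<^bsub>Gz y\<^esub> \<kappa>"
    using local_approx[OF Kz_subset[OF kz(1)]] by blast
  have \<kappa>: "\<kappa> \<in> Kz y" "\<kappa> \<in> carrier (Gz y)" using A(2) local_congruence_subset Kz_subset by auto
  have "loc y A = component k1 y \<otimes>\<^bsub>Gz y\<^esub> inv\<^bsub>Gz y\<^esub> \<kappa>" using A(1) \<kappa> by (simp add: A(3) L.m_assoc)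
  moreover have "component k1 y \<otimes>\<^bsub>Gz y\<^esub> inv\<^bsub>Gz y\<^esub> \<kappa> \<in> Kz y"
    by (intro subgroup.m_closed[OF Kz_subgroup] subgroup.m_inv_closed[OF Kz_subgroup] kz \<kappa>)
  ultimately have "A \<in> GO y" using loc_Kz by metis
  then obtain i where i: "i \<in> hecke_index y" "rinv (hecke_mat y i) ** A ** mk \<pi> 0 0 1 \<in> GO y"
    using hecke_rational[OF y \<pi>] by blast
  define B where "B = rinv (hecke_mat y i) ** A ** mk \<pi> 0 0 1"
  have hm: "det (hecke_mat y i) \<noteq> 0" using unif_nz[OF y] by (simp add: det_hecke_mat)
  have hB: "hecke_mat y i ** B = A ** mk \<pi> 0 0 1"
    by (simp add: B_def matrix_mul_assoc rinv_right[OF hm])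
  obtain \<kappa>' where \<kappa>': "\<kappa>' \<in> Kz y"
    "\<kappa> \<otimes>\<^bsub>Gz y\<^esub> loc y (mk \<pi> 0 0 1) = loc y (mk \<pi> 0 0 1) \<otimes>\<^bsub>Gz y\<^esub> \<kappa>'"
    using conj_uniformizer[OF \<pi> A(2)] by blast
  define \<tau> where "\<tau> = loc y B \<otimes>\<^bsub>Gz y\<^esub> (\<kappa>' \<otimes>\<^bsub>Gz y\<^esub> component k2 y)"
  have \<tau>: "\<tau> \<in> Kz y" unfolding \<tau>_def
    by (intro subgroup.m_closed[OF Kz_subgroup] \<kappa>' kz) (use i in \<open>simp add: B_def\<close>)
  define k where "k = assemble (\<lambda>z. if z = y then \<tau> else component k1 z \<otimes>\<^bsub>Gz z\<^esub> component k2 z)"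
  have "k \<in> K'"
    using \<tau> kz subgroup.m_closed[OF local_congruence_subgroup, of "component k1 x" x "component k2 x"]
      \<open>k1 \<in> K'\<close> \<open>k2 \<in> K'\<close> y
    by (auto simp: k_def congruence_subgroup_iff intro: subgroup.m_closed[OF Kz_subgroup])
  moreover have "g = local_emb y (hecke_mat y i) \<otimes>\<^bsub>GAk\<^esub> k"
  proof (rule component_eqI)
    fix z :: "'k place"
    interpret Lz: group "Gz z" by (rule group_Gz)
    have c: "component k1 z \<in> carrier (Gz z)" "component k2 z \<in> carrier (Gz z)" for z
      by (rule Kz_subset[OF kz(1)] Kz_subset[OF kz(2)])+
    have c': "\<kappa>' \<in> carrier (Gz y)" "loc y B \<in> carrier (Gz y)"
      using \<kappa>'(1) i(2) GO_det(1) by (auto simp: B_def intro: Kz_subset)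
    show "component g z = component (local_emb y (hecke_mat y i) \<otimes>\<^bsub>GAk\<^esub> k) z"
    proof (cases "z = y")
      case False
      thus ?thesis using c by (simp add: \<open>g = _\<close> component_local_emb k_def)
    next
      case True
      have "component g y = loc y A \<otimes>\<^bsub>Gz y\<^esub> (\<kappa> \<otimes>\<^bsub>Gz y\<^esub> loc y (mk \<pi> 0 0 1)) \<otimes>\<^bsub>Gz y\<^esub> component k2 y"
        using A(1) \<kappa> \<pi>0 c[of y] by (simp add: \<open>g = _\<close> component_local_emb A(3) L.m_assoc del: loc_mk)
      also have "\<dots> = loc y (A ** mk \<pi> 0 0 1) \<otimes>\<^bsub>Gz y\<^esub> (\<kappa>' \<otimes>\<^bsub>Gz y\<^esub> component k2 y)"
        using A(1) \<kappa>' c' \<pi>0 c[of y] by (simp add: loc_mult L.m_assoc del: loc_mk)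
      also have "\<dots> = loc y (hecke_mat y i) \<otimes>\<^bsub>Gz y\<^esub> \<tau>"
        using hm c' c[of y] by (simp add: \<tau>_def loc_mult L.m_assoc flip: hB)
      finally show ?thesis using True by (simp add: component_local_emb k_def)
    qed
  qed
  ultimately show ?thesis using i(1) by (auto simp: hecke_coset_iff)
qed

lemma hecke_coset_subset_hecke_set:
  assumes y: "y \<noteq> x" and \<pi>: "uniformizer y \<pi>"
  shows "hecke_coset y i \<subseteq> hecke_set y \<pi>"
proof -
  have \<pi>: "\<pi> \<noteq> 0" "place_val y \<pi> = 1" using \<pi> by (auto simp: uniformizer_def)
  have p: "unif y \<noteq> 0" "place_val y (unif y) = 1" using unif_nz[OF y] val_unif(1)[OF y] by auto
  have q: "vge y 0 (unif y / \<pi>)" "place_val y (unif y / \<pi>) = 0"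
    using p \<pi> by (simp_all add: vge_def place_val_divide)
  have "\<exists>k1\<in>GO y. \<exists>k2\<in>GO y. hecke_mat y i = k1 ** mk \<pi> 0 0 1 ** k2"
  proof (cases i)
    case None
    show ?thesis
      by (rule bexI[of _ "mk 0 1 1 0"], rule bexI[of _ "mk 0 (unif y / \<pi>) 1 0"])
         (use None p \<pi> q in \<open>simp_all add: hecke_mat_def mk_in_GO_iff\<close>)
  next
    case (Some b)
    show ?thesis
      by (rule bexI[of _ "mk 1 (ev s b) 0 1"], rule bexI[of _ "mk (unif y / \<pi>) 0 0 1"])
         (use Some p \<pi> q vge_poly[OF y, of b] in \<open>simp_all add: hecke_mat_def mk_in_GO_iff\<close>)
  qed
  then obtain k1 k2 where k: "k1 \<in> GO y" "k2 \<in> GO y" "hecke_mat y i = k1 ** mk \<pi> 0 0 1 ** k2" by blast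
  have dets: "det k1 \<noteq> 0" "det k2 \<noteq> 0" using k GO_det(1) by auto
  show ?thesis
  proof
    fix g assume "g \<in> hecke_coset y i"
    then obtain l where l: "l \<in> K'" "g = local_emb y (hecke_mat y i) \<otimes>\<^bsub>GAk\<^esub> l" by (auto simp: hecke_coset_iff)
    have "g = local_emb y k1 \<otimes>\<^bsub>GAk\<^esub> local_emb y (mk \<pi> 0 0 1) \<otimes>\<^bsub>GAk\<^esub> (local_emb y k2 \<otimes>\<^bsub>GAk\<^esub> l)"
      using dets \<pi> K'_closed[OF l(1)] by (simp add: l(2) k(3) local_emb_mult G.m_assoc)
    moreover have "local_emb y k1 \<in> K'" "local_emb y k2 \<otimes>\<^bsub>GAk\<^esub> l \<in> K'" using k local_emb_in_K'[OF y] l by auto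
    ultimately show "g \<in> hecke_set y \<pi>" unfolding hecke_set_iff by blast
  qed
qed

text \<open>Different cosets give different lines in the residue plane at \<open>y\<close>.\<close>

lemma hecke_coset_disjoint:
  assumes y: "y \<noteq> x" and ij: "i \<in> hecke_index y" "j \<in> hecke_index y" and g: "g \<in> hecke_coset y i" "g \<in> hecke_coset y j"
  shows "i = j"
proof -
  have p: "unif y \<noteq> 0" "place_val y (unif y) = 1" using unif_nz[OF y] val_unif(1)[OF y] by auto
  obtain k where k: "k \<in> K'" "g = local_emb y (hecke_mat y i) \<otimes>\<^bsub>GAk\<^esub> k" using g(1) by (auto simp: hecke_coset_iff)
  obtain l where l: "l \<in> K'" "g = local_emb y (hecke_mat y j) \<otimes>\<^bsub>GAk\<^esub> l" using g(2) by (auto simp: hecke_coset_iff)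
  interpret L: group "Gz y" by (rule group_Gz)
  have kl: "component k y \<in> Kz y" "component l y \<in> Kz y"
    using congruence_subgroup_Kz[OF k(1)] congruence_subgroup_Kz[OF l(1)] by auto
  note kl' = Kz_subset[OF kl(1)] Kz_subset[OF kl(2)]
  have h: "det (hecke_mat y i) \<noteq> 0" "det (hecke_mat y j) \<noteq> 0" using p by (simp_all add: det_hecke_mat)
  have "component (local_emb y (hecke_mat y i) \<otimes>\<^bsub>GAk\<^esub> k) y = component (local_emb y (hecke_mat y j) \<otimes>\<^bsub>GAk\<^esub> l) y"
    using k l by simp
  hence "loc y (hecke_mat y i) \<otimes>\<^bsub>Gz y\<^esub> component k y = loc y (hecke_mat y j) \<otimes>\<^bsub>Gz y\<^esub> component l y"
    by (simp add: component_local_emb)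
  hence "loc y (rinv (hecke_mat y i) ** hecke_mat y j) = component k y \<otimes>\<^bsub>Gz y\<^esub> inv\<^bsub>Gz y\<^esub> component l y"
    using h kl' by (simp add: loc_mult loc_rinv) (metis L.inv_solve_left L.inv_solve_right L.m_assoc L.m_closed L.inv_closed loc_carrier)
  moreover have "component k y \<otimes>\<^bsub>Gz y\<^esub> inv\<^bsub>Gz y\<^esub> component l y \<in> Kz y"
    by (intro subgroup.m_closed[OF Kz_subgroup] subgroup.m_inv_closed[OF Kz_subgroup] kl)
  ultimately have GO: "rinv (hecke_mat y i) ** hecke_mat y j \<in> GO y" using loc_Kz by metis
  have np: "\<not> vge y 0 (1 / unif y)" using p by (simp add: vge_def place_val_divide)
  show ?thesis
  proof (cases i; cases j)
    fix b c assume bc: "i = Some b" "j = Some c"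
    hence "vge y 0 ((ev s c - ev s b) / unif y)"
      using GO p by (simp add: hecke_mat_def rinv_mk mk_in_GO_iff diff_divide_distrib)
    hence "vge y 1 (ev s c - ev s b)" using p by (simp add: vge_divide)
    moreover have "b \<in> small_polys (place_degree y)" "c \<in> small_polys (place_degree y)"
      using ij bc by (auto simp: hecke_index_def)
    ultimately show ?thesis
      using residue_unique[OF y, of c b] bc by (simp add: place_degree_eq[OF y])
  qed (use GO p np in \<open>auto simp: hecke_mat_def rinv_mk mk_in_GO_iff\<close>)
qed

text \<open>The double coset is stable under left translation by \<open>K'\<close>, so its left cosets are
  permuted.\<close>

lemma hecke_permute:
  assumes y: "y \<noteq> x" and \<pi>: "uniformizer y \<pi>" and k: "k \<in> K'"
  shows "\<exists>\<sigma>. bij_betw \<sigma> (hecke_index y) (hecke_index y) \<and>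
    (\<forall>i\<in>hecke_index y. \<exists>l\<in>K'. k \<otimes>\<^bsub>GAk\<^esub> local_emb y (hecke_mat y i) = local_emb y (hecke_mat y (\<sigma> i)) \<otimes>\<^bsub>GAk\<^esub> l)"
proof -
  have c: "k \<in> carrier GAk" "local_emb y (hecke_mat y i) \<in> carrier GAk" for i
    using k K'_closed unif_nz[OF y] by (auto simp: det_hecke_mat)
  have "\<forall>i\<in>hecke_index y. \<exists>j. j \<in> hecke_index y \<and> (\<exists>l\<in>K'. k \<otimes>\<^bsub>GAk\<^esub> local_emb y (hecke_mat y i) = local_emb y (hecke_mat y j) \<otimes>\<^bsub>GAk\<^esub> l)"
  proof
    fix i assume i: "i \<in> hecke_index y"
    have "local_emb y (hecke_mat y i) \<in> hecke_coset y i"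
      using c by (auto simp: hecke_coset_iff intro!: bexI[of _ "\<one>\<^bsub>GAk\<^esub>"])
    hence "local_emb y (hecke_mat y i) \<in> hecke_set y \<pi>" using hecke_coset_subset_hecke_set[OF y \<pi>] by blast
    then obtain k1 k2 where k12: "k1 \<in> K'" "k2 \<in> K'"
      "local_emb y (hecke_mat y i) = k1 \<otimes>\<^bsub>GAk\<^esub> local_emb y (mk \<pi> 0 0 1) \<otimes>\<^bsub>GAk\<^esub> k2"
      by (auto simp: hecke_set_iff)
    have "\<pi> \<noteq> 0" using \<pi> by (simp add: uniformizer_def)
    hence "k \<otimes>\<^bsub>GAk\<^esub> local_emb y (hecke_mat y i) = (k \<otimes>\<^bsub>GAk\<^esub> k1) \<otimes>\<^bsub>GAk\<^esub> local_emb y (mk \<pi> 0 0 1) \<otimes>\<^bsub>GAk\<^esub> k2"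
      using c k12 K'_closed by (simp add: G.m_assoc)
    hence "k \<otimes>\<^bsub>GAk\<^esub> local_emb y (hecke_mat y i) \<in> hecke_set y \<pi>"
      unfolding hecke_set_iff using k k12 by blast
    thus "\<exists>j. j \<in> hecke_index y \<and> (\<exists>l\<in>K'. k \<otimes>\<^bsub>GAk\<^esub> local_emb y (hecke_mat y i) = local_emb y (hecke_mat y j) \<otimes>\<^bsub>GAk\<^esub> l)"
      using hecke_set_subset[OF y \<pi>, of "k \<otimes>\<^bsub>GAk\<^esub> local_emb y (hecke_mat y i)"] unfolding hecke_coset_iff by blast
  qed
  then obtain \<sigma> where \<sigma>: "\<And>i. i \<in> hecke_index y \<Longrightarrow> \<sigma> i \<in> hecke_index y"
    "\<And>i. i \<in> hecke_index y \<Longrightarrow> \<exists>l\<in>K'. k \<otimes>\<^bsub>GAk\<^esub> local_emb y (hecke_mat y i) = local_emb y (hecke_mat y (\<sigma> i)) \<otimes>\<^bsub>GAk\<^esub> l"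
    by metis
  have "inj_on \<sigma> (hecke_index y)"
  proof (rule inj_onI)
    fix i j assume ij: "i \<in> hecke_index y" "j \<in> hecke_index y" "\<sigma> i = \<sigma> j"
    obtain l where l: "l \<in> K'" "k \<otimes>\<^bsub>GAk\<^esub> local_emb y (hecke_mat y i) = local_emb y (hecke_mat y (\<sigma> i)) \<otimes>\<^bsub>GAk\<^esub> l"
      using \<sigma>(2) ij by blast
    obtain m where m: "m \<in> K'" "k \<otimes>\<^bsub>GAk\<^esub> local_emb y (hecke_mat y j) = local_emb y (hecke_mat y (\<sigma> i)) \<otimes>\<^bsub>GAk\<^esub> m"
      using \<sigma>(2)[OF ij(2)] ij(3) by auto
    have cl: "l \<in> carrier GAk" "m \<in> carrier GAk" using l m K'_closed by auto
    have "k \<otimes>\<^bsub>GAk\<^esub> (local_emb y (hecke_mat y i) \<otimes>\<^bsub>GAk\<^esub> inv\<^bsub>GAk\<^esub> l) = local_emb y (hecke_mat y (\<sigma> i))"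
      using l(2) c cl by (simp add: G.inv_solve_right' flip: G.m_assoc)
    moreover have "k \<otimes>\<^bsub>GAk\<^esub> (local_emb y (hecke_mat y j) \<otimes>\<^bsub>GAk\<^esub> inv\<^bsub>GAk\<^esub> m) = local_emb y (hecke_mat y (\<sigma> i))"
      using m(2) c cl by (simp add: G.inv_solve_right' flip: G.m_assoc)
    ultimately have "local_emb y (hecke_mat y i) \<otimes>\<^bsub>GAk\<^esub> inv\<^bsub>GAk\<^esub> l = local_emb y (hecke_mat y j) \<otimes>\<^bsub>GAk\<^esub> inv\<^bsub>GAk\<^esub> m"
      using c cl G.Units_l_cancel[of k] by (metis G.Units_eq G.m_closed G.inv_closed)
    moreover have "local_emb y (hecke_mat y i) \<otimes>\<^bsub>GAk\<^esub> inv\<^bsub>GAk\<^esub> l \<in> hecke_coset y i"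
      using K.m_inv_closed[OF l(1)] unfolding hecke_coset_iff by blast
    moreover have "local_emb y (hecke_mat y j) \<otimes>\<^bsub>GAk\<^esub> inv\<^bsub>GAk\<^esub> m \<in> hecke_coset y j"
      using K.m_inv_closed[OF m(1)] unfolding hecke_coset_iff by blast
    ultimately show "i = j" using hecke_coset_disjoint[OF y ij(1,2)] by simp
  qed
  hence "bij_betw \<sigma> (hecke_index y) (hecke_index y)"
    using \<sigma>(1) finite_hecke_index[of y] by (metis bij_betw_def endo_inj_surj image_subsetI)
  thus ?thesis using \<sigma>(2) by blast
qed

text \<open>The representative is rational and integral outside \<open>x\<close> and \<open>y\<close>;
  dividing by it globally transfers it from \<open>y\<close> to \<open>x\<close>.\<close>

lemma adele_equiv_neighbour:
  assumes y: "y \<noteq> x"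
  shows "adele_equiv (local_emb x (vertex_mat v) \<otimes>\<^bsub>GAk\<^esub> local_emb y (hecke_mat y i)) (local_emb x (vertex_mat (neighbour y v i)))"
proof -
  let ?h = "hecke_mat y i"
  have h: "det ?h \<noteq> 0" using unif_nz[OF y] by (simp add: det_hecke_mat)
  define k where "k = assemble (\<lambda>z. if z = x \<or> z = y then \<one>\<^bsub>Gz z\<^esub> else loc z (rinv ?h))"
  have "k \<in> K'"
    using hecke_mat_in_GO[OF y] GO_rinv y
    by (auto simp: k_def congruence_subgroup_iff subgroup.one_closed[OF local_congruence_subgroup])
  have "local_emb x (vertex_mat v) \<otimes>\<^bsub>GAk\<^esub> local_emb y ?h = diag_emb ?h \<otimes>\<^bsub>GAk\<^esub> (local_emb x (rinv ?h ** vertex_mat v) \<otimes>\<^bsub>GAk\<^esub> k)"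
  proof (rule component_eqI)
    fix z :: "'k place"
    interpret Lx: group "Gz x" by (rule group_Gz)
    interpret Ly: group "Gz y" by (rule group_Gz)
    interpret Lz: group "Gz z" by (rule group_Gz)
    have e: "loc x ?h \<otimes>\<^bsub>Gz x\<^esub> loc x (rinv ?h ** vertex_mat v) = loc x (vertex_mat v)" "loc z ?h \<otimes>\<^bsub>Gz z\<^esub> loc z (rinv ?h) = \<one>\<^bsub>Gz z\<^esub>"
      using h by (simp_all add: rinv_cancel rinv_right flip: loc_mult)
    show "component (local_emb x (vertex_mat v) \<otimes>\<^bsub>GAk\<^esub> local_emb y ?h) z =
        component (diag_emb ?h \<otimes>\<^bsub>GAk\<^esub> (local_emb x (rinv ?h ** vertex_mat v) \<otimes>\<^bsub>GAk\<^esub> k)) z"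
      using y h det_vertex_mat det_rinv[OF h] e
      by (cases "z = x"; cases "z = y") (simp_all add: component_local_emb k_def det_mul)
  qed
  moreover have c: "local_emb x (rinv ?h ** vertex_mat v) \<in> carrier GAk" "k \<in> carrier GAk"
    using h det_vertex_mat \<open>k \<in> K'\<close> K'_closed by (simp_all add: det_mul det_rinv)
  ultimately have "adele_equiv (local_emb x (vertex_mat v) \<otimes>\<^bsub>GAk\<^esub> local_emb y ?h) (local_emb x (rinv ?h ** vertex_mat v) \<otimes>\<^bsub>GAk\<^esub> k)"
    using adele_equiv_diag_emb[OF h, of "local_emb x (rinv ?h ** vertex_mat v) \<otimes>\<^bsub>GAk\<^esub> k"] by simp
  moreover have "adele_equiv (local_emb x (rinv ?h ** vertex_mat v) \<otimes>\<^bsub>GAk\<^esub> k) (local_emb x (rinv ?h ** vertex_mat v))"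
    by (rule adele_equiv_K'[OF \<open>k \<in> K'\<close> c(1)])
  moreover have "adele_equiv (local_emb x (rinv ?h ** vertex_mat v)) (local_emb x (vertex_mat (neighbour y v i)))"
    by (rule local_emb_rat_equiv[OF neighbour_rat_equiv[OF y] det_vertex_mat])
  ultimately show ?thesis using c(1) det_vertex_mat by (meson adele_equiv_trans local_emb_carrier)
qed

text \<open>The element of \<open>K'\<close> in a decomposition of \<open>g\<close> only permutes the
  summands.\<close>

lemma hecke_sum:
  fixes F :: "nat \<times> 'k option \<Rightarrow> complex"
  assumes y: "y \<noteq> x" and \<pi>: "uniformizer y \<pi>" and g: "g \<in> carrier GAk"
  shows "(\<Sum>i\<in>hecke_index y. F (vertex (g \<otimes>\<^bsub>GAk\<^esub> local_emb y (hecke_mat y i)))) = (\<Sum>i\<in>hecke_index y. F (neighbour y (vertex g) i))"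
proof -
  obtain A \<zeta> k where *: "det A \<noteq> 0" "\<zeta> \<in> monoid_center GAk" "k \<in> K'"
    "g = diag_emb A \<otimes>\<^bsub>GAk\<^esub> (\<zeta> \<otimes>\<^bsub>GAk\<^esub> (local_emb x (vertex_mat (vertex g)) \<otimes>\<^bsub>GAk\<^esub> k))"
    using vertex(2)[OF g] unfolding adele_equiv_def by blast
  let ?r = "local_emb x (vertex_mat (vertex g))"
  have c: "diag_emb A \<in> carrier GAk" "\<zeta> \<in> carrier GAk" "k \<in> carrier GAk" "?r \<in> carrier GAk"
    "local_emb y (hecke_mat y i) \<in> carrier GAk" for i
    using * center_subset K'_closed det_vertex_mat unif_nz[OF y] by (auto simp: det_hecke_mat)
  obtain \<sigma> where \<sigma>: "bij_betw \<sigma> (hecke_index y) (hecke_index y)"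
    "\<And>i. i \<in> hecke_index y \<Longrightarrow> \<exists>l\<in>K'. k \<otimes>\<^bsub>GAk\<^esub> local_emb y (hecke_mat y i) = local_emb y (hecke_mat y (\<sigma> i)) \<otimes>\<^bsub>GAk\<^esub> l"
    using hecke_permute[OF y \<pi> *(3)] by blast
  have "vertex (g \<otimes>\<^bsub>GAk\<^esub> local_emb y (hecke_mat y i)) = neighbour y (vertex g) (\<sigma> i)" if i: "i \<in> hecke_index y" for i
  proof (rule vertex_eqI)
    show "g \<otimes>\<^bsub>GAk\<^esub> local_emb y (hecke_mat y i) \<in> carrier GAk" using g c by simp
    show "neighbour y (vertex g) (\<sigma> i) \<in> vertices" by (rule neighbour_in_vertices[OF y])
    obtain l where l: "l \<in> K'" "k \<otimes>\<^bsub>GAk\<^esub> local_emb y (hecke_mat y i) = local_emb y (hecke_mat y (\<sigma> i)) \<otimes>\<^bsub>GAk\<^esub> l"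
      using \<sigma>(2)[OF i] by blast
    have "g \<otimes>\<^bsub>GAk\<^esub> local_emb y (hecke_mat y i) =
        diag_emb A \<otimes>\<^bsub>GAk\<^esub> (\<zeta> \<otimes>\<^bsub>GAk\<^esub> (?r \<otimes>\<^bsub>GAk\<^esub> (k \<otimes>\<^bsub>GAk\<^esub> local_emb y (hecke_mat y i))))"
      by (subst *(4)) (use c in \<open>simp add: G.m_assoc\<close>)
    also have "\<dots> = diag_emb A \<otimes>\<^bsub>GAk\<^esub> (\<zeta> \<otimes>\<^bsub>GAk\<^esub> ((?r \<otimes>\<^bsub>GAk\<^esub> local_emb y (hecke_mat y (\<sigma> i))) \<otimes>\<^bsub>GAk\<^esub> l))"
      using c K'_closed[OF l(1)] by (simp add: l(2) G.m_assoc)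
    finally have "adele_equiv (g \<otimes>\<^bsub>GAk\<^esub> local_emb y (hecke_mat y i)) (?r \<otimes>\<^bsub>GAk\<^esub> local_emb y (hecke_mat y (\<sigma> i)))"
      using adele_equivI[OF *(1,2) l(1)] by blast
    thus "adele_equiv (g \<otimes>\<^bsub>GAk\<^esub> local_emb y (hecke_mat y i)) (local_emb x (vertex_mat (neighbour y (vertex g) (\<sigma> i))))"
      using adele_equiv_neighbour[OF y, of "vertex g" "\<sigma> i"] det_vertex_mat by (meson adele_equiv_trans local_emb_carrier)
  qed
  hence "(\<Sum>i\<in>hecke_index y. F (vertex (g \<otimes>\<^bsub>GAk\<^esub> local_emb y (hecke_mat y i)))) = (\<Sum>i\<in>hecke_index y. F (neighbour y (vertex g) (\<sigma> i)))"
    by simp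
  also have "\<dots> = (\<Sum>i\<in>hecke_index y. F (neighbour y (vertex g) i))"
    by (rule sum.reindex_bij_betw[OF \<sigma>(1)])
  finally show ?thesis .
qed

end

section \<open>The Hecke operator as a finite sum\<close>

subsection \<open>Absolute values\<close>

lemma completion_abs_nonzero:
  fixes A :: "'k::{field,finite} completed"
  assumes "A \<noteq> \<zero>\<^bsub>completion z\<^esub>"
  shows "completion_abs z A = real CARD('k) powi (- (int (place_degree z) * completion_val z A))"
    "completion_abs z A > 0"
  using assms card_field_gt_1[where ?'k = 'k] by (simp_all add: completion_abs_def)

lemma completion_abs_zero [simp]: "completion_abs z \<zero>\<^bsub>completion z\<^esub> = 0"
  by (simp add: completion_abs_def)

lemma completion_abs_nonneg: "completion_abs z A \<ge> 0"
  by (simp add: completion_abs_def)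

subsection \<open>The maximal compact subgroup\<close>

lemma cring_integral_adeles: "cring (integral_adeles :: 'k::{field,finite} adele ring)"
proof -
  interpret A: cring "adeles :: 'k adele ring" by (rule cring_adeles)
  interpret C: cring "completion z" for z :: "'k place" by (rule cring_completion)
  let ?H = "{a :: 'k adele. \<forall>z. a z \<in> carrier (integer_ring z)}"
  have sub: "?H \<subseteq> carrier adeles"
    by (simp add: integer_ring_carrier adeles_carrier_iff subset_iff) (meson cge_closed)
  have minus: "(\<ominus>\<^bsub>adeles\<^esub> b) z = \<ominus>\<^bsub>completion z\<^esub> b z" if "b \<in> carrier adeles" for b :: "'k adele" and z
    using adeles_diff[OF that, of "\<zero>\<^bsub>adeles\<^esub>" z] that A.a_inv_closed[OF that]
    by (simp add: a_minus_def adeles_carrier_iff)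
  have "subring ?H (adeles :: 'k adele ring)"
    using sub by (intro A.subringI) (auto simp: integer_ring_carrier minus subset_iff)
  hence "subcring ?H (adeles :: 'k adele ring)" by (intro A.subcringI')
  thus ?thesis using A.subcring_iff[OF sub] by (simp add: integral_adeles_def)
qed

lemma max_compact_iff:
  fixes g :: "'k::{field,finite} adele^2^2"
  shows "g \<in> max_compact \<longleftrightarrow> (\<forall>z. component g z \<in> Kz z)"
proof -
  interpret C: cring "completion z" for z :: "'k place" by (rule cring_completion)
  let ?I = "integral_adeles :: 'k adele ring"
  let ?H = "{a :: 'k adele. \<forall>z. a z \<in> carrier (integer_ring z)}"
  obtain a b c d where g: "g = mk a b c d" by (rule mk_cases)
  have I: "carrier ?I = {a. \<forall>z. cge z 0 (a z)}"
    by (simp add: integral_adeles_def integer_ring_carrier)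
  have units: "D \<in> Units ?I \<longleftrightarrow> (\<forall>z. D z \<in> Units (integer_ring z))" for D
  proof
    assume "D \<in> Units ?I"
    then obtain E where E: "D \<in> carrier ?I" "E \<in> carrier ?I" "E \<otimes>\<^bsub>?I\<^esub> D = \<one>\<^bsub>?I\<^esub>" "D \<otimes>\<^bsub>?I\<^esub> E = \<one>\<^bsub>?I\<^esub>"
      by (auto simp: Units_def)
    have "E z \<otimes>\<^bsub>completion z\<^esub> D z = \<one>\<^bsub>completion z\<^esub>" "D z \<otimes>\<^bsub>completion z\<^esub> E z = \<one>\<^bsub>completion z\<^esub>" for z
      using fun_cong[OF E(3), of z] fun_cong[OF E(4), of z] by (simp_all add: integral_adeles_def adeles_def)
    thus "\<forall>z. D z \<in> Units (integer_ring z)"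
      using E(1,2) unfolding I Units_def integer_ring_carrier integer_ring_simps by blast
  next
    assume "\<forall>z. D z \<in> Units (integer_ring z)"
    hence "\<forall>z. \<exists>E. cge z 0 (D z) \<and> cge z 0 E \<and> E \<otimes>\<^bsub>completion z\<^esub> D z = \<one>\<^bsub>completion z\<^esub> \<and>
        D z \<otimes>\<^bsub>completion z\<^esub> E = \<one>\<^bsub>completion z\<^esub>"
      unfolding Units_def integer_ring_carrier integer_ring_simps by blast
    then obtain E where "\<And>z. cge z 0 (D z) \<and> cge z 0 (E z) \<and> E z \<otimes>\<^bsub>completion z\<^esub> D z = \<one>\<^bsub>completion z\<^esub> \<and>
        D z \<otimes>\<^bsub>completion z\<^esub> E z = \<one>\<^bsub>completion z\<^esub>" by metis
    thus "D \<in> Units ?I"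
      unfolding Units_def I by (simp add: integral_adeles_def adeles_def) (rule exI[of _ E], simp)
  qed
  have diff: "(a \<otimes>\<^bsub>?I\<^esub> d \<ominus>\<^bsub>?I\<^esub> b \<otimes>\<^bsub>?I\<^esub> c) z =
      a z \<otimes>\<^bsub>integer_ring z\<^esub> d z \<ominus>\<^bsub>integer_ring z\<^esub> b z \<otimes>\<^bsub>integer_ring z\<^esub> c z"
    if int: "a \<in> carrier ?I" "b \<in> carrier ?I" "c \<in> carrier ?I" "d \<in> carrier ?I" for z
  proof -
    interpret R: cring ?I by (rule cring_integral_adeles)
    have cl: "a \<otimes>\<^bsub>?I\<^esub> d \<in> ?H" "b \<otimes>\<^bsub>?I\<^esub> c \<in> ?H"
      using R.m_closed[OF int(1,4)] R.m_closed[OF int(2,3)] by (simp_all add: integral_adeles_def)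
    have sub: "?H \<subseteq> carrier adeles"
      by (simp add: integer_ring_carrier adeles_carrier_iff subset_iff) (meson cge_closed)
    have "a \<otimes>\<^bsub>?I\<^esub> d \<ominus>\<^bsub>?I\<^esub> b \<otimes>\<^bsub>?I\<^esub> c = a \<otimes>\<^bsub>?I\<^esub> d \<ominus>\<^bsub>adeles\<^esub> b \<otimes>\<^bsub>?I\<^esub> c"
      using cring_subring_diff[OF cring_adeles _ sub cl] cring_integral_adeles
      by (simp add: integral_adeles_def)
    moreover have "(b \<otimes>\<^bsub>?I\<^esub> c) \<in> carrier adeles" using cl sub by blast
    ultimately have "(a \<otimes>\<^bsub>?I\<^esub> d \<ominus>\<^bsub>?I\<^esub> b \<otimes>\<^bsub>?I\<^esub> c) z =
        (a \<otimes>\<^bsub>?I\<^esub> d) z \<ominus>\<^bsub>completion z\<^esub> (b \<otimes>\<^bsub>?I\<^esub> c) z"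
      by (simp add: adeles_diff)
    also have "\<dots> = a z \<otimes>\<^bsub>completion z\<^esub> d z \<ominus>\<^bsub>completion z\<^esub> b z \<otimes>\<^bsub>completion z\<^esub> c z"
      by (simp add: integral_adeles_def)
    also have "\<dots> = a z \<otimes>\<^bsub>integer_ring z\<^esub> d z \<ominus>\<^bsub>integer_ring z\<^esub> b z \<otimes>\<^bsub>integer_ring z\<^esub> c z"
      using int by (simp add: I integer_ring_diff cge_mult_0)
    finally show ?thesis .
  qed
  show ?thesis
  proof
    assume "g \<in> max_compact"
    hence *: "a \<in> carrier ?I" "b \<in> carrier ?I" "c \<in> carrier ?I" "d \<in> carrier ?I"
      "a \<otimes>\<^bsub>?I\<^esub> d \<ominus>\<^bsub>?I\<^esub> b \<otimes>\<^bsub>?I\<^esub> c \<in> Units ?I"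
      unfolding max_compact_def g GL2_carrier by blast+
    have "a z \<otimes>\<^bsub>integer_ring z\<^esub> d z \<ominus>\<^bsub>integer_ring z\<^esub> b z \<otimes>\<^bsub>integer_ring z\<^esub> c z \<in> Units (integer_ring z)" for z
      using *(5) unfolding units diff[OF *(1-4), symmetric] by blast
    thus "\<forall>z. component g z \<in> Kz z"
      using *(1-4) unfolding g component_mk GL2_carrier by (simp add: I integer_ring_carrier)
  next
    assume *: "\<forall>z. component g z \<in> Kz z"
    hence int: "a \<in> carrier ?I" "b \<in> carrier ?I" "c \<in> carrier ?I" "d \<in> carrier ?I"
      unfolding g component_mk GL2_carrier I integer_ring_carrier by simp_all
    moreover have "a \<otimes>\<^bsub>?I\<^esub> d \<ominus>\<^bsub>?I\<^esub> b \<otimes>\<^bsub>?I\<^esub> c \<in> Units ?I"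
      using * unfolding units diff[OF int] g component_mk GL2_carrier by blast
    ultimately show "g \<in> max_compact" unfolding max_compact_def g GL2_carrier by blast
  qed
qed

lemma max_compact_carrier: "max_compact \<subseteq> carrier GA"
  by (auto simp: max_compact_iff GA_iff Kz_subset)

lemma Kz_entry: "M \<in> Kz z \<Longrightarrow> cge z 0 (M$i$j)"
  by (simp add: GL2_def integer_ring_carrier)

subsection \<open>Measurability by substitution of matrix entries\<close>

text \<open>A set of nonzero measure is measurable. With invariance, this makes all translates of the
  maximal compact subgroup available as measurable sets.\<close>

lemma haar_sets:
  fixes \<mu> :: "('k::{field,finite} adele^2^2) measure"
  assumes \<mu>: "normalized_haar \<mu>"
  shows haar_max_compact: "max_compact \<in> sets \<mu>"
    and haar_space: "carrier GA \<in> sets \<mu>"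
    and haar_translate_emeasure: "g \<in> carrier GA \<Longrightarrow> A \<in> sets \<mu> \<Longrightarrow> emeasure \<mu> (g <#\<^bsub>GA\<^esub> A) = emeasure \<mu> A"
proof -
  show "max_compact \<in> sets \<mu>"
    using \<mu> emeasure_notin_sets[of max_compact \<mu>] by (auto simp: normalized_haar_def)
  show "carrier GA \<in> sets \<mu>" using \<mu> sets.top[of \<mu>] by (simp add: normalized_haar_def)
  show "g \<in> carrier GA \<Longrightarrow> A \<in> sets \<mu> \<Longrightarrow> emeasure \<mu> (g <#\<^bsub>GA\<^esub> A) = emeasure \<mu> A"
    using \<mu> by (simp add: normalized_haar_def)
qed

lemma haar_translate_sets:
  fixes \<mu> :: "('k::{field,finite} adele^2^2) measure"
  assumes \<mu>: "normalized_haar \<mu>" and "g \<in> carrier GA" "A \<in> sets \<mu>" "emeasure \<mu> A \<noteq> 0"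
  shows "g <#\<^bsub>GA\<^esub> A \<in> sets \<mu>"
  using haar_translate_emeasure[OF assms(1-3)] assms(4) emeasure_notin_sets[of "g <#\<^bsub>GA\<^esub> A" \<mu>] by auto

text \<open>Substituting an entry of \<open>g\<close> into a matrix that is otherwise constant. All
  generating open sets of the topology of \<open>GL\<^sub>2(\<A>)\<close> constrain one entry or
  the inverse determinant, so their preimages under such a substitution are either open by
  definition or trivial. Measurable conditions on matrices thereby become measurable conditions on
  single entries.\<close>

definition lower_mat :: "'k::{field,finite} adele \<Rightarrow> 'k adele \<Rightarrow> 'k adele^2^2" where
  "lower_mat p a = mk \<one>\<^bsub>adeles\<^esub> \<zero>\<^bsub>adeles\<^esub> a p"

lemma lower_mat_carrier:
  "p \<in> Units adeles \<Longrightarrow> a \<in> carrier adeles \<Longrightarrow> lower_mat p a \<in> carrier GA"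
  and det2_lower_mat: "p \<in> Units adeles \<Longrightarrow> a \<in> carrier adeles \<Longrightarrow> det2 adeles (lower_mat p a) = p"
proof -
  interpret A: cring "adeles :: 'a adele ring" by (rule cring_adeles)
  assume *: "p \<in> Units adeles" "a \<in> carrier adeles"
  hence c: "p \<in> carrier adeles" by (rule_tac A.Units_closed)
  hence "\<one>\<^bsub>adeles\<^esub> \<otimes>\<^bsub>adeles\<^esub> p \<ominus>\<^bsub>adeles\<^esub> \<zero>\<^bsub>adeles\<^esub> \<otimes>\<^bsub>adeles\<^esub> a = p"
    using * by (simp add: a_minus_def)
  thus "lower_mat p a \<in> carrier GA" "det2 adeles (lower_mat p a) = p"
    unfolding lower_mat_def GL2_carrier det2_mk using * c by simp_all
qed

definition subst_entry :: "'k::{field,finite} adele \<Rightarrow> 2 \<Rightarrow> 2 \<Rightarrow> ('k adele^2^2) set \<Rightarrow> ('k adele^2^2) set" where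
  "subst_entry p i j S = {g \<in> carrier GA. lower_mat p (g$i$j) \<in> S}"

text \<open>For a constant entry the preimage is everything or nothing; everything is kept as a separate
  case, which is stable under unions and intersections.\<close>

lemma subst_entry_open:
  fixes p :: "'k::{field,finite} adele"
  assumes p: "p \<in> Units adeles" and S: "openin GA_topology S"
  shows "openin GA_topology (subst_entry p i j S) \<or> subst_entry p i j S = carrier GA"
proof -
  let ?B = "{{g \<in> carrier GA. g$i$j \<in> U} | i j U. openin adele_topology U} \<union>
      {{g \<in> carrier GA. inv\<^bsub>adeles\<^esub> (det2 adeles g) \<in> U} | U. openin adele_topology U} :: ('k adele^2^2) set set"
  have sub: "subst_entry p i j T \<subseteq> carrier GA" for T by (auto simp: subst_entry_def)
  have entry: "g$i$j \<in> carrier adeles" if "g \<in> carrier GA" for g :: "'k adele^2^2"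
    using that by (simp add: GL2_def)
  have const: "subst_entry p i j {g \<in> carrier GA. P g} \<in> {{}, carrier GA}"
    if "\<And>a b. a \<in> carrier adeles \<Longrightarrow> b \<in> carrier adeles \<Longrightarrow> P (lower_mat p a) = P (lower_mat p b)" for P
  proof (cases "P (lower_mat p \<one>\<^bsub>adeles\<^esub>)")
    interpret A: cring "adeles :: 'k adele ring" by (rule cring_adeles)
    case True
    hence "P (lower_mat p (g$i$j))" if "g \<in> carrier GA" for g
      using that(1) \<open>\<And>b a. a \<in> carrier adeles \<Longrightarrow> b \<in> carrier adeles \<Longrightarrow> P (lower_mat p a) = P (lower_mat p b)\<close>[OF entry[OF that] A.one_closed] by simp
    hence "subst_entry p i j {g \<in> carrier GA. P g} = carrier GA"
      using lower_mat_carrier[OF p entry] by (auto simp: subst_entry_def)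
    thus ?thesis by simp
  next
    interpret A: cring "adeles :: 'k adele ring" by (rule cring_adeles)
    case False
    hence "\<not> P (lower_mat p (g$i$j))" if "g \<in> carrier GA" for g
      using that(1) \<open>\<And>b a. a \<in> carrier adeles \<Longrightarrow> b \<in> carrier adeles \<Longrightarrow> P (lower_mat p a) = P (lower_mat p b)\<close>[OF entry[OF that] A.one_closed] by simp
    hence "subst_entry p i j {g \<in> carrier GA. P g} = {}" by (auto simp: subst_entry_def)
    thus ?thesis by simp
  qed
  have "generate_topology_on ?B S"
    using S by (simp add: GA_topology_def openin_topology_generated_by)
  thus ?thesis
  proof induction
    case Empty
    show ?case by (simp add: subst_entry_def)
  next
    case (Int a b)
    have "subst_entry p i j (a \<inter> b) = subst_entry p i j a \<inter> subst_entry p i j b"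
      by (auto simp: subst_entry_def)
    thus ?case using Int.IH sub[of a] sub[of b] by (metis inf.absorb2 inf.orderE openin_Int)
  next
    case (UN K)
    have *: "subst_entry p i j (\<Union>K) = (\<Union>k\<in>K. subst_entry p i j k)"
      by (auto simp: subst_entry_def)
    show ?case
    proof (cases "\<exists>k\<in>K. subst_entry p i j k = carrier GA")
      case True
      then obtain k where k: "k \<in> K" "subst_entry p i j k = carrier GA" by blast
      have "(\<Union>k\<in>K. subst_entry p i j k) = carrier GA"
        using k by (intro antisym UN_least sub) auto
      thus ?thesis using * by simp
    next
      case False
      thus ?thesis unfolding * using UN.IH by (intro disjI1 openin_Union) auto
    qed
  next
    case (Basis T)
    have lower: "lower_mat p a $ 1 $ 1 = \<one>\<^bsub>adeles\<^esub>" "lower_mat p a $ 1 $ 2 = \<zero>\<^bsub>adeles\<^esub>"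
       "lower_mat p a $ 2 $ 1 = a" "lower_mat p a $ 2 $ 2 = p" for a
      by (simp_all add: lower_mat_def)
    from Basis consider (ent) k l U where "T = {g \<in> carrier GA. g$k$l \<in> U}" "openin adele_topology U"
      | (det) U where "T = {g \<in> carrier GA. inv\<^bsub>adeles\<^esub> (det2 adeles g) \<in> U}" by blast
    thus ?case
    proof cases
      case ent
      show ?thesis
      proof (cases "k = 2 \<and> l = 1")
        case True
        have "subst_entry p i j T = {g \<in> carrier GA. g$i$j \<in> U}"
          using lower_mat_carrier[OF p entry] True
          by (auto simp: subst_entry_def ent lower)
        moreover have "openin GA_topology {g \<in> carrier GA. g$i$j \<in> U}"
          unfolding GA_topology_def openin_topology_generated_by_iff
          by (rule generate_topology_on.Basis) (use ent in blast)
        ultimately show ?thesis by simp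
      next
        case False
        have "subst_entry p i j T \<in> {{}, carrier GA}"
          unfolding ent by (rule const) (use False exhaust_2[of k] exhaust_2[of l] in \<open>auto simp: lower\<close>)
        thus ?thesis by auto
      qed
    next
      case det
      have "subst_entry p i j T \<in> {{}, carrier GA}"
        unfolding det by (rule const) (simp add: det2_lower_mat[OF p])
      thus ?thesis by auto
    qed
  qed
qed

lemma subst_entry_sets:
  fixes \<mu> :: "('k::{field,finite} adele^2^2) measure"
  assumes \<mu>: "normalized_haar \<mu>" and p: "p \<in> Units adeles" and S: "S \<in> sets \<mu>"
  shows "subst_entry p i j S \<in> sets \<mu>"
proof -
  have entry: "g$i$j \<in> carrier adeles" if "g \<in> carrier GA" for g :: "'k adele^2^2"
    using that by (simp add: GL2_def)
  have sets: "sets \<mu> = sigma_sets (carrier GA) {U. openin GA_topology U}"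
    using \<mu> by (simp add: normalized_haar_def)
  have "S \<in> sigma_sets (carrier GA) {U. openin GA_topology U}" using S sets by simp
  thus ?thesis
  proof induction
    case (Basic a)
    hence "openin GA_topology (subst_entry p i j a) \<or> subst_entry p i j a = carrier GA"
      using subst_entry_open[OF p] by blast
    thus ?case using haar_space[OF \<mu>] unfolding sets by auto
  next
    case Empty
    show ?case by (simp add: subst_entry_def)
  next
    case (Compl a)
    have "subst_entry p i j (carrier GA - a) = carrier GA - subst_entry p i j a"
      using lower_mat_carrier[OF p entry] by (auto simp: subst_entry_def)
    thus ?case using Compl.IH haar_space[OF \<mu>] by auto
  next
    case (Union a)
    have "subst_entry p i j (\<Union>n. a n) = (\<Union>n. subst_entry p i j (a n))"
      by (auto simp: subst_entry_def)
    thus ?case using Union.IH by auto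
  qed
qed


subsection \<open>The congruence subgroup has positive measure\<close>

context coord
begin

interpretation G: group GAk by (rule group_GA)

interpretation K: subgroup K' GAk by (rule congruence_subgroup_subgroup)

text \<open>The lower right entry of the substituted matrix: a uniformizer at \<open>x\<close> and
  \<open>1\<close> elsewhere. It makes a coset of the maximal compact subgroup see the entry
  modulo the maximal ideal at \<open>x\<close>.\<close>

definition pad :: "'k adele" where
  "pad = (\<lambda>z. if z = x then to_completion x (inverse s) else \<one>\<^bsub>completion z\<^esub>)"

definition single :: "'k poly fract \<Rightarrow> 'k adele" where
  "single f = (\<lambda>z. if z = x then to_completion x f else \<zero>\<^bsub>completion z\<^esub>)"

lemma single_carrier: "single f \<in> carrier adeles"
  by (rule adeles_carrierI[of _ "{x}"]) (auto simp: single_def cring.cring_simprules cring_completion)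

lemma pad_Units: "pad \<in> Units adeles"
proof -
  interpret A: cring "adeles :: 'k adele ring" by (rule cring_adeles)
  interpret C: cring "completion z" for z :: "'k place" by (rule cring_completion)
  define q :: "'k adele" where "q = (\<lambda>z. if z = x then to_completion x s else \<one>\<^bsub>completion z\<^esub>)"
  have c: "pad \<in> carrier adeles" "q \<in> carrier adeles"
    by (rule adeles_carrierI[of _ "{x}"]; simp add: pad_def q_def)+
  have "pad \<otimes>\<^bsub>adeles\<^esub> q = \<one>\<^bsub>adeles\<^esub>"
    using s_nz by (auto simp: fun_eq_iff pad_def q_def simp flip: to_completion_mult)
  thus ?thesis using c A.m_comm[of pad q] unfolding Units_def by auto
qed

lemma lower_mat_coset_iff:
  assumes a: "a \<in> carrier adeles" "\<And>z. cge z 0 (a z)"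
  shows "lower_mat pad a \<in> lower_mat pad (single f) <#\<^bsub>GAk\<^esub> max_compact \<longleftrightarrow>
    cge x 1 (a x \<ominus>\<^bsub>completion x\<^esub> to_completion x f)"
proof -
  interpret C: cring "completion z" for z :: "'k place" by (rule cring_completion)
  let ?c = "completion x" and ?\<iota> = "to_completion x"
  have comp: "component (lower_mat pad b) z = mk \<one>\<^bsub>completion z\<^esub> \<zero>\<^bsub>completion z\<^esub> (b z) (pad z)" for b z
    by (simp add: lower_mat_def component_mk)
  have ax: "a x \<in> carrier ?c" by (rule cge_closed[OF a(2)])
  have inv: "?\<iota> s \<otimes>\<^bsub>?c\<^esub> ?\<iota> (inverse s) = \<one>\<^bsub>?c\<^esub>" using s_nz by (simp flip: to_completion_mult)
  have ge: "cge x 1 (?\<iota> (inverse s))" "cge x (-1) (?\<iota> s)" using s_nz val_s by (auto simp: vge_def place_val_inverse)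
  show ?thesis
  proof
    assume "lower_mat pad a \<in> lower_mat pad (single f) <#\<^bsub>GAk\<^esub> max_compact"
    then obtain k where k: "k \<in> max_compact" "lower_mat pad a = lower_mat pad (single f) \<otimes>\<^bsub>GAk\<^esub> k"
      by (auto simp: l_coset_def)
    obtain p q r t where c: "component k x = mk p q r t" by (rule mk_cases)
    have int: "cge x 0 p" "cge x 0 q" "cge x 0 r" "cge x 0 t"
      using k(1) unfolding max_compact_iff by (metis Kz_iff c)+
    note cl = int[THEN cge_closed]
    have "mk \<one>\<^bsub>?c\<^esub> \<zero>\<^bsub>?c\<^esub> (a x) (pad x) = mk \<one>\<^bsub>?c\<^esub> \<zero>\<^bsub>?c\<^esub> (single f x) (pad x) \<otimes>\<^bsub>Gz x\<^esub> mk p q r t"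
      using k(2) comp component_mult c by metis
    hence e: "\<one>\<^bsub>?c\<^esub> = p" "a x = ?\<iota> f \<otimes>\<^bsub>?c\<^esub> p \<oplus>\<^bsub>?c\<^esub> ?\<iota> (inverse s) \<otimes>\<^bsub>?c\<^esub> r"
      using cl by (simp_all add: GL2_mult single_def pad_def)
    have "a x \<ominus>\<^bsub>?c\<^esub> ?\<iota> f = ?\<iota> (inverse s) \<otimes>\<^bsub>?c\<^esub> r"
      unfolding e(2) e(1)[symmetric] using cl(3) to_completion_closed[of x f] to_completion_closed[of x "inverse s"]
      C.r_one[of "?\<iota> f" x] by algebra
    thus "cge x 1 (a x \<ominus>\<^bsub>?c\<^esub> ?\<iota> f)" using cge_mult[OF ge(1) int(3)] by simp
  next
    assume *: "cge x 1 (a x \<ominus>\<^bsub>?c\<^esub> ?\<iota> f)"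
    define r where "r = ?\<iota> s \<otimes>\<^bsub>?c\<^esub> (a x \<ominus>\<^bsub>?c\<^esub> ?\<iota> f)"
    have r: "cge x 0 r" using cge_mult[OF ge(2) *] by (simp add: r_def)
    define k where "k = assemble (\<lambda>z. mk \<one>\<^bsub>completion z\<^esub> \<zero>\<^bsub>completion z\<^esub> (if z = x then r else a z) \<one>\<^bsub>completion z\<^esub>)"
    have "component k z \<in> Kz z" for z
    proof -
      define m where "m = (if z = x then r else a z)"
      have m: "cge z 0 m" using r a by (simp add: m_def)
      have "\<one>\<^bsub>completion z\<^esub> \<otimes>\<^bsub>completion z\<^esub> \<one>\<^bsub>completion z\<^esub> \<ominus>\<^bsub>completion z\<^esub> \<zero>\<^bsub>completion z\<^esub> \<otimes>\<^bsub>completion z\<^esub> m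
          = \<one>\<^bsub>completion z\<^esub>" using cge_closed[OF m] by (simp add: a_minus_def)
      hence "mk \<one>\<^bsub>completion z\<^esub> \<zero>\<^bsub>completion z\<^esub> m \<one>\<^bsub>completion z\<^esub> \<in> Kz z"
        unfolding Kz_iff using m by (simp add: completion_one_neq_zero)
      thus ?thesis by (simp add: k_def m_def)
    qed
    hence "k \<in> max_compact" by (simp add: max_compact_iff)
    moreover have "lower_mat pad a = lower_mat pad (single f) \<otimes>\<^bsub>GAk\<^esub> k"
    proof (rule component_eqI)
      fix z :: "'k place"
      have az: "a z \<in> carrier (completion z)" using a cge_closed by blast
      show "component (lower_mat pad a) z = component (lower_mat pad (single f) \<otimes>\<^bsub>GAk\<^esub> k) z"
      proof (cases "z = x")
        case False
        hence "pad z = \<one>\<^bsub>completion z\<^esub>" "single f z = \<zero>\<^bsub>completion z\<^esub>"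
          by (simp_all add: pad_def single_def)
        thus ?thesis using False az by (simp add: comp k_def GL2_mult)
      next
        case True
        have "?\<iota> (inverse s) \<otimes>\<^bsub>?c\<^esub> r = ?\<iota> s \<otimes>\<^bsub>?c\<^esub> ?\<iota> (inverse s) \<otimes>\<^bsub>?c\<^esub> (a x \<ominus>\<^bsub>?c\<^esub> ?\<iota> f)"
          unfolding r_def using ax to_completion_closed[of x s] to_completion_closed[of x "inverse s"]
            to_completion_closed[of x f] by algebra
        also have "\<dots> = a x \<ominus>\<^bsub>?c\<^esub> ?\<iota> f" using ax by (simp add: inv)
        finally have e: "?\<iota> (inverse s) \<otimes>\<^bsub>?c\<^esub> r = a x \<ominus>\<^bsub>?c\<^esub> ?\<iota> f" .
        have "?\<iota> f \<oplus>\<^bsub>?c\<^esub> (a x \<ominus>\<^bsub>?c\<^esub> ?\<iota> f) = a x" using ax to_completion_closed[of x f] by algebra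
        moreover have "pad x = ?\<iota> (inverse s)" "single f x = ?\<iota> f" by (simp_all add: pad_def single_def)
        ultimately show ?thesis using True ax cge_closed[OF r] by (simp add: comp k_def GL2_mult e)
      qed
    qed
    ultimately show "lower_mat pad a \<in> lower_mat pad (single f) <#\<^bsub>GAk\<^esub> max_compact"
      by (auto simp: l_coset_def)
  qed
qed

definition near :: "'k poly fract^2^2 \<Rightarrow> ('k adele^2^2) set" where
  "near A = {g \<in> max_compact. \<forall>i j. cge x 1 (component g x $ i $ j \<ominus>\<^bsub>completion x\<^esub> to_completion x (A$i$j))}"

text \<open>Each condition on an entry is a substituted coset of the maximal compact subgroup.\<close>

lemma near_sets:
  assumes \<mu>: "normalized_haar (\<mu> :: ('k adele^2^2) measure)"
  shows "near A \<in> sets \<mu>"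
proof -
  let ?T = "\<lambda>i j. lower_mat pad (single (A$i$j)) <#\<^bsub>GAk\<^esub> max_compact"
  have T: "?T i j \<in> sets \<mu>" for i j
  proof (rule haar_translate_sets[OF \<mu> lower_mat_carrier[OF pad_Units single_carrier] haar_max_compact[OF \<mu>]])
    show "emeasure \<mu> max_compact \<noteq> 0" using \<mu> by (simp add: normalized_haar_def)
  qed
  have "g \<in> subst_entry pad i j (?T i j) \<longleftrightarrow>
      cge x 1 (component g x $ i $ j \<ominus>\<^bsub>completion x\<^esub> to_completion x (A$i$j))" if g: "g \<in> max_compact" for g i j
  proof -
    have gc: "g \<in> carrier GA" using g max_compact_carrier by blast
    hence e: "g$i$j \<in> carrier adeles" by (simp add: GL2_def)
    have "cge z 0 ((g$i$j) z)" for z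
      using Kz_entry[of "component g z" z i j] g by (simp add: max_compact_iff component_def)
    from lower_mat_coset_iff[OF e this] show ?thesis
      using gc by (simp add: subst_entry_def component_def)
  qed
  hence "near A = max_compact \<inter> (\<Inter>i. \<Inter>j. subst_entry pad i j (?T i j))" unfolding near_def by blast
  moreover have "(\<Inter>i. \<Inter>j. subst_entry pad i j (?T i j)) \<in> sets \<mu>"
    by (intro sets.finite_INT subst_entry_sets[OF \<mu> pad_Units T]) auto
  ultimately show ?thesis using haar_max_compact[OF \<mu>] by auto
qed

lemma near_mult:
  assumes A: "A \<in> GO x" and k: "k \<in> local_congruence x"
  shows "cge x 1 ((loc x A \<otimes>\<^bsub>Gz x\<^esub> k) $ i $ j \<ominus>\<^bsub>completion x\<^esub> to_completion x (A$i$j))"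
proof -
  interpret C: cring "completion x" by (rule cring_completion)
  let ?c = "completion x" and ?\<iota> = "to_completion x"
  obtain a b c d where A': "A = mk a b c d" by (rule mk_cases)
  obtain p q r t where k': "k = mk p q r t" by (rule mk_cases)
  have int: "cge x 0 (?\<iota> a)" "cge x 0 (?\<iota> b)" "cge x 0 (?\<iota> c)" "cge x 0 (?\<iota> d)"
    using A by (simp_all add: A' mk_in_GO_iff)
  have kk: "p \<in> carrier ?c" "t \<in> carrier ?c" "cge x 1 (p \<ominus>\<^bsub>?c\<^esub> \<one>\<^bsub>?c\<^esub>)" "cge x 1 q" "cge x 1 r"
    "cge x 1 (t \<ominus>\<^bsub>?c\<^esub> \<one>\<^bsub>?c\<^esub>)" using k unfolding k' local_congruence_iff by blast+
  have D: "cge x 1 (A \<otimes>\<^bsub>?c\<^esub> P \<oplus>\<^bsub>?c\<^esub> B \<otimes>\<^bsub>?c\<^esub> Q \<ominus>\<^bsub>?c\<^esub> A)" "cge x 1 (B \<otimes>\<^bsub>?c\<^esub> Q \<oplus>\<^bsub>?c\<^esub> A \<otimes>\<^bsub>?c\<^esub> P \<ominus>\<^bsub>?c\<^esub> A)"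
    if "cge x 0 A" "cge x 0 B" "P \<in> carrier ?c" "cge x 1 (P \<ominus>\<^bsub>?c\<^esub> \<one>\<^bsub>?c\<^esub>)" "cge x 1 Q" for A B P Q
  proof -
    have cl: "A \<in> carrier ?c" "B \<in> carrier ?c" "Q \<in> carrier ?c" using that by (auto intro: cge_closed)
    have "A \<otimes>\<^bsub>?c\<^esub> P \<oplus>\<^bsub>?c\<^esub> B \<otimes>\<^bsub>?c\<^esub> Q \<ominus>\<^bsub>?c\<^esub> A = A \<otimes>\<^bsub>?c\<^esub> (P \<ominus>\<^bsub>?c\<^esub> \<one>\<^bsub>?c\<^esub>) \<oplus>\<^bsub>?c\<^esub> B \<otimes>\<^bsub>?c\<^esub> Q"
      using cl that(3) C.r_one[OF cl(1)] C.one_closed by algebra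
    moreover have "B \<otimes>\<^bsub>?c\<^esub> Q \<oplus>\<^bsub>?c\<^esub> A \<otimes>\<^bsub>?c\<^esub> P \<ominus>\<^bsub>?c\<^esub> A = A \<otimes>\<^bsub>?c\<^esub> P \<oplus>\<^bsub>?c\<^esub> B \<otimes>\<^bsub>?c\<^esub> Q \<ominus>\<^bsub>?c\<^esub> A"
      using cl that(3) by (simp add: C.a_comm)
    moreover have "cge x (0 + 1) (A \<otimes>\<^bsub>?c\<^esub> (P \<ominus>\<^bsub>?c\<^esub> \<one>\<^bsub>?c\<^esub>))" "cge x (0 + 1) (B \<otimes>\<^bsub>?c\<^esub> Q)"
      using that by (blast intro: cge_mult)+
    ultimately show "cge x 1 (A \<otimes>\<^bsub>?c\<^esub> P \<oplus>\<^bsub>?c\<^esub> B \<otimes>\<^bsub>?c\<^esub> Q \<ominus>\<^bsub>?c\<^esub> A)" "cge x 1 (B \<otimes>\<^bsub>?c\<^esub> Q \<oplus>\<^bsub>?c\<^esub> A \<otimes>\<^bsub>?c\<^esub> P \<ominus>\<^bsub>?c\<^esub> A)"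
      by (simp_all add: cge_add)
  qed
  show ?thesis
    using D(1)[OF int(1,2) kk(1,3,5)] D(2)[OF int(2,1) kk(2,6,4)] D(1)[OF int(3,4) kk(1,3,5)] D(2)[OF int(4,3) kk(2,6,4)]
      exhaust_2[of i] exhaust_2[of j] by (auto simp: A' k' GL2_mult)
qed

lemma GO_congruent:
  assumes B: "B \<in> GO x" and D: "\<And>i j. vge x 1 (A$i$j - B$i$j)"
  shows "A \<in> GO x" "rinv B ** A \<in> GO1 x"
proof -
  have rB: "rinv B \<in> GO x" "det B \<noteq> 0" using B GO_rinv GO_det by auto
  have "vge x (0 + 1) ((rinv B ** (A - B))$i$j)" for i j
    using rB D by (intro vge_matrix_mult) (auto simp: GO_def)
  moreover have "rinv B ** A = mat 1 + rinv B ** (A - B)"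
  proof -
    have "rinv B ** A = rinv B ** B + rinv B ** (A - B)" by (simp flip: matrix_add_ldistrib)
    thus ?thesis using rB by (simp add: rinv_left)
  qed
  ultimately show 1: "rinv B ** A \<in> GO1 x" unfolding GO1_iff by auto
  hence "B ** (rinv B ** A) \<in> GO x" using GO1_subset_GO GO_mult[OF B] by blast
  thus "A \<in> GO x" using rB by (simp add: rinv_right matrix_mul_assoc)
qed

lemma near_rational:
  assumes M: "M \<in> Kz x"
  obtains B \<kappa> where "B \<in> GO x" "\<kappa> \<in> local_congruence x" "M = loc x B \<otimes>\<^bsub>Gz x\<^esub> \<kappa>"
proof -
  interpret L: group "Gz x" by (rule group_Gz)
  obtain B \<kappa> where B: "det B \<noteq> 0" "\<kappa> \<in> local_congruence x" "M = loc x B \<otimes>\<^bsub>Gz x\<^esub> \<kappa>"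
    using local_approx[OF Kz_subset[OF M]] by blast
  have \<kappa>: "\<kappa> \<in> Kz x" "\<kappa> \<in> carrier (Gz x)" using B(2) local_congruence_subset Kz_subset by auto
  have "loc x B = M \<otimes>\<^bsub>Gz x\<^esub> inv\<^bsub>Gz x\<^esub> \<kappa>" using B(1) \<kappa> by (simp add: B(3) L.m_assoc)
  moreover have "M \<otimes>\<^bsub>Gz x\<^esub> inv\<^bsub>Gz x\<^esub> \<kappa> \<in> Kz x"
    by (intro subgroup.m_closed[OF Kz_subgroup] subgroup.m_inv_closed[OF Kz_subgroup] M \<kappa>)
  ultimately have "B \<in> GO x" using loc_Kz by metis
  thus thesis using that B by blast
qed

text \<open>For an integral rational matrix \<open>A\<close>, congruence to \<open>A\<close> modulo the
  maximal ideal describes a left coset of \<open>K'\<close>; for \<open>A = 1\<close> it is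
  \<open>K'\<close> itself.\<close>

lemma near_eq:
  assumes A: "A \<in> GO x"
  shows "near A = local_emb x A <#\<^bsub>GAk\<^esub> K'"
proof
  interpret L: group "Gz z" for z :: "'k place" by (rule group_Gz)
  interpret C: cring "completion x" by (rule cring_completion)
  have dA: "det A \<noteq> 0" using A GO_det by blast
  show "local_emb x A <#\<^bsub>GAk\<^esub> K' \<subseteq> near A"
  proof
    fix g assume "g \<in> local_emb x A <#\<^bsub>GAk\<^esub> K'"
    then obtain k where k: "k \<in> K'" "g = local_emb x A \<otimes>\<^bsub>GAk\<^esub> k" by (auto simp: l_coset_def)
    have kx: "component k x \<in> local_congruence x" "\<And>z. component k z \<in> Kz z" "\<And>z. component k z \<in> carrier (Gz z)"
      using k(1) congruence_subgroup_Kz[OF k(1)] by (auto simp: congruence_subgroup_iff Kz_subset)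
    have "component g z \<in> Kz z" for z
    proof (cases "z = x")
      case True
      have "loc x A \<otimes>\<^bsub>Gz x\<^esub> component k x \<in> Kz x" using A kx by (intro subgroup.m_closed[OF Kz_subgroup]) simp_all
      thus ?thesis using True by (simp add: k(2) component_local_emb)
    next
      case False
      thus ?thesis using kx by (simp add: k(2) component_local_emb)
    qed
    moreover have "component g x = loc x A \<otimes>\<^bsub>Gz x\<^esub> component k x" by (simp add: k(2) component_local_emb)
    ultimately show "g \<in> near A" using near_mult[OF A kx(1)] by (simp add: near_def max_compact_iff)
  qed
  show "near A \<subseteq> local_emb x A <#\<^bsub>GAk\<^esub> K'"
  proof
    fix g assume "g \<in> near A"
    hence g: "\<And>z. component g z \<in> Kz z"
      and gx: "\<And>i j. cge x 1 (component g x $ i $ j \<ominus>\<^bsub>completion x\<^esub> to_completion x (A$i$j))"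
      by (auto simp: near_def max_compact_iff)
    obtain B \<kappa> where B: "B \<in> GO x" "\<kappa> \<in> local_congruence x" "component g x = loc x B \<otimes>\<^bsub>Gz x\<^esub> \<kappa>"
      using near_rational[OF g] by blast
    have dB: "det B \<noteq> 0" using B GO_det by blast
    have "vge x 1 (B$i$j - A$i$j)" for i j
    proof -
      let ?u = "component g x $ i $ j" and ?a = "to_completion x (A$i$j)" and ?b = "to_completion x (B$i$j)"
      have "?u \<in> carrier (completion x)" using Kz_entry[OF g] cge_closed by blast
      hence "(?u \<ominus>\<^bsub>completion x\<^esub> ?a) \<ominus>\<^bsub>completion x\<^esub> (?u \<ominus>\<^bsub>completion x\<^esub> ?b) = ?b \<ominus>\<^bsub>completion x\<^esub> ?a"
        using to_completion_closed[of x "A$i$j"] to_completion_closed[of x "B$i$j"] by algebra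
      moreover have "cge x 1 ((?u \<ominus>\<^bsub>completion x\<^esub> ?a) \<ominus>\<^bsub>completion x\<^esub> (?u \<ominus>\<^bsub>completion x\<^esub> ?b))"
        by (rule cge_diff[OF gx[of i j] near_mult[OF B(1,2), of i j, folded B(3)]])
      ultimately show ?thesis by (simp flip: to_completion_diff)
    qed
    note B1 = GO_congruent(2)[OF A this]
    define k where "k = assemble (\<lambda>z. if z = x then loc x (rinv A ** B) \<otimes>\<^bsub>Gz x\<^esub> \<kappa> else component g z)"
    have "loc x (rinv A ** B) \<otimes>\<^bsub>Gz x\<^esub> \<kappa> \<in> local_congruence x"
      using B1 B(2) by (intro subgroup.m_closed[OF local_congruence_subgroup]) simp_all
    hence "k \<in> K'" using g by (simp add: k_def congruence_subgroup_iff)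
    moreover have "g = local_emb x A \<otimes>\<^bsub>GAk\<^esub> k"
    proof (rule component_eqI)
      fix z :: "'k place"
      have \<kappa>: "\<kappa> \<in> carrier (Gz x)" using B(2) local_congruence_subset Kz_subset by blast
      have "loc x B = loc x A \<otimes>\<^bsub>Gz x\<^esub> loc x (rinv A ** B)"
        using dA by (simp add: rinv_right matrix_mul_assoc flip: loc_mult)
      moreover have "loc x A \<in> carrier (Gz x)" "loc x (rinv A ** B) \<in> carrier (Gz x)"
        using dA dB by (simp_all add: det_mul det_rinv)
      ultimately have "loc x B \<otimes>\<^bsub>Gz x\<^esub> \<kappa> = loc x A \<otimes>\<^bsub>Gz x\<^esub> (loc x (rinv A ** B) \<otimes>\<^bsub>Gz x\<^esub> \<kappa>)"
        using \<kappa> by (simp add: L.m_assoc)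
      thus "component g z = component (local_emb x A \<otimes>\<^bsub>GAk\<^esub> k) z"
        using B(3) Kz_subset[OF g] by (simp add: component_local_emb k_def)
    qed
    ultimately show "g \<in> local_emb x A <#\<^bsub>GAk\<^esub> K'" by (auto simp: l_coset_def)
  qed
qed

lemma K'_sets:
  assumes \<mu>: "normalized_haar (\<mu> :: ('k adele^2^2) measure)"
  shows "K' \<in> sets \<mu>"
proof -
  have "mat 1 \<in> GO x" using line_mat_in_GO[of None x] by (simp add: line_mat_def)
  hence "near (mat 1) = local_emb x (mat 1) <#\<^bsub>GAk\<^esub> K'" by (rule near_eq)
  also have "local_emb x (mat 1) = \<one>\<^bsub>GAk\<^esub>" by (rule component_eqI) (simp add: component_local_emb)
  also have "\<one>\<^bsub>GAk\<^esub> <#\<^bsub>GAk\<^esub> K' = K'" by (rule G.lcos_mult_one[OF K.subset])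
  finally show ?thesis using near_sets[OF \<mu>] by metis
qed

text \<open>The residue field at \<open>x\<close> consists of the constants, so finitely many congruence
  conditions exhaust the maximal compact subgroup.\<close>

lemma max_compact_cover:
  "max_compact \<subseteq> (\<Union>C\<in>{C :: 'k^2^2. (\<chi> i j. const_elt (C$i$j)) \<in> GO x}. near (\<chi> i j. const_elt (C$i$j)))"
proof
  interpret C: cring "completion x" by (rule cring_completion)
  have tel: "u \<ominus>\<^bsub>completion x\<^esub> d = (u \<ominus>\<^bsub>completion x\<^esub> b) \<oplus>\<^bsub>completion x\<^esub> (b \<ominus>\<^bsub>completion x\<^esub> d)"
    if "u \<in> carrier (completion x)" "b \<in> carrier (completion x)" "d \<in> carrier (completion x)" for u b d
    using that by (simp add: a_minus_def C.a_assoc C.r_neg1)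
  fix g :: "'k adele^2^2" assume g: "g \<in> max_compact"
  hence gx: "component g x \<in> Kz x" by (simp add: max_compact_iff)
  obtain B \<kappa> where B: "B \<in> GO x" "\<kappa> \<in> local_congruence x" "component g x = loc x B \<otimes>\<^bsub>Gz x\<^esub> \<kappa>"
    using near_rational[OF gx] by blast
  have "\<forall>i j. \<exists>c. vge x 1 (B$i$j - const_elt c)" using B(1) residue_const by (auto simp: GO_def)
  then obtain c where c: "\<And>i j. vge x 1 (B$i$j - const_elt (c i j))" by metis
  let ?C = "\<chi> i j. const_elt ((\<chi> i j. c i j) $ i $ j) :: 'k poly fract^2^2"
  have "vge x 1 (?C$i$j - B$i$j)" for i j using c[of i j] vge_minus[of x 1 "B$i$j - const_elt (c i j)"] by simp
  hence "?C \<in> GO x" by (rule GO_congruent(1)[OF B(1)])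
  moreover have "g \<in> near ?C"
    unfolding near_def
  proof (intro CollectI conjI allI g)
    fix i j
    let ?u = "component g x $ i $ j" and ?b = "to_completion x (B$i$j)" and ?d = "to_completion x (?C$i$j)"
    have "?u \<in> carrier (completion x)" using Kz_entry[OF gx] cge_closed by blast
    hence "?u \<ominus>\<^bsub>completion x\<^esub> ?d = (?u \<ominus>\<^bsub>completion x\<^esub> ?b) \<oplus>\<^bsub>completion x\<^esub> (?b \<ominus>\<^bsub>completion x\<^esub> ?d)"
      using tel[OF _ to_completion_closed to_completion_closed] by blast
    moreover have "cge x 1 (?u \<ominus>\<^bsub>completion x\<^esub> ?b)" unfolding B(3) by (rule near_mult[OF B(1,2)])
    moreover have "cge x 1 (?b \<ominus>\<^bsub>completion x\<^esub> ?d)" using c by (simp flip: to_completion_diff)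
    ultimately show "cge x 1 (?u \<ominus>\<^bsub>completion x\<^esub> ?d)" by (simp add: cge_add)
  qed
  ultimately show "g \<in> (\<Union>C\<in>{C :: 'k^2^2. (\<chi> i j. const_elt (C$i$j)) \<in> GO x}. near (\<chi> i j. const_elt (C$i$j)))" by blast
qed

text \<open>The maximal compact subgroup has measure \<open>1\<close> and is covered by finitely many
  translates of \<open>K'\<close>.\<close>

lemma K'_emeasure:
  assumes \<mu>: "normalized_haar (\<mu> :: ('k adele^2^2) measure)"
  shows "emeasure \<mu> K' \<noteq> 0" "emeasure \<mu> K' \<le> 1"
proof -
  note sub = sets.sets_into_space
  show "emeasure \<mu> K' \<noteq> 0"
  proof
    assume 0: "emeasure \<mu> K' = 0"
    let ?I = "{C :: 'k^2^2. (\<chi> i j. const_elt (C$i$j)) \<in> GO x}"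
    have "near A \<in> null_sets \<mu>" if "A \<in> GO x" for A
      using haar_translate_emeasure[OF \<mu> _ K'_sets[OF \<mu>], of "local_emb x A"] near_sets[OF \<mu>, of A] near_eq[OF that] 0
        GO_det(1)[OF that] by (auto simp: null_sets_def)
    hence "(\<Union>C\<in>?I. near (\<chi> i j. const_elt (C$i$j))) \<in> null_sets \<mu>"
      by (intro null_sets.finite_UN) auto
    hence "max_compact \<in> null_sets \<mu>"
      by (rule null_sets_subset[OF _ haar_max_compact[OF \<mu>] max_compact_cover])
    thus False using \<mu> by (simp add: normalized_haar_def null_sets_def)
  qed
  have "emeasure \<mu> K' \<le> emeasure \<mu> max_compact"
    by (rule emeasure_mono[OF _ haar_max_compact[OF \<mu>]]) (auto simp: max_compact_iff congruence_subgroup_Kz)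
  thus "emeasure \<mu> K' \<le> 1" using \<mu> by (simp add: normalized_haar_def)
qed

subsection \<open>The Hecke operator\<close>

text \<open>The integrand is supported on the double coset and constant on each of its left cosets of
  \<open>K'\<close>, all of which have the measure of \<open>K'\<close>.\<close>

lemma hecke_eq_sum:
  fixes F :: "nat \<times> 'k option \<Rightarrow> complex" and \<mu> :: "('k adele^2^2) measure"
  assumes \<mu>: "normalized_haar \<mu>" and y: "y \<noteq> x" and \<pi>: "uniformizer y \<pi>" and g: "g \<in> carrier GAk"
  shows "hecke \<mu> (hecke_fun K' y \<pi>) (\<lambda>g. if g \<in> carrier GAk then F (vertex g) else 0) g =
    complex_of_real (measure \<mu> K') * (\<Sum>i\<in>hecke_index y. F (neighbour y (vertex g) i))"
proof -
  define f where "f = (\<lambda>g. if g \<in> carrier GAk then F (vertex g) else 0)"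
  define a where "a = (\<lambda>i. local_emb y (hecke_mat y i))"
  have a: "a i \<in> carrier GAk" for i using unif_nz[OF y] by (simp add: a_def det_hecke_mat)
  have coset: "hecke_coset y i = a i <#\<^bsub>GAk\<^esub> K'" for i by (simp add: hecke_coset_def a_def)
  have sets: "hecke_coset y i \<in> sets \<mu>" for i
    unfolding coset by (rule haar_translate_sets[OF \<mu> a K'_sets[OF \<mu>] K'_emeasure(1)[OF \<mu>]])
  have em: "emeasure \<mu> (hecke_coset y i) = emeasure \<mu> K'" for i
    unfolding coset by (rule haar_translate_emeasure[OF \<mu> a K'_sets[OF \<mu>]])
  have fin: "emeasure \<mu> K' < \<infinity>" using K'_emeasure(2)[OF \<mu>] by (simp add: le_less_trans)
  have const: "f (g \<otimes>\<^bsub>GAk\<^esub> h) = f (g \<otimes>\<^bsub>GAk\<^esub> a i)" if h: "h \<in> hecke_coset y i" for h i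
  proof -
    obtain k where k: "k \<in> K'" "h = a i \<otimes>\<^bsub>GAk\<^esub> k" using h by (auto simp: hecke_coset_iff a_def)
    have "g \<otimes>\<^bsub>GAk\<^esub> h = (g \<otimes>\<^bsub>GAk\<^esub> a i) \<otimes>\<^bsub>GAk\<^esub> k" using g a K'_closed[OF k(1)] by (simp add: k(2) G.m_assoc)
    moreover have "adele_equiv ((g \<otimes>\<^bsub>GAk\<^esub> a i) \<otimes>\<^bsub>GAk\<^esub> k) (g \<otimes>\<^bsub>GAk\<^esub> a i)" using g a by (intro adele_equiv_K' k) simp
    ultimately show ?thesis
      using g a K'_closed[OF k(1)] vertex_cong[of "(g \<otimes>\<^bsub>GAk\<^esub> a i) \<otimes>\<^bsub>GAk\<^esub> k" "g \<otimes>\<^bsub>GAk\<^esub> a i"] by (simp add: f_def)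
  qed
  have integrand: "hecke_fun K' y \<pi> h * f (g \<otimes>\<^bsub>GAk\<^esub> h) =
      (\<Sum>i\<in>hecke_index y. indicator (hecke_coset y i) h *\<^sub>R f (g \<otimes>\<^bsub>GAk\<^esub> a i))" for h
  proof (cases "h \<in> hecke_set y \<pi>")
    case True
    then obtain i where i: "i \<in> hecke_index y" "h \<in> hecke_coset y i" using hecke_set_subset[OF y \<pi>] by blast
    have "(\<Sum>j\<in>hecke_index y. indicator (hecke_coset y j) h *\<^sub>R f (g \<otimes>\<^bsub>GAk\<^esub> a j)) =
        (\<Sum>j\<in>hecke_index y. if j = i then f (g \<otimes>\<^bsub>GAk\<^esub> a i) else 0)"
    proof (rule sum.cong[OF refl])
      fix j assume "j \<in> hecke_index y"
      hence "h \<in> hecke_coset y j \<longleftrightarrow> j = i" using hecke_coset_disjoint[OF y i(1) _ i(2)] i(2) by metis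
      thus "indicator (hecke_coset y j) h *\<^sub>R f (g \<otimes>\<^bsub>GAk\<^esub> a j) = (if j = i then f (g \<otimes>\<^bsub>GAk\<^esub> a i) else 0)"
        by (cases "j = i") simp_all
    qed
    also have "\<dots> = f (g \<otimes>\<^bsub>GAk\<^esub> a i)" using i finite_hecke_index[of y] by simp
    finally show ?thesis
      using True const[OF i(2)] by (simp add: hecke_fun_def hecke_set_def)
  next
    case False
    hence "h \<notin> hecke_coset y i" for i using hecke_coset_subset_hecke_set[OF y \<pi>] by blast
    thus ?thesis using False by (simp add: hecke_fun_def hecke_set_def)
  qed
  have "has_bochner_integral \<mu> (\<lambda>h. hecke_fun K' y \<pi> h * f (g \<otimes>\<^bsub>GAk\<^esub> h))
      (\<Sum>i\<in>hecke_index y. measure \<mu> (hecke_coset y i) *\<^sub>R f (g \<otimes>\<^bsub>GAk\<^esub> a i))"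
    unfolding integrand using em fin
    by (intro has_bochner_integral_sum has_bochner_integral_scaleR_left has_bochner_integral_real_indicator sets) simp_all
  hence "(LINT h|\<mu>. hecke_fun K' y \<pi> h * f (g \<otimes>\<^bsub>GAk\<^esub> h)) =
      (\<Sum>i\<in>hecke_index y. measure \<mu> (hecke_coset y i) *\<^sub>R f (g \<otimes>\<^bsub>GAk\<^esub> a i))"
    by (rule has_bochner_integral_integral_eq)
  also have "\<dots> = complex_of_real (measure \<mu> K') * (\<Sum>i\<in>hecke_index y. F (vertex (g \<otimes>\<^bsub>GAk\<^esub> a i)))"
    using em g a by (simp add: measure_def sum_distrib_left scaleR_conv_of_real f_def)
  also have "(\<Sum>i\<in>hecke_index y. F (vertex (g \<otimes>\<^bsub>GAk\<^esub> a i))) = (\<Sum>i\<in>hecke_index y. F (neighbour y (vertex g) i))"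
    unfolding a_def by (rule hecke_sum[OF y \<pi> g])
  finally show ?thesis using g unfolding f_def[symmetric] hecke_def by simp
qed

end

section \<open>The height along the cusp\<close>

lemma completion_abs_le:
  fixes A :: "'k::{field,finite} completed"
  assumes "cge z n A"
  shows "completion_abs z A \<le> real CARD('k) powi (- (int (place_degree z) * n))"
proof (cases "A = \<zero>\<^bsub>completion z\<^esub>")
  case False
  hence "n \<le> completion_val z A" using assms by (simp add: cge_def)
  hence "- (int (place_degree z) * completion_val z A) \<le> - (int (place_degree z) * n)"
    by (simp add: mult_left_mono)
  thus ?thesis
    unfolding completion_abs_nonzero(1)[OF False]
    using card_field_gt_1[where ?'k = 'k] by (intro power_int_increasing) auto
qed simp

lemma completion_abs_mult:
  fixes A :: "'k::{field,finite} completed"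
  assumes "A \<in> carrier (completion z)" "B \<in> carrier (completion z)"
  shows "completion_abs z (A \<otimes>\<^bsub>completion z\<^esub> B) = completion_abs z A * completion_abs z B"
proof -
  interpret C: cring "completion z" by (rule cring_completion)
  show ?thesis
  proof (cases "A = \<zero>\<^bsub>completion z\<^esub> \<or> B = \<zero>\<^bsub>completion z\<^esub>")
    case True
    thus ?thesis using assms by (elim disjE) simp_all
  next
    case False
    hence nz: "A \<noteq> \<zero>\<^bsub>completion z\<^esub>" "B \<noteq> \<zero>\<^bsub>completion z\<^esub>" by simp_all
    note m = completion_val_mult[OF assms nz]
    have e: "- (int (place_degree z) * (completion_val z A + completion_val z B)) =
        - (int (place_degree z) * completion_val z A) + - (int (place_degree z) * completion_val z B)"
      by (simp add: distrib_left)
    show ?thesis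
      unfolding completion_abs_nonzero(1)[OF m(1)] completion_abs_nonzero(1)[OF nz(1)]
        completion_abs_nonzero(1)[OF nz(2)] m(2) e
      by (rule power_int_add) simp
  qed
qed

lemma completion_abs_one [simp]: "completion_abs z \<one>\<^bsub>completion z\<^esub> = 1"
  by (simp add: completion_abs_def completion_one_neq_zero)

text \<open>The ultrametric inequality. It keeps constants out of the estimates at single places, where they
  would accumulate in the product over all places.\<close>

lemma completion_abs_add:
  fixes A :: "'k::{field,finite} completed"
  assumes "A \<in> carrier (completion z)" "B \<in> carrier (completion z)"
  shows "completion_abs z (A \<oplus>\<^bsub>completion z\<^esub> B) \<le> max (completion_abs z A) (completion_abs z B)"
proof -
  interpret C: cring "completion z" by (rule cring_completion)
  show ?thesis
  proof (cases "A = \<zero>\<^bsub>completion z\<^esub> \<or> B = \<zero>\<^bsub>completion z\<^esub>")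
    case True
    thus ?thesis using assms completion_abs_nonneg by (elim disjE) simp_all
  next
    case False
    hence nz: "A \<noteq> \<zero>\<^bsub>completion z\<^esub>" "B \<noteq> \<zero>\<^bsub>completion z\<^esub>" by simp_all
    define n where "n = min (completion_val z A) (completion_val z B)"
    have "cge z n A" "cge z n B"
      using assms by (auto simp: n_def intro!: cge_mono[OF cge_val])
    hence "completion_abs z (A \<oplus>\<^bsub>completion z\<^esub> B) \<le> real CARD('k) powi (- (int (place_degree z) * n))"
      by (intro completion_abs_le cge_add)
    moreover have "real CARD('k) powi (- (int (place_degree z) * n)) \<in> {completion_abs z A, completion_abs z B}"
      unfolding completion_abs_nonzero(1)[OF nz(1)] completion_abs_nonzero(1)[OF nz(2)] n_def
      by (cases "completion_val z A \<le> completion_val z B") simp_all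
    ultimately show ?thesis by (auto simp: le_max_iff_disj)
  qed
qed

lemma completion_abs_integral: "cge z 0 A \<Longrightarrow> completion_abs z A \<le> 1"
  using completion_abs_le[of z 0 A] by simp

lemma loc_nth: "loc z A $ i $ j = to_completion z (A$i$j)"
  by (simp add: loc_def)

lemma det2_mult:
  assumes "cring R" "A \<in> carrier (GL2 R)" "B \<in> carrier (GL2 R)"
  shows "det2 R (A \<otimes>\<^bsub>GL2 R\<^esub> B) = det2 R A \<otimes>\<^bsub>R\<^esub> det2 R B"
proof -
  interpret cring R by fact
  obtain a b c d where A: "A = mk a b c d" by (rule mk_cases)
  obtain a' b' c' d' where B: "B = mk a' b' c' d'" by (rule mk_cases)
  show ?thesis using assms(2,3) by (simp add: A B GL2_mult GL2_carrier GL2_det_mult)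
qed

lemma det2_Gz: "M \<in> carrier (Gz z) \<Longrightarrow> det2 (completion z) M \<in> carrier (completion z)"
  "M \<in> carrier (Gz z) \<Longrightarrow> det2 (completion z) M \<noteq> \<zero>\<^bsub>completion z\<^esub>"
proof -
  assume "M \<in> carrier (Gz z)"
  hence "det2 (completion z) M \<in> Units (completion z)" by (simp add: GL2_def)
  thus "det2 (completion z) M \<in> carrier (completion z)" "det2 (completion z) M \<noteq> \<zero>\<^bsub>completion z\<^esub>"
    by (simp_all add: completion_Units_iff)
qed

lemma Kz_det_abs: "M \<in> Kz z \<Longrightarrow> completion_abs z (det2 (completion z) M) = 1"
proof -
  assume M: "M \<in> Kz z"
  obtain a b c d where M': "M = mk a b c d" by (rule mk_cases)
  show ?thesis using M unfolding M' Kz_iff det2_mk by (simp add: completion_abs_nonzero(1))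
qed

lemma completion_abs_inv:
  assumes "A \<in> carrier (completion z)" "A \<noteq> \<zero>\<^bsub>completion z\<^esub>"
  shows "completion_abs z A * completion_abs z (inv\<^bsub>completion z\<^esub> A) = 1"
  using completion_abs_mult[OF assms(1) completion_inv(1)[OF assms]] by (simp add: completion_inv(4)[OF assms])

lemma local_height_ge:
  "completion_abs z (M$i$j) \<le> local_height z M"
  "completion_abs z (inv\<^bsub>completion z\<^esub> (det2 (completion z) M)) \<le> local_height z M"
  unfolding local_height_def by (intro Max_ge; force)+

lemma local_height_nonneg: "local_height z M \<ge> 0"
  using local_height_ge(1)[of z M 1 1] completion_abs_nonneg[of z "M$1$1"] by linarith

lemma local_height_Kz: assumes M: "M \<in> Kz z" shows "local_height z M = 1"
proof -
  have "completion_abs z (det2 (completion z) M) * completion_abs z (inv\<^bsub>completion z\<^esub> (det2 (completion z) M)) = 1"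
    using M det2_Gz[OF Kz_subset] by (intro completion_abs_inv)
  hence "completion_abs z (inv\<^bsub>completion z\<^esub> (det2 (completion z) M)) = 1" by (simp add: Kz_det_abs[OF M])
  moreover have "completion_abs z (M$i$j) \<le> 1" for i j by (rule completion_abs_integral[OF Kz_entry[OF M]])
  ultimately show ?thesis unfolding local_height_def by (intro Max_eqI) auto
qed

text \<open>The inverse determinant in the height gives a lower bound for the determinant.\<close>

lemma local_height_det:
  assumes "M \<in> carrier (Gz z)"
  shows "1 \<le> completion_abs z (det2 (completion z) M) * local_height z M"
  using completion_abs_inv[OF det2_Gz[OF assms]] mult_left_mono[OF local_height_ge(2)[of z M] completion_abs_nonneg[of z "det2 (completion z) M"]]
  by simp

lemma height_eq_prod:
  fixes g :: "'k::{field,finite} adele^2^2"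
  assumes "g \<in> carrier GA" "finite S" "{z. component g z \<notin> Kz z} \<subseteq> S"
  shows "height g = (\<Prod>z\<in>S. local_height z (component g z))"
  unfolding height_def
  by (rule prod.mono_neutral_left[OF assms(2)]) (use assms(3) local_height_Kz in blast)+

lemma height_pos:
  fixes g :: "'k::{field,finite} adele^2^2"
  assumes "g \<in> carrier GA" shows "height g > 0"
proof -
  have "local_height z (component g z) > 0" for z
  proof (rule ccontr)
    assume "\<not> local_height z (component g z) > 0"
    hence "local_height z (component g z) = 0" using local_height_nonneg[of z "component g z"] by simp
    thus False using local_height_det[OF component_in_Gz[OF assms, of z]] by simp
  qed
  thus ?thesis unfolding height_def by (intro prod_pos) simp
qed

text \<open>The quantity \<open>f\<^sup>2 / det A\<close>, with \<open>f\<close> an entry of the first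
  column of \<open>A\<close>, does not change when \<open>A\<close> is scaled, so the unknown
  central factor \<open>a\<close> cancels. Its square comes from the entries of \<open>M\<close>
  and its denominator from the determinant of \<open>M\<close>, which accounts for the third power
  of the height.\<close>

lemma local_entry_bound:
  assumes M: "M \<in> carrier (Gz z)" and k: "k \<in> Kz z" and A: "det A \<noteq> 0" and B: "det B \<noteq> 0"
    and a: "a \<in> carrier (completion z)" "a \<noteq> \<zero>\<^bsub>completion z\<^esub>"
    and eq: "M = loc z A \<otimes>\<^bsub>Gz z\<^esub> (mk a \<zero>\<^bsub>completion z\<^esub> \<zero>\<^bsub>completion z\<^esub> a \<otimes>\<^bsub>Gz z\<^esub> (loc z B \<otimes>\<^bsub>Gz z\<^esub> k))"
    and c: "\<And>j. completion_abs z (to_completion z (rinv B$j$1)) \<le> c"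
  shows "completion_abs z (to_completion z ((A$i$1)\<^sup>2 / det A)) \<le>
    local_height z M ^ 3 * (completion_abs z (to_completion z (det B)) * c\<^sup>2)"
proof -
  interpret C: cring "completion z" by (rule cring_completion)
  interpret G: group "Gz z" by (rule group_Gz)
  let ?c = "completion z" and ?\<iota> = "to_completion z" and ?abs = "completion_abs z" and ?H = "local_height z M"
  let ?Z = "mk a \<zero>\<^bsub>?c\<^esub> \<zero>\<^bsub>?c\<^esub> a"
  have dZ: "det2 ?c ?Z = a \<otimes>\<^bsub>?c\<^esub> a" using a by (simp add: a_minus_def)
  have Z: "?Z \<in> carrier (Gz z)"
    unfolding Gz_carrier_iff using a dZ[unfolded det2_mk] completion_val_mult(1)[OF a(1) a(1) a(2) a(2)] by simp
  have kc: "k \<in> carrier (Gz z)" using k by (rule Kz_subset)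
  define k' where "k' = inv\<^bsub>Gz z\<^esub> k"
  have k': "k' \<in> Kz z" unfolding k'_def by (rule subgroup.m_inv_closed[OF Kz_subgroup k])
  note k'c = Kz_subset[OF k']
  \<comment> \<open>multiplication by the integral matrix \<open>k\<inverse>\<close> does not increase the entries\<close>
  define P where "P = M \<otimes>\<^bsub>Gz z\<^esub> k'"
  have P: "P \<in> carrier (Gz z)" using M k'c by (simp add: P_def)
  have Peq: "P = loc z A \<otimes>\<^bsub>Gz z\<^esub> (?Z \<otimes>\<^bsub>Gz z\<^esub> loc z B)"
    unfolding P_def eq using A B Z kc k'c by (simp add: k'_def G.m_assoc del: loc_mk)
  have "P \<otimes>\<^bsub>Gz z\<^esub> loc z (rinv B) = loc z A \<otimes>\<^bsub>Gz z\<^esub> (?Z \<otimes>\<^bsub>Gz z\<^esub> (loc z B \<otimes>\<^bsub>Gz z\<^esub> loc z (rinv B)))"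
    unfolding Peq using A B Z det_rinv[OF B] by (simp add: G.m_assoc)
  also have "loc z B \<otimes>\<^bsub>Gz z\<^esub> loc z (rinv B) = \<one>\<^bsub>Gz z\<^esub>" using B by (simp add: rinv_right flip: loc_mult)
  also have "?Z \<otimes>\<^bsub>Gz z\<^esub> \<one>\<^bsub>Gz z\<^esub> = ?Z" using Z by simp
  finally have PB: "P \<otimes>\<^bsub>Gz z\<^esub> loc z (rinv B) = loc z A \<otimes>\<^bsub>Gz z\<^esub> ?Z" .
  have ent: "N$i$j \<in> carrier ?c" if "N \<in> carrier (Gz z)" for N i j using that by (simp add: GL2_def)
  have mult_ent: "(N \<otimes>\<^bsub>Gz z\<^esub> N')$i$j = N$i$1 \<otimes>\<^bsub>?c\<^esub> N'$1$j \<oplus>\<^bsub>?c\<^esub> N$i$2 \<otimes>\<^bsub>?c\<^esub> N'$2$j" for N N' i j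
    by (simp add: GL2_def)
  have bound: "?abs ((N \<otimes>\<^bsub>Gz z\<^esub> N')$i$j) \<le> u * w"
    if N: "N \<in> carrier (Gz z)" "N' \<in> carrier (Gz z)" and u: "\<And>i j. ?abs (N$i$j) \<le> u" "\<And>l. ?abs (N'$l$j) \<le> w" for N N' i j u w
  proof -
    have u0: "u \<ge> 0" using u(1)[of 1 1] completion_abs_nonneg[of z "N$1$1"] by linarith
    have "?abs (N$i$l \<otimes>\<^bsub>?c\<^esub> N'$l$j) \<le> u * w" for l
      unfolding completion_abs_mult[OF ent[OF N(1)] ent[OF N(2)]]
      by (rule mult_mono[OF u u0 completion_abs_nonneg])
    moreover have "?abs ((N \<otimes>\<^bsub>Gz z\<^esub> N')$i$j) \<le> max (?abs (N$i$1 \<otimes>\<^bsub>?c\<^esub> N'$1$j)) (?abs (N$i$2 \<otimes>\<^bsub>?c\<^esub> N'$2$j))"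
      unfolding mult_ent using ent[OF N(1)] ent[OF N(2)] by (intro completion_abs_add) simp_all
    ultimately show ?thesis by (meson le_max_iff_disj order_trans)
  qed
  have "?abs (P$i$j) \<le> ?H * 1" for i j
    unfolding P_def using M k'c local_height_ge(1) completion_abs_integral[OF Kz_entry[OF k']] by (intro bound)
  hence "?abs ((P \<otimes>\<^bsub>Gz z\<^esub> loc z (rinv B))$i$1) \<le> ?H * c"
    using P B det_rinv[OF B] c by (intro bound) (simp_all add: loc_nth)
  moreover have "(loc z A \<otimes>\<^bsub>Gz z\<^esub> ?Z)$i$1 = ?\<iota> (A$i$1) \<otimes>\<^bsub>?c\<^esub> a"
    unfolding mult_ent using a by (simp add: loc_def)
  ultimately have 1: "?abs (?\<iota> (A$i$1)) * ?abs a \<le> ?H * c"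
    unfolding PB using a by (simp add: completion_abs_mult)
  have "det2 ?c P = det2 ?c M \<otimes>\<^bsub>?c\<^esub> det2 ?c k'"
    unfolding P_def by (rule det2_mult[OF cring_completion M k'c])
  hence "?abs (det2 ?c P) = ?abs (det2 ?c M)"
    using completion_abs_mult[OF det2_Gz(1)[OF M] det2_Gz(1)[OF k'c]] Kz_det_abs[OF k'] by simp
  moreover have "det2 ?c P = ?\<iota> (det A) \<otimes>\<^bsub>?c\<^esub> ((a \<otimes>\<^bsub>?c\<^esub> a) \<otimes>\<^bsub>?c\<^esub> ?\<iota> (det B))"
    unfolding Peq using A B Z dZ by (simp add: det2_mult[OF cring_completion] det2_loc del: det2_mk)
  ultimately have "?abs (det2 ?c M) = ?abs (?\<iota> (det A)) * ((?abs a * ?abs a) * ?abs (?\<iota> (det B)))"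
    using a by (simp add: completion_abs_mult)
  hence 2: "1 \<le> ?abs (?\<iota> (det A)) * ((?abs a)\<^sup>2 * ?abs (?\<iota> (det B))) * ?H"
    using local_height_det[OF M] by (simp add: power2_eq_square)
  have pos: "?abs (?\<iota> (det A)) > 0" "?abs a > 0"
    using A a by (simp_all add: completion_abs_nonzero(2))
  have "?\<iota> ((A$i$1)\<^sup>2 / det A) \<otimes>\<^bsub>?c\<^esub> ?\<iota> (det A) = ?\<iota> (A$i$1) \<otimes>\<^bsub>?c\<^esub> ?\<iota> (A$i$1)"
    using A by (simp add: power2_eq_square flip: to_completion_mult)
  hence "?abs (?\<iota> ((A$i$1)\<^sup>2 / det A) \<otimes>\<^bsub>?c\<^esub> ?\<iota> (det A)) = ?abs (?\<iota> (A$i$1) \<otimes>\<^bsub>?c\<^esub> ?\<iota> (A$i$1))" by simp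
  hence 3: "?abs (?\<iota> ((A$i$1)\<^sup>2 / det A)) * ?abs (?\<iota> (det A)) = (?abs (?\<iota> (A$i$1)))\<^sup>2"
    by (simp add: completion_abs_mult power2_eq_square)
  define E where "E = ?abs (?\<iota> ((A$i$1)\<^sup>2 / det A))"
  have E0: "E \<ge> 0" by (simp add: E_def completion_abs_nonneg)
  have "E * (?abs (?\<iota> (det A)) * (?abs a)\<^sup>2) = (E * ?abs (?\<iota> (det A))) * (?abs a)\<^sup>2"
    by (simp only: mult.assoc)
  also have "\<dots> = (?abs (?\<iota> (A$i$1)) * ?abs a)\<^sup>2"
    unfolding E_def 3 by (simp only: power_mult_distrib)
  also have "\<dots> \<le> (?H * c)\<^sup>2"
    by (intro power_mono 1 mult_nonneg_nonneg completion_abs_nonneg)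
  finally have 4: "E * (?abs (?\<iota> (det A)) * (?abs a)\<^sup>2) \<le> (?H * c)\<^sup>2" .
  have "E \<le> E * (?abs (?\<iota> (det A)) * ((?abs a)\<^sup>2 * ?abs (?\<iota> (det B))) * ?H)"
    using mult_left_mono[OF 2 E0] by simp
  also have "\<dots> = (E * (?abs (?\<iota> (det A)) * (?abs a)\<^sup>2)) * (?abs (?\<iota> (det B)) * ?H)" by (simp add: mult_ac)
  also have "\<dots> \<le> (?H * c)\<^sup>2 * (?abs (?\<iota> (det B)) * ?H)"
    by (intro mult_right_mono 4 mult_nonneg_nonneg completion_abs_nonneg local_height_nonneg)
  also have "\<dots> = ?H ^ 3 * (?abs (?\<iota> (det B)) * c\<^sup>2)" by (simp add: power2_eq_square power3_eq_cube mult_ac)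
  finally show ?thesis by (simp add: E_def)
qed

context coord
begin

text \<open>Dividing \<open>f\<close> by the product of the primes with its multiplicities leaves a
  constant, and each prime has a pole at \<open>x\<close> of order equal to the degree of its
  place.\<close>

lemma product_formula:
  assumes deg: "place_degree x = 1" and f: "f \<noteq> 0" and S: "finite S" "x \<in> S" "{z. place_val z f \<noteq> 0} \<subseteq> S"
  shows "(\<Sum>z\<in>S. int (place_degree z) * place_val z f) = 0"
proof -
  define S' where "S' = S - {x}"
  have S': "finite S'" "\<And>w. w \<in> S' \<Longrightarrow> w \<noteq> x" using S by (auto simp: S'_def)
  define g where "g = (\<Prod>w\<in>S'. unif w powi place_val w f)"
  have nz: "unif w powi place_val w f \<noteq> 0" if "w \<in> S'" for w using that unif_nz S' by simp
  have g: "g \<noteq> 0" using nz S' by (simp add: g_def)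
  have vg: "place_val z g = (\<Sum>w\<in>S'. place_val w f * place_val z (unif w))" for z
  proof -
    have "place_val z g = (\<Sum>w\<in>S'. place_val z (unif w powi place_val w f))"
      unfolding g_def using S'(1) nz by (rule place_val_prod)
    also have "\<dots> = (\<Sum>w\<in>S'. place_val w f * place_val z (unif w))"
      using S' unif_nz by (intro sum.cong) (simp_all add: place_val_powi)
    finally show ?thesis .
  qed
  have "place_val z (f / g) = 0" if z: "z \<noteq> x" for z
  proof -
    have "place_val z g = (\<Sum>w\<in>S'. if w = z then place_val z f else 0)"
      unfolding vg using val_unif(1,2) z S' by (intro sum.cong) auto
    also have "\<dots> = place_val z f" using S S' z by (auto simp: S'_def)
    finally show ?thesis using f g by (simp add: place_val_divide)
  qed
  hence "f / g \<in> Poly_ring x" "inverse (f / g) \<in> Poly_ring x"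
    using place_val_inverse[of _ "f / g"] by (simp_all add: Poly_ring_def vge_def del: place_val_inverse)
  hence "place_val x (f / g) \<le> 0" "place_val x (inverse (f / g)) \<le> 0" using f g by (auto intro!: Poly_ring_val)
  hence "place_val x (f / g) = 0" by (simp only: place_val_inverse)
  hence "place_val x f = (\<Sum>w\<in>S'. place_val w f * place_val x (unif w))"
    using f g by (simp add: place_val_divide vg)
  also have "\<dots> = - (\<Sum>w\<in>S'. int (place_degree w) * place_val w f)"
    unfolding sum_negf[symmetric] using val_unif(3) S' by (intro sum.cong) simp_all
  finally show ?thesis using deg S by (simp add: sum.remove[of S x] S'_def)
qed

text \<open>Only \<open>s\<^sup>n\<close> on the diagonal matters, as the matrix of the line is invertible
  over the constants.\<close>

lemma rinv_vertex_mat_first_column: "vge x (int (fst v)) (rinv (vertex_mat v) $ j $ 1)"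
proof -
  have "vge x (int (fst v)) (1 / s ^ fst v)"
    using s_nz val_s by (simp add: vge_def place_val_divide place_val_power)
  moreover have "vge x (int (fst v)) (const_elt c / s ^ fst v)" for c
    using vge_mult_0[of x "const_elt c" "int (fst v)" "1 / s ^ fst v"] calculation by (simp add: vge_def)
  ultimately show ?thesis
    using exhaust_2[of j] s_nz by (cases "snd v") (auto simp: vertex_mat_def line_mat_def mat_1_mk rinv_mk)
qed

text \<open>The product formula for \<open>f\<^sup>2 / det A\<close>, where \<open>A\<close> is the global
  factor of \<open>g\<close>: each place contributes at most the third power of the local height,
  and \<open>x\<close> an additional factor \<open>q\<^sup>-\<^sup>n\<close> because the first
  column of \<open>A\<close> is divided by \<open>s\<^sup>n\<close>.\<close>

theorem height_bound:
  assumes deg: "place_degree x = 1" and g: "g \<in> carrier GAk"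
  shows "real CARD('k) ^ fst (vertex g) \<le> height g ^ 3"
proof -
  let ?q = "real CARD('k)" and ?n = "fst (vertex g)" and ?H = "\<lambda>z. local_height z (component g z)"
  have q: "?q > 1" using card_field_gt_1[where ?'k = 'k] by simp
  obtain A \<zeta> k where *: "det A \<noteq> 0" "\<zeta> \<in> monoid_center GAk" "k \<in> K'"
    "g = diag_emb A \<otimes>\<^bsub>GAk\<^esub> (\<zeta> \<otimes>\<^bsub>GAk\<^esub> (local_emb x (vertex_mat (vertex g)) \<otimes>\<^bsub>GAk\<^esub> k))"
    using vertex(2)[OF g] unfolding adele_equiv_def by blast
  obtain i where i: "A$i$1 \<noteq> 0"
    using *(1) by (metis det_2 diff_0_right mult_zero_left mult_zero_right)
  define e where "e = (A$i$1)\<^sup>2 / det A"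
  have e: "e \<noteq> 0" using i *(1) by (simp add: e_def)
  have bound: "completion_abs z (to_completion z e) \<le> ?H z ^ 3 * (if z = x then 1 / ?q ^ ?n else 1)" for z
  proof -
    obtain a where a: "a \<in> carrier (completion z)" "a \<noteq> \<zero>\<^bsub>completion z\<^esub>"
      "component \<zeta> z = mk a \<zero>\<^bsub>completion z\<^esub> \<zero>\<^bsub>completion z\<^esub> a" using center_component[OF *(2)] by blast
    define B where "B = (if z = x then vertex_mat (vertex g) else mat 1)"
    have B: "det B \<noteq> 0" by (simp add: B_def det_vertex_mat)
    have "component g z = loc z A \<otimes>\<^bsub>Gz z\<^esub> (component \<zeta> z \<otimes>\<^bsub>Gz z\<^esub> (loc z B \<otimes>\<^bsub>Gz z\<^esub> component k z))"
      by (subst *(4)) (simp add: component_local_emb B_def)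
    note bd = local_entry_bound[OF component_in_Gz[OF g] congruence_subgroup_Kz[OF *(3)] *(1) B a(1,2) this[unfolded a(3)], of _ i, folded e_def]
    show ?thesis
    proof (cases "z = x")
      case True
      have c: "completion_abs x (to_completion x (rinv B$j$1)) \<le> ?q powi (- int ?n)" for j
        using completion_abs_le[of x "int ?n" "to_completion x (rinv B$j$1)"] rinv_vertex_mat_first_column deg
        by (simp add: B_def True)
      have d: "completion_abs x (to_completion x (det B)) = ?q powi (int ?n)"
        using det_vertex_mat val_det_vertex_mat deg by (simp add: completion_abs_nonzero(1) B_def True)
      have "?q powi (int ?n) * (?q powi (- int ?n))\<^sup>2 = 1 / ?q ^ ?n"
        using q by (simp add: power_int_minus power2_eq_square field_simps)
      thus ?thesis using bd[of "?q powi (- int ?n)"] c d True by simp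
    next
      case False
      have "rinv B = mk 1 0 0 1" using False by (simp add: B_def mat_1_mk rinv_mk)
      hence c: "completion_abs z (to_completion z (rinv B$j$1)) \<le> 1" for j using exhaust_2[of j] by auto
      have "completion_abs z (to_completion z (det B)) = 1" using False by (simp add: B_def)
      thus ?thesis using bd[OF c] False by simp
    qed
  qed
  define S where "S = insert x ({z. place_val z e \<noteq> 0} \<union> {z. component g z \<notin> Kz z})"
  have S: "finite S" using g finite_support[OF e] by (simp add: S_def GA_iff)
  have "(\<Prod>z\<in>S. completion_abs z (to_completion z e)) = (\<Prod>z\<in>S. ?q powi (- (int (place_degree z) * place_val z e)))"
    using e by (intro prod.cong) (simp_all add: completion_abs_nonzero(1))
  also have "\<dots> = ?q powi (\<Sum>z\<in>S. - (int (place_degree z) * place_val z e))"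
    using S
  proof (induction S rule: finite_induct)
    case (insert z S)
    let ?t = "\<lambda>z. - (int (place_degree z) * place_val z e)"
    have "(\<Prod>z\<in>insert z S. ?q powi ?t z) = ?q powi ?t z * ?q powi (\<Sum>z\<in>S. ?t z)"
      using insert by simp
    also have "\<dots> = ?q powi (?t z + (\<Sum>z\<in>S. ?t z))"
      by (rule power_int_add[symmetric]) simp
    finally show ?case by (simp only: sum.insert[OF insert(1,2)])
  qed simp
  also have "(\<Sum>z\<in>S. - (int (place_degree z) * place_val z e)) = 0"
  proof -
    have "x \<in> S" "{z. place_val z e \<noteq> 0} \<subseteq> S" by (auto simp: S_def)
    thus ?thesis using product_formula[OF deg e S] by (simp add: sum_negf)
  qed
  finally have "1 = (\<Prod>z\<in>S. completion_abs z (to_completion z e))" by simp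
  also have "\<dots> \<le> (\<Prod>z\<in>S. ?H z ^ 3 * (if z = x then 1 / ?q ^ ?n else 1))"
    using bound completion_abs_nonneg by (intro prod_mono) blast
  also have "\<dots> = (\<Prod>z\<in>S. ?H z) ^ 3 * (1 / ?q ^ ?n)"
    using S by (simp add: prod.distrib prod_power_distrib S_def)
  also have "(\<Prod>z\<in>S. ?H z) = height g"
    by (rule height_eq_prod[symmetric, OF g S]) (auto simp: S_def)
  finally show ?thesis using q by (simp add: field_simps)
qed

end

section \<open>Triangular recursions\<close>

text \<open>The eigenvalue equation in abstract form: the vertices are ranked so that the equation at
  \<open>v\<close> relates the value at the vertex \<open>top v\<close> to values at vertices of
  smaller level. Several indices \<open>i\<close> may lead to \<open>top v\<close>.\<close>

locale triangular =
  fixes V :: "'v set" and I :: "'i set" and N :: "'v \<Rightarrow> 'i \<Rightarrow> 'v" and top :: "'v \<Rightarrow> 'v"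
    and r :: "'v \<Rightarrow> nat" and c :: complex
  assumes finite_I: "finite I"
    and top_inj: "inj_on top V"
    and top_hit: "v \<in> V \<Longrightarrow> \<exists>i\<in>I. N v i = top v"
    and N_in: "v \<in> V \<Longrightarrow> i \<in> I \<Longrightarrow> N v i \<in> V"
    and r_top: "v \<in> V \<Longrightarrow> r v < r (top v)"
    and r_N: "v \<in> V \<Longrightarrow> i \<in> I \<Longrightarrow> N v i = top v \<or> r (N v i) < r (top v)"
begin

text \<open>The vertices at which no equation determines the value.\<close>

definition free :: "'v set" where "free = V - top ` V"

definition solution :: "('v \<Rightarrow> complex) \<Rightarrow> bool" where
  "solution F \<longleftrightarrow> (\<forall>v\<in>V. (\<Sum>i\<in>I. F (N v i)) = c * F v)"

definition hits :: "'v \<Rightarrow> 'i set" where "hits v = {i \<in> I. N v i = top v}"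

lemma card_hits: "v \<in> V \<Longrightarrow> card (hits v) > 0"
  using finite_I top_hit[of v] by (auto simp: hits_def card_gt_0_iff)

text \<open>The coefficient of the top value is a positive integer, so the equation can be solved for it.\<close>

lemma equation_iff:
  assumes v: "v \<in> V"
  shows "(\<Sum>i\<in>I. F (N v i)) = c * F v \<longleftrightarrow>
    F (top v) = (c * F v - (\<Sum>i\<in>I - hits v. F (N v i))) / of_nat (card (hits v))"
proof -
  have "(\<Sum>i\<in>I. F (N v i)) = (\<Sum>i\<in>I - hits v. F (N v i)) + (\<Sum>i\<in>hits v. F (N v i))"
    using finite_I by (intro sum.subset_diff) (auto simp: hits_def)
  also have "(\<Sum>i\<in>hits v. F (N v i)) = of_nat (card (hits v)) * F (top v)"
    by (simp add: hits_def)
  finally show ?thesis using card_hits[OF v] by (auto simp: field_simps)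
qed

lemma r_other: "v \<in> V \<Longrightarrow> i \<in> I - hits v \<Longrightarrow> r (N v i) < r (top v)"
  using r_N by (auto simp: hits_def)

text \<open>Each vertex outside the free ones is the top of exactly one vertex, so well-founded recursion on
  the level defines the values without conflict.\<close>

lemma solution_exists: "\<exists>F. solution F \<and> (\<forall>v\<in>free. F v = b v)"
proof -
  define G where "G = (\<lambda>F u. if u \<in> top ` V then
      let v = the_inv_into V top u in (c * F v - (\<Sum>i\<in>I - hits v. F (N v i))) / of_nat (card (hits v))
    else b u)"
  define F where "F = wfrec (Wellfounded.measure r) G"
  have F: "F u = G (cut F (Wellfounded.measure r) u) u" for u
    unfolding F_def by (rule wfrec) simp
  have "F (top v) = (c * F v - (\<Sum>i\<in>I - hits v. F (N v i))) / of_nat (card (hits v))" if v: "v \<in> V" for v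
  proof -
    have "F (top v) = G (cut F (Wellfounded.measure r) (top v)) (top v)" by (rule F)
    also have "\<dots> = (c * cut F (Wellfounded.measure r) (top v) v -
        (\<Sum>i\<in>I - hits v. cut F (Wellfounded.measure r) (top v) (N v i))) / of_nat (card (hits v))"
      using v top_inj by (simp add: G_def the_inv_into_f_f)
    also have "cut F (Wellfounded.measure r) (top v) v = F v" using r_top[OF v] by (simp add: cut_def)
    also have "(\<Sum>i\<in>I - hits v. cut F (Wellfounded.measure r) (top v) (N v i)) = (\<Sum>i\<in>I - hits v. F (N v i))"
      using r_other[OF v] by (intro sum.cong) (simp_all add: cut_def)
    finally show ?thesis .
  qed
  hence "solution F" unfolding solution_def using equation_iff by blast
  moreover have "F v = b v" if "v \<in> free" for v
    using that by (subst F) (simp add: G_def free_def)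
  ultimately show ?thesis by blast
qed

lemma solution_unique:
  assumes F: "solution F" "solution F'" "\<And>v. v \<in> free \<Longrightarrow> F v = F' v" and u: "u \<in> V"
  shows "F u = F' u"
  using u
proof (induction u rule: measure_induct_rule[of r])
  case (less u)
  show ?case
  proof (cases "u \<in> free")
    case False
    then obtain v where v: "v \<in> V" "u = top v" using less.prems by (auto simp: free_def)
    have "F v = F' v" using less.IH[of v] v r_top by simp
    moreover have "(\<Sum>i\<in>I - hits v. F (N v i)) = (\<Sum>i\<in>I - hits v. F' (N v i))"
      using less.IH r_other[OF v(1)] N_in[OF v(1)] v(2) by (intro sum.cong) auto
    ultimately show ?thesis
      using F(1,2) equation_iff[OF v(1), of F] equation_iff[OF v(1), of F'] v unfolding solution_def by metis
  qed (rule F(3))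
qed

text \<open>One step of the recursion multiplies the bound by at most \<open>\<bar>c\<bar>\<close> plus the
  number of neighbours.\<close>

lemma solution_growth:
  assumes F: "solution F" and fin: "finite free"
  shows "\<exists>C B. C \<ge> 0 \<and> B \<ge> 1 \<and> (\<forall>u\<in>V. cmod (F u) \<le> C * B ^ r u)"
proof -
  define C where "C = (\<Sum>v\<in>free. cmod (F v))"
  define B where "B = max 1 (cmod c + real (card I))"
  have C: "C \<ge> 0" by (simp add: C_def sum_nonneg)
  have B: "B \<ge> 1" "cmod c + real (card I) \<le> B" by (simp_all add: B_def)
  have "cmod (F u) \<le> C * B ^ r u" if "u \<in> V" for u
    using that
  proof (induction u rule: measure_induct_rule[of r])
    case (less u)
    show ?case
    proof (cases "u \<in> free")
      case True
      hence "cmod (F u) \<le> C" unfolding C_def using fin by (intro member_le_sum) auto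
      also have "C * 1 \<le> C * B ^ r u" using B C by (intro mult_left_mono) simp_all
      finally show ?thesis by simp
    next
      case False
      then obtain v where v: "v \<in> V" "u = top v" using less.prems by (auto simp: free_def)
      then obtain m where m: "r u = Suc m" using r_top[of v] by (cases "r u") auto
      have small: "cmod (F w) \<le> C * B ^ m" if "w \<in> V" "r w < r u" for w
      proof -
        have "cmod (F w) \<le> C * B ^ r w" using less.IH that by simp
        also have "\<dots> \<le> C * B ^ m" using that m B C by (intro mult_left_mono power_increasing) auto
        finally show ?thesis .
      qed
      define h where "h = real (card (hits v))"
      have h: "h \<ge> 1" using card_hits[OF v(1)] by (simp add: h_def)
      have "F u = (c * F v - (\<Sum>i\<in>I - hits v. F (N v i))) / of_nat (card (hits v))"
        using F equation_iff[OF v(1), of F] v unfolding solution_def by simp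
      hence "cmod (F u) = cmod (c * F v - (\<Sum>i\<in>I - hits v. F (N v i))) / h"
        by (simp add: norm_divide h_def)
      also have "\<dots> \<le> cmod (c * F v - (\<Sum>i\<in>I - hits v. F (N v i))) / 1"
        using h by (intro divide_left_mono) auto
      also have "\<dots> \<le> cmod c * cmod (F v) + cmod (\<Sum>i\<in>I - hits v. F (N v i))"
        using norm_triangle_ineq4[of "c * F v" "\<Sum>i\<in>I - hits v. F (N v i)"] by (simp add: norm_mult)
      also have "\<dots> \<le> cmod c * (C * B ^ m) + (\<Sum>i\<in>I. C * B ^ m)"
      proof (intro add_mono mult_left_mono)
        show "cmod (F v) \<le> C * B ^ m" using small v r_top by simp
        have "cmod (\<Sum>i\<in>I - hits v. F (N v i)) \<le> (\<Sum>i\<in>I - hits v. C * B ^ m)"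
          using small r_other[OF v(1)] N_in[OF v(1)] v(2) by (intro sum_norm_le) auto
        also have "\<dots> \<le> (\<Sum>i\<in>I. C * B ^ m)"
          using finite_I C B by (intro sum_mono2) auto
        finally show "cmod (\<Sum>i\<in>I - hits v. F (N v i)) \<le> (\<Sum>i\<in>I. C * B ^ m)" .
      qed simp
      also have "\<dots> = (cmod c + real (card I)) * (C * B ^ m)" by (simp add: distrib_right)
      also have "\<dots> \<le> B * (C * B ^ m)" using B C by (intro mult_right_mono) auto
      finally show ?thesis by (simp add: m mult_ac)
    qed
  qed
  thus ?thesis using C B(1) by blast
qed

lemma solution_sum:
  "(\<And>a. a \<in> A \<Longrightarrow> solution (F a)) \<Longrightarrow> solution (\<lambda>v. \<Sum>a\<in>A. b a * F a v)"
  unfolding solution_def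
proof (intro ballI)
  fix v assume *: "\<And>a. a \<in> A \<Longrightarrow> \<forall>v\<in>V. (\<Sum>i\<in>I. F a (N v i)) = c * F a v" and v: "v \<in> V"
  have "(\<Sum>i\<in>I. \<Sum>a\<in>A. b a * F a (N v i)) = (\<Sum>a\<in>A. b a * (\<Sum>i\<in>I. F a (N v i)))"
    by (subst sum.swap) (simp add: sum_distrib_left)
  also have "\<dots> = (\<Sum>a\<in>A. b a * (c * F a v))" using * v by (intro sum.cong) auto
  finally show "(\<Sum>i\<in>I. \<Sum>a\<in>A. b a * F a (N v i)) = c * (\<Sum>a\<in>A. b a * F a v)"
    by (simp add: sum_distrib_left mult_ac)
qed

end

section \<open>The dimension of the eigenspace\<close>

lemma sum_fun_apply: "(\<Sum>a\<in>A. f a) x = (\<Sum>a\<in>A. f a x :: 'b::comm_monoid_add)"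
  by (induction A rule: infinite_finite_induct) simp_all

context coord
begin

text \<open>Twice the first component, with \<open>(d, None)\<close> raised above the other vertices at
  distance \<open>d\<close>: the neighbours of \<open>(0, None)\<close> may all lie at distance
  \<open>d\<close>, and the top one among them has to come last.\<close>

definition level :: "nat \<Rightarrow> nat \<times> 'k option \<Rightarrow> nat" where
  "level d v = 2 * fst v + (if v = (d, None) then 1 else 0)"

lemma triangular_neighbour:
  assumes y: "y \<noteq> x"
  shows "triangular vertices (hecke_index y) (neighbour y) (\<lambda>v. (fst v + place_degree y, snd v)) (level (place_degree y))"
proof
  let ?d = "place_degree y" and ?T = "\<lambda>v :: nat \<times> 'k option. (fst v + place_degree y, snd v)"
  have d: "?d > 0" by (rule place_degree_pos[OF y])
  show "finite (hecke_index y)" by (rule finite_hecke_index)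
  show "inj_on ?T vertices" by (auto simp: inj_on_def)
  show "\<exists>i\<in>hecke_index y. neighbour y v i = ?T v" if "v \<in> vertices" for v
    using neighbour_None[OF y that] by (auto simp: hecke_index_def)
  show "neighbour y v i \<in> vertices" for v i by (rule neighbour_in_vertices[OF y])
  show "level ?d v < level ?d (?T v)" for v using d by (auto simp: level_def)
  show "neighbour y v i = ?T v \<or> level ?d (neighbour y v i) < level ?d (?T v)" if v: "v \<in> vertices" and "i \<in> hecke_index y" for v i
  proof (cases i)
    case None
    thus ?thesis using neighbour_None[OF y v] by simp
  next
    case (Some b)
    obtain n w where v': "v = (n, w)" by (cases v)
    obtain m u where m: "neighbour y v i = (m, u)" by (cases "neighbour y v i")
    have le: "int m \<le> \<bar>int n - int ?d\<bar>" using neighbour_Some[OF y, of v b, folded Some] unfolding m by (simp add: v')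
    show ?thesis
    proof (cases "n = 0")
      case True
      hence "w = None" "m \<le> ?d" using v le by (auto simp: v' vertices_def)
      thus ?thesis unfolding m unfolding level_def v' using True by auto
    next
      case False
      hence "m < n + ?d" using le d by linarith
      thus ?thesis unfolding m unfolding level_def v' using False by auto
    qed
  qed
qed

text \<open>The vertices with \<open>0 < n \<le> d\<close> number \<open>d (q + 1)\<close>; one of them is
  the top of the vertex at \<open>0\<close>, which takes its place.\<close>

lemma free_vertices:
  assumes "d > 0"
  shows "finite (vertices - (\<lambda>v :: nat \<times> 'k option. (fst v + d, snd v)) ` vertices)"
    "card (vertices - (\<lambda>v :: nat \<times> 'k option. (fst v + d, snd v)) ` vertices) = d * (CARD('k) + 1)"
proof -
  let ?A = "{1..d} \<times> (UNIV :: 'k option set)"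
  have "vertices - (\<lambda>v :: nat \<times> 'k option. (fst v + d, snd v)) ` vertices = insert (0, None) (?A - {(d, None)})"
  proof (rule Set.set_eqI)
    fix v :: "nat \<times> 'k option"
    obtain n w where v: "v = (n, w)" by (cases v)
    have "v \<in> (\<lambda>v. (fst v + d, snd v)) ` vertices \<longleftrightarrow> d \<le> n \<and> (n = d \<longrightarrow> w = None)"
    proof
      assume "d \<le> n \<and> (n = d \<longrightarrow> w = None)"
      hence "(n - d, w) \<in> vertices" "v = (fst (n - d, w) + d, snd (n - d, w))" by (auto simp: v vertices_def)
      thus "v \<in> (\<lambda>v. (fst v + d, snd v)) ` vertices" by blast
    qed (auto simp: v vertices_def)
    thus "v \<in> vertices - (\<lambda>v. (fst v + d, snd v)) ` vertices \<longleftrightarrow> v \<in> insert (0, None) (?A - {(d, None)})"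
      using assms by (cases w) (auto simp: v vertices_def)
  qed
  moreover have "card (insert (0, None) (?A - {(d, None)})) = card ?A"
    using assms by (subst card_insert_disjoint) (auto simp: card_Diff_singleton)
  moreover have "card ?A = d * (CARD('k) + 1)" by (simp add: card_UNIV_option)
  ultimately show "finite (vertices - (\<lambda>v :: nat \<times> 'k option. (fst v + d, snd v)) ` vertices)"
    "card (vertices - (\<lambda>v :: nat \<times> 'k option. (fst v + d, snd v)) ` vertices) = d * (CARD('k) + 1)" by simp_all
qed

definition lift_vertex :: "(nat \<times> 'k option \<Rightarrow> complex) \<Rightarrow> 'k adele^2^2 \<Rightarrow> complex" where
  "lift_vertex F = (\<lambda>g. if g \<in> carrier GAk then F (vertex g) else 0)"

lemma lift_vertex_vertex_mat: "v \<in> vertices \<Longrightarrow> lift_vertex F (local_emb x (vertex_mat v)) = F v"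
  by (simp add: lift_vertex_def det_vertex_mat vertex_vertex_mat)

text \<open>The level is at most \<open>2 n + 1\<close>, and \<open>B\<^sup>2\<^sup>n\<close> is a fixed
  power of \<open>q\<^sup>n\<close>, which the height bounds.\<close>

lemma lift_vertex_growth:
  assumes deg: "place_degree x = 1" and F: "C \<ge> 0" "B \<ge> 1" "\<And>v. v \<in> vertices \<Longrightarrow> cmod (F v) \<le> C * B ^ level d v"
    and g: "g \<in> carrier GAk"
  shows "cmod (lift_vertex F g) \<le> C * B * height g powr (3 * log (real CARD('k)) (B\<^sup>2))"
proof -
  let ?q = "real CARD('k)" and ?n = "fst (vertex g)"
  define t where "t = log ?q (B\<^sup>2)"
  have q: "?q > 1" using card_field_gt_1[where ?'k = 'k] by simp
  have t: "t \<ge> 0" using q F(2) by (simp add: t_def)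
  have h: "height g > 0" by (rule height_pos[OF g])
  have "(B\<^sup>2) ^ ?n = (?q powr t) ^ ?n" using q F(2) by (simp add: t_def)
  also have "\<dots> = (?q ^ ?n) powr t" using q by (simp add: powr_powr mult.commute flip: powr_realpow)
  also have "\<dots> \<le> (height g ^ 3) powr t"
    using height_bound[OF deg g] t by (intro powr_mono2) simp_all
  also have "height g ^ 3 = height g powr 3" using h by (simp add: powr_numeral)
  also have "(height g powr 3) powr t = height g powr (3 * t)" by (simp add: powr_powr)
  finally have bd: "(B\<^sup>2) ^ ?n \<le> height g powr (3 * t)" .
  have "cmod (lift_vertex F g) \<le> C * B ^ level d (vertex g)" using F(3) vertex(1)[OF g] g by (simp add: lift_vertex_def)
  also have "\<dots> \<le> C * B ^ (2 * ?n + 1)"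
    using F by (intro mult_left_mono power_increasing) (simp_all add: level_def)
  also have "\<dots> = C * B * (B\<^sup>2) ^ ?n" by (simp add: power_mult)
  also have "\<dots> \<le> C * B * height g powr (3 * t)" using F bd by (intro mult_left_mono) simp_all
  finally show ?thesis by (simp add: t_def)
qed

text \<open>The eigenspace is identified with the solutions of the recursion whose constant is the
  eigenvalue divided by the volume of \<open>K'\<close>; the solutions that are \<open>1\<close>
  at one free vertex and \<open>0\<close> at the others form a basis.\<close>

theorem dim_eigenspace:
  fixes \<mu> :: "('k adele^2^2) measure"
  assumes deg: "place_degree x = 1" and y: "y \<noteq> x" and \<pi>: "uniformizer y \<pi>" and \<mu>: "normalized_haar \<mu>"
  shows "vector_space.dim fun_scale (automorphic_eigenspace \<mu> K' (hecke_fun K' y \<pi>) l) =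
    place_degree y * (CARD('k) + 1)"
proof -
  let ?d = "place_degree y"
  define m where "m = measure \<mu> K'"
  have "emeasure \<mu> K' < \<infinity>" using K'_emeasure(2)[OF \<mu>] by (simp add: le_less_trans)
  hence m: "m \<noteq> 0" using K'_emeasure(1)[OF \<mu>] by (simp add: m_def measure_def enn2real_eq_0_iff)
  interpret triangular vertices "hecke_index y" "neighbour y" "\<lambda>v. (fst v + ?d, snd v)" "level ?d" "l / complex_of_real m"
    by (rule triangular_neighbour[OF y])
  interpret W: vector_space "fun_scale :: complex \<Rightarrow> ('k adele^2^2 \<Rightarrow> complex) \<Rightarrow> _" by (rule vector_space_fun_scale)
  have fin: "finite free" and card: "card free = ?d * (CARD('k) + 1)"
    using free_vertices[OF place_degree_pos[OF y]] by (simp_all add: free_def)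
  let ?E = "automorphic_eigenspace \<mu> K' (hecke_fun K' y \<pi>) l"
  have E_iff: "f \<in> ?E \<longleftrightarrow> (\<exists>F. f = lift_vertex F \<and> solution F)" for f
  proof
    assume f: "f \<in> ?E"
    then obtain F where F: "f = lift_vertex F" by (auto simp: automorphic_eigenspace_def automorphic_iff lift_vertex_def)
    have "(\<Sum>i\<in>hecke_index y. F (neighbour y v i)) = l / complex_of_real m * F v" if v: "v \<in> vertices" for v
    proof -
      have c: "local_emb x (vertex_mat v) \<in> carrier GAk" by (simp add: det_vertex_mat)
      have "hecke \<mu> (hecke_fun K' y \<pi>) f (local_emb x (vertex_mat v)) = l * f (local_emb x (vertex_mat v))"
        using f by (simp add: automorphic_eigenspace_def fun_scale_def)
      hence "complex_of_real m * (\<Sum>i\<in>hecke_index y. F (neighbour y v i)) = l * F v"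
        using hecke_eq_sum[OF \<mu> y \<pi> c, of F] v by (simp add: F lift_vertex_vertex_mat vertex_vertex_mat m_def flip: lift_vertex_def)
      thus ?thesis using m by (simp add: field_simps)
    qed
    thus "\<exists>F. f = lift_vertex F \<and> solution F" using F unfolding solution_def by blast
  next
    assume "\<exists>F. f = lift_vertex F \<and> solution F"
    then obtain F where F: "f = lift_vertex F" "solution F" by blast
    obtain C B where CB: "C \<ge> 0" "B \<ge> 1" "\<forall>v\<in>vertices. cmod (F v) \<le> C * B ^ level ?d v"
      using solution_growth[OF F(2) fin] by blast
    have "f \<in> automorphic K'"
      unfolding automorphic_iff
    proof (intro conjI exI ballI)
      show "f = (\<lambda>g. if g \<in> carrier GAk then F (vertex g) else 0)" by (simp add: F lift_vertex_def)
      show "cmod (f g) \<le> C * B * height g powr (3 * log (real CARD('k)) (B\<^sup>2))" if "g \<in> carrier GAk" for g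
        unfolding F(1) using CB by (intro lift_vertex_growth[OF deg _ _ _ that]) auto
    qed
    moreover have "hecke \<mu> (hecke_fun K' y \<pi>) f g = l * f g" for g
    proof (cases "g \<in> carrier GAk")
      case True
      have "hecke \<mu> (hecke_fun K' y \<pi>) f g = complex_of_real m * (\<Sum>i\<in>hecke_index y. F (neighbour y (vertex g) i))"
        using hecke_eq_sum[OF \<mu> y \<pi> True, of F] by (simp add: F m_def lift_vertex_def)
      also have "\<dots> = complex_of_real m * (l / complex_of_real m * F (vertex g))"
        using F(2) vertex(1)[OF True] by (simp add: solution_def)
      finally show ?thesis using m True by (simp add: F lift_vertex_def)
    qed (simp add: hecke_def F lift_vertex_def)
    ultimately show "f \<in> ?E" by (auto simp: automorphic_eigenspace_def fun_scale_def)
  qed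
  have "\<forall>\<sigma>. \<exists>F. solution F \<and> (\<forall>v\<in>free. F v = (if v = \<sigma> then 1 else 0))"
    by (intro allI solution_exists)
  from choice[OF this] obtain \<Phi>
    where \<Phi>: "\<And>\<sigma>. solution (\<Phi> \<sigma>)" "\<And>\<sigma> v. v \<in> free \<Longrightarrow> \<Phi> \<sigma> v = (if v = \<sigma> then 1 else 0)"
    by blast
  let ?f = "\<lambda>\<sigma>. lift_vertex (\<Phi> \<sigma>)"
  have free_vertices: "\<sigma> \<in> free \<Longrightarrow> \<sigma> \<in> vertices" for \<sigma> by (simp add: free_def)
  have delta: "?f \<sigma> (local_emb x (vertex_mat \<tau>)) = (if \<tau> = \<sigma> then 1 else 0)" if "\<tau> \<in> free" for \<sigma> \<tau>
    using that \<Phi>(2) free_vertices by (simp add: lift_vertex_vertex_mat)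
  have inj: "inj_on ?f free"
  proof (rule inj_onI)
    fix \<sigma> \<tau> assume "\<sigma> \<in> free" "\<tau> \<in> free" "?f \<sigma> = ?f \<tau>"
    thus "\<sigma> = \<tau>" using delta[of \<sigma> \<sigma>] delta[of \<sigma> \<tau>] by (metis zero_neq_one)
  qed
  have "card (?f ` free) = W.dim ?E"
  proof (rule W.basis_card_eq_dim)
    show "?f ` free \<subseteq> ?E" using \<Phi>(1) E_iff by blast
    show "W.independent (?f ` free)"
    proof (rule W.independent_if_scalars_zero)
      show "finite (?f ` free)" using fin by simp
      fix u h assume 0: "(\<Sum>h\<in>?f ` free. fun_scale (u h) h) = 0" and "h \<in> ?f ` free"
      then obtain \<sigma> where \<sigma>: "\<sigma> \<in> free" "h = ?f \<sigma>" by blast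
      have "(\<Sum>\<tau>\<in>free. fun_scale (u (?f \<tau>)) (?f \<tau>)) = 0"
        using 0 inj by (simp add: sum.reindex)
      hence "(\<Sum>\<tau>\<in>free. fun_scale (u (?f \<tau>)) (?f \<tau>)) (local_emb x (vertex_mat \<sigma>)) = 0" by simp
      hence "(\<Sum>\<tau>\<in>free. u (?f \<tau>) * (if \<sigma> = \<tau> then 1 else 0)) = 0"
        using \<sigma> delta by (simp add: sum_fun_apply fun_scale_def)
      thus "u h = 0" using fin \<sigma> by (simp add: if_distrib cong: if_cong)
    qed
    show "?E \<subseteq> W.span (?f ` free)"
    proof
      fix f assume "f \<in> ?E"
      then obtain F where F: "f = lift_vertex F" "solution F" using E_iff by blast
      have "F v = (\<Sum>\<sigma>\<in>free. F \<sigma> * \<Phi> \<sigma> v)" if "v \<in> vertices" for v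
      proof (rule solution_unique[OF F(2) solution_sum _ that])
        fix v assume v: "v \<in> free"
        have "(\<Sum>\<sigma>\<in>free. F \<sigma> * \<Phi> \<sigma> v) = (\<Sum>\<sigma>\<in>free. if \<sigma> = v then F v else 0)"
          by (intro sum.cong) (simp_all add: \<Phi>(2)[OF v])
        thus "F v = (\<Sum>\<sigma>\<in>free. F \<sigma> * \<Phi> \<sigma> v)" using v fin by simp
      qed (rule \<Phi>(1))
      hence "f = (\<Sum>\<sigma>\<in>free. fun_scale (F \<sigma>) (?f \<sigma>))"
        using vertex(1) by (auto simp: F fun_eq_iff sum_fun_apply fun_scale_def lift_vertex_def)
      also have "\<dots> \<in> W.span (?f ` free)"
        by (intro W.span_sum W.span_scale W.span_base) simp
      finally show "f \<in> W.span (?f ` free)" .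
    qed
  qed
  thus ?thesis using card card_image[OF inj] by simp
qed

end

theorem theorem3:
  fixes x y :: "'k::{field,finite} place"
    and \<pi> :: "'k poly fract"
    and \<mu> :: "('k adele^2^2) measure"
    and d :: nat
    and l :: complex
  assumes "place_degree x = 1"
    and "place_degree y = d" and "y \<noteq> x"
    and "uniformizer y \<pi>"
    and "normalized_haar \<mu>"
    and "l \<noteq> 0"
  shows "vector_space.dim fun_scale
           (automorphic_eigenspace \<mu> (congruence_subgroup x)
              (hecke_fun (congruence_subgroup x) y \<pi>) l)
         = d * (CARD('k) + 1)"
proof -
  obtain s where "coord x s" using coord_exists[OF assms(1)] by blast
  from coord.dim_eigenspace[OF this assms(1,3,4,5)] show ?thesis by (simp add: assms(2))
qed

end
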